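(* Let $\theta>0$ and $f(u)=u^{-\theta}$ for $u>0$, and let $X=(X_t)_{t\ge 0}$ be the solution, started at $x>0$, of the stochastic integral equation $$X_t=x+\sqrt{2c}\int_0^t\sqrt{1/f(X_s)}\,dW_s+\int_0^t\int_{(0,1]}\int_0^{1/f(X_{s-})}z\,\tilde M(ds,dz,du)-b\int_0^t \frac{1}{f(X_s)}\,ds+\int_0^t\int_{(1,\infty)}\int_0^{1/f(X_{s-})}z\,M(ds,dz,du).$$ (i) The process $X$ goes extinct in finite time with a positive probability (i.e. $\mathbb{P}(T_0^-<\infty)>0$) if and only if $$\int^{\infty-}\frac{s^{\theta-1}}{\psi(s)}\,ds<\infty;$$ and the process does not go extinct but becomes extinguishing with a positive probability (i.e. $\mathbb{P}(T_0^-=\infty,\ \lim_{t\to\infty}X_t=0)>0$) if and only if $$\int^{\infty-}\frac{s^{\theta-1}}{\psi(s)}\,ds=\infty.$$ (ii) The process $X$ explodes in finite time with a positive probability (i.e. $\mathbb{P}(T_\infty^+<\infty)>0$) if and only if $\Phi(0)>0$ and $$\int_{0+}\frac{s^{\theta-1}}{\psi(s)}\,ds>-\infty.$$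
   Context: Let $b\in\mathbb{R}$, $c\ge 0$ be constants and $\pi$ a $\sigma$-finite measure on $(0,\infty)$ with $\int_{(0,\infty)}(1\wedge z^2)\,\pi(dz)<\infty$. Put $$\psi(\lambda)=b\lambda+c\lambda^2+\int_{(0,\infty)}\big(e^{-\lambda u}-1+\lambda u1_{(0,1]}(u)\big)\pi(du),\quad \lambda\ge 0,$$ which is the Laplace exponent of the spectrally positive Lévy process $Z$ with $\mathbb{E}[e^{-\lambda Z_t}\mid Z_0=x]=e^{-\lambda x+\psi(\lambda)t}$. Standing assumption: $Z$ is not a subordinator (so $\psi(\lambda)>0$ for some $\lambda>0$), and $\Phi(0):=\inf\{\lambda>0:\psi(\lambda)>0\}<\infty$. On a filtered probability space $(\Omega,\mathcal{G},(\mathcal{G}_t)_{t\ge0},\mathbb{P})$ satisfying the usual hypotheses, $W$ is a $(\mathcal{G}_t)$-Brownian motion, $M(ds,dz,du)$ is an independent $(\mathcal{G}_t)$-Poisson random measure on $(0,\infty)^3$ with intensity $ds\,\pi(dz)\,du$, and $\tilde M$ is its compensated measure. A solution of the equation is a càdlàg $(\mathcal{G}_t)$-adapted process $X$ that satisfies the equation up to the times $\zeta_n:=\inf\{t\ge 0: X_t\ge n\text{ or }X_t\le 1/n\}$ for all $n$, takes values in $(0,\infty)$ until it reaches $0$ or $\infty$, and for which both $0$ and $\infty$ are absorbing. For $1/f$ locally Lipschitz on $(0,\infty)$ (in particular for $f(u)=u^{-\theta}$) the solution is pathwise unique. $T_0^-:=\inf\{t\ge 0:X_t=0\}$ (extinction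 time) and $T_\infty^+:=\inf\{t\ge 0:X_t=\infty\}$ (explosion time), with $\inf\emptyset=\infty$. $X$ becomes extinguishing if $T_0^-=\infty$ and $X_t\to 0$ as $t\to\infty$. $\int^{\infty-}$ denotes integration over $(K,\infty)$ for some $K>\Phi(0)$. $\int_{0+}$ denotes integration over $(0,\delta)$ for some small $\delta>0$ (with $\delta<\Phi(0)$ when $\Phi(0)>0$). *)

theory Defs
  imports "HOL-Probability.Probability"
begin

definition levy_measure :: "real measure \<Rightarrow> bool" where
  "levy_measure \<pi> \<longleftrightarrow>
     sets \<pi> = sets (restrict_space borel {0<..}) \<and> sigma_finite_measure \<pi> \<and>
     (\<integral>\<^sup>+ z. ennreal (min 1 (z\<^sup>2)) \<partial>\<pi>) < \<infinity>"

definition psi :: "real \<Rightarrow> real \<Rightarrow> real measure \<Rightarrow> real \<Rightarrow> real" where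
  "psi b c \<pi> l = b * l + c * l\<^sup>2 +
     (\<integral>u. (exp (- l * u) - 1 + l * u * indicator {0<..1} u) \<partial>\<pi>)"

text \<open>The infimum of the empty set is \<open>\<infinity>\<close>; so \<open>Phi0 b c \<pi> < \<infinity>\<close> says that \<open>psi\<close> is
  positive somewhere, which excludes that the underlying Levy process is a subordinator.\<close>

definition Phi0 :: "real \<Rightarrow> real \<Rightarrow> real measure \<Rightarrow> ereal" where
  "Phi0 b c \<pi> = Inf {ereal l |l. 0 < l \<and> 0 < psi b c \<pi> l}"

text \<open>Lebesgue integral with values in the extended reals. It has its usual meaning when the
  positive or the negative part has finite integral (\<open>\<infinity> - \<infinity> = \<infinity>\<close> in \<^typ>\<open>ereal\<close>).\<close>

definition ext_integral :: "real set \<Rightarrow> (real \<Rightarrow> real) \<Rightarrow> ereal" where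
  "ext_integral A g =
     enn2ereal (\<integral>\<^sup>+ s\<in>A. ennreal (g s) \<partial>lborel) - enn2ereal (\<integral>\<^sup>+ s\<in>A. ennreal (- g s) \<partial>lborel)"

text \<open>Time is \<open>[0,\<infinity>)\<close>, rendered by reals \<open>t \<ge> 0\<close>. The values of processes and
  filtrations at negative times are never used.\<close>

definition usual_hypotheses :: "'a measure \<Rightarrow> (real \<Rightarrow> 'a measure) \<Rightarrow> bool" where
  "usual_hypotheses P F \<longleftrightarrow>
     prob_space P \<and> complete_measure P \<and>
     filtration (space P) (\<lambda>t. F (max 0 t)) \<and>
     (\<forall>t\<ge>0. sets (F t) \<subseteq> sets P) \<and>
     null_sets P \<subseteq> sets (F 0) \<and>
     (\<forall>t\<ge>0. sets (F t) = (\<Inter>s\<in>{t<..}. sets (F s)))"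

definition cadlag :: "(real \<Rightarrow> 'b::topological_space) \<Rightarrow> bool" where
  "cadlag p \<longleftrightarrow>
     (\<forall>t\<ge>0. (p \<longlongrightarrow> p t) (at_right t)) \<and> (\<forall>t>0. \<exists>l. (p \<longlongrightarrow> l) (at_left t))"

definition adapted :: "(real \<Rightarrow> 'a measure) \<Rightarrow> (real \<Rightarrow> 'a \<Rightarrow> 'b::topological_space) \<Rightarrow> bool" where
  "adapted F Y \<longleftrightarrow> (\<forall>t\<ge>0. Y t \<in> borel_measurable (F t))"

definition generated_events ::
    "'a measure \<Rightarrow> ('i \<Rightarrow> 'a \<Rightarrow> 'b::topological_space) \<Rightarrow> 'i set \<Rightarrow> 'a set set" where
  "generated_events P Y I =
     sigma_sets (space P) {Y i -` B \<inter> space P |i B. i \<in> I \<and> B \<in> sets borel}"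

definition brownian_motion ::
    "'a measure \<Rightarrow> (real \<Rightarrow> 'a measure) \<Rightarrow> (real \<Rightarrow> 'a \<Rightarrow> real) \<Rightarrow> bool" where
  "brownian_motion P F W \<longleftrightarrow>
     adapted F W \<and>
     (\<forall>\<omega>\<in>space P. continuous_on {0..} (\<lambda>t. W t \<omega>)) \<and>
     (AE \<omega> in P. W 0 \<omega> = 0) \<and>
     (\<forall>s t. 0 \<le> s \<and> s < t \<longrightarrow>
        distributed P lborel (\<lambda>\<omega>. W t \<omega> - W s \<omega>) (\<lambda>y. ennreal (normal_density 0 (sqrt (t - s)) y)) \<and>
        prob_space.indep_set P (sets (F s)) (generated_events P (\<lambda>r \<omega>. W r \<omega> - W s \<omega>) {t}))"

text \<open>A random measure is a map \<open>N\<close> from the sample space to measures on time \<open>(0,\<infinity>)\<close> times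
  the mark space of \<open>\<nu>\<close>.\<close>

definition time_mark :: "'e measure \<Rightarrow> (real \<times> 'e) measure" where
  "time_mark \<nu> = restrict_space lborel {0<..} \<Otimes>\<^sub>M \<nu>"

definition poisson_random_measure ::
    "'a measure \<Rightarrow> (real \<Rightarrow> 'a measure) \<Rightarrow> 'e measure \<Rightarrow> ('a \<Rightarrow> (real \<times> 'e) measure) \<Rightarrow> bool" where
  "poisson_random_measure P F \<nu> N \<longleftrightarrow>
     (\<forall>\<omega>\<in>space P. sets (N \<omega>) = sets (time_mark \<nu>)) \<and>
     (\<forall>A\<in>sets (time_mark \<nu>). (\<lambda>\<omega>. emeasure (N \<omega>) A) \<in> borel_measurable P) \<and>
     (\<forall>A\<in>sets (time_mark \<nu>). emeasure (time_mark \<nu>) A < \<infinity> \<longrightarrow>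
        (\<forall>k::nat. \<P>(\<omega> in P. emeasure (N \<omega>) A = of_nat k) =
           measure (time_mark \<nu>) A ^ k / fact k * exp (- measure (time_mark \<nu>) A))) \<and>
     (\<forall>A :: nat \<Rightarrow> (real \<times> 'e) set. range A \<subseteq> sets (time_mark \<nu>) \<and> disjoint_family A \<longrightarrow>
        prob_space.indep_vars P (\<lambda>_. borel) (\<lambda>i \<omega>. emeasure (N \<omega>) (A i)) UNIV) \<and>
     (\<forall>t\<ge>0. \<forall>A\<in>sets (time_mark \<nu>). A \<subseteq> {..t} \<times> UNIV \<longrightarrow>
        (\<lambda>\<omega>. emeasure (N \<omega>) A) \<in> borel_measurable (F t)) \<and>
     (\<forall>t\<ge>0. prob_space.indep_set P (sets (F t))
        (generated_events P (\<lambda>A \<omega>. emeasure (N \<omega>) A)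
           {A \<in> sets (time_mark \<nu>). A \<subseteq> {t<..} \<times> UNIV}))"

definition independent_noises ::
    "'a measure \<Rightarrow> 'e measure \<Rightarrow> (real \<Rightarrow> 'a \<Rightarrow> real) \<Rightarrow> ('a \<Rightarrow> (real \<times> 'e) measure) \<Rightarrow> bool" where
  "independent_noises P \<nu> W N \<longleftrightarrow>
     prob_space.indep_set P (generated_events P W {0..})
       (generated_events P (\<lambda>A \<omega>. emeasure (N \<omega>) A) (sets (time_mark \<nu>)))"

text \<open>Both the Ito integral and the integral with respect to a compensated Poisson random measure
  are instances of the integral with respect to an orthogonal martingale measure
  \<open>L A t\<close> (\<open>A\<close> a set of marks) with covariance \<open>ds \<nu>(dy)\<close>. An entry \<open>(a, b, A, \<xi>)\<close> of a
  simple integrand stands for the predictable integrand \<open>\<xi>(\<omega>) 1\<^sub>(\<^sub>a\<^sub>,\<^sub>b\<^sub>](s) 1\<^sub>A(y)\<close>.\<close>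

type_synonym ('e, 'a) simple = "(real \<times> real \<times> 'e set \<times> ('a \<Rightarrow> real)) list"

definition simple_integrand ::
    "'a measure \<Rightarrow> (real \<Rightarrow> 'a measure) \<Rightarrow> 'e measure \<Rightarrow> ('e, 'a) simple \<Rightarrow> bool" where
  "simple_integrand P F \<nu> D \<longleftrightarrow>
     (\<forall>(a, b, A, \<xi>) \<in> set D. 0 \<le> a \<and> a \<le> b \<and> A \<in> sets \<nu> \<and> emeasure \<nu> A < \<infinity> \<and>
        \<xi> \<in> borel_measurable (F a) \<and> bounded (\<xi> ` space P))"

definition simple_value :: "('e, 'a) simple \<Rightarrow> real \<Rightarrow> 'e \<Rightarrow> 'a \<Rightarrow> real" where
  "simple_value D s y \<omega> = (\<Sum>(a, b, A, \<xi>) \<leftarrow> D. \<xi> \<omega> * indicator {a<..b} s * indicator A y)"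

definition simple_integral ::
    "('e set \<Rightarrow> real \<Rightarrow> 'a \<Rightarrow> real) \<Rightarrow> ('e, 'a) simple \<Rightarrow> real \<Rightarrow> 'a \<Rightarrow> real" where
  "simple_integral L D t \<omega> = (\<Sum>(a, b, A, \<xi>) \<leftarrow> D. \<xi> \<omega> * (L A (min t b) \<omega> - L A (min t a) \<omega>))"

definition tendsto_0_in_prob :: "'a measure \<Rightarrow> (nat \<Rightarrow> 'a \<Rightarrow> ennreal) \<Rightarrow> bool" where
  "tendsto_0_in_prob P Y \<longleftrightarrow> (\<forall>e>0. (\<lambda>k. \<P>(\<omega> in P. ennreal e < Y k \<omega>)) \<longlonglongrightarrow> 0)"

text \<open>The cadlag adapted process \<open>J\<close> is the stochastic integral of \<open>H\<close>: the limit in probability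
  of integrals of simple integrands \<open>D k\<close> with
  \<open>\<integral>\<^sub>0\<^sup>t \<integral> (H - D k)\<^sup>2 d\<nu> ds \<rightarrow> 0\<close> in probability for all \<open>t\<close>. The integral is the same for every
  approximating sequence, and this determines \<open>J\<close> up to indistinguishability.\<close>

definition stochastic_integral ::
    "'a measure \<Rightarrow> (real \<Rightarrow> 'a measure) \<Rightarrow> 'e measure \<Rightarrow> ('e set \<Rightarrow> real \<Rightarrow> 'a \<Rightarrow> real) \<Rightarrow>
     (real \<Rightarrow> 'e \<Rightarrow> 'a \<Rightarrow> real) \<Rightarrow> (real \<Rightarrow> 'a \<Rightarrow> real) \<Rightarrow> bool" where
  "stochastic_integral P F \<nu> L H J \<longleftrightarrow>
     (\<lambda>(\<omega>, s, y). H s y \<omega>) \<in> borel_measurable (P \<Otimes>\<^sub>M time_mark \<nu>) \<and>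
     adapted F J \<and> (\<forall>\<omega>\<in>space P. cadlag (\<lambda>t. J t \<omega>)) \<and>
     (\<exists>D. (\<forall>k. simple_integrand P F \<nu> (D k)) \<and>
        (\<forall>t\<ge>0. tendsto_0_in_prob P
           (\<lambda>k \<omega>. \<integral>\<^sup>+ s\<in>{0<..t}. (\<integral>\<^sup>+ y. ennreal ((H s y \<omega> - simple_value (D k) s y \<omega>)\<^sup>2) \<partial>\<nu>) \<partial>lborel)) \<and>
        (\<forall>t\<ge>0. tendsto_0_in_prob P
           (\<lambda>k \<omega>. ennreal \<bar>J t \<omega> - simple_integral L (D k) t \<omega>\<bar>)))"

text \<open>For Brownian motion the mark space is a single point.\<close>

definition ito_integral ::
    "'a measure \<Rightarrow> (real \<Rightarrow> 'a measure) \<Rightarrow> (real \<Rightarrow> 'a \<Rightarrow> real) \<Rightarrow>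
     (real \<Rightarrow> 'a \<Rightarrow> real) \<Rightarrow> (real \<Rightarrow> 'a \<Rightarrow> real) \<Rightarrow> bool" where
  "ito_integral P F W H I \<longleftrightarrow>
     stochastic_integral P F (count_space (UNIV :: unit set))
       (\<lambda>A t \<omega>. indicator A () * W t \<omega>) (\<lambda>s _ \<omega>. H s \<omega>) I"

definition compensated_integral ::
    "'a measure \<Rightarrow> (real \<Rightarrow> 'a measure) \<Rightarrow> 'e measure \<Rightarrow> ('a \<Rightarrow> (real \<times> 'e) measure) \<Rightarrow>
     (real \<Rightarrow> 'e \<Rightarrow> 'a \<Rightarrow> real) \<Rightarrow> (real \<Rightarrow> 'a \<Rightarrow> real) \<Rightarrow> bool" where
  "compensated_integral P F \<nu> N H J \<longleftrightarrow>
     stochastic_integral P F \<nu>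
       (\<lambda>A t \<omega>. measure (N \<omega>) ({0<..t} \<times> A) - t * measure \<nu> A) H J"

text \<open>The state space is \<open>[0,\<infinity>]\<close>, so processes take values in \<^typ>\<open>ennreal\<close>.\<close>

definition hitting_time :: "(real \<Rightarrow> 'a \<Rightarrow> ennreal) \<Rightarrow> ennreal set \<Rightarrow> 'a \<Rightarrow> ereal" where
  "hitting_time X S \<omega> = Inf {ereal t |t. 0 \<le> t \<and> X t \<omega> \<in> S}"

definition zeta :: "(real \<Rightarrow> 'a \<Rightarrow> ennreal) \<Rightarrow> nat \<Rightarrow> 'a \<Rightarrow> ereal" where
  "zeta X n = hitting_time X ({ennreal (real n)..} \<union> {..ennreal (1 / real n)})"

definition extinction_time :: "(real \<Rightarrow> 'a \<Rightarrow> ennreal) \<Rightarrow> 'a \<Rightarrow> ereal" where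
  "extinction_time X = hitting_time X {0}"

definition explosion_time :: "(real \<Rightarrow> 'a \<Rightarrow> ennreal) \<Rightarrow> 'a \<Rightarrow> ereal" where
  "explosion_time X = hitting_time X {\<infinity>}"

definition left_limit :: "(real \<Rightarrow> 'a \<Rightarrow> ennreal) \<Rightarrow> real \<Rightarrow> 'a \<Rightarrow> ennreal" where
  "left_limit X s \<omega> = Lim (at_left s) (\<lambda>r. X r \<omega>)"

text \<open>The mark \<open>(z, u)\<close> of a point has intensity \<open>\<pi>(dz) du\<close> on \<open>(0,\<infinity>)\<^sup>2\<close>.\<close>

definition mark_measure :: "real measure \<Rightarrow> (real \<times> real) measure" where
  "mark_measure \<pi> = \<pi> \<Otimes>\<^sub>M restrict_space lborel {0<..}"

text \<open>The equation at time \<open>t \<and> \<zeta>\<^sub>n\<close>: all integrands are multiplied by \<open>1\<^bsub>{s \<le> \<zeta>\<^sub>n}\<^esub>\<close>.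
  Equality is stated in \<^typ>\<open>ereal\<close> because \<^const>\<open>ennreal\<close> would truncate a
  negative right-hand side to \<open>0\<close>.\<close>

definition solves_up_to_zeta ::
    "'a measure \<Rightarrow> (real \<Rightarrow> 'a measure) \<Rightarrow> (real \<Rightarrow> 'a \<Rightarrow> real) \<Rightarrow>
     ('a \<Rightarrow> (real \<times> real \<times> real) measure) \<Rightarrow> real \<Rightarrow> real \<Rightarrow> real measure \<Rightarrow>
     (real \<Rightarrow> real) \<Rightarrow> real \<Rightarrow> (real \<Rightarrow> 'a \<Rightarrow> ennreal) \<Rightarrow> nat \<Rightarrow> bool" where
  "solves_up_to_zeta P F W N b c \<pi> f x X n \<longleftrightarrow>
     (\<exists>I J.
        ito_integral P F W
          (\<lambda>s \<omega>. if ereal s \<le> zeta X n \<omega> then sqrt (1 / f (enn2real (X s \<omega>))) else 0) I \<and>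
        compensated_integral P F (mark_measure \<pi>) N
          (\<lambda>s (z, u) \<omega>. if ereal s \<le> zeta X n \<omega> \<and> z \<le> 1 \<and> u \<le> 1 / f (enn2real (left_limit X s \<omega>))
             then z else 0) J \<and>
        (AE \<omega> in P. \<forall>t\<ge>0.
          enn2ereal (X (real_of_ereal (min (ereal t) (zeta X n \<omega>))) \<omega>) =
          ereal (x + sqrt (2 * c) * I t \<omega> + J t \<omega>
            - b * (LINT s:{s. 0 \<le> s \<and> s \<le> t \<and> ereal s \<le> zeta X n \<omega>}|lborel. 1 / f (enn2real (X s \<omega>)))
            + (\<integral>(s, z, u). (if s \<le> t \<and> ereal s \<le> zeta X n \<omega> \<and> 1 < z \<and>
                   u \<le> 1 / f (enn2real (left_limit X s \<omega>)) then z else 0) \<partial>N \<omega>))))"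

text \<open>Absorption includes the case where a boundary is reached as a left limit: the equation alone
  does not constrain the process from \<open>sup\<^sub>n \<zeta>\<^sub>n\<close> on.\<close>

definition absorbing :: "'a measure \<Rightarrow> (real \<Rightarrow> 'a \<Rightarrow> ennreal) \<Rightarrow> ennreal \<Rightarrow> bool" where
  "absorbing P X a \<longleftrightarrow>
     (AE \<omega> in P. \<forall>t\<ge>0. X t \<omega> = a \<or> (0 < t \<and> left_limit X t \<omega> = a) \<longrightarrow> (\<forall>s\<ge>t. X s \<omega> = a))"

definition sde_solution ::
    "'a measure \<Rightarrow> (real \<Rightarrow> 'a measure) \<Rightarrow> (real \<Rightarrow> 'a \<Rightarrow> real) \<Rightarrow>
     ('a \<Rightarrow> (real \<times> real \<times> real) measure) \<Rightarrow> real \<Rightarrow> real \<Rightarrow> real measure \<Rightarrow>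
     (real \<Rightarrow> real) \<Rightarrow> real \<Rightarrow> (real \<Rightarrow> 'a \<Rightarrow> ennreal) \<Rightarrow> bool" where
  "sde_solution P F W N b c \<pi> f x X \<longleftrightarrow>
     adapted F X \<and> (\<forall>\<omega>\<in>space P. cadlag (\<lambda>t. X t \<omega>)) \<and>
     (\<forall>n\<ge>1. solves_up_to_zeta P F W N b c \<pi> f x X n) \<and>
     absorbing P X 0 \<and> absorbing P X \<infinity>"

end

(* Exponential martingales of W and N, for simple integrands approximating the coefficients, give
E e^{-l X_t} = e^{-l x} + psi(l) int_0^t E[X_s^theta e^{-l X_s}] ds. Integrate this in l against
l^(theta-1)/|psi(l)|: as int_0^oo l^(theta-1) y^theta e^{-l y} dl = Gamma(theta) for 0 < y < oo, the last
term becomes an occupation time, while near l = oo (l = 0) the event X_t = 0 (X_t = oo) contributes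
the integral of the criterion. X tends to 0 with positive probability since e^{-K X} is a
submartingale when psi(K) > 0. *)
theory Submission
  imports Defs "HOL-Complex_Analysis.Complex_Analysis"
begin

text \<open>No Ito formula enters. The stochastic integrals are known only as limits in probability
  of integrals of simple integrands, so exponentials are computed for simple integrands and carried
  to the limit. Real exponentials resist this: the approximants of the Gaussian and of the
  compensated part can have either sign, and nothing bounds their exponentials. Imaginary exponents
  are bounded after a truncation; only for the stopped solution, which is nonnegative, are the
  frequencies continued from the real line through the upper half-plane to \<open>\<i> * l\<close>.
  The large jumps enter the equation as a pathwise integral, so their simple approximants have to be
  constructed. The equivalences rest on two opposite uses of the mixture over \<open>l\<close>. When
  the integral of the criterion is infinite, the mixture is infinite at the boundary but has finite
  mean, so the boundary is not reached. When it is finite, it bounds the mean occupation for all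
  times, whereas avoiding the boundary would make the occupation grow linearly; the same bound
  excludes paths that tend to 0 without reaching it.\<close>

lemmas lebesgue_integral_cong = Bochner_Integration.integral_cong

section \<open>Exponential martingales of the Brownian motion\<close>

text \<open>Stands in for conditioning on \<open>G\<close>: independence makes the joint law of the
  two copies of the identity, read in \<open>G\<close> and in \<open>H\<close>, a product, so the
  \<open>G\<close>-argument can be frozen while the \<open>H\<close>-argument is averaged.\<close>

lemma (in prob_space) integral_indep_freeze:
 fixes f :: "'a \<times> 'a => 'b::{banach, second_countable_topology}"
 assumes G: "subalgebra M G" and H: "subalgebra M H"
  and ind: "indep_set (sets G) (sets H)"
  and f: "f \<in> borel_measurable (G \<Otimes>\<^sub>M H)"
  and b: "\<And>x y. x \<in> space M ==> y \<in> space M ==> norm (f (x, y)) \<le> B" shows "(LINT x|M. f (x, x)) = (LINT x|M. (LINT y|M. f (x, y)))"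
proof -
 let ?a = "\<lambda>x. \<integral>y. f (x, y) \<partial>distr M H (\<lambda>x. x)"
 let ?b = "distr M G (\<lambda>x. x) \<Otimes>\<^sub>M distr M H (\<lambda>x. x)"
 have sp: "space G = space M" "space H = space M" using G H by (auto simp: subalgebra_def)
 have [measurable]: "(\<lambda>x. x) \<in> measurable M G" "(\<lambda>x. x) \<in> measurable M H"
  using G H by (auto simp: subalgebra_def measurable_def intro: sets.Int_space_eq2 dest: sets.sets_into_space)
 have eq: "sigma_sets (space M) {(\<lambda>x. x) -` A \<inter> space M |A. A \<in> sets K} = sets K"
  if "subalgebra M K" for K
 proof -
  have sK: "space K = space M" using that by (simp add: subalgebra_def)
  have "{(\<lambda>x. x) -` A \<inter> space M |A. A \<in> sets K} = sets K" using sets.sets_into_space[of _ K] sK by (auto simp: Int_absorb2)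
  thus ?thesis using sets.sigma_sets_eq[of K] sK by simp
 qed
 have "indep_var G (\<lambda>x. x) H (\<lambda>x. x)" unfolding indep_var_eq using ind by (simp only: eq[OF G] eq[OF H]) simp
 hence d: "distr M (G \<Otimes>\<^sub>M H) (\<lambda>x. (x, x)) = distr M G (\<lambda>x. x) \<Otimes>\<^sub>M distr M H (\<lambda>x. x)"
  by (auto simp: indep_var_distribution_eq)
 interpret g: prob_space "distr M G (\<lambda>x. x)" by (rule prob_space_distr) simp
 interpret h: prob_space "distr M H (\<lambda>x. x)" by (rule prob_space_distr) simp
 interpret gh: pair_prob_space "distr M G (\<lambda>x. x)" "distr M H (\<lambda>x. x)" ..
 have f': "f \<in> borel_measurable ?b" using f by (simp cong: measurable_cong_sets sets_pair_measure_cong)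
 have int: "integrable ?b f" by (rule gh.integrable_const_bound[where B=B]) (use f' b sp in \<open>auto simp: space_pair_measure\<close>)
 have "(LINT x|M. f (x, x)) = (LINT p|distr M (G \<Otimes>\<^sub>M H) (\<lambda>x. (x, x)). f p)" by (subst integral_distr) (use f in auto)
 also have "\<dots> = (LINT x|distr M G (\<lambda>x. x). (?a x))" unfolding d using gh.integral_fst'[OF int] by simp
 also have "\<dots> = (LINT x|M. (?a x))"
 proof (subst integral_distr)
  show "(\<lambda>x. \<integral>y. f (x, y) \<partial>distr M H (\<lambda>x. x)) \<in> borel_measurable G"
   using f by (intro h.borel_measurable_lebesgue_integral) (simp add: case_prod_beta cong: measurable_cong_sets sets_pair_measure_cong)
 qed simp_all
 also have "\<dots> = (LINT x|M. (LINT y|M. f (x, y)))"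
 proof (rule lebesgue_integral_cong[OF refl])
  fix x assume "x \<in> space M"
  hence "(\<lambda>y. f (x, y)) \<in> borel_measurable H" using f sp by (metis measurable_Pair1' measurable_compose)
  thus "(?a x) = (LINT y|M. f (x, y))" by (subst integral_distr) auto
 qed
 finally show ?thesis .
qed

lemma (in prob_space) indep_set_mono:
 "indep_set A B ==> A' \<subseteq> A ==> B' \<subseteq> B ==> indep_set A' B'"
 unfolding indep_set_def by (erule indep_sets_mono_sets) (auto split: bool.split)

locale noisy_space = prob_space P
 for P :: "'a measure" +
 fixes F :: "real => 'a measure" and W :: "real => 'a => real"
  and \<nu> :: "'e measure" and N :: "'a => (real \<times> 'e) measure"
 assumes usual: "usual_hypotheses P F"
  and bm: "brownian_motion P F W"
  and prm: "poisson_random_measure P F \<nu> N"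
  and sf: "sigma_finite_measure \<nu>"
begin

sublocale mark: sigma_finite_measure \<nu> by (rule sf)

lemma subalgebra_F: "0 \<le> t ==> subalgebra P (F t)" using usual unfolding usual_hypotheses_def filtration_def subalgebra_def by (metis max.absorb2)

lemma space_F [simp]: "0 \<le> t ==> space (F t) = space P" using subalgebra_F by (simp add: subalgebra_def)

lemma sets_F: "0 \<le> t ==> sets (F t) \<subseteq> sets P" using subalgebra_F by (simp add: subalgebra_def)

lemma F_mono: "0 \<le> s ==> s \<le> t ==> sets (F s) \<subseteq> sets (F t)" using usual unfolding usual_hypotheses_def filtration_def
 by (metis max.absorb2 order_trans)

lemma measurable_F: "f \<in> measurable (F t) M ==> 0 \<le> t ==> f \<in> measurable P M" using measurable_from_subalg[OF subalgebra_F] by blast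

lemma measurable_F_mono:
 "f \<in> measurable (F s) M ==> 0 \<le> s ==> s \<le> t ==> f \<in> measurable (F t) M"
 using F_mono[of s t] space_F[of s] space_F[of t] by (auto simp: measurable_def)

lemma W_increment_char:
 assumes "0 \<le> q" "q < r"
 shows "(LINT w|P. exp (\<i> * complex_of_real (v * (W r w - W q w)))) = exp (- complex_of_real (v\<^sup>2 * (r - q) / 2))"
proof -
 define \<sigma> where "\<sigma> = sqrt (r - q)"
 have s: "\<sigma> > 0" "\<sigma>\<^sup>2 = r - q" using assms by (auto simp: \<sigma>_def)
 have "distributed P lborel (\<lambda>w. W r w - W q w) (normal_density 0 \<sigma>)"
  using bm assms unfolding brownian_motion_def \<sigma>_def by blast
 hence "distributed P lborel (\<lambda>w. (W r w - W q w - 0) / \<sigma>) std_normal_density" by (subst (asm) normal_standard_normal_convert[OF s(1)])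
 hence d: "distr P lborel (\<lambda>w. (W r w - W q w) / \<sigma>) = std_normal_distribution"
  and m: "(\<lambda>w. (W r w - W q w) / \<sigma>) \<in> measurable P lborel" by (auto simp: distributed_def)
 have "(LINT w|P. exp (\<i> * complex_of_real (v * (W r w - W q w))))
   = (LINT w|P. iexp ((v * \<sigma>) * ((W r w - W q w) / \<sigma>)))" using s by simp
 also have "\<dots> = (LINT x|distr P lborel (\<lambda>w. (W r w - W q w) / \<sigma>). iexp ((v * \<sigma>) * x))"
  by (subst integral_distr[OF m]) auto
 also have "\<dots> = char std_normal_distribution (v * \<sigma>)" unfolding d char_def ..
 also have "\<dots> = exp (- complex_of_real (v\<^sup>2 * (r - q) / 2))"
  using s by (simp add: char_std_normal_distribution power_mult_distrib exp_of_real[symmetric] flip: of_real_power)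
 finally show ?thesis .
qed

text \<open>\<open>Z\<close> and \<open>a\<close> are known at time \<open>q\<close> and are frozen;
  the independent Gaussian increment then contributes
  \<open>exp (- a\<^sup>2 * (r - q) / 2)\<close>, which the second term of the exponent cancels. The
  coefficient sits at the left end of the interval, as in a simple integrand.\<close>

lemma W_exp_martingale:
 fixes Z :: "'a => complex"
 assumes q: "0 \<le> q" "q \<le> r"
  and Z [measurable]: "Z \<in> borel_measurable (F q)" and a [measurable]: "a \<in> borel_measurable (F q)"
  and ZB: "\<And>w. w \<in> space P ==> norm (Z w) \<le> B"
  and aB: "\<And>w. w \<in> space P ==> \<bar>a w\<bar> \<le> B'"
 shows "(LINT w|P. Z w * exp (\<i> * of_real (a w * (W r w - W q w)) + of_real ((a w)\<^sup>2 * (r - q) / 2)))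
  = (LINT w|P. Z w)"
proof (cases "q = r")
 let ?a = "\<lambda>x r. of_real ((a x)\<^sup>2 * (r - q) / 2)"
 case False
 hence qr: "q < r" using q by simp
 define D where "D w = W r w - W q w" for w
 have "adapted F W" using bm by (simp add: brownian_motion_def)
 hence "W r \<in> borel_measurable (F r)" "W q \<in> borel_measurable (F q)" using q by (auto simp: adapted_def)
 hence D: "D \<in> borel_measurable P" unfolding D_def using q by (intro borel_measurable_diff) (auto intro: measurable_F)
 \<comment> \<open>The partner of \<open>F q\<close> is the sigma-algebra of this single increment,
   for which \<open>brownian_motion\<close> states the independence.\<close>
 define H where "H = vimage_algebra (space P) D borel"
 have DH [measurable]: "D \<in> borel_measurable H" unfolding H_def by (rule measurable_vimage_algebra1) simp
 have sH: "sets H = {D -` A \<inter> space P |A. A \<in> sets borel}" unfolding H_def by (subst sets_vimage_algebra2) auto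
 have H: "subalgebra P H" unfolding subalgebra_def sH using D by (auto simp: H_def)
 have "indep_set (sets (F q)) (generated_events P (\<lambda>r w. W r w - W q w) {r})" using bm q qr unfolding brownian_motion_def by blast
 moreover have "sets H \<subseteq> generated_events P (\<lambda>r w. W r w - W q w) {r}"
  unfolding generated_events_def sH D_def by (auto intro!: sigma_sets.Basic)
 ultimately have ind: "indep_set (sets (F q)) (sets H)" by (rule indep_set_mono[OF _ order_refl])
 define f where "f = (\<lambda>(x, y). Z x * exp (\<i> * of_real (a x * D y) + ?a x r))"
 have fm: "f \<in> borel_measurable (F q \<Otimes>\<^sub>M H)" unfolding f_def by measurable
 have fb: "norm (f (x, y)) \<le> B * exp (B'\<^sup>2 * (r - q) / 2)" if "x \<in> space P" "y \<in> space P" for x y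
 proof -
  have "(a x)\<^sup>2 \<le> B'\<^sup>2" using aB[OF that(1)] by (simp add: abs_le_square_iff[symmetric])
  hence "(a x)\<^sup>2 * (r - q) / 2 \<le> B'\<^sup>2 * (r - q) / 2" using q by (intro divide_right_mono mult_right_mono) auto
  moreover have "0 \<le> B" using ZB[OF that(1)] norm_ge_zero order_trans by blast
  ultimately show ?thesis unfolding f_def using ZB[OF that(1)] by (auto simp: norm_mult intro!: mult_mono)
 qed
 have "(LINT w|P. f (w, w)) = (LINT x|P. (LINT y|P. f (x, y)))" by (rule integral_indep_freeze[OF subalgebra_F[OF q(1)] H ind fm fb])
 also have "\<dots> = (LINT x|P. Z x)"
 proof (rule lebesgue_integral_cong[OF refl])
  fix x
  have "(LINT y|P. f (x, y)) = (LINT y|P. (Z x * exp (?a x r)) * exp (\<i> * of_real (a x * D y)))" by (simp add: f_def exp_add mult_ac)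
  also have "\<dots> = Z x * exp (?a x r) * exp (- ?a x r)"
   unfolding D_def by (subst integral_mult_right_zero) (simp only: W_increment_char[OF q(1) qr])
  also have "\<dots> = Z x" by (simp add: mult.assoc flip: exp_add)
  finally show "(LINT y|P. f (x, y)) = Z x" .
 qed
 finally show ?thesis by (simp add: f_def D_def)
qed simp

end

section \<open>Poisson counts and characteristic functions of compound Poisson sums\<close>

lemma poisson_char_sums:
 fixes m :: real and z :: complex shows "(\<lambda>k. z ^ k * of_real (m ^ k / fact k * exp (- m))) sums exp (of_real m * (z - 1))"
proof -
 have "(\<lambda>k. (of_real m * z) ^ k /\<^sub>R fact k) sums exp (of_real m * z)" by (rule exp_converges)
 hence "(\<lambda>k. (of_real m * z) ^ k /\<^sub>R fact k * exp (- of_real m)) sums (exp (of_real m * z) * exp (- of_real m))" by (rule sums_mult2)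
 moreover have "(of_real m * z) ^ k /\<^sub>R fact k * exp (- of_real m) = z ^ k * of_real (m ^ k / fact k * exp (- m))" for k
  by (simp add: power_mult_distrib scaleR_conv_of_real field_simps exp_of_real[symmetric])
 moreover have "exp (of_real m * z) * exp (- of_real m) = exp (of_real m * (z - 1))" by (simp add: algebra_simps flip: exp_add)
 ultimately show ?thesis by simp
qed

context noisy_space begin

lemma sets_N: "w \<in> space P ==> sets (N w) = sets (time_mark \<nu>)" using prm by (simp add: poisson_random_measure_def)

lemma N_measurable: "A \<in> sets (time_mark \<nu>) ==> (\<lambda>w. emeasure (N w) A) \<in> borel_measurable P"
 using prm by (simp add: poisson_random_measure_def)

lemma N_adapted:
 "0 \<le> t ==> A \<in> sets (time_mark \<nu>) ==> A \<subseteq> {..t} \<times> UNIV ==> (\<lambda>w. emeasure (N w) A) \<in> borel_measurable (F t)"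
 using prm by (simp add: poisson_random_measure_def)

lemma N_prob:
 assumes "A \<in> sets (time_mark \<nu>)" "emeasure (time_mark \<nu>) A < \<infinity>" shows "\<P>(w in P. emeasure (N w) A = of_nat k) =
  measure (time_mark \<nu>) A ^ k / fact k * exp (- measure (time_mark \<nu>) A)" using prm assms unfolding poisson_random_measure_def by blast

text \<open>The Poisson weights already sum to 1, which leaves no mass for an infinite or a
  fractional count.\<close>

lemma AE_N_nat:
 assumes A: "A \<in> sets (time_mark \<nu>)" "emeasure (time_mark \<nu>) A < \<infinity>"
 shows "AE w in P. \<exists>k::nat. emeasure (N w) A = of_nat k"
proof -
 let ?E = "\<lambda>k::nat. {w\<in>space P. emeasure (N w) A = of_nat k}"
 have [measurable]: "(\<lambda>w. emeasure (N w) A) \<in> borel_measurable P" using N_measurable[OF A(1)] .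
 have E: "?E k \<in> sets P" for k by measurable
 have "disjoint_family ?E" by (auto simp: disjoint_family_on_def)
 hence "(\<lambda>k. prob (?E k)) sums prob (\<Union>k. ?E k)" using E by (intro finite_measure_UNION) auto
 moreover have "(\<lambda>k. prob (?E k)) sums 1"
  using sums_mult2[OF exp_converges[of "measure (time_mark \<nu>) A"], of "exp (- measure (time_mark \<nu>) A)"]
  unfolding N_prob[OF A] by (simp add: field_simps flip: exp_add)
 ultimately have "prob (\<Union>k. ?E k) = 1" by (rule sums_unique2)
 hence "AE w in P. w \<in> (\<Union>k. ?E k)" using E by (subst prob_eq_1[symmetric]) auto
 thus ?thesis by eventually_elim auto
qed

text \<open>Only the values of \<open>h\<close> at integer counts matter, because all other counts
  form a null set by \<open>AE_N_nat\<close>.\<close>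

lemma N_expectation_sums:
 fixes g :: "nat => ennreal"
 assumes A: "A \<in> sets (time_mark \<nu>)" "emeasure (time_mark \<nu>) A < \<infinity>"
  and h: "h \<in> borel_measurable P"
  and hg: "\<And>w k. w \<in> space P ==> emeasure (N w) A = of_nat k ==> h w = g k"
 shows "(\<integral>\<^sup>+w. h w \<partial>P) = (\<Sum>k. g k * ennreal (measure (time_mark \<nu>) A ^ k / fact k * exp (- measure (time_mark \<nu>) A)))"
proof -
 let ?E = "\<lambda>k::nat. {w\<in>space P. emeasure (N w) A = of_nat k}"
 have [measurable]: "(\<lambda>w. emeasure (N w) A) \<in> borel_measurable P" using N_measurable[OF A(1)] .
 have E[measurable]: "?E k \<in> sets P" for k by measurable
 have "(\<integral>\<^sup>+w. h w \<partial>P) = (\<integral>\<^sup>+w. (\<Sum>k. g k * indicator (?E k) w) \<partial>P)"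
 proof (rule nn_integral_cong_AE)
  show "AE w in P. h w = (\<Sum>k. g k * indicator (?E k) w)" using AE_N_nat[OF A] AE_space
  proof eventually_elim
   case (elim w)
   then obtain k :: nat where k: "emeasure (N w) A = of_nat k" by auto
   have "(\<Sum>j. g j * indicator (?E j) w) = (\<Sum>j\<in>{k}. g j * indicator (?E j) w)"
    using k by (intro suminf_finite) (auto split: split_indicator)
   thus ?case using hg[OF elim(2) k] k elim by simp
  qed
 qed
 also have "\<dots> = (\<Sum>k. g k * emeasure P (?E k))" by (subst nn_integral_suminf) (auto intro!: suminf_cong nn_integral_cmult_indicator)
 finally show ?thesis unfolding emeasure_eq_measure N_prob[OF A] .
qed

lemma N_mean:
 assumes A: "A \<in> sets (time_mark \<nu>)" "emeasure (time_mark \<nu>) A < \<infinity>"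
 shows "(\<integral>\<^sup>+w. emeasure (N w) A \<partial>P) = emeasure (time_mark \<nu>) A"
proof -
 define m where "m = measure (time_mark \<nu>) A"
 have m0: "0 \<le> m" by (simp add: m_def)
 have "(\<lambda>k. m ^ k /\<^sub>R fact k * (m * exp (- m))) sums (exp m * (m * exp (- m)))" by (intro sums_mult2 exp_converges)
 moreover have "m ^ k /\<^sub>R fact k * (m * exp (- m)) = real (Suc k) * (m ^ Suc k / fact (Suc k) * exp (- m))" for k
  by (simp add: divide_inverse mult_ac)
 moreover have "exp m * (m * exp (- m)) = m" by (simp add: exp_minus)
 ultimately have "(\<lambda>k. real (Suc k) * (m ^ Suc k / fact (Suc k) * exp (- m))) sums m" by simp
 \<comment> \<open>Shifting the index back is free, since the term at \<open>k = 0\<close>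
   vanishes.\<close>
 hence s: "(\<lambda>k. real k * (m ^ k / fact k * exp (- m))) sums m" by (subst (asm) sums_Suc_iff) simp
 have "(\<integral>\<^sup>+w. emeasure (N w) A \<partial>P) = (\<Sum>k. of_nat k * ennreal (m ^ k / fact k * exp (- m)))"
  unfolding m_def by (rule N_expectation_sums[OF A N_measurable[OF A(1)]])
 also have "\<dots> = (\<Sum>k. ennreal (real k * (m ^ k / fact k * exp (- m))))"
  using m0 by (intro suminf_cong) (simp add: ennreal_mult ennreal_of_nat_eq_real_of_nat del: times_divide_eq_right)
 also have "\<dots> = ennreal m" using s m0 by (intro suminf_ennreal_eq) auto
 also have "\<dots> = emeasure (time_mark \<nu>) A" using A(2) by (simp add: m_def measure_def)
 finally show ?thesis .
qed

lemma integrable_N: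
 assumes A: "A \<in> sets (time_mark \<nu>)" "emeasure (time_mark \<nu>) A < \<infinity>" shows "integrable P (\<lambda>w. measure (N w) A)"
proof (rule integrableI_bounded)
 let ?a = "\<integral>\<^sup>+w. ennreal (norm (measure (N w) A)) \<partial>P"
 show "(\<lambda>w. measure (N w) A) \<in> borel_measurable P" using N_measurable[OF A(1)] by (simp add: measure_def)
 have "?a \<le> (\<integral>\<^sup>+w. emeasure (N w) A \<partial>P)" by (intro nn_integral_mono) (simp add: measure_def ennreal_enn2real_if)
 thus "?a < \<infinity>" using A(2) N_mean[OF A] by (simp add: le_less_trans)
qed

lemma N_char:
 assumes A: "A \<in> sets (time_mark \<nu>)" "emeasure (time_mark \<nu>) A < \<infinity>"
 shows "(LINT y|P. exp (\<i> * of_real (w * measure (N y) A)))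
  = exp (of_real (measure (time_mark \<nu>) A) * (exp (\<i> * of_real w) - 1))"
proof -
 let ?a = "exp (\<i> * of_real w)"
 let ?E = "\<lambda>k::nat. {y\<in>space P. emeasure (N y) A = of_nat k}"
 let ?f = "\<lambda>y. exp (\<i> * complex_of_real (w * measure (N y) A))"
 have [measurable]: "(\<lambda>y. emeasure (N y) A) \<in> borel_measurable P" using N_measurable[OF A(1)] .
 hence [measurable]: "(\<lambda>y. measure (N y) A) \<in> borel_measurable P" by (simp add: measure_def)
 have E[measurable]: "?E k \<in> sets P" for k by measurable
 have int: "integrable P ?f" by (rule integrable_const_bound[where B=1]) (auto intro!: AE_I2)
 have "(LINT y|P. ?f y) = (LINT y:(\<Union>k. ?E k)|P. ?f y)" unfolding set_lebesgue_integral_def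
 proof (rule integral_cong_AE)
  show "AE y in P. ?f y = indicator (\<Union>k. ?E k) y *\<^sub>R ?f y" using AE_N_nat[OF A] AE_space by eventually_elim (auto simp: indicator_def)
 qed auto
 also have "\<dots> = (\<Sum>k. (LINT y:?E k|P. ?f y))" by (rule lebesgue_integral_countable_add)
    (use int in \<open>auto simp: set_integrable_def intro!: integrable_mult_indicator\<close>)
 also have "\<dots> = (\<Sum>k. ?a ^ k * of_real (prob (?E k)))"
 proof (rule suminf_cong)
  fix k
  have "(LINT y:?E k|P. ?f y) = (LINT y:?E k|P. ?a ^ k)" by (rule set_lebesgue_integral_cong[OF E])
     (auto simp: measure_def mult_ac simp flip: exp_of_nat_mult)
  also have "\<dots> = ?a ^ k * of_real (prob (?E k))" by (simp add: set_lebesgue_integral_def scaleR_conv_of_real mult.commute)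
  finally show "(LINT y:?E k|P. ?f y) = ?a ^ k * of_real (prob (?E k))" .
 qed
 also have "\<dots> = exp (of_real (measure (time_mark \<nu>) A) * (?a - 1))"
  unfolding N_prob[OF A] by (rule sums_unique[symmetric, OF poisson_char_sums])
 finally show ?thesis .
qed

end

lemma norm_exp_i_minus_1_le: "norm (exp (\<i> * complex_of_real x) - 1) \<le> \<bar>x\<bar>" using iexp_approx1[of x 0] by simp

lemmas sum_list_cong = arg_cong[where f=sum_list, OF map_cong]

lemma abs_sum_list_le: "\<bar>sum_list xs\<bar> \<le> (\<Sum>x\<leftarrow>xs. \<bar>x\<bar>)" for xs :: "real list" by (induction xs) auto

lemma borel_measurable_sum_list [measurable (raw)]:
 fixes f :: "'c => 'a => 'b::{second_countable_topology, topological_monoid_add}"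
 assumes "\<And>x. x \<in> set xs ==> f x \<in> borel_measurable M" shows "(\<lambda>w. \<Sum>x\<leftarrow>xs. f x w) \<in> borel_measurable M"
 using assms by (induction xs) auto

lemma integrable_sum_list:
 fixes f :: "'c => 'a => 'b::{banach, second_countable_topology}"
 assumes "\<And>x. x \<in> set xs ==> integrable M (f x)" shows "integrable M (\<lambda>w. \<Sum>x\<leftarrow>xs. f x w)"
 using assms by (induction xs) auto

lemma integral_sum_list:
 fixes f :: "'c => 'a => 'b::{banach, second_countable_topology}"
 assumes "\<And>x. x \<in> set xs ==> integrable M (f x)"
 shows "(LINT w|M. (\<Sum>x\<leftarrow>xs. f x w)) = (\<Sum>x\<leftarrow>xs. \<integral>w. f x w \<partial>M)" using assms
proof (induction xs)
 case (Cons a xs)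
 thus ?case by (simp add: integral_add integrable_sum_list)
qed simp

context noisy_space begin

lemma space_time_mark: "space (time_mark \<nu>) = {0<..} \<times> space \<nu>" by (simp add: time_mark_def space_pair_measure space_restrict_space)

lemma time_mark_rect [measurable]:
 assumes "0 \<le> q" "A \<in> sets \<nu>" shows "{q<..r} \<times> A \<in> sets (time_mark \<nu>)" unfolding time_mark_def using assms
 by (intro pair_measureI) (auto simp: sets_restrict_space_iff)

lemma emeasure_time_mark_rect:
 assumes "0 \<le> q" "q \<le> r" "A \<in> sets \<nu>" shows "emeasure (time_mark \<nu>) ({q<..r} \<times> A) = ennreal (r - q) * emeasure \<nu> A"
proof -
 have "{q<..r} \<in> sets (restrict_space lborel {0<..})" using assms by (auto simp: sets_restrict_space_iff)
 moreover have "emeasure (restrict_space lborel {0<..}) {q<..r} = ennreal (r - q)" using assms by (subst emeasure_restrict_space) auto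
 ultimately show ?thesis unfolding time_mark_def using assms by (simp add: mark.emeasure_pair_measure_Times)
qed

lemma emeasure_time_mark_rect_finite:
 assumes "0 \<le> q" "A \<in> sets \<nu>" "emeasure \<nu> A < \<infinity>" shows "emeasure (time_mark \<nu>) ({q<..r} \<times> A) < \<infinity>"
 using emeasure_time_mark_rect[of q r A] assms by (cases "q \<le> r") (auto simp: ennreal_mult_less_top)

lemma AE_N_finite:
 assumes "0 \<le> q" "A \<in> sets \<nu>" "emeasure \<nu> A < \<infinity>" shows "AE w in P. emeasure (N w) ({q<..r} \<times> A) < \<infinity>"
 using AE_N_nat[OF time_mark_rect emeasure_time_mark_rect_finite, OF assms(1,2) assms, of r] by eventually_elim (auto simp: of_nat_less_top)

text \<open>An integral against \<open>N w\<close> does not depend on how the simple function is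
  written; this allows \<open>N_simple_char\<close> to exchange overlapping sets for disjoint
  ones.\<close>

lemma sum_list_N_eq_integral:
 assumes w: "w \<in> space P" and q: "0 \<le> q"
  and A: "\<And>A v. (A, v) \<in> set xs ==> A \<in> sets \<nu> \<and> emeasure (N w) ({q<..r} \<times> A) < \<infinity>"
 shows "(\<Sum>(A, v)\<leftarrow>xs. v * measure (N w) ({q<..r} \<times> A))
  = (LINT p|N w. (\<Sum>(A, v)\<leftarrow>xs. v * indicator ({q<..r} \<times> A) p))"
proof -
 have "(LINT p|N w. (\<Sum>(A, v)\<leftarrow>xs. v * indicator ({q<..r} \<times> A) p))
  = (\<Sum>x\<leftarrow>xs. \<integral>p. (case x of (A, v) => v * indicator ({q<..r} \<times> A) p) \<partial>N w)"
  using A w q by (intro integral_sum_list)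
   (auto split: prod.split simp: sets_N time_mark_rect)
 also have "\<dots> = (\<Sum>(A, v)\<leftarrow>xs. v * measure (N w) ({q<..r} \<times> A))" using A w q
  by (intro sum_list_cong) (auto simp: sets_N time_mark_rect)
 finally show ?thesis by simp
qed

text \<open>The sets in \<open>xs\<close> may overlap, so their counts need not be independent. The
  simple function is rewritten over its level sets, which are disjoint and carry independent Poisson
  counts; the characteristic function becomes a finite product, and the product of exponentials is
  the exponential of the integral over \<open>\<nu>\<close>.\<close>

lemma N_simple_char:
 assumes q: "0 \<le> q" "q \<le> r"
  and A: "\<And>A v. (A, v) \<in> set xs ==> A \<in> sets \<nu> \<and> emeasure \<nu> A < \<infinity>"
 shows "(LINT z|P. exp (\<i> * of_real (\<Sum>(A, v)\<leftarrow>xs. v * measure (N z) ({q<..r} \<times> A))))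
  = exp (of_real (r - q) * (LINT y|\<nu>. (exp (\<i> * of_real (\<Sum>(A, v)\<leftarrow>xs. v * indicator A y)) - 1)))"
proof -
 let ?a = "\<lambda>z. \<Sum>(A, v)\<leftarrow>xs. v * measure (N z) ({q<..r} \<times> A)"
 let ?b = "\<lambda>p. \<Sum>(A, v)\<leftarrow>xs. v * indicator ({q<..r} \<times> A) p"
 let ?c = "\<lambda>w. exp (\<i> * of_real w)"
 let ?d = "\<lambda>B w. {q<..r} \<times> B w"
 define s :: "'e => real" where "s y = (\<Sum>(A, v)\<leftarrow>xs. v * indicator A y)" for y
 \<comment> \<open>The value 0 is left out because its level set may have infinite measure.\<close>
 define V where "V = s ` space \<nu> - {0}"
 define B where "B w = s -` {w} \<inter> space \<nu>" for w
 define U where "U = (\<Union>(A, v)\<in>set xs. A)"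
 have s_meas [measurable]: "s \<in> borel_measurable \<nu>" unfolding s_def
 proof (intro borel_measurable_sum_list)
  fix x assume "x \<in> set xs"
  hence [measurable]: "fst x \<in> sets \<nu>" using A[of "fst x" "snd x"] by simp
  show "(\<lambda>y. case x of (A, v) => v * indicator A y) \<in> borel_measurable \<nu>" unfolding case_prod_beta by measurable
 qed
 have "finite (range (\<lambda>y. s y))"
 proof -
  have "finite (range (\<lambda>y. \<Sum>(A, v)\<leftarrow>ys. v * indicator A y :: real))" for ys :: "('e set \<times> real) list"
  proof (induction ys)
   case (Cons a ys)
   have "range (\<lambda>y. \<Sum>(A, v)\<leftarrow>a # ys. v * indicator A y :: real)
    \<subseteq> (\<lambda>(x, y). x + y) ` ({0, snd a} \<times> range (\<lambda>y. \<Sum>(A, v)\<leftarrow>ys. v * indicator A y))"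
    by (cases a) (auto simp: image_iff indicator_def intro: bexI[rotated])
   thus ?case using Cons by (meson finite.emptyI finite.insertI finite_SigmaI finite_imageI finite_subset)
  qed simp
  thus ?thesis by (simp add: s_def)
 qed
 hence fV: "finite V" unfolding V_def by (auto intro: finite_subset[of _ "range s"])
 have s0: "s y = 0" if "y \<notin> U" for y
 proof -
  have "(\<Sum>(A, v)\<leftarrow>xs. v * indicator A y) = (\<Sum>x\<leftarrow>xs. 0::real)" using that by (intro sum_list_cong) (auto simp: U_def)
  thus ?thesis by (simp add: s_def)
 qed
 have U: "U \<in> sets \<nu>" "emeasure \<nu> U < \<infinity>"
 proof -
  show "U \<in> sets \<nu>" unfolding U_def using A by (intro sets.finite_UN) auto
  have "emeasure \<nu> U \<le> (\<Sum>x\<in>set xs. emeasure \<nu> (fst x))"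
   unfolding U_def using A by (intro order_trans[OF _ emeasure_subadditive_finite]) (auto simp: case_prod_beta)
  also have "\<dots> < \<infinity>" using A by (auto simp: ennreal_sum_less_top)
  finally show "emeasure \<nu> U < \<infinity>" .
 qed
 have Bs [measurable]: "B w \<in> sets \<nu>" for w unfolding B_def by measurable
 have Bf: "emeasure \<nu> (B w) < \<infinity>" if "w \<in> V" for w
 proof -
  have "B w \<subseteq> U" using that s0 by (auto simp: B_def V_def)
  thus ?thesis using U by (meson emeasure_mono le_less_trans)
 qed
 \<comment> \<open>Subtracting \<open>g 0\<close> makes the level set of 0 drop out. The identity is
   used with \<open>g = of_real\<close> for the simple function itself and with the exponential for
   the characteristic function.\<close>
 have s_sum: "g (s y) - g 0 = (\<Sum>w\<in>V. (g w - g 0) * indicator (B w) y)" if "y \<in> space \<nu>" for y and g :: "real => complex"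
 proof (cases "s y = 0")
  case True
  thus ?thesis by (simp add: B_def V_def indicator_def)
 next
  case False
  hence "(\<Sum>w\<in>V. (g w - g 0) * indicator (B w) y) = (\<Sum>w\<in>{s y}. (g w - g 0) * indicator (B w) y)"
   using that fV by (intro sum.mono_neutral_right) (auto simp: V_def B_def indicator_def)
  thus ?thesis using that by (simp add: B_def)
 qed
 have s_sum': "s y = (\<Sum>w\<in>V. w * indicator (B w) y)" if "y \<in> space \<nu>" for y
 proof -
  have "complex_of_real (s y) = complex_of_real (\<Sum>w\<in>V. w * indicator (B w) y)"
   using s_sum[OF that, of of_real] by (simp add: of_real_indicator)
  thus ?thesis by (simp only: of_real_eq_iff)
 qed
 define X where "X w z = exp (\<i> * complex_of_real (w * measure (N z) (?d B w)))" for w z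
 have Xm [measurable]: "X w \<in> borel_measurable P" for w
  unfolding X_def measure_def using N_measurable[OF time_mark_rect[OF q(1) Bs]] by measurable
 have Xint: "integrable P (X w)" for w by (rule integrable_const_bound[where B=1]) (auto intro!: AE_I2 simp: X_def)
 obtain h where h: "bij_betw h {..<card V} V" using ex_bij_betw_nat_finite[OF fV] by (auto simp: atLeast0LessThan)
 \<comment> \<open>The sequence is padded with empty sets because
   \<open>poisson_random_measure\<close> states independence for families indexed by all natural
   numbers.\<close>
 define C where "C i = (if i < card V then {q<..r} \<times> B (h i) else {})" for i
 have disj: "disjoint_family C" unfolding disjoint_family_on_def
 proof (intro ballI impI)
  fix i j :: nat assume "i \<noteq> j"
  thus "C i \<inter> C j = {}" using h by (auto simp: C_def B_def bij_betw_def inj_on_def)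
 qed
 have "range C \<subseteq> sets (time_mark \<nu>)" using time_mark_rect[OF q(1) Bs] by (auto simp: C_def)
 hence "indep_vars (\<lambda>_. borel) (\<lambda>i z. emeasure (N z) (C i)) UNIV" using prm disj unfolding poisson_random_measure_def by blast
 hence "indep_vars (\<lambda>_. borel) (\<lambda>i z. emeasure (N z) (C i)) {..<card V}" by (rule indep_vars_subset) auto
 hence ind: "indep_vars (\<lambda>_. borel) (\<lambda>i z. exp (\<i> * complex_of_real (h i * enn2real (emeasure (N z) (C i))))) {..<card V}"
  by (rule indep_vars_compose2) measurable
 have ind': "indep_vars (\<lambda>_. borel) (\<lambda>i. X (h i)) {..<card V}"
  by (rule indep_vars_cong[THEN iffD1, OF refl _ refl ind]) (auto simp: X_def C_def measure_def)
 have "(LINT z|P. exp (\<i> * of_real (?a z)))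
   = (LINT z|P. (\<Prod>w\<in>V. X w z))"
 proof (rule integral_cong_AE)
  have fA: "(\<lambda>z. \<Sum>(A, v)\<leftarrow>xs. v * measure (N z) ({q<..r} \<times> A)) \<in> borel_measurable P"
  proof (intro borel_measurable_sum_list)
   fix x assume "x \<in> set xs"
   thus "(\<lambda>z. case x of (A, v) => v * measure (N z) ({q<..r} \<times> A)) \<in> borel_measurable P"
    using A[of "fst x" "snd x"] N_measurable[OF time_mark_rect[OF q(1), of "fst x" r]] by (auto split: prod.split simp: measure_def)
  qed
  thus "(\<lambda>z. exp (\<i> * complex_of_real (?a z))) \<in> borel_measurable P" by measurable
  show "AE z in P. exp (\<i> * complex_of_real (?a z)) = (\<Prod>w\<in>V. X w z)" using AE_N_finite[OF q(1) U, of r] AE_space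
  proof eventually_elim
   case (elim z)
   note [simp] = sets_N[OF elim(2)]
   have sp: "space (N z) = {0<..} \<times> space \<nu>" using sets_eq_imp_space_eq[OF sets_N[OF elim(2)]] space_time_mark by simp
   have fin: "emeasure (N z) ({q<..r} \<times> D) < \<infinity>" if "D \<subseteq> U" for D
    using elim(1) by (rule le_less_trans[rotated]) (use that U time_mark_rect[OF q(1) U(1)] in \<open>auto intro!: emeasure_mono\<close>)
   have fA: "A \<in> sets \<nu> \<and> emeasure (N z) ({q<..r} \<times> A) < \<infinity>" if "(A, v) \<in> set xs" for A v
    using fin[of A] A[OF that] that by (auto simp: U_def)
   have fB: "emeasure (N z) (?d B w) < \<infinity>" if "w \<in> V" for w using that s0 by (intro fin) (auto simp: B_def V_def)
   have "(?a z)
     = (LINT p|N z. (?b p))" by (rule sum_list_N_eq_integral[OF elim(2) q(1) fA])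
   also have "\<dots> = (LINT p|N z. (\<Sum>w\<in>V. w * indicator (?d B w) p))"
   proof (rule lebesgue_integral_cong[OF refl])
    fix p assume "p \<in> space (N z)"
    hence p: "snd p \<in> space \<nu>" unfolding sp by (simp add: mem_Times_iff)
    have ind: "indicator ({q<..r} \<times> D) p = (indicator {q<..r} (fst p) * indicator D (snd p) :: real)" for D
     by (cases p) (simp add: indicator_def)
    have "(?b p) = indicator {q<..r} (fst p) * s (snd p)" unfolding ind s_def by (induction xs) (auto simp: algebra_simps)
    thus "(?b p) = (\<Sum>w\<in>V. w * indicator (?d B w) p)" using s_sum'[OF p] unfolding ind by (simp add: sum_distrib_left mult_ac)
   qed
   also have "\<dots> = (\<Sum>w\<in>V. w * measure (N z) (?d B w))"
    using fB time_mark_rect[OF q(1) Bs] by (subst Bochner_Integration.integral_sum) auto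
   finally have eq: "(?a z) = (\<Sum>w\<in>V. w * measure (N z) (?d B w))" .
   have "(\<Prod>w\<in>V. X w z) = exp (\<Sum>w\<in>V. \<i> * complex_of_real (w * measure (N z) (?d B w)))"
    unfolding X_def by (rule exp_sum[OF fV, symmetric])
   thus ?case by (simp only: eq of_real_sum sum_distrib_left)
  qed
 qed auto
 also have "\<dots> = (LINT z|P. (\<Prod>i<card V. X (h i) z))" by (subst prod.reindex_bij_betw[OF h]) simp
 also have "\<dots> = (\<Prod>i<card V. \<integral>z. X (h i) z \<partial>P)" by (rule indep_vars_lebesgue_integral[OF _ ind' Xint]) simp
 also have "\<dots> = (\<Prod>w\<in>V. \<integral>z. X w z \<partial>P)" by (rule prod.reindex_bij_betw[OF h])
 also have "\<dots> = (\<Prod>w\<in>V. exp (of_real ((r - q) * measure \<nu> (B w)) * (?c w - 1)))"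
 proof (rule prod.cong[OF refl])
  fix w assume "w \<in> V"
  thus "(LINT z|P. X w z) = exp (of_real ((r - q) * measure \<nu> (B w)) * (?c w - 1))"
   unfolding X_def using N_char[OF time_mark_rect emeasure_time_mark_rect_finite, OF q(1) Bs q(1) Bs Bf, where w=w and r1=r] q
   by (simp add: measure_def emeasure_time_mark_rect enn2real_mult)
 qed
 also have "\<dots> = exp (of_real (r - q) * (\<Sum>w\<in>V. of_real (measure \<nu> (B w)) * (?c w - 1)))"
  by (subst exp_sum[OF fV, symmetric]) (simp add: sum_distrib_left mult_ac)
 also have "(\<Sum>w\<in>V. of_real (measure \<nu> (B w)) * (?c w - 1))
   = (LINT y|\<nu>. (\<Sum>w\<in>V. indicator (B w) y *\<^sub>R (?c w - 1)))"
  using Bf by (subst Bochner_Integration.integral_sum) (auto simp: scaleR_conv_of_real)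
 also have "\<dots> = (LINT y|\<nu>. (exp (\<i> * of_real (s y)) - 1))"
  using s_sum[of _ "\<lambda>w. ?c w"] by (intro lebesgue_integral_cong) (auto simp: scaleR_conv_of_real of_real_indicator mult.commute)
 finally show ?thesis by (simp add: s_def)
qed

end

section \<open>Exponential martingales with adapted marks, and of both noises jointly\<close>

lemma norm_exp_minus_1_le: "norm (exp z - 1) \<le> norm z * exp (norm z)" for z :: complex
proof -
 have "norm (exp z - exp 0) \<le> exp (norm z) * norm (z - 0)"
 proof (rule differentiable_bound[where S="cball 0 (norm z)" and f'="\<lambda>x. (*) (exp x)"])
  fix x :: complex assume "x \<in> cball 0 (norm z)"
  hence "Re x \<le> norm z" using complex_Re_le_cmod[of x] by simp
  hence "norm (exp x) \<le> exp (norm z)" by simp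
  thus "onorm ((*) (exp x)) \<le> exp (norm z)" by (intro onorm_bound) (auto simp: norm_mult mult_right_mono)
  show "(exp has_derivative (*) (exp x)) (at x within cball 0 (norm z))"
   by (rule has_derivative_at_withinI) (auto intro!: derivative_eq_intros simp: has_field_derivative_def[symmetric])
 qed auto
 thus ?thesis by (simp add: mult.commute)
qed

context noisy_space begin

definition adapted_marks :: "real => ('e set \<times> ('a => real)) list => bool" where
 "adapted_marks q xs \<longleftrightarrow>
  (\<forall>(A, \<xi>)\<in>set xs. A \<in> sets \<nu> \<and> emeasure \<nu> A < \<infinity> \<and> \<xi> \<in> borel_measurable (F q))"

definition mark_value :: "('e set \<times> ('a => real)) list => 'a => 'e => real" where
 "mark_value xs w y = (\<Sum>(A, \<xi>)\<leftarrow>xs. \<xi> w * indicator A y)"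

text \<open>The Levy-Khintchine exponent per unit time of the compound Poisson sum
  \<open>jump_sum\<close> when the marks are frozen.\<close>

definition jump_symbol :: "('e set \<times> ('a => real)) list => 'a => complex" where
 "jump_symbol xs w = (LINT y|\<nu>. (exp (\<i> * of_real (mark_value xs w y)) - 1))"

definition jump_sum :: "('e set \<times> ('a => real)) list => real => real => 'a => real" where
 "jump_sum xs q r w = (\<Sum>(A, \<xi>)\<leftarrow>xs. \<xi> w * measure (N w) ({q<..r} \<times> A))"

definition mark_support :: "('e set \<times> ('a => real)) list => 'e set" where
 "mark_support xs = (\<Union>(A, \<xi>)\<in>set xs. A)"

lemma adapted_marksD:
 assumes "adapted_marks q xs" "(A, \<xi>) \<in> set xs"
 shows "A \<in> sets \<nu>" "emeasure \<nu> A < \<infinity>" "\<xi> \<in> borel_measurable (F q)" using assms unfolding adapted_marks_def by auto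

lemma adapted_marks_mono: "adapted_marks q xs ==> 0 \<le> q ==> q \<le> r ==> adapted_marks r xs"
 unfolding adapted_marks_def by (auto intro: measurable_F_mono)

lemma mark_support:
 assumes "adapted_marks q xs" shows "mark_support xs \<in> sets \<nu>" "emeasure \<nu> (mark_support xs) < \<infinity>"
proof -
 show "mark_support xs \<in> sets \<nu>" unfolding mark_support_def using adapted_marksD[OF assms] by (intro sets.finite_UN) auto
 have "emeasure \<nu> (mark_support xs) \<le> (\<Sum>x\<in>set xs. emeasure \<nu> (fst x))" unfolding mark_support_def using adapted_marksD[OF assms]
  by (intro order_trans[OF _ emeasure_subadditive_finite]) (auto simp: case_prod_beta)
 also have "\<dots> < \<infinity>" using adapted_marksD(2)[OF assms] by (auto simp: ennreal_sum_less_top)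
 finally show "emeasure \<nu> (mark_support xs) < \<infinity>" .
qed

lemma mark_value_eq_0:
 assumes "y \<notin> mark_support xs" shows "mark_value xs w y = 0"
proof -
 have "mark_value xs w y = (\<Sum>x\<leftarrow>xs. 0::real)" unfolding mark_value_def using assms
  by (intro sum_list_cong) (auto simp: mark_support_def)
 thus ?thesis by simp
qed

lemma measurable_mark_value:
 assumes "adapted_marks q xs" shows "(\<lambda>p. mark_value xs (fst p) (snd p)) \<in> borel_measurable (F q \<Otimes>\<^sub>M \<nu>)"
 unfolding mark_value_def
proof (intro borel_measurable_sum_list)
 fix x assume "x \<in> set xs"
 hence [measurable]: "fst x \<in> sets \<nu>" "snd x \<in> borel_measurable (F q)" using adapted_marksD[OF assms, of "fst x" "snd x"] by auto
 show "(\<lambda>p. case x of (A, \<xi>) => \<xi> (fst p) * indicator A (snd p)) \<in> borel_measurable (F q \<Otimes>\<^sub>M \<nu>)"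
  unfolding case_prod_beta by measurable
qed

lemma measurable_mark_value2:
 assumes "adapted_marks q xs" shows "mark_value xs w \<in> borel_measurable \<nu>" unfolding mark_value_def
proof (intro borel_measurable_sum_list)
 fix x assume "x \<in> set xs"
 hence [measurable]: "fst x \<in> sets \<nu>" using adapted_marksD[OF assms, of "fst x" "snd x"] by auto
 show "(\<lambda>y. case x of (A, \<xi>) => \<xi> w * indicator A y) \<in> borel_measurable \<nu>" unfolding case_prod_beta by measurable
qed

lemma measurable_jump_symbol:
 assumes "adapted_marks q xs" shows "jump_symbol xs \<in> borel_measurable (F q)" unfolding jump_symbol_def using measurable_mark_value[OF assms]
 by (intro mark.borel_measurable_lebesgue_integral) (simp add: case_prod_beta)

lemma jump_symbol_integrable:
 assumes "adapted_marks q xs" shows "integrable \<nu> (\<lambda>y. exp (\<i> * of_real (mark_value xs w y)) - 1)"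
proof (rule Bochner_Integration.integrable_bound)
 let ?a = "\<lambda>y. exp (\<i> * of_real (mark_value xs w y))"
 show "integrable \<nu> (\<lambda>y. 2 * indicator (mark_support xs) y :: real)" using mark_support[OF assms] by auto
 show "(\<lambda>y. ?a y - 1) \<in> borel_measurable \<nu>" using measurable_mark_value2[OF assms, of w] by measurable
 show "AE y in \<nu>. norm (?a y - 1) \<le> norm (2 * indicator (mark_support xs) y :: real)"
 proof (rule AE_I2)
  fix y
  have "norm (?a y - 1) \<le> norm (?a y) + norm (1::complex)" by (rule norm_triangle_ineq4)
  thus "norm (?a y - 1) \<le> norm (2 * indicator (mark_support xs) y :: real)" by (cases "y \<in> mark_support xs") (auto simp: mark_value_eq_0)
 qed
qed

lemma norm_jump_symbol_le:
 assumes "adapted_marks q xs" shows "norm (jump_symbol xs w) \<le> 2 * measure \<nu> (mark_support xs)"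
proof -
 let ?a = "\<lambda>y. exp (\<i> * of_real (mark_value xs w y))"
 have "norm (jump_symbol xs w) \<le> (LINT y|\<nu>. norm (?a y - 1))" unfolding jump_symbol_def by (rule integral_norm_bound)
 also have "\<dots> \<le> (LINT y|\<nu>. 2 * indicator (mark_support xs) y)"
 proof (rule integral_mono)
  fix y
  have "norm (?a y - 1) \<le> norm (?a y) + norm (1::complex)" by (rule norm_triangle_ineq4)
  thus "norm (?a y - 1) \<le> 2 * indicator (mark_support xs) y" by (cases "y \<in> mark_support xs") (auto simp: mark_value_eq_0)
 qed (use jump_symbol_integrable[OF assms] mark_support[OF assms] in auto)
 also have "\<dots> = 2 * measure \<nu> (mark_support xs)" using mark_support[OF assms] by simp
 finally show ?thesis .
qed

lemma measurable_jump_sum: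
 assumes "adapted_marks q xs" "0 \<le> q" "q \<le> s" "s \<le> t" shows "jump_sum xs s t \<in> borel_measurable (F t)" unfolding jump_sum_def
proof (intro borel_measurable_sum_list)
 fix x assume "x \<in> set xs"
 hence A: "fst x \<in> sets \<nu>" and [measurable]: "snd x \<in> borel_measurable (F t)"
  using adapted_marksD[OF assms(1), of "fst x" "snd x"] assms by (auto intro: measurable_F_mono)
 have "(\<lambda>w. emeasure (N w) ({s<..t} \<times> fst x)) \<in> borel_measurable (F t)" using assms A by (intro N_adapted time_mark_rect) auto
 thus "(\<lambda>w. case x of (A, \<xi>) => \<xi> w * measure (N w) ({s<..t} \<times> A)) \<in> borel_measurable (F t)"
  unfolding case_prod_beta measure_def by measurable
qed

text \<open>The marks are known at time \<open>q\<close>, and the restriction of \<open>N\<close> to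
  later times is independent of \<open>F q\<close>. With the marks frozen, \<open>jump_sum\<close>
  is a compound Poisson variable, whose characteristic function from \<open>N_simple_char\<close>
  cancels the term with \<open>jump_symbol\<close>.\<close>

lemma N_exp_martingale:
 fixes Z :: "'a => complex"
 assumes q: "0 \<le> q" "q \<le> r" and xs: "adapted_marks q xs"
  and Z [measurable]: "Z \<in> borel_measurable (F q)"
  and ZB: "\<And>w. w \<in> space P ==> norm (Z w) \<le> B"
 shows "(LINT w|P. Z w * exp (\<i> * of_real (jump_sum xs q r w) - of_real (r - q) * jump_symbol xs w)) = (LINT w|P. Z w)"
proof -
 let ?a = "\<lambda>A. \<lambda>w. emeasure (N w) ({q<..r} \<times> A)"
 let ?b = "\<lambda>H. borel_measurable (F q \<Otimes>\<^sub>M H)"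
 let ?c = "\<lambda>x. exp (- of_real (r - q) * jump_symbol xs x)"
 define GE where "GE = {(\<lambda>w. emeasure (N w) A) -` S \<inter> space P |A S. A \<in> {A \<in> sets (time_mark \<nu>). A \<subseteq> {q<..} \<times> UNIV} \<and> S \<in> sets borel}"
 define H where "H = sigma (space P) GE"
 have GE: "GE \<subseteq> Pow (space P)" by (auto simp: GE_def)
 have sH: "sets H = generated_events P (\<lambda>A w. emeasure (N w) A) {A \<in> sets (time_mark \<nu>). A \<subseteq> {q<..} \<times> UNIV}"
  unfolding H_def generated_events_def using GE by (simp add: GE_def)
 have ind: "indep_set (sets (F q)) (sets H)" using prm q unfolding sH poisson_random_measure_def by blast
 have H: "subalgebra P H" using indep_setD_ev2[OF ind] unfolding subalgebra_def using GE by (simp add: H_def space_measure_of)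
 have NH: "(?a A) \<in> borel_measurable H" if "A \<in> sets \<nu>" for A
 proof (rule measurableI)
  fix S :: "ennreal set" assume "S \<in> sets borel"
  hence "(?a A) -` S \<inter> space P \<in> GE"
   unfolding GE_def using that q by (intro CollectI exI[of _ "{q<..r} \<times> A"] exI[of _ S]) (auto intro: time_mark_rect)
  thus "(?a A) -` S \<inter> space H \<in> sets H" unfolding H_def using GE by (auto intro: sigma_sets.Basic)
 qed auto
 define f where "f = (\<lambda>(x, y). Z x * exp (\<i> * of_real (\<Sum>(A, \<xi>)\<leftarrow>xs. \<xi> x * measure (N y) ({q<..r} \<times> A)) - of_real (r - q) * jump_symbol xs x))"
 have [measurable]: "jump_symbol xs \<in> borel_measurable (F q)" by (rule measurable_jump_symbol[OF xs])
 have "(\<lambda>p. \<Sum>(A, \<xi>)\<leftarrow>xs. \<xi> (fst p) * measure (N (snd p)) ({q<..r} \<times> A)) \<in> ?b H"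
 proof (intro borel_measurable_sum_list)
  fix x assume "x \<in> set xs"
  hence A: "fst x \<in> sets \<nu>" and [measurable]: "snd x \<in> borel_measurable (F q)" using adapted_marksD[OF xs, of "fst x" "snd x"] by auto
  have [measurable]: "(\<lambda>w. emeasure (N w) ({q<..r} \<times> fst x)) \<in> borel_measurable H" by (rule NH[OF A])
  show "(\<lambda>p. case x of (A, \<xi>) => \<xi> (fst p) * measure (N (snd p)) ({q<..r} \<times> A)) \<in> ?b H"
   unfolding case_prod_beta measure_def by measurable
 qed
 hence fm: "f \<in> ?b H" unfolding f_def case_prod_beta by measurable
 define K where "K = 2 * measure \<nu> (mark_support xs)"
 have fb: "norm (f (x, y)) \<le> B * exp ((r - q) * K)" if "x \<in> space P" "y \<in> space P" for x y
 proof -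
  have "- Re (jump_symbol xs x) \<le> K" using norm_jump_symbol_le[OF xs, of x] abs_Re_le_cmod[of "jump_symbol xs x"] by (simp add: K_def)
  hence "(r - q) * (- Re (jump_symbol xs x)) \<le> (r - q) * K" using q by (intro mult_left_mono) auto
  moreover have "0 \<le> B" using ZB[OF that(1)] norm_ge_zero order_trans by blast
  ultimately show ?thesis unfolding f_def using ZB[OF that(1)] by (auto simp: norm_mult intro!: mult_mono)
 qed
 have "(LINT w|P. f (w, w)) = (LINT x|P. (LINT y|P. f (x, y)))" by (rule integral_indep_freeze[OF subalgebra_F[OF q(1)] H ind fm fb])
 also have "\<dots> = (LINT x|P. Z x)"
 proof (rule lebesgue_integral_cong[OF refl])
  fix x
  let ?S = "\<lambda>y. \<i> * complex_of_real (\<Sum>(A, v)\<leftarrow>map (\<lambda>(A, \<xi>). (A, \<xi> x)) xs. v * measure (N y) ({q<..r} \<times> A))"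
  have e: "exp (a - d * k) = exp (- d * k) * exp a" for a d k :: complex by (simp add: exp_diff exp_minus divide_inverse)
  have "f (x, y) = (Z x * ?c x) * exp (?S y)" for y
   unfolding f_def prod.case e by (simp only: map_map comp_def case_prod_unfold fst_conv snd_conv mult.assoc)
  hence "(LINT y|P. f (x, y)) = (LINT y|P. (Z x * ?c x) * exp (?S y))" by simp
  also have "\<dots> = Z x * ?c x * exp (of_real (r - q) * jump_symbol xs x)" using adapted_marksD[OF xs]
   by (subst integral_mult_right_zero, subst N_simple_char[OF q])
     (auto simp: jump_symbol_def mark_value_def comp_def case_prod_unfold)
  also have "\<dots> = Z x" by (simp only: mult.assoc mult_minus_left exp_minus) simp
  finally show "(LINT y|P. f (x, y)) = Z x" .
 qed
 finally show ?thesis by (simp add: f_def jump_sum_def)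
qed

text \<open>Finiteness is required because \<open>measure\<close> is 0 on sets of infinite mass,
  where additivity in time would fail.\<close>

lemma jump_sum_add:
 assumes w: "w \<in> space P" and xs: "adapted_marks q' xs"
  and q: "0 \<le> q" "q \<le> s" "s \<le> t" "t \<le> r"
  and fin: "emeasure (N w) ({q<..r} \<times> mark_support xs) < \<infinity>" shows "jump_sum xs q t w = jump_sum xs q s w + jump_sum xs s t w"
proof -
 have e: "measure (N w) ({q<..t} \<times> A) = measure (N w) ({q<..s} \<times> A) + measure (N w) ({s<..t} \<times> A)"
  if A: "A \<in> sets \<nu>" "A \<subseteq> mark_support xs" for A
 proof -
  have f: "emeasure (N w) ({a<..b} \<times> A) \<noteq> \<infinity>" if "q \<le> a" "b \<le> r" for a b
  proof -
   have "emeasure (N w) ({a<..b} \<times> A) \<le> emeasure (N w) ({q<..r} \<times> mark_support xs)"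
    using that A q mark_support(1)[OF xs] by (intro emeasure_mono) (auto simp: sets_N[OF w] time_mark_rect)
   thus ?thesis using fin by (auto simp: top_unique)
  qed
  have "{q<..t} \<times> A = ({q<..s} \<times> A) \<union> ({s<..t} \<times> A)" using q by auto
  thus ?thesis using f[of q s] f[of s t] q A by (auto intro!: measure_Union simp: sets_N[OF w] time_mark_rect)
 qed
 have sub: "A \<subseteq> mark_support xs" "A \<in> sets \<nu>" if "(A, \<xi>) \<in> set xs" for A \<xi>
  using that adapted_marksD[OF xs that] by (auto simp: mark_support_def)
 have "jump_sum xs q t w = (\<Sum>x\<leftarrow>xs. snd x w * measure (N w) ({q<..s} \<times> fst x) + snd x w * measure (N w) ({s<..t} \<times> fst x))"
  unfolding jump_sum_def
 proof (intro sum_list_cong refl)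
  fix x assume "x \<in> set xs"
  thus "(case x of (A, \<xi>) => \<xi> w * measure (N w) ({q<..t} \<times> A)) =
     snd x w * measure (N w) ({q<..s} \<times> fst x) + snd x w * measure (N w) ({s<..t} \<times> fst x)"
   using sub[of "fst x" "snd x"] e[of "fst x"] by (simp add: case_prod_beta distrib_left)
 qed
 thus ?thesis by (simp add: jump_sum_def case_prod_unfold sum_list_addf)
qed

text \<open>With all coefficients replaced by 1 the sum counts jumps, with multiplicity where the
  sets overlap. It is integrable and additive in time, hence a bound for the variation of
  \<open>jump_sum\<close>.\<close>

lemma abs_jump_sum_le:
 assumes "\<And>A \<xi>. (A, \<xi>) \<in> set xs ==> \<bar>\<xi> w\<bar> \<le> c"
 shows "\<bar>jump_sum xs q r w\<bar> \<le> c * jump_sum (map (\<lambda>(A, \<xi>). (A, \<lambda>_. 1)) xs) q r w"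
proof -
 have "\<bar>jump_sum xs q r w\<bar> \<le> (\<Sum>x\<leftarrow>xs. \<bar>snd x w * measure (N w) ({q<..r} \<times> fst x)\<bar>)"
  using abs_sum_list_le[of "map (\<lambda>x. snd x w * measure (N w) ({q<..r} \<times> fst x)) xs"]
  by (simp add: jump_sum_def case_prod_unfold comp_def)
 also have "\<dots> \<le> (\<Sum>x\<leftarrow>xs. c * measure (N w) ({q<..r} \<times> fst x))"
  using assms by (intro sum_list_mono) (auto simp: abs_mult intro!: mult_right_mono)
 also have "\<dots> = c * jump_sum (map (\<lambda>(A, \<xi>). (A, \<lambda>_. 1)) xs) q r w"
  by (simp add: jump_sum_def case_prod_unfold comp_def sum_list_const_mult)
 finally show ?thesis .
qed

lemma integrable_jump_sum_1:
 assumes "adapted_marks q' xs" "0 \<le> q" shows "integrable P (jump_sum (map (\<lambda>(A, \<xi>). (A, \<lambda>_. 1)) xs) q r)"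
proof -
 have "integrable P (\<lambda>w. measure (N w) ({q<..r} \<times> A))" if "(A, \<xi>) \<in> set xs" for A \<xi>
  using adapted_marksD[OF assms(1) that] assms by (intro integrable_N time_mark_rect emeasure_time_mark_rect_finite) auto
 thus ?thesis unfolding jump_sum_def by (auto simp: case_prod_unfold comp_def intro!: integrable_sum_list)
qed

text \<open>\<open>W\<close> and \<open>N\<close> are driven by the same filtration, so the product of a \<open>W\<close>-martingale and an
 \<open>N\<close>-martingale is a martingale: the sum of the products of their increments along a partition
 tends to \<open>0\<close>, because one factor is continuous and the other one has finite variation.\<close>

lemma WN_exp_martingale:
 fixes Z :: "'a => complex"
 assumes q: "0 \<le> q" "q \<le> r" and xs: "adapted_marks q xs"
  and Z [measurable]: "Z \<in> borel_measurable (F q)"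
  and ZB: "\<And>w. w \<in> space P ==> norm (Z w) \<le> B"
  and a [measurable]: "a \<in> borel_measurable (F q)"
  and aB: "\<And>w. w \<in> space P ==> \<bar>a w\<bar> \<le> B'"
  and xB: "\<And>A \<xi> w. (A, \<xi>) \<in> set xs ==> w \<in> space P ==> \<bar>\<xi> w\<bar> \<le> c"
 shows "(LINT w|P. Z w * (exp (\<i> * of_real (a w * (W r w - W q w)) + of_real ((a w)\<^sup>2 * (r - q) / 2)) *
   exp (\<i> * of_real (jump_sum xs q r w) - of_real (r - q) * jump_symbol xs w))) = (LINT w|P. Z w)"
proof (cases "q = r")
 case True
 have "jump_sum xs q q w = 0" for w by (induction xs) (auto simp: jump_sum_def)
 thus ?thesis using True by simp
next
 let ?a = "\<lambda>t. borel_measurable (F t)"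
 let ?b = "\<lambda>s t w. exp (\<i> * of_real (jump_sum xs s t w) - of_real (t - s) * jump_symbol xs w)"
 let ?c = "map (\<lambda>(A, \<xi>). (A, \<lambda>_. 1::real)) xs"
 let ?d = "\<integral>w. Z w \<partial>P"
 let ?e = "\<lambda>M1 M2. \<integral>w. Z w * (M1 r w * M2 r w) \<partial>P"
 case False
 hence qr: "q < r" using q by simp
 have Wm: "W t \<in> ?a t" if "0 \<le> t" for t using bm that by (simp add: brownian_motion_def adapted_def)
 have jm: "jump_symbol xs \<in> ?a t" "Z \<in> ?a t" "a \<in> ?a t" if "q \<le> t" for t
  using measurable_F_mono[OF measurable_jump_symbol[OF xs] q(1) that] measurable_F_mono[OF Z q(1) that]
   measurable_F_mono[OF a q(1) that] by auto
 define K where "K = 2 * measure \<nu> (mark_support xs)"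
 have K: "norm (jump_symbol xs w) \<le> K" "0 \<le> K" for w using norm_jump_symbol_le[OF xs] by (auto simp: K_def)
 obtain w0 where w0: "w0 \<in> space P" using not_empty by auto
 have B0: "0 \<le> B" using ZB[OF w0] norm_ge_zero order_trans by blast
 define M1 where "M1 t w = exp (\<i> * of_real (a w * (W t w - W q w)) + of_real ((a w)\<^sup>2 * (t - q) / 2))" for t w
 define M2 where "M2 t w = exp (\<i> * of_real (jump_sum xs q t w) - of_real (t - q) * jump_symbol xs w)" for t w
 have M1m: "M1 t \<in> ?a t" if "q \<le> t" for t
 proof -
  have [measurable]: "W t \<in> ?a t" "W q \<in> ?a t" "a \<in> ?a t" using Wm[of t] Wm[of q] jm[of t] that q by (auto intro: measurable_F_mono)
  show ?thesis unfolding M1_def by measurable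
 qed
 have M2m: "M2 t \<in> ?a t" if "q \<le> t" for t
 proof -
  have [measurable]: "jump_sum xs q t \<in> ?a t" "jump_symbol xs \<in> ?a t" using measurable_jump_sum[OF xs q(1)] jm[of t] that by auto
  show ?thesis unfolding M2_def by measurable
 qed
 define C1 where "C1 = exp (B'\<^sup>2 * (r - q) / 2)"
 define C2 where "C2 = exp ((r - q) * K)"
 have C: "1 \<le> C1" "1 \<le> C2" using q K by (auto simp: C1_def C2_def)
 have M1b: "norm (M1 t w) \<le> C1" if "w \<in> space P" "q \<le> t" "t \<le> r" for t w
 proof -
  have "(a w)\<^sup>2 \<le> B'\<^sup>2" using aB[OF that(1)] by (simp add: abs_le_square_iff[symmetric])
  hence "(a w)\<^sup>2 * (t - q) / 2 \<le> B'\<^sup>2 * (r - q) / 2" using that by (intro divide_right_mono mult_mono) auto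
  thus ?thesis by (simp add: M1_def C1_def)
 qed
 have M2b: "norm (M2 t w) \<le> C2" if "q \<le> t" "t \<le> r" for t w
 proof -
  have "- Re (jump_symbol xs w) \<le> K" using K(1)[of w] K(2) abs_Re_le_cmod[of "jump_symbol xs w"] by simp
  hence "(t - q) * (- Re (jump_symbol xs w)) \<le> (t - q) * K" using that by (intro mult_left_mono) auto
  also have "\<dots> \<le> (r - q) * K" using that K by (intro mult_right_mono) auto
  finally show ?thesis by (simp add: M2_def C2_def)
 qed
 define good where "good w \<longleftrightarrow> w \<in> space P \<and> emeasure (N w) ({q<..r} \<times> mark_support xs) < \<infinity>" for w
 have AEgood: "AE w in P. good w" using AE_N_finite[OF q(1) mark_support[OF xs], of r] AE_space unfolding good_def by eventually_elim auto
 have M1_step: "M1 t w = M1 s w * exp (\<i> * of_real (a w * (W t w - W s w)) + of_real ((a w)\<^sup>2 * (t - s) / 2))" for s t w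
  unfolding M1_def exp_add[symmetric] by (rule arg_cong[where f=exp]) (simp add: field_simps)
 have M2_step: "M2 t w = M2 s w * ?b s t w"
  if "good w" "q \<le> s" "s \<le> t" "t \<le> r" for s t w unfolding M2_def exp_add[symmetric] using that jump_sum_add[OF _ xs q(1) that(2-4)]
  by (intro arg_cong[where f=exp]) (simp add: good_def algebra_simps)
 define V where "V w = C2 * (c * jump_sum (map (\<lambda>(A, \<xi>). (A, \<lambda>_. 1)) xs) q r w + (r - q) * (K * C2))" for w
 have Vint: "integrable P V" unfolding V_def using integrable_jump_sum_1[OF xs q(1), of r] by auto
 have key: "norm ((?e M1 M2) - ?d) = 0"
 proof -
  define p where "p m j = q + (r - q) * real j / real m" for m j :: nat
  have p: "q \<le> p m j" "p m j \<le> r" "p m j \<le> p m (Suc j)" if "j \<le> m" "0 < m" for m j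
  proof -
   have "(r - q) * real j / real m \<le> (r - q) * real m / real m" using that q by (intro divide_right_mono mult_left_mono) auto
   thus "p m j \<le> r" using that by (simp add: p_def)
   show "q \<le> p m j" using q by (simp add: p_def)
   show "p m j \<le> p m (Suc j)" using q that by (auto simp: p_def intro!: divide_right_mono mult_left_mono)
  qed
  have p0: "p m 0 = q" for m by (simp add: p_def)
  have pm: "p m m = r" if "0 < m" for m using that by (simp add: p_def)
  \<comment> \<open>The sum of products of increments along \<open>m\<close> equal pieces. Its mean
    against \<open>Z\<close> turns out to be exactly the defect of the martingale property of
    \<open>M1 * M2\<close>.\<close>
  define T where "T m w = (\<Sum>j<m. (M1 (p m (Suc j)) w - M1 (p m j) w) * (M2 (p m (Suc j)) w - M2 (p m j) w))" for m w
  have mP: "M1 t \<in> borel_measurable P" "M2 t \<in> borel_measurable P" if "q \<le> t" for t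
   using M1m[OF that] M2m[OF that] that q by (auto intro: measurable_F)
  have ZP [measurable]: "Z \<in> borel_measurable P" by (rule measurable_F[OF Z q(1)])
  have Tm [measurable]: "T m \<in> borel_measurable P" if "0 < m" for m
   unfolding T_def by (intro borel_measurable_sum borel_measurable_times borel_measurable_diff mP)
    (use p[OF _ that] in \<open>auto\<close>)
  have int: "integrable P (\<lambda>w. Z w * (M1 s w * M2 t w))" if "q \<le> s" "s \<le> r" "q \<le> t" "t \<le> r" for s t
   by (rule integrable_const_bound[where B="B * (C1 * C2)"])
     (use mP that ZB M1b M2b B0 C in \<open>auto intro!: AE_I2 mult_mono simp: norm_mult\<close>)
  have expT: "(?e M1 M2) - ?d = (LINT w|P. Z w * T m w)" if m: "0 < m" for m
  proof -
   let ?E = "\<lambda>s t. \<integral>w. Z w * (M1 s w * M2 t w) \<partial>P"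
   \<comment> \<open>With one factor stopped at the left endpoint, the other one has a martingale
     increment. So both mixed terms reduce to the value at the left endpoint, and the sum over the
     pieces telescopes.\<close>
   have e1: "?E t s = ?E s s" if "q \<le> s" "s \<le> t" "t \<le> r" for s t
   proof -
    have "?E t s = (LINT w|P. (Z w * (M1 s w * M2 s w)) * exp (\<i> * of_real (a w * (W t w - W s w)) + of_real ((a w)\<^sup>2 * (t - s) / 2)))"
     by (subst M1_step[of t _ s]) (simp add: mult_ac)
    also have "\<dots> = ?E s s" using that q jm[of s] M1m[of s] M2m[of s] aB ZB M1b M2b B0 C
     by (intro W_exp_martingale[where B="B * (C1 * C2)" and B'=B']) (auto simp: norm_mult intro!: mult_mono borel_measurable_times)
    finally show ?thesis .
   qed
   have e2: "?E s t = ?E s s" if "q \<le> s" "s \<le> t" "t \<le> r" for s t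
   proof -
    have [measurable]: "M1 s \<in> borel_measurable P" "M2 s \<in> borel_measurable P" "M2 t \<in> borel_measurable P"
      "jump_sum xs s t \<in> borel_measurable P" "jump_symbol xs \<in> borel_measurable P"
     using mP that measurable_jump_sum[OF xs q(1), of s t] jm(1)[of s] q by (auto intro: measurable_F)
    have "?E s t = (LINT w|P. (Z w * (M1 s w * M2 s w)) * ?b s t w)"
    proof (rule integral_cong_AE)
     show "AE w in P. Z w * (M1 s w * M2 t w) = Z w * (M1 s w * M2 s w) * ?b s t w"
      using AEgood by eventually_elim (simp add: M2_step[OF _ that] mult_ac)
    qed measurable
    also have "\<dots> = ?E s s" using that q jm[of s] M1m[of s] M2m[of s] ZB M1b M2b B0 C adapted_marks_mono[OF xs q(1), of s]
     by (intro N_exp_martingale[where B="B * (C1 * C2)"]) (auto simp: norm_mult intro!: mult_mono borel_measurable_times)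
    finally show ?thesis .
   qed
   have "(LINT w|P. Z w * T m w) = (LINT w|P. (\<Sum>j<m. Z w * (M1 (p m (Suc j)) w * M2 (p m (Suc j)) w) - Z w * (M1 (p m (Suc j)) w * M2 (p m j) w)
     - Z w * (M1 (p m j) w * M2 (p m (Suc j)) w) + Z w * (M1 (p m j) w * M2 (p m j) w)))"
    unfolding T_def sum_distrib_left by (intro lebesgue_integral_cong sum.cong refl) (simp add: algebra_simps)
   also have "\<dots> = (\<Sum>j<m. ?E (p m (Suc j)) (p m (Suc j)) - ?E (p m (Suc j)) (p m j) - ?E (p m j) (p m (Suc j)) + ?E (p m j) (p m j))"
    by (subst Bochner_Integration.integral_sum)
      (use int p[OF _ m] in \<open>auto intro!: sum.cong Bochner_Integration.integrable_add Bochner_Integration.integrable_diff simp: Suc_le_eq\<close>)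
   also have "\<dots> = (\<Sum>j<m. ?E (p m (Suc j)) (p m (Suc j)) - ?E (p m j) (p m j))"
    using e1[of "p m j" "p m (Suc j)" for j] e2[of "p m j" "p m (Suc j)" for j] p[OF _ m] by (intro sum.cong) (auto simp: Suc_le_eq)
   also have "\<dots> = ?E r r - ?E q q" by (subst sum_lessThan_telescope) (simp add: p0 pm m)
   also have "?E q q = ?d"
   proof -
    have "jump_sum xs q q w = 0" for w by (induction xs) (auto simp: jump_sum_def)
    thus ?thesis by (simp add: M1_def M2_def)
   qed
   finally show ?thesis by simp
  qed
  \<comment> \<open>The increments of the continuous factor are at most \<open>e\<close>, and those
    of \<open>M2\<close> add up to its variation.\<close>
  have TV: "norm (T m w) \<le> e * V w"
   if m: "0 < m" and g: "good w" and e: "\<And>j. j < m ==> norm (M1 (p m (Suc j)) w - M1 (p m j) w) \<le> e" for m w e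
  proof -
   let ?J = "jump_sum ?c"
   have e0: "0 \<le> e" using e[of 0] m norm_ge_zero order_trans by blast
   have xs1: "adapted_marks q ?c" using xs by (auto simp: adapted_marks_def)
   have ms: "mark_support ?c = mark_support xs" by (force simp: mark_support_def)
   have d: "norm (M2 t w - M2 s w) \<le> C2 * (c * ?J s t w + (t - s) * (K * C2))"
    if st: "q \<le> s" "s \<le> t" "t \<le> r" for s t
   proof -
    have split: "exp (x - y) - 1 = exp x * (exp (- y) - 1) + (exp x - 1)" for x y :: complex
     by (simp add: exp_diff exp_minus divide_inverse algebra_simps)
    let ?k = "of_real (t - s) * jump_symbol xs w" and ?i = "\<i> * complex_of_real (jump_sum xs s t w)"
    have nk: "norm ?k \<le> (t - s) * K" unfolding norm_mult using st K(1)[of w] K(2) by (auto intro!: mult_mono simp del: of_real_diff)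
    have tK: "(t - s) * K \<le> (r - q) * K" using st K by (intro mult_right_mono) auto
    have "norm (exp (- ?k) - 1) \<le> norm ?k * exp (norm ?k)" using norm_exp_minus_1_le[of "- ?k"] by simp
    also have "\<dots> \<le> (t - s) * K * C2" unfolding C2_def using nk tK st K by (intro mult_mono) auto
    finally have n1: "norm (exp (- ?k) - 1) \<le> (t - s) * (K * C2)" by (simp add: mult_ac)
    have n2: "norm (exp ?i - 1) \<le> c * ?J s t w" using norm_exp_i_minus_1_le[of "jump_sum xs s t w"] abs_jump_sum_le[of xs w c s t] xB g
     by (force simp: good_def)
    have "exp (?i - ?k) - 1 = exp ?i * (exp (- ?k) - 1) + (exp ?i - 1)" by (rule split)
    hence "norm (exp (?i - ?k) - 1) \<le> norm (exp ?i * (exp (- ?k) - 1)) + norm (exp ?i - 1)" by (metis norm_triangle_ineq)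
    also have "\<dots> \<le> c * ?J s t w + (t - s) * (K * C2)" using n1 n2 by (simp add: norm_mult)
    finally have n: "norm (exp (?i - ?k) - 1) \<le> c * ?J s t w + (t - s) * (K * C2)" .
    have "M2 t w - M2 s w = M2 s w * (exp (?i - ?k) - 1)" using M2_step[OF g st] by (simp add: algebra_simps)
    thus ?thesis unfolding \<open>M2 t w - M2 s w = _\<close> norm_mult using n M2b[of s w] st C by (intro mult_mono) auto
   qed
   have "norm (T m w) \<le> (\<Sum>j<m. e * (C2 * (c * ?J (p m j) (p m (Suc j)) w + (p m (Suc j) - p m j) * (K * C2))))" unfolding T_def
    by (intro order_trans[OF norm_sum] sum_mono)
      (use e d p[OF _ m] e0 in \<open>auto simp: norm_mult Suc_le_eq intro!: mult_mono\<close>)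
   also have "\<dots> = e * (C2 * (c * (\<Sum>j<m. ?J q (p m (Suc j)) w - ?J q (p m j) w) + (\<Sum>j<m. p m (Suc j) - p m j) * (K * C2)))"
   proof -
    have "?J (p m j) (p m (Suc j)) w = ?J q (p m (Suc j)) w - ?J q (p m j) w" if "j < m" for j
     using jump_sum_add[OF _ xs1 q(1) p(1)[of j m] p(3)[of j m] p(2)[of "Suc j" m]] that m g by (simp add: good_def ms)
    thus ?thesis by (simp add: sum_distrib_left sum_distrib_right sum.distrib distrib_left)
   qed
   also have "\<dots> = e * V w"
   proof -
    have "?J q q w = 0" by (induction xs) (auto simp: jump_sum_def)
    thus ?thesis unfolding V_def by (subst (1 2) sum_lessThan_telescope) (simp add: p0 pm m)
   qed
   finally show ?thesis .
  qed
  have lim: "(\<lambda>m. \<integral>w. Z w * T (Suc m) w \<partial>P) \<longlonglongrightarrow> (LINT w|P. 0)"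
  proof (rule integral_dominated_convergence)
   show "integrable P (\<lambda>w. B * (2 * C1 * V w))" using Vint by auto
   show "(\<lambda>w. Z w * T (Suc m) w) \<in> borel_measurable P" for m by measurable
   show "AE w in P. norm (Z w * T (Suc m) w) \<le> B * (2 * C1 * V w)" for m using AEgood
   proof eventually_elim
    case (elim w)
    have "norm (M1 t w - M1 s w) \<le> 2 * C1" if "q \<le> s" "s \<le> r" "q \<le> t" "t \<le> r" for s t
     using norm_triangle_ineq4[of "M1 t w" "M1 s w"] M1b[of w s] M1b[of w t] that elim by (auto simp: good_def)
    hence "norm (T (Suc m) w) \<le> 2 * C1 * V w" using p[of _ "Suc m"] by (intro TV elim) (auto simp: less_Suc_eq_le)
    thus ?case using ZB[of w] elim B0 by (auto simp: norm_mult good_def intro!: mult_mono)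
   qed
   show "AE w in P. (\<lambda>m. Z w * T (Suc m) w) \<longlonglongrightarrow> 0" using AEgood
   proof eventually_elim
    case (elim w)
    have cW: "continuous_on {0..} (\<lambda>t. W t w)" using bm elim by (simp add: brownian_motion_def good_def)
    have "continuous_on {q..r} (\<lambda>t. M1 t w)" unfolding M1_def by (intro continuous_intros continuous_on_subset[OF cW]) (use q in auto)
    hence uc: "uniformly_continuous_on {q..r} (\<lambda>t. M1 t w)" by (rule compact_uniformly_continuous) simp
    have "(\<lambda>m. T (Suc m) w) \<longlonglongrightarrow> 0"
    proof (rule LIMSEQ_I)
     fix e :: real assume "e > 0"
     define e' where "e' = e / (\<bar>V w\<bar> + 1)"
     have e': "e' > 0" using \<open>e > 0\<close> by (auto simp: e'_def)
     obtain d where d: "d > 0" "\<And>s t. s \<in> {q..r} ==> t \<in> {q..r} ==> dist t s < d ==> dist (M1 t w) (M1 s w) < e'"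
      using uc e' unfolding uniformly_continuous_on_def by metis
     obtain m0 :: nat where m0: "(r - q) / d < real m0" using reals_Archimedean2 by blast
     show "\<exists>m0. \<forall>m\<ge>m0. norm (T (Suc m) w - 0) < e"
     proof (intro exI allI impI)
      fix m assume "m \<ge> m0"
      hence "(r - q) / d < real (Suc m)" using m0 by linarith
      hence step: "(r - q) / real (Suc m) < d" using d(1) by (simp add: field_simps)
      have "norm (T (Suc m) w) \<le> e' * V w"
      proof (rule TV[OF _ elim])
       fix j assume j: "j < Suc m"
       have "p (Suc m) (Suc j) - p (Suc m) j = (r - q) / real (Suc m)" by (simp add: p_def diff_divide_distrib[symmetric] algebra_simps)
       hence "dist (p (Suc m) (Suc j)) (p (Suc m) j) < d" using step p(3)[of j "Suc m"] j by (simp add: dist_real_def)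
       thus "norm (M1 (p (Suc m) (Suc j)) w - M1 (p (Suc m) j) w) \<le> e'"
        using d(2)[of "p (Suc m) j" "p (Suc m) (Suc j)"] p[of j "Suc m"] p[of "Suc j" "Suc m"] j by (simp add: dist_norm)
      qed simp
      also have "\<dots> \<le> e' * \<bar>V w\<bar>" using e' by (intro mult_left_mono) auto
      also have "\<dots> < e" using \<open>e > 0\<close> by (auto simp: e'_def field_simps)
      finally show "norm (T (Suc m) w - 0) < e" by simp
     qed
    qed
    thus ?case by (rule tendsto_mult_right_zero)
   qed
  qed auto
  moreover have "(LINT w|P. Z w * T (Suc m) w) = (?e M1 M2) - ?d" for m using expT[of "Suc m"] by simp
  ultimately show ?thesis by (simp add: LIMSEQ_const_iff)
 qed
 thus ?thesis by (simp add: M1_def M2_def)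
qed

end

section \<open>Exponential martingales of simple integrands\<close>

text \<open>On such an interval a simple integrand is constant in time and known at the left
  endpoint, so the identities for frozen coefficients apply to it.\<close>

definition no_endpoint :: "('e, 'a) simple => real => real => bool" where
 "no_endpoint D q r \<longleftrightarrow> q < r \<and> (\<forall>(a, b, A, \<xi>)\<in>set D. a \<le> b \<and> (a \<le> q \<or> r \<le> a) \<and> (b \<le> q \<or> r \<le> b))"

definition active :: "('e, 'a) simple => real => real => ('e set \<times> ('a => real)) list" where
 "active D q r = map (\<lambda>(a, b, A, \<xi>). (A, \<xi>)) (filter (\<lambda>(a, b, A, \<xi>). a \<le> q \<and> r \<le> b) D)"

lemma simple_value_active:
 assumes "no_endpoint D q r" "q < p" "p \<le> r" shows "simple_value D p y w = (\<Sum>(A, \<xi>)\<leftarrow>active D q r. \<xi> w * indicator A y)"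
 using assms
proof (induction D)
 case (Cons d D)
 thus ?case by (cases d) (auto simp: simple_value_def active_def no_endpoint_def indicator_def)
qed (simp add: simple_value_def active_def)

lemma simple_integral_active:
 assumes "no_endpoint D q r"
 shows "simple_integral L D r w - simple_integral L D q w = (\<Sum>(A, \<xi>)\<leftarrow>active D q r. \<xi> w * (L A r w - L A q w))" using assms
proof (induction D)
 case (Cons d D)
 obtain a b A \<xi> where d: "d = (a, b, A, \<xi>)" by (cases d)
 have h: "a \<le> b" "a \<le> q \<or> r \<le> a" "b \<le> q \<or> r \<le> b" "q < r" "no_endpoint D q r"
  using Cons.prems by (auto simp: d no_endpoint_def)
 have e: "\<xi> w * (L A (min r b) w - L A (min r a) w) - \<xi> w * (L A (min q b) w - L A (min q a) w)
   = (if a \<le> q \<and> r \<le> b then \<xi> w * (L A r w - L A q w) else 0)" using h by (auto simp: min_def algebra_simps)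
 show ?case using Cons.IH[OF h(5)] e by (auto simp: simple_integral_def active_def d algebra_simps)
qed (simp add: simple_integral_def active_def)

lemma simple_value_bounded:
 assumes "simple_integrand P F \<nu> D" shows "\<exists>B. \<forall>v\<in>space P. \<forall>s y. \<bar>simple_value D s y v\<bar> \<le> B" using assms
proof (induction D)
 case (Cons d D)
 obtain a b A \<xi> where d: "d = (a, b, A, \<xi>)" by (cases d)
 have "simple_integrand P F \<nu> D" "bounded (\<xi> ` space P)" using Cons.prems by (auto simp: d simple_integrand_def)
 then obtain B B' where B: "\<And>v s y. v \<in> space P ==> \<bar>simple_value D s y v\<bar> \<le> B" "\<And>v. v \<in> space P ==> \<bar>\<xi> v\<bar> \<le> B'"
  using Cons.IH by (force simp: bounded_iff)
 have "\<bar>simple_value (d # D) s y v\<bar> \<le> B' + B" if w: "v \<in> space P" for v s y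
 proof -
  have "\<bar>\<xi> v * indicator {a<..b} s * indicator A y\<bar> \<le> B'" using B(2)[OF w] by (auto simp: indicator_def)
  thus ?thesis using B(1)[OF w, of s y] by (simp add: simple_value_def d)
 qed
 thus ?case by blast
qed (auto simp: simple_value_def)

lemma simple_integrandD:
 assumes "simple_integrand P F \<mu> D" "(a, b, A, \<xi>) \<in> set D"
 shows "0 \<le> a" "a \<le> b" "A \<in> sets \<mu>" "emeasure \<mu> A < \<infinity>" "\<xi> \<in> borel_measurable (F a)" "bounded (\<xi> ` space P)"
 using bspec[OF assms(1)[unfolded simple_integrand_def] assms(2)] by auto

context noisy_space begin

abbreviation comp_noise :: "'e set => real => 'a => real" where
 "comp_noise \<equiv> \<lambda>A t w. measure (N w) ({0<..t} \<times> A) - t * measure \<nu> A"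

abbreviation raw_noise :: "'e set => real => 'a => real" where
 "raw_noise \<equiv> \<lambda>A t w. measure (N w) ({0<..t} \<times> A)"

abbreviation bm_noise :: "unit set => real => 'a => real" where
 "bm_noise \<equiv> \<lambda>A t w. indicator A () * W t w"

definition exponent ::
 "real => (unit, 'a) simple => ('e, 'a) simple => ('e, 'a) simple => real => real => 'a => real" where
 "exponent \<sigma> D1 D2 D3 s t w =
   \<sigma> * (simple_integral bm_noise D1 t w - simple_integral bm_noise D1 s w)
   + (simple_integral comp_noise D2 t w - simple_integral comp_noise D2 s w)
   + (simple_integral raw_noise D3 t w - simple_integral raw_noise D3 s w)"

text \<open>The Levy-Khintchine exponent per unit time at frequency \<open>u\<close>. Only
  \<open>f\<close> is compensated: \<open>f\<close> is integrated against the compensated measure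
  and \<open>g\<close> against the raw one.\<close>

definition symbol_rate ::
 "real => real => real => ('e => real) => ('e => real) => complex" where
 "symbol_rate u \<sigma> v f g = - of_real (u\<^sup>2 * \<sigma>\<^sup>2 / 2 * v\<^sup>2) +
   (LINT y|\<nu>. (exp (\<i> * of_real (u * (f y + g y))) - 1 - \<i> * of_real (u * f y)))"

definition simple_rate ::
 "real => real => (unit, 'a) simple => ('e, 'a) simple => ('e, 'a) simple => real => 'a => complex" where
 "simple_rate u \<sigma> D1 D2 D3 p w =
   symbol_rate u \<sigma> (simple_value D1 p () w) (\<lambda>y. simple_value D2 p y w) (\<lambda>y. simple_value D3 p y w)"

lemma active_adapted:
 assumes "simple_integrand P F \<nu> D" "no_endpoint D q r" shows "adapted_marks q (active D q r)"
proof -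
 have "\<xi> \<in> borel_measurable (F q)" if "(a, b, A, \<xi>) \<in> set D" "a \<le> q" for a b A \<xi>
  using assms(1) that unfolding simple_integrand_def by (auto intro: measurable_F_mono)
 thus ?thesis using assms unfolding adapted_marks_def active_def simple_integrand_def by fastforce
qed

lemma active_bounded:
 assumes "simple_integrand P F \<nu> D"
 shows "\<exists>c. \<forall>(A, \<xi>)\<in>set (active D q r). \<forall>w\<in>space P. \<bar>\<xi> w\<bar> \<le> c"
proof -
 have "\<exists>c. \<forall>w\<in>space P. \<bar>snd x w\<bar> \<le> c" if "x \<in> set (active D q r)" for x
  using assms that unfolding active_def simple_integrand_def by (fastforce simp: bounded_iff)
 then obtain c where c: "\<And>x w. x \<in> set (active D q r) ==> w \<in> space P ==> \<bar>snd x w\<bar> \<le> c x" by metis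
 have "\<bar>snd x w\<bar> \<le> (\<Sum>x\<in>set (active D q r). \<bar>c x\<bar>)" if "x \<in> set (active D q r)" "w \<in> space P" for x w
 proof -
  have "\<bar>c x\<bar> \<le> (\<Sum>x\<in>set (active D q r). \<bar>c x\<bar>)" using that by (intro member_le_sum) auto
  thus ?thesis using c[OF that] by linarith
 qed
 thus ?thesis by (intro exI[of _ "\<Sum>x\<in>set (active D q r). \<bar>c x\<bar>"]) auto
qed

lemma simple_value_adapted:
 assumes "simple_integrand P F \<mu> D" "0 \<le> q" "no_endpoint D q r" shows "(\<lambda>w. simple_value D r y w) \<in> borel_measurable (F q)"
proof -
 have "simple_value D r y = (\<lambda>w. \<Sum>x\<leftarrow>active D q r. snd x w * indicator (fst x) y)"
  using simple_value_active[OF assms(3), of r y] assms(3) by (auto simp: no_endpoint_def case_prod_unfold)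
 also have "\<dots> \<in> borel_measurable (F q)"
 proof (intro borel_measurable_sum_list borel_measurable_times borel_measurable_const)
  fix x assume "x \<in> set (active D q r)"
  thus "snd x \<in> borel_measurable (F q)" using assms unfolding active_def simple_integrand_def by (fastforce intro: measurable_F_mono)
 qed
 finally show ?thesis .
qed

lemma mark_value_integrable:
 assumes "adapted_marks q xs" shows "integrable \<nu> (\<lambda>y. mark_value xs w y)"
  and "(LINT y|\<nu>. mark_value xs w y) = (\<Sum>(A, \<xi>)\<leftarrow>xs. \<xi> w * measure \<nu> A)"
proof -
 have i: "integrable \<nu> (\<lambda>y. snd x w * indicator (fst x) y)" if "x \<in> set xs" for x
  using adapted_marksD[OF assms, of "fst x" "snd x"] that by auto
 show "integrable \<nu> (\<lambda>y. mark_value xs w y)" unfolding mark_value_def case_prod_unfold using i by (intro integrable_sum_list) auto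
 have "(LINT y|\<nu>. mark_value xs w y) = (\<Sum>x\<leftarrow>xs. \<integral>y. snd x w * indicator (fst x) y \<partial>\<nu>)"
  unfolding mark_value_def case_prod_unfold using i by (intro integral_sum_list) auto
 also have "\<dots> = (\<Sum>x\<leftarrow>xs. snd x w * measure \<nu> (fst x))" using adapted_marksD[OF assms] by (intro sum_list_cong) auto
 finally show "(LINT y|\<nu>. mark_value xs w y) = (\<Sum>(A, \<xi>)\<leftarrow>xs. \<xi> w * measure \<nu> A)" by (simp add: case_prod_unfold)
qed

end

locale simple_noise = noisy_space P F W \<nu> N
 for P :: "'a measure" and F and W and \<nu> :: "'e measure" and N +
 fixes u \<sigma> :: real and D1 :: "(unit, 'a) simple" and D2 D3 :: "('e, 'a) simple"
 assumes D: "simple_integrand P F (count_space UNIV) D1" "simple_integrand P F \<nu> D2" "simple_integrand P F \<nu> D3"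
begin

abbreviation "ends q r \<equiv> no_endpoint D1 q r \<and> no_endpoint D2 q r \<and> no_endpoint D3 q r"

definition "coef r w = u * \<sigma> * simple_value D1 r () w"
definition "marks q r = map (\<lambda>(A, \<xi>). (A, \<lambda>w. u * \<xi> w)) (active D2 q r @ active D3 q r)"
text \<open>The constant value of \<open>simple_rate\<close> on an interval without endpoints. The
  compensator of \<open>D2\<close> appears as a finite sum, in the form in which it arises from
  \<open>simple_integral\<close>.\<close>

definition "step_rate q r w = - of_real ((coef r w)\<^sup>2 / 2) + jump_symbol (marks q r) w
  - \<i> * of_real (u * (\<Sum>(A, \<xi>)\<leftarrow>active D2 q r. \<xi> w * measure \<nu> A))"

lemma marks_adapted: "ends q r ==> adapted_marks q (marks q r)" using active_adapted[OF D(2)] active_adapted[OF D(3)]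
 unfolding marks_def adapted_marks_def by fastforce

lemma mark_value_marks:
 assumes "ends q r" "q < p" "p \<le> r" shows "mark_value (marks q r) w y = u * (simple_value D2 p y w + simple_value D3 p y w)"
 using simple_value_active[of D2 q r p y w] simple_value_active[of D3 q r p y w] assms
 by (simp add: mark_value_def marks_def case_prod_unfold comp_def sum_list_const_mult mult.assoc distrib_left)

lemma simple_rate_eq:
 assumes e: "ends q r" and p: "q < p" "p \<le> r" shows "simple_rate u \<sigma> D1 D2 D3 p w = step_rate q r w"
proof -
 have v1: "simple_value D1 p () w = simple_value D1 r () w" using simple_value_active[of D1 q r _ "()" w] e p by (auto simp: no_endpoint_def)
 have v2: "simple_value D2 p y w = mark_value (active D2 q r) w y" for y using simple_value_active[of D2 q r p y w] e p by (simp add: mark_value_def)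
 have a2: "adapted_marks q (active D2 q r)" using active_adapted[OF D(2)] e by blast
 have "(LINT y|\<nu>. (exp (\<i> * of_real (u * (simple_value D2 p y w + simple_value D3 p y w))) - 1 - \<i> * of_real (u * simple_value D2 p y w)))
   = (LINT y|\<nu>. ((exp (\<i> * of_real (mark_value (marks q r) w y)) - 1) - \<i> * of_real (u * mark_value (active D2 q r) w y)))"
  using mark_value_marks[OF e p] v2 by simp
 also have "\<dots> = jump_symbol (marks q r) w - \<i> * of_real (u * (\<Sum>(A, \<xi>)\<leftarrow>active D2 q r. \<xi> w * measure \<nu> A))"
  using jump_symbol_integrable[OF marks_adapted[OF e], of w] mark_value_integrable[OF a2, of w] by (simp add: jump_symbol_def)
 finally show ?thesis by (simp add: simple_rate_def symbol_rate_def step_rate_def v1 coef_def power_mult_distrib algebra_simps)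
qed

lemma coef_measurable: "0 \<le> q ==> ends q r ==> coef r \<in> borel_measurable (F q)"
 unfolding coef_def using simple_value_adapted[OF D(1), of q r "()"] by simp

lemma coef_bounded: "\<exists>B\<ge>0. \<forall>r. \<forall>w\<in>space P. \<bar>coef r w\<bar> \<le> B"
proof -
 obtain B where B: "\<And>w s y. w \<in> space P ==> \<bar>simple_value D1 s y w\<bar> \<le> B" using simple_value_bounded[OF D(1)] by blast
 have "\<bar>coef r w\<bar> \<le> \<bar>u * \<sigma>\<bar> * \<bar>B\<bar>" if "w \<in> space P" for r w
  using B[OF that, of r "()"] unfolding coef_def abs_mult[of "u * \<sigma>"] by (intro mult_left_mono) auto
 thus ?thesis by (intro exI[of _ "\<bar>u * \<sigma>\<bar> * \<bar>B\<bar>"]) auto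
qed

lemma step_rate_measurable:
 assumes "0 \<le> q" "ends q r" shows "step_rate q r \<in> borel_measurable (F q)"
proof -
 let ?a = "borel_measurable (F q)"
 have [measurable]: "coef r \<in> ?a" "jump_symbol (marks q r) \<in> ?a"
  using coef_measurable[OF assms] measurable_jump_symbol[OF marks_adapted[OF assms(2)]] by auto
 have [measurable]: "(\<lambda>w. \<Sum>(A, \<xi>)\<leftarrow>active D2 q r. \<xi> w * measure \<nu> A) \<in> ?a"
 proof (intro borel_measurable_sum_list)
  fix x assume "x \<in> set (active D2 q r)"
  thus "(\<lambda>w. case x of (A, \<xi>) => \<xi> w * measure \<nu> A) \<in> ?a"
   using adapted_marksD(3)[OF active_adapted[OF D(2)], of q r "fst x" "snd x"] assms by (simp add: case_prod_unfold)
 qed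
 show ?thesis unfolding step_rate_def by measurable
qed

lemma Re_jump_symbol_le:
 assumes "adapted_marks q xs" shows "Re (jump_symbol xs w) \<le> 0"
proof -
 have "Re (jump_symbol xs w) = (LINT y|\<nu>. Re (exp (\<i> * of_real (mark_value xs w y)) - 1))"
  unfolding jump_symbol_def using jump_symbol_integrable[OF assms] by (rule integral_Re[symmetric])
 also have "\<dots> \<le> (LINT y|\<nu>. 0)" by (rule integral_mono[OF integrable_Re[OF jump_symbol_integrable[OF assms]]]) (auto simp: Re_exp)
 finally show ?thesis by simp
qed

text \<open>This sign makes the real part of the accumulated exponent decrease in time, on which the
  monotone truncation in \<open>simple_exp_martingale\<close> depends.\<close>

lemma step_rate_le: "ends q r ==> Re (step_rate q r w) \<le> 0"
 using Re_jump_symbol_le[OF marks_adapted, of q r w] by (auto simp: step_rate_def intro: order_trans[OF _ zero_le_power2])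

text \<open>On this almost sure event the counts are finite, so a difference of
  \<open>measure\<close> values is the count on the difference of the sets.\<close>

definition "bad_free t w \<longleftrightarrow> w \<in> space P \<and> (\<forall>x\<in>set (D2 @ D3). emeasure (N w) ({0<..t} \<times> fst (snd (snd x))) < \<infinity>)"

lemma AE_bad_free: "AE w in P. bad_free t w"
proof -
 have "AE w in P. \<forall>x\<in>set (D2 @ D3). emeasure (N w) ({0<..t} \<times> fst (snd (snd x))) < \<infinity>"
 proof (subst AE_finite_all, simp, intro ballI)
  fix x assume "x \<in> set (D2 @ D3)"
  moreover obtain a b A \<xi> where x: "x = (a, b, A, \<xi>)" by (cases x)
  ultimately have "A \<in> sets \<nu>" "emeasure \<nu> A < \<infinity>"
   using simple_integrandD(3,4)[OF D(2), of a b A \<xi>] simple_integrandD(3,4)[OF D(3), of a b A \<xi>] by auto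
  thus "AE w in P. emeasure (N w) ({0<..t} \<times> fst (snd (snd x))) < \<infinity>" unfolding x by (intro AE_N_finite) auto
 qed
 thus ?thesis using AE_space unfolding bad_free_def by eventually_elim blast
qed

text \<open>Brings the exponent into the form treated by \<open>WN_exp_martingale\<close>. The last
  term is the compensator of \<open>D2\<close>, which cancels against the corresponding term of
  \<open>step_rate\<close>.\<close>

lemma exponent_step:
 assumes q: "0 \<le> q" and e: "ends q r" and y: "bad_free r y"
 shows "u * exponent \<sigma> D1 D2 D3 q r y = coef r y * (W r y - W q y) + jump_sum (marks q r) q r y
   - (r - q) * (u * (\<Sum>(A, \<xi>)\<leftarrow>active D2 q r. \<xi> y * measure \<nu> A))"
proof -
 let ?a = "\<lambda>A. {q<..r} \<times> A"
 have qr: "q < r" using e by (simp add: no_endpoint_def)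
 have w: "y \<in> space P" using y by (simp add: bad_free_def)
 have "measure (N y) ({0<..r} \<times> A) - measure (N y) ({0<..q} \<times> A) = measure (N y) (?a A)"
  if A: "A \<in> sets \<nu>" "emeasure (N y) ({0<..r} \<times> A) < \<infinity>" for A
 proof -
  have f: "emeasure (N y) ({a<..b} \<times> A) \<noteq> \<infinity>" if "0 \<le> a" "b \<le> r" for a b
  proof -
   have "emeasure (N y) ({a<..b} \<times> A) \<le> emeasure (N y) ({0<..r} \<times> A)"
    using that A by (intro emeasure_mono) (auto simp: sets_N[OF w] time_mark_rect)
   thus ?thesis using A(2) by (auto simp: top_unique)
  qed
  have "{0<..r} \<times> A = ({0<..q} \<times> A) \<union> (?a A)" using q qr by auto
  hence "measure (N y) ({0<..r} \<times> A) = measure (N y) ({0<..q} \<times> A) + measure (N y) (?a A)"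
   using f[of 0 q] f[of q r] q A qr by (auto intro!: measure_Union simp: sets_N[OF w] time_mark_rect)
  thus ?thesis by simp
 qed
 moreover have "A \<in> sets \<nu> \<and> emeasure (N y) ({0<..r} \<times> A) < \<infinity>" if mem: "(A, \<xi>) \<in> set (active D2 q r) \<union> set (active D3 q r)" for A \<xi>
 proof -
  obtain a b where ab: "(a, b, A, \<xi>) \<in> set (D2 @ D3)" using mem unfolding active_def by force
  hence "A \<in> sets \<nu>" using simple_integrandD(3)[OF D(2), of a b A \<xi>] simple_integrandD(3)[OF D(3), of a b A \<xi>] by auto
  moreover have "emeasure (N y) ({0<..r} \<times> A) < \<infinity>" using bspec[OF conjunct2[OF y[unfolded bad_free_def]] ab] by simp
  ultimately show ?thesis by simp
 qed
 ultimately have m: "raw_noise A r y - raw_noise A q y = measure (N y) (?a A)" if "(A, \<xi>) \<in> set (active D2 q r) \<union> set (active D3 q r)" for A \<xi>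
  using that by blast
 have i1: "simple_integral bm_noise D1 r y - simple_integral bm_noise D1 q y = simple_value D1 r () y * (W r y - W q y)"
 proof -
  have sl: "(\<Sum>(A, \<xi>)\<leftarrow>xs. \<xi> y * (bm_noise A r y - bm_noise A q y)) = (\<Sum>(A, \<xi>)\<leftarrow>xs. \<xi> y * indicator A ()) * (W r y - W q y)" for xs
   by (induction xs) (auto simp: algebra_simps)
  have "simple_value D1 r () y = (\<Sum>(A, \<xi>)\<leftarrow>active D1 q r. \<xi> y * indicator A ())"
   using simple_value_active[of D1 q r r "()" y] e qr by simp
  thus ?thesis using simple_integral_active[of D1 q r bm_noise y] e by (simp add: sl)
 qed
 have i2: "simple_integral comp_noise D2 r y - simple_integral comp_noise D2 q y
   = jump_sum (active D2 q r) q r y - (r - q) * (\<Sum>(A, \<xi>)\<leftarrow>active D2 q r. \<xi> y * measure \<nu> A)"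
 proof -
  have "(\<Sum>(A, \<xi>)\<leftarrow>active D2 q r. \<xi> y * (comp_noise A r y - comp_noise A q y))
    = (\<Sum>(A, \<xi>)\<leftarrow>active D2 q r. \<xi> y * measure (N y) (?a A) - (r - q) * (\<xi> y * measure \<nu> A))"
  proof (intro sum_list_cong refl)
   fix x assume "x \<in> set (active D2 q r)"
   hence "raw_noise (fst x) r y = raw_noise (fst x) q y + measure (N y) ({q<..r} \<times> fst x)"
    using m[of "fst x" "snd x"] by (simp add: algebra_simps)
   thus "(case x of (A, \<xi>) => \<xi> y * (comp_noise A r y - comp_noise A q y)) =
    (case x of (A, \<xi>) => \<xi> y * measure (N y) (?a A) - (r - q) * (\<xi> y * measure \<nu> A))"
    unfolding case_prod_unfold by (simp add: algebra_simps)
  qed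
  thus ?thesis using simple_integral_active[of D2 q r comp_noise y] e
   by (simp add: jump_sum_def case_prod_unfold sum_list_subtractf sum_list_const_mult)
 qed
 have i3: "simple_integral raw_noise D3 r y - simple_integral raw_noise D3 q y = jump_sum (active D3 q r) q r y"
 proof -
  have "(\<Sum>(A, \<xi>)\<leftarrow>active D3 q r. \<xi> y * (raw_noise A r y - raw_noise A q y))
    = (\<Sum>(A, \<xi>)\<leftarrow>active D3 q r. \<xi> y * measure (N y) (?a A))"
  proof (intro sum_list_cong refl)
   fix x assume "x \<in> set (active D3 q r)"
   thus "(case x of (A, \<xi>) => \<xi> y * (raw_noise A r y - raw_noise A q y)) =
    (case x of (A, \<xi>) => \<xi> y * measure (N y) (?a A))" using m[of "fst x" "snd x"] by (simp add: case_prod_unfold)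
  qed
  thus ?thesis using simple_integral_active[of D3 q r raw_noise y] e by (simp add: jump_sum_def)
 qed
 have j: "jump_sum (marks q r) q r y = u * (jump_sum (active D2 q r) q r y + jump_sum (active D3 q r) q r y)"
  by (simp add: jump_sum_def marks_def case_prod_unfold comp_def sum_list_const_mult mult.assoc distrib_left)
 show ?thesis unfolding exponent_def i1 i2 i3 j coef_def by (simp add: algebra_simps)
qed

end

context noisy_space begin

lemma measurable_simple_integral:
 assumes D: "simple_integrand P F \<mu> D"
  and L: "\<And>A r. A \<in> sets \<mu> ==> emeasure \<mu> A < \<infinity> ==> 0 \<le> r ==> L A r \<in> borel_measurable (F r)"
  and t: "0 \<le> t" shows "simple_integral L D t \<in> borel_measurable (F t)"
proof -
 let ?a = "borel_measurable (F t)"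
 have "(\<lambda>w. snd (snd (snd x)) w * (L (fst (snd (snd x))) (min t (fst (snd x))) w - L (fst (snd (snd x))) (min t (fst x)) w)) \<in> ?a"
  if mem: "x \<in> set D" for x
 proof -
  obtain a b A \<xi> where x: "x = (a, b, A, \<xi>)" by (cases x)
  note d = simple_integrandD[OF D mem[unfolded x]]
  show ?thesis
  proof (cases "a \<le> t")
   case True
   have "\<xi> \<in> ?a" using measurable_F_mono[OF d(5) d(1) True] .
   moreover have "L A (min t b) \<in> ?a" "L A (min t a) \<in> ?a"
    using measurable_F_mono[OF L[OF d(3,4), of "min t b"], of t] measurable_F_mono[OF L[OF d(3,4), of "min t a"], of t] d t by auto
   ultimately show ?thesis by (simp add: x)
  next
   \<comment> \<open>An entry that starts after \<open>t\<close> contributes 0, so it does no harm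
     that its coefficient becomes measurable only later.\<close>
   case False
   thus ?thesis using d by (simp add: x min_def)
  qed
 qed
 thus ?thesis unfolding simple_integral_def case_prod_unfold by (intro borel_measurable_sum_list)
qed

lemma measurable_noises:
 assumes "0 \<le> r" shows "bm_noise B r \<in> borel_measurable (F r)"
  and "A \<in> sets \<nu> ==> raw_noise A r \<in> borel_measurable (F r)"
  and "A \<in> sets \<nu> ==> comp_noise A r \<in> borel_measurable (F r)"
proof -
 let ?a = "borel_measurable (F r)"
 show "bm_noise B r \<in> ?a" using bm assms unfolding brownian_motion_def adapted_def by (intro borel_measurable_times borel_measurable_const) auto
 show *: "raw_noise A r \<in> ?a" if "A \<in> sets \<nu>"
 proof -
  have "(\<lambda>w. emeasure (N w) ({0<..r} \<times> A)) \<in> ?a" using that assms by (intro N_adapted time_mark_rect) auto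
  thus ?thesis unfolding measure_def by simp
 qed
 show "comp_noise A r \<in> ?a" if "A \<in> sets \<nu>" using *[OF that] by simp
qed

end

context simple_noise begin

lemma exponent_measurable:
 assumes "0 \<le> s" "s \<le> t" shows "exponent \<sigma> D1 D2 D3 s t \<in> borel_measurable (F t)"
proof -
 let ?a = "borel_measurable (F t)"
 have [measurable]: "simple_integral bm_noise D1 t \<in> ?a" "simple_integral comp_noise D2 t \<in> ?a"
  "simple_integral raw_noise D3 t \<in> ?a" using assms D by (auto intro!: measurable_simple_integral measurable_noises)
 have "simple_integral bm_noise D1 s \<in> borel_measurable (F s)" "simple_integral comp_noise D2 s \<in> borel_measurable (F s)"
  "simple_integral raw_noise D3 s \<in> borel_measurable (F s)" using assms D by (auto intro!: measurable_simple_integral measurable_noises)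
 hence [measurable]: "simple_integral bm_noise D1 s \<in> ?a" "simple_integral comp_noise D2 s \<in> ?a"
  "simple_integral raw_noise D3 s \<in> ?a" using assms by (auto intro: measurable_F_mono)
 show ?thesis unfolding exponent_def by measurable
qed

text \<open>Cutting at an interior endpoint leaves fewer endpoints inside each half, so the
  induction runs on their number. It reduces claims about arbitrary intervals to intervals on which
  all three simple integrands are constant.\<close>

lemma ends_induct [consumes 2, case_names refl step comp]:
 assumes "l \<le> q" "q \<le> r" and refl: "\<And>q. A q q" and step: "\<And>q r. l \<le> q ==> ends q r ==> A q r"
  and comp: "\<And>q r v. l \<le> q ==> q \<le> r ==> r \<le> v ==> A q r ==> A r v ==> A q v" shows "A q r"
proof -
 let ?e = "\<lambda>D. \<Union>(a, b, _)\<in>set D. {a, b}"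
 define E where "E = ?e D1 \<union> ?e D2 \<union> ?e D3"
 have E: "finite (E \<inter> S)" for S unfolding E_def by auto
 have "no_endpoint D q r" if "simple_integrand P F \<mu> D" "?e D \<inter> {q<..<r} = {}" "q < r" for D :: "('x, 'a) simple" and \<mu> q r
  unfolding no_endpoint_def
 proof (intro conjI ballI that(3), clarify)
  fix a b A \<xi> assume d: "(a, b, A, \<xi>) \<in> set D"
  hence "a \<notin> {q<..<r}" "b \<notin> {q<..<r}" using that(2) by blast+
  thus "a \<le> b \<and> (a \<le> q \<or> r \<le> a) \<and> (b \<le> q \<or> r \<le> b)" using simple_integrandD(2)[OF that(1) d] by auto
 qed
 from this[OF D(1)] this[OF D(2)] this[OF D(3)] have 1: "ends q r" if "q < r" "E \<inter> {q<..<r} = {}" for q r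
  using that by (simp add: E_def Int_Un_distrib2)
 show ?thesis using assms(1,2)
 proof (induction "card (E \<inter> {q<..<r})" arbitrary: q r rule: less_induct)
  case less
  show ?case
  proof (cases "q < r \<and> E \<inter> {q<..<r} \<noteq> {}")
   case True
   then obtain e where e: "e \<in> E" "q < e" "e < r" by auto
   have "E \<inter> {q<..<e} \<subset> E \<inter> {q<..<r}" "E \<inter> {e<..<r} \<subset> E \<inter> {q<..<r}" using e by auto
   hence "A q e" "A e r" using less.prems e by (auto intro!: less.hyps psubset_card_mono[OF E])
   thus ?thesis using e less.prems by (intro comp[of q e r]) auto
  next
   case False
   thus ?thesis using less.prems 1[of q r] refl[of q] step[of q r] by (cases "q = r") auto
  qed
 qed
qed

abbreviation "rate_int q r w \<equiv> LINT p:{q<..r}|lborel. simple_rate u \<sigma> D1 D2 D3 p w"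

lemma rate_int_ends:
 assumes "ends q r" shows "set_integrable lborel {q<..r} (\<lambda>p. simple_rate u \<sigma> D1 D2 D3 p w)"
  and "rate_int q r w = of_real (r - q) * step_rate q r w"
proof -
 have lt: "q < r" using assms by (simp add: no_endpoint_def)
 have eq: "indicator {q<..r} p *\<^sub>R simple_rate u \<sigma> D1 D2 D3 p w = indicator {q<..r} p *\<^sub>R step_rate q r w" for p
  using simple_rate_eq[OF assms, of p w] by (auto simp: indicator_def)
 show "set_integrable lborel {q<..r} (\<lambda>p. simple_rate u \<sigma> D1 D2 D3 p w)"
  unfolding set_integrable_def eq using lt by (intro integrable_scaleR_left integrable_real_indicator) auto
 show "rate_int q r w = of_real (r - q) * step_rate q r w" unfolding set_lebesgue_integral_def eq using lt by (simp add: scaleR_conv_of_real)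
qed

lemma rate_int_integrable: "q \<le> r ==> set_integrable lborel {q<..r} (\<lambda>p. simple_rate u \<sigma> D1 D2 D3 p w)"
proof (induction rule: ends_induct[OF order_refl, consumes 1, case_names refl step comp])
 case (comp q r v)
 thus ?case using set_integrable_Un[OF comp(4,5)] by (simp add: ivl_disj_un_two)
qed (auto simp: set_integrable_def[of _ "{}"] rate_int_ends)

lemma rate_int_add: "q \<le> r ==> r \<le> v ==> rate_int q v w = rate_int q r w + rate_int r v w"
 using set_integral_Un[OF _ rate_int_integrable rate_int_integrable, of q r r v] by (simp add: ivl_disj_un_two)

lemma rate_int_adapted:
 assumes "0 \<le> q" "q \<le> r" shows "rate_int q r \<in> borel_measurable (F r)" using assms
proof (induction rule: ends_induct)
 case (step q r)
 hence "q \<le> r" by (simp add: no_endpoint_def)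
 thus ?case unfolding rate_int_ends(2)[OF step(2)] using measurable_F_mono[OF step_rate_measurable[OF step] step(1)] by measurable
next
 case (comp q r v)
 thus ?case unfolding rate_int_add[OF comp(2,3)] by (intro borel_measurable_add) (auto intro: measurable_F_mono)
qed (simp add: set_lebesgue_integral_def)

text \<open>The truncation at level \<open>C\<close> makes the bound independent of the simple integrands.\<close>

lemma simple_exp_martingale:
 fixes Z :: "'a => complex"
 assumes st: "0 \<le> s" "s \<le> t" and C: "0 \<le> C"
  and Z: "Z \<in> borel_measurable (F s)" and Zb: "\<And>y. y \<in> space P ==> norm (Z y) \<le> 1"
 shows "norm ((LINT y|P. Z y * (if - Re (rate_int s t y) \<le> C then exp (\<i> * of_real (u * exponent \<sigma> D1 D2 D3 s t y) - rate_int s t y) else 0)) - (LINT y|P. Z y))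
  \<le> exp C * prob {y\<in>space P. C < - Re (rate_int s t y)}"
proof -
 let ?I = "rate_int s"
 define S where "S v y = exp (\<i> * of_real (u * exponent \<sigma> D1 D2 D3 s v y) - ?I v y)" for v y
 define \<phi> where "\<phi> v y = (if - Re (?I v y) \<le> C then 1 else 0 :: real)" for v y
 have m: "S v \<in> borel_measurable (F v)" "\<phi> v \<in> borel_measurable (F v)" if "s \<le> v" for v
 proof -
  note [measurable] = rate_int_adapted[OF st(1) that] exponent_measurable[OF st(1) that]
  show "S v \<in> borel_measurable (F v)" "\<phi> v \<in> borel_measurable (F v)" unfolding S_def \<phi>_def by measurable
 qed
 have mP [measurable]: "s \<le> v ==> S v \<in> borel_measurable P" "s \<le> v ==> \<phi> v \<in> borel_measurable P" for v
  using m[of v] st by (auto intro: measurable_F)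
 have ZP [measurable]: "Z \<in> borel_measurable P" by (rule measurable_F[OF Z st(1)])
 have i\<phi>: "integrable P (\<phi> v)" if "s \<le> v" for v
  by (rule integrable_const_bound[where B=1]) (use that in \<open>auto simp: \<phi>_def\<close>)
 \<comment> \<open>The error over \<open>[q, r]\<close> is measured by the mean loss of the
   truncation indicator. Such errors add up over adjacent intervals to the probability that the
   level has been exceeded by time \<open>t\<close>.\<close>
 have bound: "norm ((LINT y|P. Z y * (\<phi> r y * S r y)) - (LINT y|P. Z y * (\<phi> q y * S q y))) \<le> exp C * ((LINT y|P. \<phi> q y) - (LINT y|P. \<phi> r y))"
  if "s \<le> q" "q \<le> r" for q r using that
 proof (induction rule: ends_induct)
  case (step q r)
  note e = step(2)
  have q: "0 \<le> q" "q < r" "s \<le> r" using step st by (auto simp: no_endpoint_def)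
  have I: "?I r y = ?I q y + of_real (r - q) * step_rate q r y" for y using rate_int_add[of s q r y] rate_int_ends(2)[OF e] step q by simp
  \<comment> \<open>Once the level \<open>C\<close> is exceeded it stays exceeded, since the real
    part of the rate is nonpositive.\<close>
  have \<phi>: "\<phi> r y \<le> \<phi> q y" for y
  proof -
   have "(r - q) * Re (step_rate q r y) \<le> 0" using step_rate_le[OF e] q by (intro mult_nonneg_nonpos) auto
   hence "Re (?I r y) \<le> Re (?I q y)" unfolding I by simp
   thus ?thesis by (simp add: \<phi>_def)
  qed
  have Zn: "norm (Z y * (\<phi> v y * S q y)) \<le> exp C * \<phi> v y" if "y \<in> space P" "v = q \<or> v = r" for y v
  proof -
   have "\<phi> v y * norm (S q y) \<le> exp C * \<phi> v y" using that(2) \<phi>[of y] by (auto simp: S_def \<phi>_def split: if_splits)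
   thus ?thesis using mult_mono[OF Zb[OF that(1)]] by (fastforce simp: norm_mult \<phi>_def)
  qed
  hence Y: "norm (Z y * (\<phi> v y * S q y)) \<le> exp C" if "y \<in> space P" "v = q \<or> v = r" for y v
   using that by (fastforce simp: \<phi>_def split: if_splits)
  have Ym: "(\<lambda>y. Z y * (\<phi> r y * S q y)) \<in> borel_measurable (F q)"
  proof -
   note [measurable] = rate_int_adapted[OF st(1) step(1)] step_rate_measurable[OF q(1) e] m(1)[OF step(1)] measurable_F_mono[OF Z st(1) step(1)]
   show ?thesis unfolding \<phi>_def I by measurable
  qed
  obtain B where B: "\<And>y. y \<in> space P ==> \<bar>coef r y\<bar> \<le> B" using coef_bounded by blast
  obtain c2 c3 where c: "\<And>A \<xi> y. (A, \<xi>) \<in> set (active D2 q r) ==> y \<in> space P ==> \<bar>\<xi> y\<bar> \<le> c2"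
    "\<And>A \<xi> y. (A, \<xi>) \<in> set (active D3 q r) ==> y \<in> space P ==> \<bar>\<xi> y\<bar> \<le> c3"
   using active_bounded[OF D(2), of q r] active_bounded[OF D(3), of q r] by fast
  let ?\<rho> = "\<lambda>y. exp (\<i> * of_real (coef r y * (W r y - W q y)) + of_real ((coef r y)\<^sup>2 * (r - q) / 2)) *
   exp (\<i> * of_real (jump_sum (marks q r) q r y) - of_real (r - q) * jump_symbol (marks q r) y)"
  have [measurable]: "coef r \<in> borel_measurable P" "jump_symbol (marks q r) \<in> borel_measurable P"
   "jump_sum (marks q r) q r \<in> borel_measurable P" "W r \<in> borel_measurable P" "W q \<in> borel_measurable P"
   using measurable_F[OF coef_measurable[OF q(1) e] q(1)] measurable_F[OF measurable_jump_symbol[OF marks_adapted[OF e]] q(1)]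
    measurable_F[OF measurable_jump_sum[OF marks_adapted[OF e] q(1) order_refl, of r]]
    measurable_F[OF measurable_noises(1)[of r UNIV]] measurable_F[OF measurable_noises(1)[of q UNIV]] q by simp_all
  have "(LINT y|P. Z y * (\<phi> r y * S r y)) = (LINT y|P. (Z y * (\<phi> r y * S q y)) * ?\<rho> y)"
  proof (rule integral_cong_AE)
   show "AE y in P. Z y * (\<phi> r y * S r y) = (Z y * (\<phi> r y * S q y)) * ?\<rho> y" using AE_bad_free[of r]
   proof eventually_elim
    case (elim y)
    have "u * exponent \<sigma> D1 D2 D3 s r y = u * exponent \<sigma> D1 D2 D3 s q y + u * exponent \<sigma> D1 D2 D3 q r y"
     by (simp add: exponent_def algebra_simps)
    note ex = this[unfolded exponent_step[OF q(1) e elim]]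
    have "S r y = S q y * ?\<rho> y" unfolding S_def exp_add[symmetric] I ex step_rate_def by (intro arg_cong[where f=exp]) (simp add: field_simps)
    thus ?case by simp
   qed
  qed (use q step in measurable)
  also have "\<dots> = (LINT y|P. Z y * (\<phi> r y * S q y))"
  proof (rule WN_exp_martingale[OF q(1) less_imp_le[OF q(2)] marks_adapted[OF e] Ym Y[OF _ disjI2[OF refl]] coef_measurable[OF q(1) e] B])
   fix A \<xi> y assume "(A, \<xi>) \<in> set (marks q r)" and w: "y \<in> space P"
   then obtain \<eta> where eta: "\<xi> = (\<lambda>y. u * \<eta> y)" "(A, \<eta>) \<in> set (active D2 q r) \<or> (A, \<eta>) \<in> set (active D3 q r)"
    unfolding marks_def by auto
   hence "\<bar>\<eta> y\<bar> \<le> max c2 c3" using c(1)[of A \<eta> y] c(2)[of A \<eta> y] w by (auto simp: le_max_iff_disj)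
   thus "\<bar>\<xi> y\<bar> \<le> \<bar>u\<bar> * max c2 c3" by (simp add: eta(1) abs_mult mult_left_mono)
  qed
  finally have eq: "(LINT y|P. Z y * (\<phi> r y * S r y)) = (LINT y|P. Z y * (\<phi> r y * S q y))" .
  have i: "integrable P (\<lambda>y. Z y * (\<phi> v y * S q y))" if "v = q \<or> v = r" for v
   by (rule integrable_const_bound[where B="exp C"]) (use Y that step q in auto)
  have "norm ((LINT y|P. Z y * (\<phi> r y * S q y)) - (LINT y|P. Z y * (\<phi> q y * S q y))) = norm (LINT y|P. Z y * (\<phi> r y * S q y) - Z y * (\<phi> q y * S q y))"
   using i by simp
  also have "\<dots> \<le> (LINT y|P. exp C * (\<phi> q y - \<phi> r y))"
  proof (rule order_trans[OF integral_norm_bound integral_mono])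
   fix y assume w: "y \<in> space P"
   show "norm (Z y * (\<phi> r y * S q y) - Z y * (\<phi> q y * S q y)) \<le> exp C * (\<phi> q y - \<phi> r y)"
    using Zn[OF w, of q] \<phi>[of y] by (auto simp: \<phi>_def split: if_splits)
  qed (use i i\<phi> step q in auto)
  finally show ?case unfolding eq using i\<phi>[of q] i\<phi>[of r] step q by simp
 next
  case (comp q r v)
  thus ?case by (intro norm_diff_triangle_le[OF comp(5,4), THEN order_trans]) (simp add: algebra_simps)
 qed simp
 have "?I s y = 0" for y by (simp add: set_lebesgue_integral_def)
 hence s: "\<phi> s y = 1" "S s y = 1" for y using C by (auto simp: S_def \<phi>_def exponent_def)
 have t: "Z y * (if - Re (?I t y) \<le> C then exp (\<i> * of_real (u * exponent \<sigma> D1 D2 D3 s t y) - ?I t y) else 0) = Z y * (\<phi> t y * S t y)" for y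
  by (simp add: \<phi>_def S_def)
 have "1 - (LINT y|P. \<phi> t y) = (LINT y|P. 1 - \<phi> t y)" using i\<phi>[OF st(2)] by (simp add: prob_space)
 also have "\<dots> = (LINT y|P. indicator {y\<in>space P. C < - Re (?I t y)} y)"
  by (intro lebesgue_integral_cong) (auto simp: \<phi>_def indicator_def)
 also have "\<dots> = prob {y\<in>space P. C < - Re (?I t y)}" by (simp add: Int_absorb2 Collect_restrict)
 finally show ?thesis using bound[OF order_refl st(2)] unfolding t s by (simp add: prob_space)
qed

end

section \<open>Measurability of paths and convergence in probability\<close>

text \<open>The floor plus one yields grid points strictly to the right of the time, along which
  right continuity gives convergence; each approximation takes countably many time values.\<close>

lemma borel_measurable_right_continuous:
 fixes Y :: "real => 'a => ennreal"
 assumes Y: "\<And>r. Y r \<in> borel_measurable G" and rc: "\<And>w t. w \<in> space G ==> ((\<lambda>r. Y r w) \<longlongrightarrow> Y t w) (at_right t)"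
 shows "(\<lambda>(r, w). Y r w) \<in> borel_measurable (borel \<Otimes>\<^sub>M G)"
proof (rule borel_measurable_LIMSEQ_order[where u="\<lambda>m p. Y ((of_int \<lfloor>real (Suc m) * fst p\<rfloor> + 1) / real (Suc m)) (snd p)"])
 show "(\<lambda>p. Y ((of_int \<lfloor>real (Suc m) * fst p\<rfloor> + 1) / real (Suc m)) (snd p)) \<in> borel_measurable (borel \<Otimes>\<^sub>M G)" for m
  by (rule measurable_compose_countable[where f="\<lambda>i p. Y ((of_int i + 1) / real (Suc m)) (snd p)"])
    (use measurable_compose[OF measurable_snd Y] in measurable)
 fix p :: "real \<times> 'a" assume "p \<in> space (borel \<Otimes>\<^sub>M G)"
 then obtain r w where p: "p = (r, w)" "w \<in> space G" by (auto simp: space_pair_measure)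
 define d where "d m = (of_int \<lfloor>real (Suc m) * r\<rfloor> + 1) / real (Suc m)" for m
 have d: "r < d m" "d m \<le> r + 1 / real (Suc m)" for m
 proof -
  have "real (Suc m) * r < of_int \<lfloor>real (Suc m) * r\<rfloor> + 1" "of_int \<lfloor>real (Suc m) * r\<rfloor> \<le> real (Suc m) * r" by linarith+
  thus "r < d m" "d m \<le> r + 1 / real (Suc m)" unfolding d_def by (simp_all add: field_simps del: of_nat_Suc)
 qed
 have "(\<lambda>m. r + 1 / real (Suc m)) \<longlonglongrightarrow> r + 0" by (intro tendsto_add tendsto_const LIMSEQ_Suc[OF lim_1_over_n])
 hence "d \<longlonglongrightarrow> r"
  using d by (intro tendsto_sandwich[of "\<lambda>_. r" d sequentially "\<lambda>m. r + 1 / real (Suc m)" r]) (auto simp: less_imp_le)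
 hence "filterlim d (at_right r) sequentially" using d(1) by (auto simp: filterlim_at intro!: always_eventually less_imp_neq[THEN not_sym])
 from filterlim_compose[OF rc[OF p(2)] this]
 show "(\<lambda>m. Y ((of_int \<lfloor>real (Suc m) * fst p\<rfloor> + 1) / real (Suc m)) (snd p)) \<longlonglongrightarrow> (case p of (r, w) => Y r w)"
  by (simp add: p d_def)
qed

text \<open>Clamping the time to \<open>[0, T]\<close> preserves right continuity and reads only
  values that are \<open>G\<close>-measurable. With \<open>G = F T\<close> this is progressive
  measurability.\<close>

lemma borel_measurable_progressive:
 fixes Y :: "real => 'a => ennreal"
 assumes Y: "\<And>r. 0 \<le> r ==> r \<le> T ==> Y r \<in> borel_measurable G" and T: "0 \<le> T"
  and rc: "\<And>y t. y \<in> space G ==> 0 \<le> t ==> ((\<lambda>r. Y r y) \<longlongrightarrow> Y t y) (at_right t)"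
 shows "(\<lambda>(r, y). Y (min (max r 0) T) y) \<in> borel_measurable (borel \<Otimes>\<^sub>M G)"
proof (rule borel_measurable_right_continuous)
 fix y t assume w: "y \<in> space G"
 consider "t < 0" | "T \<le> t" | "0 \<le> t" "t < T" by linarith
 thus "((\<lambda>r. Y (min (max r 0) T) y) \<longlongrightarrow> Y (min (max t 0) T) y) (at_right t)"
 proof cases
  case 1
  hence "eventually (\<lambda>r. r \<in> {t<..<0}) (at_right t)" by (intro eventually_at_right_real)
  thus ?thesis by (rule tendsto_eventually[OF eventually_mono]) (use 1 in auto)
 next
  case 2
  have "eventually (\<lambda>r. r \<in> {t<..<t + 1}) (at_right t)" by (intro eventually_at_right_real) simp
  thus ?thesis by (rule tendsto_eventually[OF eventually_mono]) (use 2 T in \<open>auto simp: min_def\<close>)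
 next
  case 3
  hence "eventually (\<lambda>r. r \<in> {t<..<T}) (at_right t)" by (intro eventually_at_right_real)
  hence "eventually (\<lambda>r. Y r y = Y (min (max r 0) T) y) (at_right t)" by eventually_elim (use 3 in auto)
  thus ?thesis using Lim_transform_eventually[OF rc[OF w 3(1)]] 3 by simp
 qed
qed (use T in \<open>auto intro: Y\<close>)

context prob_space begin

text \<open>The variables may be infinite; the truncation turns their convergence in probability
  into convergence of means.\<close>

lemma tendsto_0_in_prob_min:
 assumes [measurable]: "\<And>k. Y k \<in> borel_measurable M" and Y: "tendsto_0_in_prob M Y" and C: "0 < C"
 shows "(\<lambda>k. \<integral>\<^sup>+w. min (ennreal C) (Y k w) \<partial>M) \<longlonglongrightarrow> 0"
proof -
 let ?a = "\<lambda>k. \<integral>\<^sup>+w. min (ennreal C) (Y k w) \<partial>M"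
 have le: "(?a k) \<le> ennreal (e + C * prob {w\<in>space M. ennreal e < Y k w})" if "0 < e" for e k
 proof -
  have "(?a k) \<le> (\<integral>\<^sup>+w. ennreal e + ennreal C * indicator {w\<in>space M. ennreal e < Y k w} w \<partial>M)"
   by (intro nn_integral_mono) (auto simp: indicator_def min_def not_less intro: add_increasing order_trans)
  also have "\<dots> = ennreal e + ennreal C * emeasure M {w\<in>space M. ennreal e < Y k w}"
   by (subst nn_integral_add) (auto simp: nn_integral_cmult_indicator emeasure_space_1)
  finally show ?thesis using that C by (simp add: emeasure_eq_measure ennreal_mult'' ennreal_plus)
 qed
 show ?thesis
 proof (rule order_tendstoI)
  fix a :: ennreal assume "0 < a"
  then obtain e where e: "0 < e" "ennreal (2 * e) < a"
  proof -
   obtain b where b: "0 < b" "b < a" using \<open>0 < a\<close> dense by blast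
   then obtain b' where b': "b = ennreal b'" "0 < b'" by (cases b) auto
   thus ?thesis using b that[of "b' / 2"] by simp
  qed
  have "(\<lambda>k. prob {w\<in>space M. ennreal e < Y k w}) \<longlonglongrightarrow> 0" using Y e unfolding tendsto_0_in_prob_def by blast
  hence "eventually (\<lambda>k. prob {w\<in>space M. ennreal e < Y k w} < e / C) sequentially" using e C by (intro order_tendstoD) auto
  thus "eventually (\<lambda>k. (?a k) < a) sequentially"
  proof eventually_elim
   case (elim k)
   hence "e + C * prob {w\<in>space M. ennreal e < Y k w} \<le> 2 * e" using C by (simp add: field_simps)
   thus ?case using le[OF e(1), of k] e(2) by (meson ennreal_leI le_less_trans order_trans)
  qed
 qed simp
qed

lemma tendsto_0_in_prob_add:
 assumes [measurable]: "\<And>k. Y k \<in> borel_measurable M" "\<And>k. Z k \<in> borel_measurable M"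
  and Y: "tendsto_0_in_prob M Y" and Z: "tendsto_0_in_prob M Z" shows "tendsto_0_in_prob M (\<lambda>k w. Y k w + Z k w)"
 unfolding tendsto_0_in_prob_def
proof (intro allI impI)
 fix e :: real assume e: "0 < e"
 have "(\<lambda>k. prob {w\<in>space M. ennreal (e / 2) < Y k w}) \<longlonglongrightarrow> 0" "(\<lambda>k. prob {w\<in>space M. ennreal (e / 2) < Z k w}) \<longlonglongrightarrow> 0"
  using Y Z e unfolding tendsto_0_in_prob_def by auto
 hence lim: "(\<lambda>k. prob {w\<in>space M. ennreal (e / 2) < Y k w} + prob {w\<in>space M. ennreal (e / 2) < Z k w}) \<longlonglongrightarrow> 0 + 0" (is "?r \<longlonglongrightarrow> _")
  by (rule tendsto_add)
 have "prob {w\<in>space M. ennreal e < Y k w + Z k w} \<le> prob {w\<in>space M. ennreal (e / 2) < Y k w} + prob {w\<in>space M. ennreal (e / 2) < Z k w}" for k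
 proof (rule order_trans[OF finite_measure_mono measure_Un_le])
  show "{w\<in>space M. ennreal e < Y k w + Z k w} \<subseteq> {w\<in>space M. ennreal (e / 2) < Y k w} \<union> {w\<in>space M. ennreal (e / 2) < Z k w}"
  proof (intro subsetI, rule ccontr)
   fix w assume "w \<in> {w\<in>space M. ennreal e < Y k w + Z k w}"
    "w \<notin> {w\<in>space M. ennreal (e / 2) < Y k w} \<union> {w\<in>space M. ennreal (e / 2) < Z k w}"
   hence "Y k w + Z k w \<le> ennreal (e / 2) + ennreal (e / 2)" "ennreal e < Y k w + Z k w" by (auto simp: not_less intro: add_mono)
   moreover have "ennreal (e / 2) + ennreal (e / 2) = ennreal e" using e by (simp flip: ennreal_plus)
   ultimately show False by simp
  qed
 qed measurable
 note le = this
 show "(\<lambda>k. prob {w\<in>space M. ennreal e < Y k w + Z k w}) \<longlonglongrightarrow> 0"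
 proof (rule tendsto_sandwich[OF _ _ tendsto_const])
  show "eventually (\<lambda>k. 0 \<le> prob {w\<in>space M. ennreal e < Y k w + Z k w}) sequentially" by simp
  show "eventually (\<lambda>k. prob {w\<in>space M. ennreal e < Y k w + Z k w} \<le> ?r k) sequentially" by (rule always_eventually[OF allI[OF le]])
  show "?r \<longlonglongrightarrow> 0" using lim by simp
 qed
qed

text \<open>The subsequence is found for the truncations at 1, which are real and converge in mean.
  A truncation with a value below 1 is the variable itself, so the limit carries over.\<close>

lemma tendsto_0_in_prob_AE_subseq:
 assumes [measurable]: "\<And>k. Y k \<in> borel_measurable M" and Y: "tendsto_0_in_prob M Y"
 shows "\<exists>r::nat=>nat. strict_mono r \<and> (AE w in M. (\<lambda>k. Y (r k) w) \<longlonglongrightarrow> 0)"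
proof -
 define u where "u k w = enn2real (min 1 (Y k w))" for k w
 have [measurable]: "u k \<in> borel_measurable M" for k unfolding u_def by measurable
 have u: "ennreal (u k w) = min 1 (Y k w)" "0 \<le> u k w" for k w unfolding u_def by (subst ennreal_enn2real) (auto simp: min_less_iff_disj)
 have ui: "integrable M (u k)" for k by (rule integrable_const_bound[where B=1]) (auto intro!: AE_I2 simp: u_def enn2real_leI)
 have "(\<lambda>k. ennreal (LINT w|M. norm (u k w))) \<longlonglongrightarrow> 0" using tendsto_0_in_prob_min[OF assms, of 1] ui u
  by (subst nn_integral_eq_integral[symmetric]) (auto simp: nn_integral_eq_integral[symmetric] abs_of_nonneg)
 hence "(\<lambda>k. \<integral>w. norm (u k w) \<partial>M) \<longlonglongrightarrow> 0" by (simp add: ennreal_tendsto_0_iff)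
 then obtain r where r: "strict_mono r" "AE w in M. (\<lambda>k. u (r k) w) \<longlonglongrightarrow> 0"
  using tendsto_L1_AE_subseq[where u=u, OF ui] by blast
 have "AE w in M. (\<lambda>k. Y (r k) w) \<longlonglongrightarrow> 0" using r(2)
 proof eventually_elim
  case (elim w)
  have "(\<lambda>k. min 1 (Y (r k) w)) \<longlonglongrightarrow> 0" using tendsto_ennrealI[OF elim] by (simp add: u)
  hence "eventually (\<lambda>k. min 1 (Y (r k) w) < 1) sequentially" by (rule order_tendstoD) simp
  hence "eventually (\<lambda>k. min 1 (Y (r k) w) = Y (r k) w) sequentially" by eventually_elim (auto simp: min_def split: if_splits)
  thus ?case using \<open>(\<lambda>k. min 1 (Y (r k) w)) \<longlonglongrightarrow> 0\<close> by (rule Lim_transform_eventually[rotated])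
 qed
 thus ?thesis using r by blast
qed

end

context noisy_space begin

lemma null_sets_F: "0 \<le> t ==> null_sets P \<subseteq> sets (F t)" using usual F_mono[of 0 t] unfolding usual_hypotheses_def by blast

text \<open>By completeness every part of a null set is again a null set and so belongs to
  \<open>G\<close>; hence an event may be changed on a null set. All measurability of almost sure
  limits comes from here.\<close>

lemma AE_sets:
 assumes G: "space G = space P" "null_sets P \<subseteq> sets G" and A: "A \<in> sets G" and eq: "AE w in P. Q w \<longleftrightarrow> w \<in> A"
 shows "{w\<in>space P. Q w} \<in> sets G"
proof -
 obtain B where B: "B \<in> null_sets P" "{w\<in>space P. \<not> (Q w \<longleftrightarrow> w \<in> A)} \<subseteq> B"
  using eq by (auto elim!: AE_E simp: null_sets_def)
 have "complete_measure P" using usual unfolding usual_hypotheses_def by blast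
 hence n: "{w\<in>space P. Q w} \<inter> B \<in> sets G"
  using complete_measure.complete2[OF _ _ B(1), of "{w\<in>space P. Q w} \<inter> B"] G(2) by blast
 have "{w\<in>space P. Q w} = (A - B) \<union> ({w\<in>space P. Q w} \<inter> B)" using B(2) sets.sets_into_space[OF A] G(1) by auto
 also have "\<dots> \<in> sets G" using B(1) G(2) by (intro sets.Un sets.Diff A n) blast
 finally show ?thesis .
qed

lemma measurable_AE_LIMSEQ:
 fixes f :: "nat => 'a => 'c::{banach, second_countable_topology}"
 assumes G: "space G = space P" "null_sets P \<subseteq> sets G"
  and f: "\<And>k. f k \<in> borel_measurable G" and lim: "AE w in P. (\<lambda>k. f k w) \<longlonglongrightarrow> g w"
 shows "g \<in> borel_measurable G"
proof (rule measurableI)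
 fix S :: "'c set" assume "S \<in> sets borel"
 hence A: "(\<lambda>w. lim (\<lambda>k. f k w)) -` S \<inter> space G \<in> sets G"
  using f by (intro measurable_sets[OF borel_measurable_lim_metric]) auto
 have "AE w in P. g w \<in> S \<longleftrightarrow> w \<in> (\<lambda>w. lim (\<lambda>k. f k w)) -` S \<inter> space G"
  using lim AE_space by eventually_elim (auto simp: G(1) limI)
 from AE_sets[OF G A this] show "g -` S \<inter> space G \<in> sets G" by (simp add: G(1) vimage_def Int_def conj_commute)
qed simp

lemma null_sets_P: "null_sets P \<subseteq> sets P" by auto

lemmas measurable_P_AE_LIMSEQ = measurable_AE_LIMSEQ[OF refl null_sets_P]

lemma simple_value_adapted_pt:
 assumes D: "simple_integrand P F \<mu> D" and s: "0 \<le> s" shows "(\<lambda>w. simple_value D s y w) \<in> borel_measurable (F s)"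
proof -
 have "(\<lambda>w. case x of (a, b, A, \<xi>) => \<xi> w * indicator {a<..b} s * indicator A y) \<in> borel_measurable (F s)"
  if mem: "x \<in> set D" for x
 proof -
  obtain a b A \<xi> where x: "x = (a, b, A, \<xi>)" by (cases x)
  note d = simple_integrandD[OF D mem[unfolded x]]
  show ?thesis
  proof (cases "a \<le> s")
   case True
   hence "\<xi> \<in> borel_measurable (F s)" using measurable_F_mono[OF d(5) d(1)] by blast
   thus ?thesis by (simp add: x)
  qed (simp add: x)
 qed
 thus ?thesis unfolding simple_value_def by (intro borel_measurable_sum_list)
qed

lemma simple_value_joint:
 assumes D: "simple_integrand P F \<mu> D"
 shows "(\<lambda>(w, s, y). simple_value D s y w) \<in> borel_measurable (P \<Otimes>\<^sub>M (borel \<Otimes>\<^sub>M \<mu>))"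
proof -
 have "(\<lambda>p. case x of (a, b, A, \<xi>) => \<xi> (fst p) * indicator {a<..b} (fst (snd p)) * indicator A (snd (snd p))) \<in> borel_measurable (P \<Otimes>\<^sub>M (borel \<Otimes>\<^sub>M \<mu>))"
  if mem: "x \<in> set D" for x
 proof -
  obtain a b A \<xi> where x: "x = (a, b, A, \<xi>)" by (cases x)
  note d = simple_integrandD[OF D mem[unfolded x]]
  have [measurable]: "\<xi> \<in> borel_measurable P" "A \<in> sets \<mu>" using measurable_F[OF d(5) d(1)] d(3) by auto
  show ?thesis unfolding x prod.case by measurable
 qed
 thus ?thesis unfolding simple_value_def case_prod_unfold by (intro borel_measurable_sum_list)
qed

abbreviation interval_measure :: "real => real => real measure" where
 "interval_measure s t \<equiv> restrict_space lborel {s<..t}"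

lemma finite_interval_measure: "finite_measure (interval_measure s t)"
 by (rule finite_measureI) (cases "s \<le> t"; simp add: space_restrict_space emeasure_restrict_space)

text \<open>The squared errors of the simple approximations vanish in probability, so along a
  subsequence they vanish almost everywhere on time times sample space. By Fubini the integrand at
  almost every time is an almost sure limit of adapted simple values, and the filtration contains
  the null sets.\<close>

lemma ito_integrand_adapted:
 assumes "ito_integral P F W h I" shows "AE s in lborel. 0 < s \<longrightarrow> h s \<in> borel_measurable (F s)"
proof -
 obtain D where D: "\<And>k. simple_integrand P F (count_space (UNIV::unit set)) (D k)"
  and lim: "\<And>t. 0 \<le> t ==> tendsto_0_in_prob P
      (\<lambda>k w. \<integral>\<^sup>+ s\<in>{0<..t}. (\<integral>\<^sup>+ y. ennreal ((h s w - simple_value (D k) s y w)\<^sup>2) \<partial>count_space (UNIV::unit set)) \<partial>lborel)"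
  and hm: "(\<lambda>(w, s, y). h s w) \<in> borel_measurable (P \<Otimes>\<^sub>M time_mark (count_space (UNIV::unit set)))"
  using assms unfolding ito_integral_def stochastic_integral_def by blast
 have "AE s in lborel. 0 < s \<and> s \<le> real T \<longrightarrow> h s \<in> borel_measurable (F s)" if T: "0 < T" for T :: nat
 proof -
  let ?\<mu> = "interval_measure 0 (real T)"
  interpret \<mu>: finite_measure ?\<mu> by (rule finite_interval_measure)
  interpret pr: pair_sigma_finite ?\<mu> P ..
  have id: "(\<lambda>s. s) \<in> measurable ?\<mu> borel" by (rule measurable_restrict_space1) simp
  have id0: "(\<lambda>s. s) \<in> measurable ?\<mu> (restrict_space lborel {0<..})"
   by (rule measurable_restrict_space2) (use id in \<open>auto simp: space_restrict_space\<close>)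
  have "(\<lambda>p. (snd p, fst p, ())) \<in> measurable (?\<mu> \<Otimes>\<^sub>M P) (P \<Otimes>\<^sub>M time_mark (count_space UNIV))"
   unfolding time_mark_def by (intro measurable_Pair measurable_compose[OF measurable_fst id0] measurable_snd) simp_all
  from measurable_compose[OF this hm] have [measurable]: "(\<lambda>p. h (fst p) (snd p)) \<in> borel_measurable (?\<mu> \<Otimes>\<^sub>M P)" by simp
  have "(\<lambda>p. (snd p, fst p, ())) \<in> measurable (?\<mu> \<Otimes>\<^sub>M P) (P \<Otimes>\<^sub>M (borel \<Otimes>\<^sub>M count_space UNIV))"
   by (intro measurable_Pair measurable_compose[OF measurable_fst id] measurable_snd) simp_all
  from measurable_compose[OF this simple_value_joint[OF D]]
  have [measurable]: "(\<lambda>p. simple_value (D k) (fst p) () (snd p)) \<in> borel_measurable (?\<mu> \<Otimes>\<^sub>M P)" for k by simp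
  define g where "g k p = (h (fst p) (snd p) - simple_value (D k) (fst p) () (snd p))\<^sup>2" for k p
  have gm [measurable]: "g k \<in> borel_measurable (?\<mu> \<Otimes>\<^sub>M P)" for k unfolding g_def by measurable
  \<comment> \<open>Capped at 1, the squared error has a time integral of at most both
    \<open>T\<close> and \<open>Y k\<close>, so its mean is controlled by that of
    \<open>min T (Y k)\<close>.\<close>
  define u where "u k p = min 1 (g k p)" for k p
  have um [measurable]: "u k \<in> borel_measurable (?\<mu> \<Otimes>\<^sub>M P)" for k unfolding u_def by measurable
  have u: "0 \<le> u k p" "u k p \<le> 1" "u k p \<le> g k p" for k p by (auto simp: u_def g_def)
  define Y where "Y k w = (\<integral>\<^sup>+ s. ennreal (g k (s, w)) \<partial>?\<mu>)" for k w
  have Yeq: "Y k w = (\<integral>\<^sup>+ s\<in>{0<..real T}. (\<integral>\<^sup>+ y. ennreal ((h s w - simple_value (D k) s y w)\<^sup>2) \<partial>count_space (UNIV::unit set)) \<partial>lborel)" for k w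
   unfolding Y_def g_def by (subst nn_integral_restrict_space) (auto simp: nn_integral_count_space_finite UNIV_unit)
  have "tendsto_0_in_prob P Y" using lim[of "real T"] unfolding Yeq[abs_def] by simp
  moreover have "Y k \<in> borel_measurable P" for k
   unfolding Y_def using measurable_pair_swap[OF gm[of k]] by (intro \<mu>.borel_measurable_nn_integral) auto
  ultimately have Ylim: "(\<lambda>k. \<integral>\<^sup>+w. min (ennreal (real T)) (Y k w) \<partial>P) \<longlonglongrightarrow> 0"
   using T by (intro tendsto_0_in_prob_min) auto
  have le: "(\<integral>\<^sup>+p. ennreal (u k p) \<partial>(?\<mu> \<Otimes>\<^sub>M P)) \<le> (\<integral>\<^sup>+w. min (ennreal (real T)) (Y k w) \<partial>P)" for k
  proof -
   have "(\<integral>\<^sup>+s. ennreal (u k (s, w)) \<partial>?\<mu>) \<le> (\<integral>\<^sup>+s. 1 \<partial>?\<mu>)" for w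
    using u by (intro nn_integral_mono) simp
   moreover have "(\<integral>\<^sup>+s. ennreal (u k (s, w)) \<partial>?\<mu>) \<le> Y k w" for w
    unfolding Y_def by (intro nn_integral_mono ennreal_leI u)
   ultimately show ?thesis by (subst pr.nn_integral_snd[symmetric]) (auto intro!: nn_integral_mono simp: space_restrict_space emeasure_restrict_space)
  qed
  have uint: "integrable (?\<mu> \<Otimes>\<^sub>M P) (u k)" for k
  proof (rule integrableI_bounded)
   have "(\<integral>\<^sup>+w. min (ennreal (real T)) (Y k w) \<partial>P) \<le> (\<integral>\<^sup>+w. ennreal (real T) \<partial>P)" by (intro nn_integral_mono) simp
   with le[of k] have "(\<integral>\<^sup>+p. ennreal (norm (u k p)) \<partial>(?\<mu> \<Otimes>\<^sub>M P)) \<le> ennreal (real T)" using u by (simp add: emeasure_space_1)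
   thus "(\<integral>\<^sup>+p. ennreal (norm (u k p)) \<partial>(?\<mu> \<Otimes>\<^sub>M P)) < \<infinity>" by (rule le_less_trans) simp
  qed simp
  have ule: "ennreal (LINT p|(?\<mu> \<Otimes>\<^sub>M P). norm (u k p)) \<le> (\<integral>\<^sup>+w. min (ennreal (real T)) (Y k w) \<partial>P)" for k
   using le[of k] uint[of k] u by (simp add: nn_integral_eq_integral)
  have "(\<lambda>k. ennreal (LINT p|(?\<mu> \<Otimes>\<^sub>M P). norm (u k p))) \<longlonglongrightarrow> 0"
   by (rule tendsto_sandwich[OF _ _ tendsto_const Ylim]) (use ule in auto)
  hence "(\<lambda>k. \<integral>p. norm (u k p) \<partial>(?\<mu> \<Otimes>\<^sub>M P)) \<longlonglongrightarrow> 0" by (simp add: ennreal_tendsto_0_iff)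
  then obtain r where r: "AE p in ?\<mu> \<Otimes>\<^sub>M P. (\<lambda>k. u (r k) p) \<longlonglongrightarrow> 0"
   using tendsto_L1_AE_subseq[where u=u, OF uint] by blast
  have "AE s in ?\<mu>. AE w in P. (\<lambda>k. u (r k) (s, w)) \<longlonglongrightarrow> 0" by (rule pr.AE_pair[OF r])
  hence "AE s in ?\<mu>. h s \<in> borel_measurable (F s)" using AE_space
  proof eventually_elim
   case (elim s)
   hence s: "0 < s" by (auto simp: space_restrict_space)
   show ?case
   proof (rule measurable_AE_LIMSEQ)
    show "(\<lambda>w. simple_value (D (r k)) s () w) \<in> borel_measurable (F s)" for k using s by (intro simple_value_adapted_pt[OF D]) simp
    show "AE w in P. (\<lambda>k. simple_value (D (r k)) s () w) \<longlonglongrightarrow> h s w" using elim(1)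
    proof eventually_elim
     case (elim w)
     let ?d = "\<lambda>k. (h s w - simple_value (D (r k)) s () w)\<^sup>2"
     have "eventually (\<lambda>k. u (r k) (s, w) < 1) sequentially" using elim by (rule order_tendstoD) simp
     hence "eventually (\<lambda>k. u (r k) (s, w) = ?d k) sequentially" by eventually_elim (auto simp: u_def g_def min_def split: if_splits)
     hence "?d \<longlonglongrightarrow> 0" using elim by (rule Lim_transform_eventually[rotated])
     hence "(\<lambda>k. h s w - simple_value (D (r k)) s () w) \<longlonglongrightarrow> 0"
      using tendsto_real_sqrt[of ?d 0] by (simp add: tendsto_rabs_zero_iff)
     hence "(\<lambda>k. h s w - (h s w - simple_value (D (r k)) s () w)) \<longlonglongrightarrow> h s w - 0" by (intro tendsto_diff tendsto_const)
     thus ?case by simp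
    qed
   qed (use s null_sets_F in simp_all)
  qed
  thus ?thesis by (subst (asm) AE_restrict_space_iff) auto
 qed
 hence "AE s in lborel. \<forall>T::nat. 0 < T \<longrightarrow> 0 < s \<and> s \<le> real T \<longrightarrow> h s \<in> borel_measurable (F s)"
  by (subst AE_all_countable) auto
 thus ?thesis
 proof eventually_elim
  case (elim s)
  obtain T :: nat where "s \<le> real T" using real_arch_simple by blast
  thus ?case using elim by (metis gr0I of_nat_0 not_le)
 qed
qed

end

section \<open>The solution up to its exit times, and its jump rate\<close>

lemma AE_lborel_dense:
 fixes a b :: real
 assumes "AE s in lborel. Q s" "a < b" shows "\<exists>s\<in>{a<..<b}. Q s"
proof (rule ccontr)
 assume "\<not> ?thesis"
 hence "AE s in lborel. s \<notin> {a<..<b}" using assms(1) by (auto elim!: eventually_mono)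
 hence "emeasure lborel {a<..<b} = 0" by (subst (asm) AE_iff_null_sets[symmetric]) (auto simp: null_sets_def)
 thus False using assms(2) by simp
qed

lemma interval_integral_bound:
 fixes g :: "real => real"
 assumes [measurable]: "g \<in> borel_measurable borel" and qr: "q \<le> r" and B: "\<And>u. q < u ==> u \<le> r ==> \<bar>g u\<bar> \<le> B"
 shows "set_integrable lborel {q<..r} g" "\<bar>LINT u:{q<..r}|lborel. g u\<bar> \<le> B * (r - q)"
proof -
 have i: "integrable lborel (\<lambda>u. B * indicator {q<..r} u)" using qr by (auto intro!: integrable_real_indicator)
 have b: "\<bar>indicator {q<..r} u * g u\<bar> \<le> B * indicator {q<..r} u" for u using B by (auto simp: indicator_def)
 have gi: "integrable lborel (\<lambda>u. indicator {q<..r} u * g u)"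
  by (rule Bochner_Integration.integrable_bound[OF i]) (use order_trans[OF b abs_ge_self] in auto)
 thus "set_integrable lborel {q<..r} g" by (simp add: set_integrable_def)
 have "\<bar>LINT u:{q<..r}|lborel. g u\<bar> \<le> (LINT u|lborel. B * indicator {q<..r} u)" unfolding set_lebesgue_integral_def real_scaleR_def
  by (rule order_trans[OF integral_abs_bound integral_mono[OF integrable_abs[OF gi] i b]])
 thus "\<bar>LINT u:{q<..r}|lborel. g u\<bar> \<le> B * (r - q)" using qr by simp
qed

lemma interval_integral_add:
 fixes g :: "real => real"
 assumes "q \<le> r" "r \<le> v" "set_integrable lborel {q<..r} g" "set_integrable lborel {r<..v} g"
 shows "(LINT u:{q<..v}|lborel. g u) = (LINT u:{q<..r}|lborel. g u) + (LINT u:{r<..v}|lborel. g u)"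
 using set_integral_Un[OF _ assms(3,4)] assms(1,2) by (simp add: ivl_disj_un_two)

text \<open>Instead of counting discontinuities, the translates \<open>f (r - h k)\<close> are
  integrated. They converge pointwise to the left limits, while a change of variable makes their
  integrals those of \<open>f\<close> over slightly shifted intervals.\<close>

lemma integral_left_limits:
 fixes f g :: "real => real"
 assumes [measurable]: "f \<in> borel_measurable borel" and B: "\<And>r. \<bar>f r\<bar> \<le> B"
  and g: "\<And>r. s < r ==> (f \<longlongrightarrow> g r) (at_left r)" and st: "s \<le> t"
 shows "set_integrable lborel {s<..t} g" "(LINT r:{s<..t}|lborel. g r) = (LINT r:{s<..t}|lborel. f r)"
proof -
 define h where "h k = 1 / real (Suc k)" for k
 have h: "0 < h k" "h k \<le> 1" "h \<longlonglongrightarrow> 0" for k unfolding h_def using LIMSEQ_Suc[OF lim_1_over_n[where 'a=real]] by auto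
 have sub: "(\<lambda>k. r - h k) \<longlonglongrightarrow> r" for r using tendsto_diff[OF tendsto_const h(3), of r] by simp
 have B0: "0 \<le> B" using B[of 0] by linarith
 have int: "integrable lborel (\<lambda>r. B * indicator {s - 1<..t} r)" using st by (auto intro!: integrable_real_indicator)
 have lim: "(\<lambda>k. indicator {s<..t} r * f (r - h k)) \<longlonglongrightarrow> indicator {s<..t} r * g r" for r
 proof (cases "s < r")
  case True
  have "filterlim (\<lambda>k. r - h k) (at_left r) sequentially"
   unfolding filterlim_at using h(1) sub by (auto intro!: always_eventually simp: less_imp_neq)
  from filterlim_compose[OF g[OF True] this] show ?thesis by (rule tendsto_mult_left)
 qed simp
 have gm: "(\<lambda>r. indicator {s<..t} r * g r) \<in> borel_measurable lborel" by (rule borel_measurable_LIMSEQ_metric[OF _ lim]) measurable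
 have bd: "AE r in lborel. norm (indicator {s<..t} r * f (r - h k)) \<le> B * indicator {s - 1<..t} r" for k
  using B B0 by (auto simp: indicator_def intro!: AE_I2)
 show "set_integrable lborel {s<..t} g" unfolding set_integrable_def real_scaleR_def
  by (rule integrable_dominated_convergence[OF gm _ int AE_I2[OF lim] bd]) measurable
 have L: "(\<lambda>k. \<integral>r. indicator {s<..t} r * f (r - h k) \<partial>lborel) \<longlonglongrightarrow> (LINT r|lborel. indicator {s<..t} r * g r)"
  by (rule integral_dominated_convergence[OF gm _ int AE_I2[OF lim] bd]) measurable
 have sh: "(LINT r|lborel. indicator {s<..t} r * f (r - h k)) = (LINT r|lborel. indicator {s - h k<..t - h k} r * f r)" for k
  by (subst lborel_integral_real_affine[of 1 _ "- h k"])
    (auto simp: indicator_def intro!: lebesgue_integral_cong)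
 have "(\<lambda>k. \<integral>r. indicator {s - h k<..t - h k} r * f r \<partial>lborel) \<longlonglongrightarrow> (LINT r|lborel. indicator {s..<t} r * f r)"
 proof (rule integral_dominated_convergence[OF _ _ int])
  show "AE r in lborel. (\<lambda>k. indicator {s - h k<..t - h k} r * f r) \<longlonglongrightarrow> indicator {s..<t} r * f r"
  proof (intro AE_I2 tendsto_mult_right tendsto_eventually)
   fix r
   have "eventually (\<lambda>k. r < s \<longrightarrow> r < s - h k) sequentially" "eventually (\<lambda>k. r < t \<longrightarrow> r < t - h k) sequentially"
    using order_tendstoD(1)[OF sub[of s], of r] order_tendstoD(1)[OF sub[of t], of r] by (cases "r < s"; cases "r < t"; simp)+
   thus "eventually (\<lambda>k. indicator {s - h k<..t - h k} r = (indicator {s..<t} r :: real)) sequentially"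
   proof eventually_elim
    case (elim k)
    thus ?case using h(1)[of k] by (auto simp: indicator_def)
   qed
  qed
  show "AE r in lborel. norm (indicator {s - h k<..t - h k} r * f r) \<le> B * indicator {s - 1<..t} r" for k
  proof (rule AE_I2)
   fix r show "norm (indicator {s - h k<..t - h k} r * f r) \<le> B * indicator {s - 1<..t} r"
    using B[of r] B0 h(1,2)[of k] by (auto simp: indicator_def)
  qed
 qed measurable
 from LIMSEQ_unique[OF L[unfolded sh] this]
 have "(LINT r|lborel. indicator {s<..t} r * g r) = (LINT r|lborel. indicator {s..<t} r * f r)" .
 also have "\<dots> = (LINT r|lborel. indicator {s<..t} r * f r)" by (rule integral_discrete_difference[where X="{s, t}"]) (auto simp: indicator_def)
 finally show "(LINT r:{s<..t}|lborel. g r) = (LINT r:{s<..t}|lborel. f r)" unfolding set_lebesgue_integral_def real_scaleR_def .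
qed

locale branching_sde = noisy_space P F W "mark_measure \<pi>" N
 for P :: "'a measure" and F and W and \<pi> :: "real measure" and N +
 fixes b c \<theta> x :: real and X :: "real => 'a => ennreal"
 assumes c: "0 \<le> c" and levy: "levy_measure \<pi>" and \<theta>: "0 < \<theta>" and x: "0 < x"
  and sol: "sde_solution P F W N b c \<pi> (\<lambda>u. u powr (- \<theta>)) x X"
begin

abbreviation "\<zeta> \<equiv> zeta X"

lemma X_adapted: "0 \<le> t ==> X t \<in> borel_measurable (F t)" using sol by (simp add: sde_solution_def adapted_def)

lemma X_right: "w \<in> space P ==> 0 \<le> t ==> ((\<lambda>r. X r w) \<longlongrightarrow> X t w) (at_right t)"
 using sol by (simp add: sde_solution_def cadlag_def)

lemma X_left: "y \<in> space P ==> 0 < t ==> ((\<lambda>r. X r y) \<longlongrightarrow> left_limit X t y) (at_left t)"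
proof -
 assume w: "y \<in> space P" "0 < t"
 have "cadlag (\<lambda>t. X t y)" using sol w by (simp add: sde_solution_def)
 then obtain l where "((\<lambda>r. X r y) \<longlongrightarrow> l) (at_left t)" using w(2) unfolding cadlag_def by blast
 moreover from this have "left_limit X t y = l" unfolding left_limit_def by (intro tendsto_Lim) simp
 ultimately show ?thesis by simp
qed

lemma \<zeta>_nonneg: "0 \<le> \<zeta> n w" unfolding zeta_def hitting_time_def by (rule Inf_greatest) auto

lemma before_\<zeta>:
 assumes "0 \<le> s" "ereal s < \<zeta> n w" shows "ennreal (1 / real n) < X s w" "X s w < ennreal (real n)"
proof -
 have "X s w \<notin> {ennreal (real n)..} \<union> {..ennreal (1 / real n)}"
 proof
  assume "X s w \<in> {ennreal (real n)..} \<union> {..ennreal (1 / real n)}"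
  hence "\<zeta> n w \<le> ereal s" unfolding zeta_def hitting_time_def using assms by (intro Inf_lower) auto
  thus False using assms by simp
 qed
 thus "ennreal (1 / real n) < X s w" "X s w < ennreal (real n)" by auto
qed

text \<open>Were the state inside the open band at the exit time, right continuity would keep it
  there a little longer and the infimum would be larger.\<close>

lemma at_\<zeta>:
 assumes w: "v \<in> space P" and z: "\<zeta> n v = ereal z" shows "ennreal (real n) \<le> X z v \<or> X z v \<le> ennreal (1 / real n)"
proof (rule ccontr)
 assume "\<not> ?thesis"
 hence "X z v \<in> {ennreal (1 / real n)<..<ennreal (real n)}" by auto
 moreover have z0: "0 \<le> z" using \<zeta>_nonneg[of n v] z by simp
 ultimately have "eventually (\<lambda>r. X r v \<in> {ennreal (1 / real n)<..<ennreal (real n)}) (at_right z)"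
  by (intro topological_tendstoD[OF X_right[OF w]]) auto
 then obtain e where e: "e > z" "\<And>r. z < r ==> r < e ==> X r v \<in> {ennreal (1 / real n)<..<ennreal (real n)}"
  unfolding eventually_at_right_field by auto
 have "ereal e \<le> \<zeta> n v" unfolding zeta_def hitting_time_def
 proof (rule Inf_greatest)
  fix y assume "y \<in> {ereal t |t. 0 \<le> t \<and> X t v \<in> {ennreal (real n)..} \<union> {..ennreal (1 / real n)}}"
  then obtain t where t: "y = ereal t" "0 \<le> t" "X t v \<in> {ennreal (real n)..} \<union> {..ennreal (1 / real n)}" by auto
  have "ereal z \<le> ereal t" unfolding z[symmetric] zeta_def hitting_time_def using t by (intro Inf_lower) auto
  hence "z \<le> t" by simp
  have "\<not> t < e" using e(2)[of t] t \<open>z \<le> t\<close> \<open>X z v \<in> _\<close> by (cases "t = z") auto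
  thus "ereal e \<le> y" using t by simp
 qed
 thus False using z e by simp
qed

lemma \<zeta>_mono:
 assumes "1 \<le> n" "n \<le> m" shows "\<zeta> n w \<le> \<zeta> m w"
proof -
 have "ennreal (real n) \<le> ennreal (real m)" "ennreal (1 / real m) \<le> ennreal (1 / real n)"
  using assms by (auto intro!: ennreal_leI divide_left_mono)
 hence "{ennreal (real m)..} \<union> {..ennreal (1 / real m)} \<subseteq> {ennreal (real n)..} \<union> {..ennreal (1 / real n)}"
  by (intro Un_mono) (simp_all only: atLeast_subset_iff atMost_subset_iff)
 thus ?thesis unfolding zeta_def hitting_time_def by (intro Inf_superset_mono) auto
qed

text \<open>That \<open>\<zeta> n\<close> is a stopping time is read off from the Ito integrand: it vanishes after
 \<open>\<zeta> n\<close>, is positive before, and is adapted as a limit of simple integrands.\<close>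

lemma \<zeta>_stopping_le:
 assumes n: "1 \<le> n" and s: "0 < s" shows "{y\<in>space P. ereal s \<le> \<zeta> n y} \<in> sets (F s)"
proof -
 define h where "h s y = (if ereal s \<le> \<zeta> n y then sqrt (1 / enn2real (X s y) powr (- \<theta>)) else 0)" for s y
 have "\<exists>I. ito_integral P F W h I" using sol n unfolding sde_solution_def solves_up_to_zeta_def h_def by blast
 hence ae: "AE s in lborel. 0 < s \<longrightarrow> h s \<in> borel_measurable (F s)" using ito_integrand_adapted by blast
 \<comment> \<open>Adaptedness of the integrand is known only for almost every time, so times of
   this kind are picked below \<open>s\<close> that approach \<open>s\<close>.\<close>
 have "\<exists>r\<in>{max 0 (s - 1 / real (Suc k))<..<s}. 0 < r \<longrightarrow> h r \<in> borel_measurable (F r)" for k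
  by (rule AE_lborel_dense[OF ae]) (use s in auto)
 hence "\<forall>k. \<exists>r. max 0 (s - 1 / real (Suc k)) < r \<and> r < s \<and> h r \<in> borel_measurable (F r)"
  by (metis greaterThanLessThan_iff max_less_iff_conj)
 then obtain r where r: "\<And>k. max 0 (s - 1 / real (Suc k)) < r k" "\<And>k. r k < s" "\<And>k. h (r k) \<in> borel_measurable (F (r k))" by metis
 have r0: "0 < r k" "s - 1 / real (Suc k) < r k" for k using r(1)[of k] by auto
 have "{y\<in>space P. ereal s \<le> \<zeta> n y} = (\<Inter>k. {y\<in>space P. 0 < h (r k) y})"
 proof (intro set_eqI iffI)
  fix y assume w: "y \<in> {y\<in>space P. ereal s \<le> \<zeta> n y}"
  have "0 < h (r k) y" for k
  proof -
   have lt: "ereal (r k) < \<zeta> n y" using w r(2)[of k] by (metis (mono_tags, lifting) ereal_less_eq(3) less_ereal.simps(1) mem_Collect_eq order_less_le_trans)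
   have "0 < X (r k) y" "X (r k) y < \<infinity>" using before_\<zeta>[OF less_imp_le[OF r0(1)] lt] by (auto intro: le_less_trans less_trans)
   hence "0 < enn2real (X (r k) y)" by (simp add: enn2real_positive_iff)
   thus ?thesis using lt by (simp add: h_def less_imp_le)
  qed
  thus "y \<in> (\<Inter>k. {y\<in>space P. 0 < h (r k) y})" using w by auto
 next
  fix y assume w: "y \<in> (\<Inter>k. {y\<in>space P. 0 < h (r k) y})"
  have le: "ereal (r k) \<le> \<zeta> n y" for k using w by (auto simp: h_def split: if_splits dest!: spec[of _ k])
  have "ereal s \<le> \<zeta> n y"
  proof (cases "\<zeta> n y")
   case (real z)
   have "s \<le> z"
   proof (rule field_le_epsilon)
    fix e :: real assume "e > 0"
    then obtain k where "1 / real (Suc k) < e" using nat_approx_posE by blast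
    thus "s \<le> z + e" using r0(2)[of k] le[of k] real by simp
   qed
   thus ?thesis using real by simp
  qed (use \<zeta>_nonneg[of n y] in auto)
  thus "y \<in> {y\<in>space P. ereal s \<le> \<zeta> n y}" using w by auto
 qed
 also have "\<dots> \<in> sets (F s)"
 proof (rule sets.countable_INT, simp_all, safe)
  fix k
  have "h (r k) \<in> borel_measurable (F s)" using measurable_F_mono[OF r(3)[of k]] r0(1)[of k] r(2)[of k] by simp
  hence "{y\<in>space (F s). 0 < h (r k) y} \<in> sets (F s)" by measurable
  thus "{y\<in>space P. 0 < h (r k) y} \<in> sets (F s)" using s by simp
 qed
 finally show ?thesis .
qed

lemma F_right: "0 \<le> t ==> (\<And>s. t < s ==> A \<in> sets (F s)) ==> A \<in> sets (F t)" using usual unfolding usual_hypotheses_def by blast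

text \<open>The strict inequality is a countable union of the events of
  \<open>\<zeta>_stopping_le\<close> at times slightly after \<open>s\<close>; right continuity of
  the filtration brings the union back to time \<open>s\<close>.\<close>

lemma \<zeta>_stopping_less:
 assumes n: "1 \<le> n" and s: "0 \<le> s" shows "{y\<in>space P. ereal s < \<zeta> n y} \<in> sets (F s)"
proof (rule F_right[OF s])
 let ?a = "\<lambda>t k. ereal (s + (t - s) / real (Suc k))"
 let ?b = "\<lambda>t. \<Union>k::nat. {y\<in>space P. ?a t k \<le> \<zeta> n y}"
 fix t assume t: "s < t"
 have "{y\<in>space P. ereal s < \<zeta> n y} = (?b t)"
 proof (intro set_eqI iffI)
  fix y assume "y \<in> {y\<in>space P. ereal s < \<zeta> n y}"
  hence w: "y \<in> space P" "ereal s < \<zeta> n y" by auto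
  have "\<exists>k. ?a t k \<le> \<zeta> n y"
  proof (cases "\<zeta> n y")
   case (real z)
   hence "(z - s) / (t - s) > 0" using w t by simp
   then obtain k where "1 / real (Suc k) < (z - s) / (t - s)" using nat_approx_posE by blast
   hence "(t - s) / real (Suc k) < z - s" using t by (simp add: field_simps)
   thus ?thesis using real by (intro exI[of _ k]) simp
  qed (use w in auto)
  thus "y \<in> (?b t)" using w by auto
 next
  fix y assume "y \<in> (?b t)"
  then obtain k :: nat where k: "y \<in> space P" "?a t k \<le> \<zeta> n y" by auto
  have "ereal s < ?a t k" using t by simp
  thus "y \<in> {y\<in>space P. ereal s < \<zeta> n y}" using k by (simp only: mem_Collect_eq) (metis less_le_trans)
 qed
 also have "\<dots> \<in> sets (F t)"
 proof (rule sets.countable_UN, safe)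
  fix k :: nat
  have "(t - s) / real (Suc k) \<le> t - s" using t by (simp add: divide_le_eq mult_left_le)
  hence le: "0 < s + (t - s) / real (Suc k)" "s + (t - s) / real (Suc k) \<le> t" using t s by (auto intro: add_nonneg_pos)
  show "{y\<in>space P. ?a t k \<le> \<zeta> n y} \<in> sets (F t)"
   using \<zeta>_stopping_le[OF n le(1)] F_mono[OF less_imp_le[OF le(1)] le(2)] by auto
 qed
 finally show "{y\<in>space P. ereal s < \<zeta> n y} \<in> sets (F t)" .
qed

text \<open>This is \<open>1 / f(X)\<close>, switched off from \<open>\<zeta> n\<close> on, which
  makes it right continuous. \<open>rate_left\<close> is its left-continuous companion, still alive
  at \<open>\<zeta> n\<close>, and is what the jump integrands contain.\<close>

definition rate :: "nat => real => 'a => real" where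
 "rate n s w = (if ereal s < \<zeta> n w then enn2real (X s w) powr \<theta> else 0)"

definition rate_left :: "nat => real => 'a => real" where
 "rate_left n s w = (if ereal s \<le> \<zeta> n w then enn2real (left_limit X s w) powr \<theta> else 0)"

lemma rate_bounds:
 assumes "0 \<le> s" shows "0 \<le> rate n s w" "rate n s w \<le> real n powr \<theta>"
proof -
 show "0 \<le> rate n s w" by (simp add: rate_def)
 show "rate n s w \<le> real n powr \<theta>"
 proof (cases "ereal s < \<zeta> n w")
  case True
  have "enn2real (X s w) \<le> real n" using before_\<zeta>(2)[OF assms True] by (intro enn2real_leI) auto
  thus ?thesis using True \<theta> by (simp add: rate_def powr_mono2)
 qed (simp add: rate_def)
qed

lemma rate_adapted: "1 \<le> n ==> 0 \<le> s ==> rate n s \<in> borel_measurable (F s)"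
proof -
 assume n: "1 \<le> n" and s: "0 \<le> s"
 have [measurable]: "X s \<in> borel_measurable (F s)" by (rule X_adapted[OF s])
 have "{w\<in>space (F s). ereal s < \<zeta> n w} \<in> sets (F s)" using \<zeta>_stopping_less[OF n s] s by simp
 hence [measurable]: "Measurable.pred (F s) (\<lambda>w. ereal s < \<zeta> n w)" by (simp add: pred_def)
 show "rate n s \<in> borel_measurable (F s)" unfolding rate_def by measurable
qed

lemma tendsto_enn2real_powr:
 assumes "(f \<longlongrightarrow> l) G" "l < \<infinity>" "0 < l"
 shows "((\<lambda>r. enn2real (f r) powr \<theta>) \<longlongrightarrow> enn2real l powr \<theta>) G"
 using assms by (intro tendsto_powr tendsto_enn2real tendsto_const) (auto simp: enn2real_eq_0_iff)

lemma rate_right: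
 assumes w: "y \<in> space P" and t: "0 \<le> t" shows "((\<lambda>r. rate n r y) \<longlongrightarrow> rate n t y) (at_right t)"
proof (cases "ereal t < \<zeta> n y")
 case True
 have fin: "X t y < \<infinity>" "0 < X t y" using before_\<zeta>[OF t True] by (auto intro: le_less_trans less_trans)
 obtain u where u: "t < u" "ereal u < \<zeta> n y" using ereal_dense2[OF True] by auto
 have "eventually (\<lambda>r. r < u) (at_right t)" using u by (auto simp: eventually_at_right_field)
 hence ev: "eventually (\<lambda>r. enn2real (X r y) powr \<theta> = rate n r y) (at_right t)"
 proof eventually_elim
  case (elim r)
  hence "ereal r < \<zeta> n y" using u by (metis less_ereal.simps(1) less_trans)
  thus ?case by (simp add: rate_def)
 qed
 show ?thesis using tendsto_enn2real_powr[OF X_right[OF w t] fin] True by (intro Lim_transform_eventually[OF _ ev]) (simp add: rate_def)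
next
 case False
 have "eventually (\<lambda>r. t < r) (at_right t)" by (simp add: eventually_at_filter)
 hence ev: "eventually (\<lambda>r. 0 = rate n r y) (at_right t)"
 proof eventually_elim
  case (elim r)
  hence "\<not> ereal r < \<zeta> n y" using False by (metis less_ereal.simps(1) less_trans)
  thus ?case by (simp add: rate_def)
 qed
 show ?thesis using False by (intro Lim_transform_eventually[OF _ ev]) (simp add: rate_def)
qed

lemma left_limit_bounds:
 assumes w: "y \<in> space P" and t: "0 < t" "ereal t \<le> \<zeta> n y"
 shows "ennreal (1 / real n) \<le> left_limit X t y" "left_limit X t y \<le> ennreal (real n)"
proof -
 have "eventually (\<lambda>r. 0 < r \<and> r < t) (at_left t)" using t unfolding eventually_at_left_field by auto
 hence ev: "eventually (\<lambda>r. ennreal (1 / real n) \<le> X r y \<and> X r y \<le> ennreal (real n)) (at_left t)"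
 proof eventually_elim
  case (elim r)
  hence "ereal r < \<zeta> n y" using t by (metis less_ereal.simps(1) less_le_trans)
  thus ?case using before_\<zeta>[of r n y] elim by (simp add: less_imp_le)
 qed
 show "ennreal (1 / real n) \<le> left_limit X t y" using ev by (intro tendsto_lowerbound[OF X_left[OF w t(1)]]) (auto elim: eventually_mono)
 show "left_limit X t y \<le> ennreal (real n)" using ev by (intro tendsto_upperbound[OF X_left[OF w t(1)]]) (auto elim: eventually_mono)
qed

lemma rate_left_bounds:
 assumes w: "y \<in> space P" and s: "0 < s" shows "0 \<le> rate_left n s y" "rate_left n s y \<le> real n powr \<theta>"
proof -
 show "0 \<le> rate_left n s y" by (simp add: rate_left_def)
 show "rate_left n s y \<le> real n powr \<theta>"
 proof (cases "ereal s \<le> \<zeta> n y")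
  case True
  have "enn2real (left_limit X s y) \<le> real n" using left_limit_bounds(2)[OF w s True] by (intro enn2real_leI) auto
  thus ?thesis using True \<theta> by (simp add: rate_left_def powr_mono2)
 qed (simp add: rate_left_def)
qed

lemma rate_left_limit:
 assumes w: "y \<in> space P" and t: "0 < t" and n: "1 \<le> n" shows "((\<lambda>r. rate n r y) \<longlongrightarrow> rate_left n t y) (at_left t)"
proof (cases "ereal t \<le> \<zeta> n y")
 case True
 have "0 < ennreal (1 / real n)" using n by simp
 hence fin: "left_limit X t y < \<infinity>" "0 < left_limit X t y"
  using left_limit_bounds(2)[OF w t True] less_le_trans[OF _ left_limit_bounds(1)[OF w t True]] by (auto intro: le_less_trans)
 have "eventually (\<lambda>r. r < t) (at_left t)" by (simp add: eventually_at_filter)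
 hence ev: "eventually (\<lambda>r. enn2real (X r y) powr \<theta> = rate n r y) (at_left t)"
 proof eventually_elim
  case (elim r)
  hence "ereal r < \<zeta> n y" using True by (metis less_ereal.simps(1) less_le_trans)
  thus ?case by (simp add: rate_def)
 qed
 show ?thesis using tendsto_enn2real_powr[OF X_left[OF w t] fin] True by (intro Lim_transform_eventually[OF _ ev]) (simp add: rate_left_def)
next
 case False
 then obtain u where u: "\<zeta> n y < ereal u" "u < t" using ereal_dense2[of "\<zeta> n y" "ereal t"] by (auto simp: not_le)
 have "eventually (\<lambda>r. u < r) (at_left t)" using u by (auto simp: eventually_at_left_field)
 hence ev: "eventually (\<lambda>r. 0 = rate n r y) (at_left t)"
 proof eventually_elim
  case (elim r)
  hence "\<not> ereal r < \<zeta> n y" using u by (metis less_ereal.simps(1) less_trans not_less_iff_gr_or_eq)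
  thus ?case by (simp add: rate_def)
 qed
 show ?thesis using False by (intro Lim_transform_eventually[OF _ ev]) (simp add: rate_left_def)
qed

lemma rate_progressive:
 assumes "1 \<le> n" "0 \<le> T" shows "(\<lambda>(r, w). rate n (min (max r 0) T) w) \<in> borel_measurable (borel \<Otimes>\<^sub>M F T)"
proof -
 have "(\<lambda>(r, w). ennreal (rate n (min (max r 0) T) w)) \<in> borel_measurable (borel \<Otimes>\<^sub>M F T)"
 proof (rule borel_measurable_progressive[OF _ assms(2)])
  show "(\<lambda>w. ennreal (rate n r w)) \<in> borel_measurable (F T)" if "0 \<le> r" "r \<le> T" for r
   using measurable_F_mono[OF rate_adapted[OF assms(1) that(1)] that] by simp
  show "((\<lambda>r. ennreal (rate n r w)) \<longlongrightarrow> ennreal (rate n t w)) (at_right t)" if "w \<in> space (F T)" "0 \<le> t" for w t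
   using rate_right[of w t n] that assms by (intro tendsto_ennrealI) auto
 qed
 from borel_measurable_enn2real[OF this] show ?thesis by (simp add: case_prod_unfold rate_bounds assms)
qed

end

section \<open>Simple integrands that approximate the large jumps\<close>

text \<open>For \<open>s > 0\<close> this is the last mesh point strictly before \<open>s\<close>.
  The ceiling minus one, instead of the floor, fits the half-open intervals of simple integrands and
  makes the grid times approach \<open>s\<close> from the left, where rates converge to
  \<open>rate_left\<close>.\<close>

definition grid :: "nat => real => real" where
 "grid m s = real (nat \<lceil>real (Suc m) * s\<rceil> - 1) / real (Suc m)"

lemma grid_bounds:
 assumes "0 < s" shows "0 \<le> grid m s" "grid m s < s" "s - 1 / real (Suc m) \<le> grid m s"
proof -
 have c: "0 < \<lceil>real (Suc m) * s\<rceil>" using assms by (simp add: zero_less_mult_iff)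
 have e: "real (nat \<lceil>real (Suc m) * s\<rceil> - 1) = real_of_int \<lceil>real (Suc m) * s\<rceil> - 1"
  using c by (simp add: of_nat_diff nat_less_iff le_nat_iff)
 show "0 \<le> grid m s" by (simp add: grid_def)
 have M: "0 < real (Suc m)" by simp
 have "real_of_int \<lceil>real (Suc m) * s\<rceil> - 1 < real (Suc m) * s" by linarith
 thus "grid m s < s" unfolding grid_def e pos_divide_less_eq[OF M] by (simp only: mult.commute)
 have "real (Suc m) * s - 1 \<le> real_of_int \<lceil>real (Suc m) * s\<rceil> - 1" by linarith
 moreover have "(s - 1 / real (Suc m)) * real (Suc m) = real (Suc m) * s - 1" using M by (simp add: algebra_simps del: of_nat_Suc)
 ultimately have "(s - 1 / real (Suc m)) * real (Suc m) \<le> real_of_int \<lceil>real (Suc m) * s\<rceil> - 1" by simp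
 thus "s - 1 / real (Suc m) \<le> grid m s" unfolding grid_def e pos_le_divide_eq[OF M] .
qed

lemma grid_at_left: "0 < s ==> filterlim (\<lambda>m. grid m s) (at_left s) sequentially"
proof -
 assume s: "0 < s"
 have "(\<lambda>m. s - 1 / real (Suc m)) \<longlonglongrightarrow> s - 0" by (intro tendsto_diff tendsto_const LIMSEQ_Suc[OF lim_1_over_n])
 hence "(\<lambda>m. grid m s) \<longlonglongrightarrow> s"
  using grid_bounds[OF s] by (intro tendsto_sandwich[of "\<lambda>m. s - 1 / real (Suc m)" "\<lambda>m. grid m s" sequentially "\<lambda>_. s" s])
   (auto intro!: always_eventually simp: less_imp_le)
 thus ?thesis unfolding filterlim_at using grid_bounds(2)[OF s] by (auto intro!: always_eventually simp: less_imp_neq)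
qed

lemma grid_tendsto: "0 < s ==> (\<lambda>m. grid m s) \<longlonglongrightarrow> s" using grid_at_left[of s] by (simp add: filterlim_at)

lemma step_sum:
 fixes g :: "real => real"
 assumes "0 < s" "s \<le> real I / real (Suc m)"
 shows "(\<Sum>i\<leftarrow>[0..<I]. g (real i / real (Suc m)) * indicator {real i / real (Suc m)<..(real i + 1) / real (Suc m)} s) = g (grid m s)"
proof -
 define k where "k = nat \<lceil>real (Suc m) * s\<rceil> - 1"
 have M: "0 < real (Suc m)" by simp
 have c: "0 < \<lceil>real (Suc m) * s\<rceil>" using assms by (simp add: zero_less_mult_iff)
 have e: "real k = real_of_int \<lceil>real (Suc m) * s\<rceil> - 1" using c by (simp add: k_def of_nat_diff nat_less_iff le_nat_iff)
 have iff: "s \<in> {real i / real (Suc m)<..(real i + 1) / real (Suc m)} \<longleftrightarrow> i = k" for i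
 proof -
  have "s \<in> {real i / real (Suc m)<..(real i + 1) / real (Suc m)} \<longleftrightarrow> real i < s * real (Suc m) \<and> s * real (Suc m) \<le> real i + 1"
   by (simp only: greaterThanAtMost_iff pos_divide_less_eq[OF M] pos_le_divide_eq[OF M])
  also have "\<dots> \<longleftrightarrow> \<lceil>s * real (Suc m)\<rceil> = int i + 1" by (simp add: ceiling_eq_iff)
  also have "\<dots> \<longleftrightarrow> i = k" using e by (simp only: mult.commute) linarith
  finally show ?thesis .
 qed
 have "s * real (Suc m) \<le> real I" using assms(2) by (simp only: pos_le_divide_eq[OF M])
 hence "\<lceil>real (Suc m) * s\<rceil> \<le> int I" by (simp only: mult.commute ceiling_le_iff of_int_of_nat_eq)
 hence k: "k < I" using e by linarith
 have "(\<Sum>i\<leftarrow>[0..<I]. g (real i / real (Suc m)) * indicator {real i / real (Suc m)<..(real i + 1) / real (Suc m)} s)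
  = (\<Sum>i\<leftarrow>[0..<I]. if i = k then g (real i / real (Suc m)) else 0)" by (intro sum_list_cong refl) (simp only: indicator_def iff, simp)
 also have "\<dots> = g (grid m s)" using k by (simp add: interv_sum_list_conv_sum_set_nat grid_def k_def)
 finally show ?thesis .
qed

lemma step_sum_0:
 assumes "s \<le> 0 \<or> real I / real (Suc m) < s"
 shows "(\<Sum>i\<leftarrow>[0..<I]. g i * indicator {real i / real (Suc m)<..(real i + 1) / real (Suc m)} s) = (0::real)"
proof -
 have "s \<notin> {real i / real (Suc m)<..(real i + 1) / real (Suc m)}" if "i < I" for i
 proof -
  have "(real i + 1) / real (Suc m) \<le> real I / real (Suc m)" using that by (intro divide_right_mono) auto
  moreover have "0 \<le> real i / real (Suc m)" by simp
  ultimately show ?thesis using assms unfolding greaterThanAtMost_iff by linarith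
 qed
 hence "(\<Sum>i\<leftarrow>[0..<I]. g i * indicator {real i / real (Suc m)<..(real i + 1) / real (Suc m)} s) = (\<Sum>i\<leftarrow>[0..<I]. 0)"
  by (intro sum_list_cong refl) auto
 thus ?thesis by simp
qed

text \<open>A continuous replacement for the indicator of \<open>d \<le> 0\<close>: the limit along
  the grid has to pass inside it. The width \<open>e\<close> is sent to 0 afterwards.\<close>

definition cut :: "real => real => real" where
 "cut e d = max 0 (min 1 (1 - d / e))"

lemma cut_bounds: "0 \<le> cut e d" "cut e d \<le> 1" by (auto simp: cut_def)

lemma cut_eq_0: "0 < e ==> e \<le> d ==> cut e d = 0" by (simp add: cut_def)

lemma cut_eq_1: "0 < e ==> d \<le> 0 ==> cut e d = 1" by (simp add: cut_def divide_nonpos_pos)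

lemma cut_tendsto: "0 < e ==> (f \<longlongrightarrow> l) G ==> ((\<lambda>x. cut e (f x)) \<longlongrightarrow> cut e l) G"
 unfolding cut_def by (intro tendsto_intros) auto

lemma simple_value_concat:
 "simple_value (concat (map h xs)) s y w = (\<Sum>i\<leftarrow>xs. simple_value (h i) s y w)" by (induction xs) (auto simp: simple_value_def)

context noisy_space begin

text \<open>The counts up to time \<open>T\<close> dominate those up to any earlier time, so one
  null set serves all \<open>t\<close> at once.\<close>

lemma simple_integral_raw:
 assumes D: "simple_integrand P F \<nu> D"
 shows "AE w in P. \<forall>t\<in>{0..T}. simple_integral raw_noise D t w = (\<integral>(s, y). (if s \<le> t then simple_value D s y w else 0) \<partial>N w)"
proof -
 have "AE w in P. \<forall>x\<in>set D. emeasure (N w) ({0<..T} \<times> fst (snd (snd x))) < \<infinity>"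
 proof (subst AE_finite_all, simp, intro ballI)
  fix x assume "x \<in> set D"
  moreover obtain a b A \<xi> where x: "x = (a, b, A, \<xi>)" by (cases x)
  ultimately have "A \<in> sets \<nu>" "emeasure \<nu> A < \<infinity>" using simple_integrandD(3,4)[OF D, of a b A \<xi>] by auto
  thus "AE w in P. emeasure (N w) ({0<..T} \<times> fst (snd (snd x))) < \<infinity>" unfolding x by (intro AE_N_finite) auto
 qed
 thus ?thesis using AE_space
 proof eventually_elim
  case (elim w)
  show ?case
  proof
   fix t assume t: "t \<in> {0..T}"
   let ?B = "\<lambda>x. {min t (fst x)<..min t (fst (snd x))} \<times> fst (snd (snd x))"
   have B: "?B x \<in> sets (N w)" "emeasure (N w) (?B x) < \<infinity>"
     "measure (N w) ({0<..min t (fst (snd x))} \<times> fst (snd (snd x))) - measure (N w) ({0<..min t (fst x)} \<times> fst (snd (snd x))) = measure (N w) (?B x)"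
     if mem: "x \<in> set D" for x
   proof -
    obtain a b A \<xi> where x: "x = (a, b, A, \<xi>)" by (cases x)
    note d = simple_integrandD[OF D mem[unfolded x]]
    have r: "{p<..q} \<times> A \<in> sets (N w)" if "0 \<le> p" for p q using that d(3) by (simp add: sets_N[OF elim(2)] time_mark_rect)
    show "?B x \<in> sets (N w)" using r[of "min t a"] t d by (simp add: x)
    have fin: "emeasure (N w) ({p<..q} \<times> A) < \<infinity>" if "0 \<le> p" "q \<le> t" for p q
    proof -
     have "emeasure (N w) ({p<..q} \<times> A) \<le> emeasure (N w) ({0<..T} \<times> A)" using that t r[of 0] by (intro emeasure_mono) auto
     also have "\<dots> < \<infinity>" using elim(1) mem by (auto simp: x)
     finally show ?thesis .
    qed
    show "emeasure (N w) (?B x) < \<infinity>" using fin[of "min t a" "min t b"] t d by (simp add: x)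
    have "{0<..min t b} \<times> A = {0<..min t a} \<times> A \<union> {min t a<..min t b} \<times> A" using t d by auto
    hence "measure (N w) ({0<..min t b} \<times> A) = measure (N w) ({0<..min t a} \<times> A) + measure (N w) ({min t a<..min t b} \<times> A)"
     using fin[of 0 "min t a"] fin[of "min t a" "min t b"] r t d by (auto intro!: measure_Union simp: less_top[symmetric])
    thus "measure (N w) ({0<..min t (fst (snd x))} \<times> fst (snd (snd x))) - measure (N w) ({0<..min t (fst x)} \<times> fst (snd (snd x))) = measure (N w) (?B x)"
     by (simp add: x)
   qed
   have "(\<integral>(s, y). (if s \<le> t then simple_value D s y w else 0) \<partial>N w) = (LINT p|N w. (\<Sum>x\<leftarrow>D. snd (snd (snd x)) w * indicator (?B x) p))"
   proof (rule lebesgue_integral_cong[OF refl])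
    fix p assume "p \<in> space (N w)"
    show "(case p of (s, y) => if s \<le> t then simple_value D s y w else 0) = (\<Sum>x\<leftarrow>D. snd (snd (snd x)) w * indicator (?B x) p)"
    proof (cases "fst p \<le> t")
     case True
     thus ?thesis unfolding simple_value_def case_prod_unfold by (simp, intro sum_list_cong refl) (cases p, auto simp: indicator_def)
    next
     case False
     have "(\<Sum>x\<leftarrow>D. snd (snd (snd x)) w * indicator (?B x) p) = (\<Sum>x\<leftarrow>D. 0)"
      using False by (intro sum_list_cong refl) (cases p, auto simp: indicator_def)
     thus ?thesis using False by (simp add: case_prod_unfold)
    qed
   qed
   also have "\<dots> = (\<Sum>x\<leftarrow>D. \<integral>p. snd (snd (snd x)) w * indicator (?B x) p \<partial>N w)"
    using B by (intro integral_sum_list) auto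
   also have "\<dots> = (\<Sum>x\<leftarrow>D. snd (snd (snd x)) w * measure (N w) (?B x))" using B by (intro sum_list_cong refl) auto
   also have "\<dots> = simple_integral raw_noise D t w" unfolding simple_integral_def case_prod_unfold using B(3) by (intro sum_list_cong refl) simp
   finally show "simple_integral raw_noise D t w = (\<integral>(s, y). (if s \<le> t then simple_value D s y w else 0) \<partial>N w)" ..
  qed
 qed
qed

end

context branching_sde begin

lemma sets_\<pi>: "sets \<pi> = sets (restrict_space borel {0<..})" using levy by (simp add: levy_measure_def)

lemma space_\<pi>: "space \<pi> = {0<..}" using sets_eq_imp_space_eq[OF sets_\<pi>] by (simp add: space_restrict_space)

sublocale jumps: sigma_finite_measure \<pi> using levy by (simp add: levy_measure_def)

lemma sets_\<pi>I: "A \<in> sets borel ==> A \<subseteq> {0<..} ==> A \<in> sets \<pi>" unfolding sets_\<pi> by (simp add: sets_restrict_space_iff)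

lemma measurable_\<pi>: "f \<in> measurable borel K ==> f \<in> measurable \<pi> K"
 unfolding measurable_cong_sets[OF sets_\<pi> refl] by (rule measurable_restrict_space1)

lemma \<pi>_large: "emeasure \<pi> {1<..} < \<infinity>"
proof -
 have s: "{1<..} \<in> sets \<pi>" by (rule sets_\<pi>I) auto
 have "emeasure \<pi> {1<..} = (\<integral>\<^sup>+z. indicator {1<..} z \<partial>\<pi>)" using s by simp
 also have "\<dots> \<le> (\<integral>\<^sup>+z. ennreal (min 1 (z\<^sup>2)) \<partial>\<pi>)"
  by (intro nn_integral_mono) (auto simp: indicator_def min_absorb1 one_le_power less_imp_le)
 also have "\<dots> < \<infinity>" using levy by (simp add: levy_measure_def)
 finally show ?thesis .
qed

lemma emeasure_mark_rect:
 assumes "A \<in> sets \<pi>" "0 \<le> a" "a \<le> a'"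
 shows "A \<times> {a<..a'} \<in> sets (mark_measure \<pi>)" "emeasure (mark_measure \<pi>) (A \<times> {a<..a'}) = emeasure \<pi> A * ennreal (a' - a)"
proof -
 have s: "{a<..a'} \<in> sets (restrict_space lborel {0<..})" using assms by (auto simp: sets_restrict_space_iff)
 show "A \<times> {a<..a'} \<in> sets (mark_measure \<pi>)" unfolding mark_measure_def using s assms by auto
 interpret l: sigma_finite_measure "restrict_space lborel {0::real<..}"
  by (rule sigma_finite_measure_restrict_space) (auto intro: lborel.sigma_finite_measure_axioms)
 have "emeasure (restrict_space lborel {0<..}) {a<..a'} = ennreal (a' - a)" using assms by (subst emeasure_restrict_space) auto
 thus "emeasure (mark_measure \<pi>) (A \<times> {a<..a'}) = emeasure \<pi> A * ennreal (a' - a)"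
  unfolding mark_measure_def using s assms by (simp add: l.emeasure_pair_measure_Times)
qed

definition big_marks :: "nat => (real \<times> real) set" where
 "big_marks h = {1<..} \<times> {0<..real h}"

lemma big_marks: "big_marks h \<in> sets (mark_measure \<pi>)" "emeasure (mark_measure \<pi>) (big_marks h) < \<infinity>"
 using emeasure_mark_rect[of "{1<..}" 0 "real h"] sets_\<pi>I[of "{1<..}"] \<pi>_large by (auto simp: big_marks_def ennreal_mult_less_top)

text \<open>Large jumps may have infinite mean, so integrability holds only path by path: the
  expected number of jumps above \<open>Suc k\<close> tends to 0, hence almost surely some bound is
  exceeded by no jump, and only finitely many jumps are left to sum.\<close>

lemma big_jump_integrable:
 "AE w in P. integrable (N w) (\<lambda>(s, z, u). z * indicator ({0<..T} \<times> big_marks h) (s, z, u))"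
proof -
 let ?a = "time_mark (mark_measure \<pi>)"
 define B where "B k = {0<..T} \<times> ({real (Suc k)<..} \<times> {0<..real h})" for k :: nat
 have Bs: "B k \<in> sets (?a)" for k unfolding B_def by (intro time_mark_rect emeasure_mark_rect sets_\<pi>I) auto
 have B0: "B 0 = {0<..T} \<times> big_marks h" by (simp add: B_def big_marks_def)
 have Bf0: "emeasure (?a) (B 0) < \<infinity>" unfolding B0 by (rule emeasure_time_mark_rect_finite[OF order_refl big_marks])
 have Bdec: "decseq B" unfolding decseq_def B_def by force
 have Bf: "emeasure (?a) (B k) < \<infinity>" for k using emeasure_mono[OF decseqD[OF Bdec, of 0 k] Bs[of 0]] Bf0 by (auto intro: le_less_trans)
 have "(\<Inter>k. B k) = {}"
 proof -
  have "\<exists>k. \<not> real (Suc k) < z" for z :: real using real_arch_simple[of z] by (metis less_asym less_Suc_eq not_less of_nat_less_iff order_less_le_trans)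
  thus ?thesis unfolding B_def by fastforce
 qed
 hence lim: "(\<lambda>k. emeasure (?a) (B k)) \<longlonglongrightarrow> 0" using Lim_emeasure_decseq[of B "?a"] Bs Bdec Bf by (auto simp: less_top)
 define E where "E = {w\<in>space P. \<forall>k. 1 \<le> emeasure (N w) (B k)}"
 have [measurable]: "(\<lambda>w. emeasure (N w) (B k)) \<in> borel_measurable P" for k by (rule N_measurable[OF Bs])
 have E [measurable]: "E \<in> sets P" unfolding E_def by measurable
 have "emeasure P E \<le> emeasure (?a) (B k)" for k
 proof -
  have "emeasure P E = (\<integral>\<^sup>+w. indicator E w \<partial>P)" by simp
  also have "\<dots> \<le> (\<integral>\<^sup>+w. emeasure (N w) (B k) \<partial>P)" by (intro nn_integral_mono) (auto simp: E_def indicator_def)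
  finally show ?thesis using N_mean[OF Bs Bf] by simp
 qed
 hence "emeasure P E \<le> 0" by (intro tendsto_lowerbound[OF lim]) (auto intro!: always_eventually)
 hence "E \<in> null_sets P" by (intro null_setsI) auto
 hence "AE w in P. w \<notin> E" by (rule AE_not_in)
 moreover have "AE w in P. \<forall>k. \<exists>j::nat. emeasure (N w) (B k) = of_nat j" unfolding AE_all_countable using AE_N_nat[OF Bs Bf] by blast
 ultimately show ?thesis using AE_space
 proof eventually_elim
  case (elim w)
  obtain k where "\<not> 1 \<le> emeasure (N w) (B k)" using elim unfolding E_def by auto
  moreover obtain j :: nat where "emeasure (N w) (B k) = of_nat j" using elim by blast
  ultimately have "emeasure (N w) (B k) = 0" by (cases j) auto
  hence nk: "B k \<in> null_sets (N w)" using Bs[of k] by (intro null_setsI) (auto simp: sets_N[OF elim(3)])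
  obtain i :: nat where i: "emeasure (N w) (B 0) = of_nat i" using elim by blast
  have fin: "emeasure (N w) (B 0) < \<infinity>" unfolding i by (simp add: of_nat_less_top)
  have m: "B 0 \<in> sets (N w)" using Bs[of 0] by (simp add: sets_N[OF elim(3)])
  show ?case
  proof (rule Bochner_Integration.integrable_bound[where f="\<lambda>p. real (Suc k) * indicator (B 0) p"])
   show "integrable (N w) (\<lambda>p. real (Suc k) * indicator (B 0) p)" using fin m by simp
   have "(\<lambda>p. fst (snd p)) \<in> borel_measurable (?a)" unfolding time_mark_def mark_measure_def
    by (intro measurable_compose[OF measurable_snd] measurable_compose[OF measurable_fst] measurable_\<pi>) simp
   hence [measurable]: "(\<lambda>p. fst (snd p)) \<in> borel_measurable (N w)" unfolding measurable_cong_sets[OF sets_N[OF elim(3)] refl] .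
   have [measurable]: "{0<..T} \<times> big_marks h \<in> sets (N w)" using m unfolding B0 .
   show "(\<lambda>(s, z, u). z * indicator ({0<..T} \<times> big_marks h) (s, z, u)) \<in> borel_measurable (N w)"
    unfolding case_prod_unfold prod.collapse by measurable
   show "AE p in N w. norm (case p of (s, z, u) => z * indicator ({0<..T} \<times> big_marks h) (s, z, u)) \<le> norm (real (Suc k) * indicator (B 0) p)"
    using AE_not_in[OF nk]
   proof eventually_elim
    case (elim p)
    thus ?case by (cases p) (auto simp: B_def B0 indicator_def big_marks_def)
   qed
  qed
 qed
qed

text \<open>Here \<open>z\<close> is the excess of the jump over 1, whence the factor
  \<open>1 + z\<close>. The condition \<open>ereal s < \<zeta> n w\<close> is strict because it is
  evaluated at grid times before the actual time.\<close>

definition jump_coef :: "nat => real => real => real => real => 'a => real" where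
 "jump_coef n e s z u w = (1 + z) * (if ereal s < \<zeta> n w then cut e (u - rate n s w) else 0)"

text \<open>A step function on the mesh of width \<open>1 / Suc m\<close> in time, jump size and
  level. The mesh for the jump size starts at 1 and its range grows with \<open>m\<close>; the
  ranges \<open>T\<close> for the time and \<open>h\<close> for the level stay fixed.\<close>

definition jump_approx :: "nat => real => nat => nat => nat => (real \<times> real, 'a) simple" where
 "jump_approx n e T h m = concat (map (\<lambda>i. concat (map (\<lambda>j. map (\<lambda>l.
   (real i / real (Suc m), (real i + 1) / real (Suc m),
   {1 + real j / real (Suc m)<..1 + (real j + 1) / real (Suc m)} \<times> {real l / real (Suc m)<..(real l + 1) / real (Suc m)},
   jump_coef n e (real i / real (Suc m)) (real j / real (Suc m)) (real l / real (Suc m))))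
   [0..<Suc m * h]) [0..<Suc m * Suc m])) [0..<Suc m * T])"

text \<open>The integrand of the large jumps in the equation, except that the condition
  \<open>u \<le> rate_left n s w\<close> is softened by \<open>cut\<close>.\<close>

definition big_jump :: "nat => real => real => real \<times> real => 'a => real" where
 "big_jump n e s = (\<lambda>(z, u) w. if ereal s \<le> \<zeta> n w \<and> 1 < z then z * cut e (u - rate_left n s w) else 0)"

lemma simple_value_map:
 "simple_value (map h xs) s y w = (\<Sum>i\<leftarrow>xs. case h i of (a, b, A, \<xi>) => \<xi> w * indicator {a<..b} s * indicator A y)"
 by (induction xs) (auto simp: simple_value_def)

lemma simple_value_jump_approx:
 "simple_value (jump_approx n e T h m) s (z, u) w =
  (if 0 < s \<and> s \<le> real T \<and> 1 < z \<and> z - 1 \<le> real (Suc m) \<and> 0 < u \<and> u \<le> real h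
   then jump_coef n e (grid m s) (grid m (z - 1)) (grid m u) w else 0)"
proof -
 let ?M = "real (Suc m)"
 let ?I = "\<lambda>i x. indicator {real i / ?M<..(real i + 1) / ?M} x :: real"
 have I: "real (Suc m * k) / ?M = real k" for k unfolding of_nat_mult by (simp del: of_nat_Suc)
 have ind: "indicator ({1 + real j / ?M<..1 + (real j + 1) / ?M} \<times> {real l / ?M<..(real l + 1) / ?M}) (z, u) = ?I j (z - 1) * ?I l u" for j l
  by (auto simp: indicator_def simp del: of_nat_Suc)
 have eq: "simple_value (jump_approx n e T h m) s (z, u) w =
  (\<Sum>i\<leftarrow>[0..<Suc m * T]. (\<Sum>j\<leftarrow>[0..<Suc m * Suc m]. (\<Sum>l\<leftarrow>[0..<Suc m * h].
    jump_coef n e (real i / ?M) (real j / ?M) (real l / ?M) w * ?I l u) * ?I j (z - 1)) * ?I i s)"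
  unfolding jump_approx_def simple_value_concat simple_value_map prod.case ind sum_list_mult_const[symmetric]
  by (simp only: mult.assoc mult.commute mult.left_commute)
 have l: "(\<Sum>l\<leftarrow>[0..<Suc m * h]. g (real l / ?M) * ?I l u) = (if 0 < u \<and> u \<le> real h then g (grid m u) else 0)" for g
  using step_sum[of u "Suc m * h" m g] step_sum_0[of u "Suc m * h" m "\<lambda>l. g (real l / ?M)"] unfolding I by (auto simp del: of_nat_Suc upt_Suc mult_Suc)
 have j: "(\<Sum>j\<leftarrow>[0..<Suc m * Suc m]. g (real j / ?M) * ?I j (z - 1)) = (if 1 < z \<and> z - 1 \<le> ?M then g (grid m (z - 1)) else 0)" for g
  using step_sum[of "z - 1" "Suc m * Suc m" m g] step_sum_0[of "z - 1" "Suc m * Suc m" m "\<lambda>l. g (real l / ?M)"] unfolding I by (auto simp del: of_nat_Suc upt_Suc mult_Suc)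
 have i: "(\<Sum>i\<leftarrow>[0..<Suc m * T]. g (real i / ?M) * ?I i s) = (if 0 < s \<and> s \<le> real T then g (grid m s) else 0)" for g
  using step_sum[of s "Suc m * T" m g] step_sum_0[of s "Suc m * T" m "\<lambda>l. g (real l / ?M)"] unfolding I by (auto simp del: of_nat_Suc upt_Suc mult_Suc)
 have "simple_value (jump_approx n e T h m) s (z, u) w =
  (\<Sum>i\<leftarrow>[0..<Suc m * T]. (\<Sum>j\<leftarrow>[0..<Suc m * Suc m].
    (if 0 < u \<and> u \<le> real h then jump_coef n e (real i / ?M) (real j / ?M) (grid m u) w else 0) * ?I j (z - 1)) * ?I i s)"
  unfolding eq by (subst l[of "\<lambda>u. jump_coef n e _ _ u w"]) (rule refl)
 also have "\<dots> = (\<Sum>i\<leftarrow>[0..<Suc m * T].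
    (if 1 < z \<and> z - 1 \<le> ?M then (if 0 < u \<and> u \<le> real h then jump_coef n e (real i / ?M) (grid m (z - 1)) (grid m u) w else 0) else 0) * ?I i s)"
  by (subst j[of "\<lambda>z. if 0 < u \<and> u \<le> real h then jump_coef n e _ z (grid m u) w else 0"]) (rule refl)
 also have "\<dots> = (if 0 < s \<and> s \<le> real T then (if 1 < z \<and> z - 1 \<le> ?M then (if 0 < u \<and> u \<le> real h then jump_coef n e (grid m s) (grid m (z - 1)) (grid m u) w else 0) else 0) else 0)"
  by (subst i[of "\<lambda>s. if 1 < z \<and> z - 1 \<le> ?M then (if 0 < u \<and> u \<le> real h then jump_coef n e s (grid m (z - 1)) (grid m u) w else 0) else 0"]) (rule refl)
 finally show ?thesis by auto
qed

lemma jump_coef_adapted: "1 \<le> n ==> 0 \<le> s ==> jump_coef n e s z u \<in> borel_measurable (F s)"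
proof -
 assume n: "1 \<le> n" and s: "0 \<le> s"
 have "{w\<in>space (F s). ereal s < \<zeta> n w} \<in> sets (F s)" using \<zeta>_stopping_less[OF n s] s by simp
 hence [measurable]: "Measurable.pred (F s) (\<lambda>w. ereal s < \<zeta> n w)" by (simp add: pred_def)
 have [measurable]: "rate n s \<in> borel_measurable (F s)" by (rule rate_adapted[OF n s])
 have [measurable]: "cut e \<in> borel_measurable borel" unfolding cut_def by measurable
 show ?thesis unfolding jump_coef_def by measurable
qed

lemma jump_coef_bounds: "0 \<le> z ==> 0 \<le> jump_coef n e s z u w" "0 \<le> z ==> jump_coef n e s z u w \<le> 1 + z"
 using cut_bounds[of e "u - rate n s w"] mult_left_mono[of "cut e (u - rate n s w)" 1 "1 + z"] by (auto simp: jump_coef_def)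

lemma jump_approx_simple:
 assumes n: "1 \<le> n" shows "simple_integrand P F (mark_measure \<pi>) (jump_approx n e T h m)"
proof -
 let ?M = "real (Suc m)"
 have "0 \<le> real i / ?M \<and> real i / ?M \<le> (real i + 1) / ?M \<and> A i j l \<in> sets (mark_measure \<pi>) \<and> emeasure (mark_measure \<pi>) (A i j l) < \<infinity> \<and>
   jump_coef n e (real i / ?M) (real j / ?M) (real l / ?M) \<in> borel_measurable (F (real i / ?M)) \<and>
   bounded (jump_coef n e (real i / ?M) (real j / ?M) (real l / ?M) ` space P)"
  if A: "A = (\<lambda>i j l. {1 + real j / ?M<..1 + (real j + 1) / ?M} \<times> {real l / ?M<..(real l + 1) / ?M})" for i j l :: nat and A :: "nat => nat => nat => (real \<times> real) set"
 proof (intro conjI)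
  have M: "0 < ?M" by simp
  show 1: "0 \<le> real i / ?M" "real i / ?M \<le> (real i + 1) / ?M" by (auto intro!: divide_right_mono)
  have j: "0 \<le> real j / ?M" by simp
  have l: "0 \<le> real l / ?M" "real l / ?M \<le> (real l + 1) / ?M" by (auto intro!: divide_right_mono)
  have Z: "{1 + real j / ?M<..1 + (real j + 1) / ?M} \<in> sets \<pi>"
  proof (rule sets_\<pi>I)
   show "{1 + real j / ?M<..1 + (real j + 1) / ?M} \<subseteq> {0<..}"
    using j unfolding subset_iff greaterThanAtMost_iff greaterThan_iff by (intro allI impI) linarith
  qed simp
  show "A i j l \<in> sets (mark_measure \<pi>)" unfolding A by (rule emeasure_mark_rect(1)[OF Z l])
  have "emeasure \<pi> {1 + real j / ?M<..1 + (real j + 1) / ?M} \<le> emeasure \<pi> {1<..}"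
  proof (rule emeasure_mono)
   show "{1 + real j / ?M<..1 + (real j + 1) / ?M} \<subseteq> {1<..}"
    using j unfolding subset_iff greaterThanAtMost_iff greaterThan_iff by (intro allI impI) linarith
  qed (auto intro: sets_\<pi>I)
  hence "emeasure \<pi> {1 + real j / ?M<..1 + (real j + 1) / ?M} < \<infinity>" using \<pi>_large by (rule le_less_trans)
  thus "emeasure (mark_measure \<pi>) (A i j l) < \<infinity>" unfolding A emeasure_mark_rect(2)[OF Z l] by (simp add: ennreal_mult_less_top)
  show "jump_coef n e (real i / ?M) (real j / ?M) (real l / ?M) \<in> borel_measurable (F (real i / ?M))" by (rule jump_coef_adapted[OF n 1(1)])
  show "bounded (jump_coef n e (real i / ?M) (real j / ?M) (real l / ?M) ` space P)"
   unfolding bounded_iff using jump_coef_bounds[OF j, of n e "real i / ?M" "real l / ?M"]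
   by (intro exI[of _ "1 + real j / ?M"]) (auto simp del: of_nat_Suc)
 qed
 thus ?thesis unfolding simple_integrand_def jump_approx_def by (auto simp del: of_nat_Suc upt_Suc mult_Suc)
qed

lemma jump_approx_bounds: shows "0 \<le> simple_value (jump_approx n e T h m) s (z, u) w"
  and "simple_value (jump_approx n e T h m) s (z, u) w \<le> z * indicator ({0<..real T} \<times> big_marks h) (s, z, u)"
proof -
 have "0 \<le> grid m (z - 1)" "1 + grid m (z - 1) \<le> z" if "1 < z" using grid_bounds[of "z - 1" m] that by auto
 thus "0 \<le> simple_value (jump_approx n e T h m) s (z, u) w"
  "simple_value (jump_approx n e T h m) s (z, u) w \<le> z * indicator ({0<..real T} \<times> big_marks h) (s, z, u)"
  unfolding simple_value_jump_approx using jump_coef_bounds[of "grid m (z - 1)" n e "grid m s" "grid m u" w]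
  by (auto simp: indicator_def big_marks_def simp del: of_nat_Suc)
qed

text \<open>\<open>h\<close> exceeds the largest possible rate by at least the width of the cut, so
  the integrand vanishes for all levels beyond \<open>h\<close>.\<close>

lemma big_jump_bounds:
 assumes w: "y \<in> space P" and e: "0 < e" "real n powr \<theta> + e \<le> real h" and s: "0 < s" "s \<le> T" and u: "0 < u" and z: "0 < z"
 shows "0 \<le> big_jump n e s (z, u) y"
  and "big_jump n e s (z, u) y \<le> z * indicator ({0<..T} \<times> big_marks h) (s, z, u)"
proof -
 show "0 \<le> big_jump n e s (z, u) y" using z cut_bounds by (simp add: big_jump_def)
 have "cut e (u - rate_left n s y) = 0" if "real h < u" using that rate_left_bounds[OF w s(1), of n] e by (intro cut_eq_0) auto
 thus "big_jump n e s (z, u) y \<le> z * indicator ({0<..T} \<times> big_marks h) (s, z, u)" using cut_bounds[of e "u - rate_left n s y"] s u z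
  by (auto simp: big_jump_def indicator_def big_marks_def not_le mult_left_le)
qed

text \<open>The grid times lie strictly to the left, so the rates read there converge to
  \<open>rate_left\<close>, and \<open>cut\<close> is continuous. After \<open>\<zeta> n\<close> the
  grid times eventually lie beyond it too, and the coefficient is 0.\<close>

lemma jump_approx_limit:
 assumes n: "1 \<le> n" and w: "y \<in> space P" and e: "0 < e" "real n powr \<theta> + e \<le> real h" and s: "0 < s" "s \<le> real T"
  and u: "0 < u" and z: "0 < z"
 shows "(\<lambda>m. simple_value (jump_approx n e T h m) s (z, u) y) \<longlonglongrightarrow> big_jump n e s (z, u) y"
proof (cases "1 < z \<and> u \<le> real h")
 case False
 hence "big_jump n e s (z, u) y = 0" using big_jump_bounds[OF w e s u z] by (auto simp: big_marks_def indicator_def split: if_splits)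
 thus ?thesis using False by (auto simp: simple_value_jump_approx)
next
 case True
 have coef: "(\<lambda>m. jump_coef n e (grid m s) (grid m (z - 1)) (grid m u) y) \<longlonglongrightarrow> big_jump n e s (z, u) y"
 proof (cases "ereal s \<le> \<zeta> n y")
  case zeta: True
  have lt: "ereal (grid m s) < \<zeta> n y" for m using grid_bounds(2)[OF s(1), of m] zeta by (metis less_ereal.simps(1) less_le_trans)
  have "(\<lambda>m. (1 + grid m (z - 1)) * cut e (grid m u - rate n (grid m s) y)) \<longlonglongrightarrow> (1 + (z - 1)) * cut e (u - rate_left n s y)"
   using True u by (intro tendsto_mult tendsto_add tendsto_const grid_tendsto cut_tendsto[OF e(1)] tendsto_diff
     filterlim_compose[OF rate_left_limit[OF w s(1) n] grid_at_left[OF s(1)]]) auto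
  thus ?thesis using True zeta by (simp add: jump_coef_def lt big_jump_def)
 next
  case False
  then obtain r where r: "\<zeta> n y < ereal r" "r < s" using ereal_dense2[of "\<zeta> n y" "ereal s"] by (auto simp: not_le)
  have "eventually (\<lambda>m. r < grid m s) sequentially" using grid_tendsto[OF s(1)] r(2) by (rule order_tendstoD)
  hence ev: "eventually (\<lambda>m. 0 = jump_coef n e (grid m s) (grid m (z - 1)) (grid m u) y) sequentially"
  proof eventually_elim
   case (elim m)
   hence "\<not> ereal (grid m s) < \<zeta> n y" using r(1) by (metis less_ereal.simps(1) less_trans not_less_iff_gr_or_eq)
   thus ?case by (simp add: jump_coef_def)
  qed
  show ?thesis using False by (intro Lim_transform_eventually[OF _ ev]) (simp add: big_jump_def)
 qed
 obtain m0 :: nat where m0: "z - 1 \<le> real m0" using real_arch_simple by blast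
 have ev: "eventually (\<lambda>m. jump_coef n e (grid m s) (grid m (z - 1)) (grid m u) y = simple_value (jump_approx n e T h m) s (z, u) y) sequentially"
  using eventually_ge_at_top[of m0]
 proof eventually_elim
  case (elim m)
  hence "z - 1 \<le> real (Suc m)" using m0 by (simp add: order_trans)
  thus ?case using True s u by (simp add: simple_value_jump_approx del: of_nat_Suc)
 qed
 show ?thesis by (rule Lim_transform_eventually[OF coef ev])
qed

lemma big_jump_limit_e:
 assumes w: "y \<in> space P" and z: "0 < z" shows "(\<lambda>k. big_jump n (1 / real (Suc k)) s (z, u) y)
  \<longlonglongrightarrow> (if ereal s \<le> \<zeta> n y \<and> 1 < z \<and> u \<le> rate_left n s y then z else 0)"
proof (cases "ereal s \<le> \<zeta> n y \<and> 1 < z")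
 case True
 show ?thesis
 proof (cases "u \<le> rate_left n s y")
  case le: True
  thus ?thesis using True by (simp add: big_jump_def cut_eq_1 del: of_nat_Suc)
 next
  case False
  then obtain k0 where k0: "1 / real (Suc k0) < u - rate_left n s y" using nat_approx_posE[of "u - rate_left n s y"] by auto
  have ev: "eventually (\<lambda>k. 0 = big_jump n (1 / real (Suc k)) s (z, u) y) sequentially" using eventually_ge_at_top[of k0]
  proof eventually_elim
   case (elim k)
   hence "1 / real (Suc k) \<le> 1 / real (Suc k0)" by (intro divide_left_mono) auto
   hence "cut (1 / real (Suc k)) (u - rate_left n s y) = 0" using k0 by (intro cut_eq_0) auto
   thus ?case by (simp add: big_jump_def del: of_nat_Suc)
  qed
  show ?thesis using False by (intro Lim_transform_eventually[OF _ ev]) simp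
 qed
qed (auto simp: big_jump_def)

end

section \<open>Continuity of the Levy-Khintchine exponent in the integrands\<close>

lemma L2_times_tendsto_0:
 fixes d :: "nat => 'a => real"
 assumes [measurable]: "\<And>k. d k \<in> borel_measurable M" "w \<in> borel_measurable M"
  and d: "(\<lambda>k. \<integral>\<^sup>+x. ennreal ((d k x)\<^sup>2) \<partial>M) \<longlonglongrightarrow> 0" and w: "(\<integral>\<^sup>+x. ennreal ((w x)\<^sup>2) \<partial>M) < \<infinity>"
 shows "(\<lambda>k. \<integral>\<^sup>+x. ennreal (\<bar>d k x\<bar> * \<bar>w x\<bar>) \<partial>M) \<longlonglongrightarrow> 0"
proof -
 let ?a = "\<lambda>k. \<integral>\<^sup>+x. ennreal ((d k x)\<^sup>2) \<partial>M"
 define W where "W = (\<integral>\<^sup>+x. ennreal ((w x)\<^sup>2) \<partial>M)"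
 let ?x = "\<lambda>k. \<integral>\<^sup>+x. ennreal (\<bar>d k x\<bar> * \<bar>w x\<bar>) \<partial>M"
 have cs: "(?x k)\<^sup>2 \<le> (?a k) * W" for k
  using Cauchy_Schwarz_nn_integral[of "\<lambda>x. ennreal \<bar>d k x\<bar>" M "\<lambda>x. ennreal \<bar>w x\<bar>"]
  by (simp add: ennreal_mult[symmetric] ennreal_power W_def)
 have "(\<lambda>k. (?a k) * W) \<longlonglongrightarrow> 0 * W" using w by (intro tendsto_mult_ennreal[OF d tendsto_const]) (auto simp: W_def)
 hence lim: "(\<lambda>k. (?a k) * W) \<longlonglongrightarrow> 0" by simp
 show ?thesis
 proof (rule order_tendstoI)
  fix a :: ennreal assume "0 < a"
  then obtain b where b: "0 < b" "b < a" using dense by blast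
  hence "0 < b\<^sup>2" by (simp add: power2_eq_square ennreal_zero_less_mult_iff)
  hence "eventually (\<lambda>k. (?a k) * W < b\<^sup>2) sequentially" using lim by (intro order_tendstoD)
  thus "eventually (\<lambda>k. ?x k < a) sequentially"
  proof eventually_elim
   case (elim k)
   have "?x k < b"
   proof (rule ccontr)
    assume "\<not> ?x k < b"
    hence "b\<^sup>2 \<le> (?x k)\<^sup>2" by (intro power_mono) auto
    thus False using cs[of k] elim by (meson leD order_trans)
   qed
   thus ?case using b by simp
  qed
 qed simp
qed

text \<open>The integrand of the jump part of \<open>symbol_rate\<close>: \<open>a\<close> is the
  compensated jump and \<open>b\<close> the raw one.\<close>

definition levy_term :: "real => real => real => complex" where
 "levy_term u a b = exp (\<i> * of_real (u * (a + b))) - 1 - \<i> * of_real (u * a)"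

lemma levy_term_measurable [measurable]:
 assumes [measurable]: "f \<in> borel_measurable M" "g \<in> borel_measurable M"
 shows "(\<lambda>x. levy_term u (f x) (g x)) \<in> borel_measurable M" unfolding levy_term_def by measurable

lemma norm_exp_i_le_square: "norm (exp (\<i> * complex_of_real x) - 1 - \<i> * complex_of_real x) \<le> x\<^sup>2"
proof -
 have "norm (exp (\<i> * complex_of_real x) - 1 - \<i> * complex_of_real x) \<le> \<bar>x\<bar>\<^sup>2 / 2"
  using iexp_approx1[of x 1] by (simp add: eval_nat_numeral diff_diff_eq)
 also have "\<dots> \<le> x\<^sup>2" by simp
 finally show ?thesis .
qed

lemma norm_levy_term_le: "norm (levy_term u a b) \<le> u\<^sup>2 * a\<^sup>2 + norm (exp (\<i> * complex_of_real (u * b)) - 1)"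
proof -
 have "levy_term u a b = (exp (\<i> * of_real (u * a)) - 1 - \<i> * of_real (u * a)) + exp (\<i> * of_real (u * a)) * (exp (\<i> * of_real (u * b)) - 1)"
  by (simp add: levy_term_def distrib_left exp_add algebra_simps)
 hence "norm (levy_term u a b) \<le> norm (exp (\<i> * complex_of_real (u * a)) - 1 - \<i> * of_real (u * a)) + norm (exp (\<i> * complex_of_real (u * a)) * (exp (\<i> * of_real (u * b)) - 1))"
  by (metis norm_triangle_ineq)
 also have "\<dots> \<le> u\<^sup>2 * a\<^sup>2 + norm (exp (\<i> * complex_of_real (u * b)) - 1)"
  using norm_exp_i_le_square[of "u * a"] by (simp add: norm_mult power_mult_distrib)
 finally show ?thesis .
qed

lemma norm_exp_i_minus_1_le_2: "norm (exp (\<i> * complex_of_real x) - 1) \<le> 2"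
 using norm_triangle_ineq4[of "exp (\<i> * complex_of_real x)" 1] by simp

text \<open>The small jumps are approximated only in \<open>L2\<close>, over marks of possibly
  infinite measure, so \<open>a' - a\<close> may occur only squared or multiplied by a square
  integrable factor. The regrouping arranges this: the factor is small with \<open>a\<close> and
  vanishes with \<open>b\<close>.\<close>

lemma norm_levy_term_diff:
 "norm (levy_term u a' b' - levy_term u a b) \<le>
   u\<^sup>2 * (a' - a)\<^sup>2 + \<bar>a' - a\<bar> * (u\<^sup>2 * \<bar>a\<bar> + \<bar>u\<bar> * norm (exp (\<i> * complex_of_real (u * b)) - 1))
   + norm (exp (\<i> * complex_of_real (u * b')) - exp (\<i> * complex_of_real (u * b)))"
proof -
 let ?d = "u * (a' - a)"
 let ?e = "\<lambda>x. exp (\<i> * complex_of_real x)"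
 have ed: "?e (u * a') = ?e (u * a) * ?e ?d" by (simp add: algebra_simps flip: exp_add)
 have "norm (levy_term u a' b' - levy_term u a b) =
   norm ((?e (u * a) * (?e ?d - 1 - \<i> * of_real ?d) + \<i> * of_real ?d * (?e (u * a) - 1))
   + (?e (u * a') * (?e (u * b') - ?e (u * b)) + ?e (u * a) * (?e ?d - 1) * (?e (u * b) - 1)))"
  unfolding levy_term_def distrib_left of_real_add exp_add ed by (rule arg_cong[where f=norm]) (simp add: algebra_simps)
 also have "\<dots> \<le> (norm (?e (u * a) * (?e ?d - 1 - \<i> * of_real ?d)) + norm (\<i> * of_real ?d * (?e (u * a) - 1)))
   + (norm (?e (u * a') * (?e (u * b') - ?e (u * b))) + norm (?e (u * a) * (?e ?d - 1) * (?e (u * b) - 1)))"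
  by (intro order_trans[OF norm_triangle_ineq] add_mono norm_triangle_ineq)
 also have "\<dots> \<le> (?d\<^sup>2 + \<bar>?d\<bar> * \<bar>u * a\<bar>) + (norm (?e (u * b') - ?e (u * b)) + \<bar>?d\<bar> * norm (?e (u * b) - 1))"
 proof (intro add_mono)
  show "norm (?e (u * a) * (?e ?d - 1 - \<i> * of_real ?d)) \<le> ?d\<^sup>2"
   using norm_exp_i_le_square[of ?d] by (simp only: norm_mult norm_exp_i_times mult_1)
  show "norm (\<i> * of_real ?d * (?e (u * a) - 1)) \<le> \<bar>?d\<bar> * \<bar>u * a\<bar>" unfolding norm_mult norm_of_real norm_ii mult_1
   by (intro mult_left_mono norm_exp_i_minus_1_le) simp
  show "norm (?e (u * a') * (?e (u * b') - ?e (u * b))) \<le> norm (?e (u * b') - ?e (u * b))" by (simp only: norm_mult norm_exp_i_times mult_1)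
  show "norm (?e (u * a) * (?e ?d - 1) * (?e (u * b) - 1)) \<le> \<bar>?d\<bar> * norm (?e (u * b) - 1)" unfolding norm_mult norm_exp_i_times mult_1
   by (intro mult_right_mono norm_exp_i_minus_1_le) simp
 qed
 also have "\<dots> = u\<^sup>2 * (a' - a)\<^sup>2 + \<bar>a' - a\<bar> * (u\<^sup>2 * \<bar>a\<bar> + \<bar>u\<bar> * norm (?e (u * b) - 1)) + norm (?e (u * b') - ?e (u * b))"
  unfolding abs_mult power_mult_distrib power2_abs[of u, symmetric] power2_eq_square[of "\<bar>u\<bar>"] by (simp only: ring_distribs ac_simps)
 finally show ?thesis .
qed

lemma levy_term_integrable:
 assumes [measurable]: "f \<in> borel_measurable M" "g \<in> borel_measurable M" and S: "S \<in> sets M" "emeasure M S < \<infinity>"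
  and g: "\<And>x. x \<in> space M ==> x \<notin> S ==> g x = 0" and f: "(\<integral>\<^sup>+x. ennreal ((f x)\<^sup>2) \<partial>M) < \<infinity>"
 shows "integrable M (\<lambda>x. levy_term u (f x) (g x))"
  and "norm (LINT x|M. levy_term u (f x) (g x)) \<le> u\<^sup>2 * enn2real (\<integral>\<^sup>+x. ennreal ((f x)\<^sup>2) \<partial>M) + 2 * measure M S"
proof -
 let ?a = "enn2real (\<integral>\<^sup>+x. ennreal ((f x)\<^sup>2) \<partial>M)"
 have f2: "integrable M (\<lambda>x. (f x)\<^sup>2)" using f by (intro integrableI_bounded) auto
 have bd: "norm (levy_term u (f x) (g x)) \<le> u\<^sup>2 * (f x)\<^sup>2 + 2 * indicator S x" if "x \<in> space M" for x
  using norm_levy_term_le[of u "f x" "g x"] norm_exp_i_minus_1_le_2[of "u * g x"] g[OF that] by (auto simp: indicator_def)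
 have i: "integrable M (\<lambda>x. u\<^sup>2 * (f x)\<^sup>2 + 2 * indicator S x)" using f2 S by auto
 show int: "integrable M (\<lambda>x. levy_term u (f x) (g x))"
  by (rule Bochner_Integration.integrable_bound[OF i]) (use bd in \<open>auto intro!: AE_I2 intro: order_trans\<close>)
 have "norm (LINT x|M. levy_term u (f x) (g x)) \<le> (LINT x|M. norm (levy_term u (f x) (g x)))" by (rule integral_norm_bound)
 also have "\<dots> \<le> (LINT x|M. u\<^sup>2 * (f x)\<^sup>2 + 2 * indicator S x)" using int i bd by (intro integral_mono) auto
 also have "\<dots> = u\<^sup>2 * (LINT x|M. (f x)\<^sup>2) + 2 * measure M S" using f2 S by simp
 also have "(LINT x|M. (f x)\<^sup>2) = ?a" by (rule integral_eq_nn_integral) auto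
 finally show "norm (LINT x|M. levy_term u (f x) (g x)) \<le> u\<^sup>2 * ?a + 2 * measure M S" .
qed

lemma L1_integral_limit:
 fixes h :: "'a => 'b::{banach, second_countable_topology}"
 assumes [measurable]: "\<And>k. h' k \<in> borel_measurable M" and h: "integrable M h"
  and d: "(\<lambda>k. \<integral>\<^sup>+x. ennreal (norm (h' k x - h x)) \<partial>M) \<longlonglongrightarrow> 0"
 shows "eventually (\<lambda>k. integrable M (h' k)) sequentially" "(\<lambda>k. \<integral>x. h' k x \<partial>M) \<longlonglongrightarrow> (LINT x|M. h x)"
proof -
 let ?a = "\<lambda>k. ennreal (norm ((LINT x|M. h' k x) - (LINT x|M. h x)))"
 have "eventually (\<lambda>k. (\<integral>\<^sup>+x. ennreal (norm (h' k x - h x)) \<partial>M) < 1) sequentially" by (rule order_tendstoD[OF d]) simp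
 thus ev: "eventually (\<lambda>k. integrable M (h' k)) sequentially"
 proof eventually_elim
  case (elim k)
  hence "integrable M (\<lambda>x. h' k x - h x)" using h by (intro integrableI_bounded) (auto intro: less_trans)
  from Bochner_Integration.integrable_add[OF this h] show ?case by simp
 qed
 have "(\<lambda>k. ?a k) \<longlonglongrightarrow> 0"
 proof (rule tendsto_sandwich[OF _ _ tendsto_const d])
  show "\<forall>\<^sub>F k in sequentially. ?a k \<le> (\<integral>\<^sup>+x. ennreal (norm (h' k x - h x)) \<partial>M)"
   using ev by eventually_elim (use h in \<open>simp flip: Bochner_Integration.integral_diff add: integral_norm_bound_ennreal\<close>)
 qed simp
 thus "(\<lambda>k. \<integral>x. h' k x \<partial>M) \<longlonglongrightarrow> (LINT x|M. h x)"
  by (simp add: ennreal_tendsto_0_iff tendsto_norm_zero_iff LIM_zero_iff)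
qed

text \<open>The two arguments converge in different ways: the compensated one in \<open>L2\<close>,
  the raw one pointwise on a set \<open>S\<close> of finite measure, where exponentials are
  dominated by a constant. Together with \<open>norm_levy_term_diff\<close> this gives convergence
  in \<open>L1\<close>.\<close>

lemma levy_term_integral_limit:
 fixes f g :: "'a => real" and f' g' :: "nat => 'a => real"
 assumes [measurable]: "f \<in> borel_measurable M" "g \<in> borel_measurable M" "\<And>k. f' k \<in> borel_measurable M" "\<And>k. g' k \<in> borel_measurable M"
  and S: "S \<in> sets M" "emeasure M S < \<infinity>"
  and g: "\<And>x. x \<in> space M ==> x \<notin> S ==> g x = 0" "\<And>k x. x \<in> space M ==> x \<notin> S ==> g' k x = 0"
  and f: "(\<integral>\<^sup>+x. ennreal ((f x)\<^sup>2) \<partial>M) < \<infinity>"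
  and ff: "(\<lambda>k. \<integral>\<^sup>+x. ennreal ((f' k x - f x)\<^sup>2) \<partial>M) \<longlonglongrightarrow> 0"
  and gg: "\<And>x. x \<in> space M ==> (\<lambda>k. g' k x) \<longlonglongrightarrow> g x"
 shows "eventually (\<lambda>k. integrable M (\<lambda>x. levy_term u (f' k x) (g' k x))) sequentially"
  and "(\<lambda>k. \<integral>x. levy_term u (f' k x) (g' k x) \<partial>M) \<longlonglongrightarrow> (LINT x|M. levy_term u (f x) (g x))"
proof -
 let ?e = "\<lambda>a. exp (\<i> * complex_of_real (u * a)) - 1"
 define w where "w x = u\<^sup>2 * \<bar>f x\<bar> + \<bar>u\<bar> * norm (?e (g x))" for x
 have [measurable]: "w \<in> borel_measurable M" unfolding w_def by measurable
 have fi: "integrable M (\<lambda>x. (f x)\<^sup>2)" using f by (intro integrableI_bounded) auto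
 have e2: "norm (?e a) \<le> 2" for a using norm_exp_i_minus_1_le_2[of "u * a"] by simp
 have "integrable M (\<lambda>x. (w x)\<^sup>2)"
 proof (rule Bochner_Integration.integrable_bound[where f="\<lambda>x. 2 * u^4 * (f x)\<^sup>2 + 8 * u\<^sup>2 * indicator S x"])
  show "integrable M (\<lambda>x. 2 * u^4 * (f x)\<^sup>2 + 8 * u\<^sup>2 * indicator S x)" using fi S by auto
  show "AE x in M. norm ((w x)\<^sup>2) \<le> norm (2 * u^4 * (f x)\<^sup>2 + 8 * u\<^sup>2 * indicator S x)"
  proof (rule AE_I2)
   fix x assume x: "x \<in> space M"
   have "(w x)\<^sup>2 \<le> 2 * (u\<^sup>2 * \<bar>f x\<bar>)\<^sup>2 + 2 * (\<bar>u\<bar> * norm (?e (g x)))\<^sup>2"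
    unfolding w_def using zero_le_power2[of "u\<^sup>2 * \<bar>f x\<bar> - \<bar>u\<bar> * norm (?e (g x))"] by (simp add: power2_eq_square algebra_simps)
   also have "(\<bar>u\<bar> * norm (?e (g x)))\<^sup>2 \<le> 4 * u\<^sup>2 * indicator S x"
    using mult_left_mono[OF power_mono[OF e2[of "g x"] norm_ge_zero, of 2], of "u\<^sup>2"] g(1)[OF x] by (cases "x \<in> S") (auto simp: power_mult_distrib)
   finally show "norm ((w x)\<^sup>2) \<le> norm (2 * u^4 * (f x)\<^sup>2 + 8 * u\<^sup>2 * indicator S x)" by (simp add: power_mult_distrib)
  qed
 qed measurable
 hence w2: "(\<integral>\<^sup>+x. ennreal ((w x)\<^sup>2) \<partial>M) < \<infinity>" by (simp add: integrable_iff_bounded)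
 have "(\<lambda>k. ennreal (u\<^sup>2) * (\<integral>\<^sup>+x. ennreal ((f' k x - f x)\<^sup>2) \<partial>M)) \<longlonglongrightarrow> ennreal (u\<^sup>2) * 0"
  by (intro tendsto_mult_ennreal tendsto_const ff) auto
 moreover have "(\<lambda>k. \<integral>\<^sup>+x. ennreal (\<bar>f' k x - f x\<bar> * \<bar>w x\<bar>) \<partial>M) \<longlonglongrightarrow> 0"
  by (rule L2_times_tendsto_0[OF _ _ ff w2]) measurable
 moreover have "(\<lambda>k. \<integral>\<^sup>+x. ennreal (norm (?e (g x) - ?e (g' k x))) \<partial>M) \<longlonglongrightarrow> 0"
 proof (rule nn_integral_dominated_convergence_norm[where w="\<lambda>x. 2 * indicator S x"])
  show "(\<integral>\<^sup>+x. ennreal (2 * indicator S x) \<partial>M) < \<infinity>"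
   using S by (simp add: ennreal_mult' ennreal_indicator nn_integral_cmult_indicator ennreal_mult_less_top)
  show "AE x in M. (\<lambda>k. ?e (g' k x)) \<longlonglongrightarrow> ?e (g x)" by (intro AE_I2 tendsto_intros gg)
  show "AE x in M. norm (?e (g' k x)) \<le> 2 * indicator S x" for k using e2 g(2)[of _ k] by (intro AE_I2) (auto simp: indicator_def)
 qed (use S in measurable)
 ultimately have "(\<lambda>k. ennreal (u\<^sup>2) * (\<integral>\<^sup>+x. ennreal ((f' k x - f x)\<^sup>2) \<partial>M) + (\<integral>\<^sup>+x. ennreal (\<bar>f' k x - f x\<bar> * \<bar>w x\<bar>) \<partial>M)
   + (\<integral>\<^sup>+x. ennreal (norm (?e (g x) - ?e (g' k x))) \<partial>M)) \<longlonglongrightarrow> ennreal (u\<^sup>2) * 0 + 0 + 0"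
  by (intro tendsto_add)
 hence lsum: "(\<lambda>k. \<integral>\<^sup>+x. ennreal (u\<^sup>2 * (f' k x - f x)\<^sup>2 + \<bar>f' k x - f x\<bar> * \<bar>w x\<bar> + norm (?e (g x) - ?e (g' k x))) \<partial>M) \<longlonglongrightarrow> 0"
  by (simp add: nn_integral_add ennreal_mult nn_integral_cmult)
 have lim: "(\<lambda>k. \<integral>\<^sup>+x. ennreal (norm (levy_term u (f' k x) (g' k x) - levy_term u (f x) (g x))) \<partial>M) \<longlonglongrightarrow> 0"
 proof (rule tendsto_sandwich[OF always_eventually[OF allI[OF zero_le]] _ tendsto_const lsum], intro always_eventually allI nn_integral_mono ennreal_leI)
  show "norm (levy_term u (f' k x) (g' k x) - levy_term u (f x) (g x)) \<le> u\<^sup>2 * (f' k x - f x)\<^sup>2 + \<bar>f' k x - f x\<bar> * \<bar>w x\<bar> + norm (?e (g x) - ?e (g' k x))" for k x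
   using norm_levy_term_diff[of u "f' k x" "g' k x" "f x" "g x"] by (simp add: w_def norm_minus_commute)
 qed
 note L = L1_integral_limit[OF _ levy_term_integrable(1)[OF _ _ S g(1) f] lim]
 show "eventually (\<lambda>k. integrable M (\<lambda>x. levy_term u (f' k x) (g' k x))) sequentially" by (rule L(1)) measurable
 show "(\<lambda>k. \<integral>x. levy_term u (f' k x) (g' k x) \<partial>M) \<longlonglongrightarrow> (LINT x|M. levy_term u (f x) (g x))" by (rule L(2)) measurable
qed

lemma L2_square_integral_limit:
 fixes f :: "'a => real" and f' :: "nat => 'a => real"
 assumes [measurable]: "f \<in> borel_measurable M" "\<And>k. f' k \<in> borel_measurable M"
  and f: "(\<integral>\<^sup>+x. ennreal ((f x)\<^sup>2) \<partial>M) < \<infinity>"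
  and ff: "(\<lambda>k. \<integral>\<^sup>+x. ennreal ((f' k x - f x)\<^sup>2) \<partial>M) \<longlonglongrightarrow> 0"
 shows "eventually (\<lambda>k. integrable M (\<lambda>x. (f' k x)\<^sup>2)) sequentially"
  and "(\<lambda>k. \<integral>x. (f' k x)\<^sup>2 \<partial>M) \<longlonglongrightarrow> (LINT x|M. (f x)\<^sup>2)"
proof -
 have l2: "(\<lambda>k. \<integral>\<^sup>+x. ennreal (\<bar>f' k x - f x\<bar> * \<bar>f x\<bar>) \<partial>M) \<longlonglongrightarrow> 0"
  by (rule L2_times_tendsto_0[OF _ _ ff f]) measurable
 have lsum: "(\<lambda>k. \<integral>\<^sup>+x. ennreal ((f' k x - f x)\<^sup>2 + 2 * (\<bar>f' k x - f x\<bar> * \<bar>f x\<bar>)) \<partial>M) \<longlonglongrightarrow> 0"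
  using tendsto_add[OF ff tendsto_mult_ennreal[OF tendsto_const l2, of 2]] by (simp add: nn_integral_add ennreal_mult nn_integral_cmult)
 have lim: "(\<lambda>k. \<integral>\<^sup>+x. ennreal (norm ((f' k x)\<^sup>2 - (f x)\<^sup>2)) \<partial>M) \<longlonglongrightarrow> 0"
 proof (rule tendsto_sandwich[OF always_eventually[OF allI[OF zero_le]] _ tendsto_const lsum], intro always_eventually allI nn_integral_mono ennreal_leI)
  fix k x
  have "(f' k x)\<^sup>2 - (f x)\<^sup>2 = (f' k x - f x)\<^sup>2 + 2 * ((f' k x - f x) * f x)" by (simp add: power2_eq_square algebra_simps)
  thus "norm ((f' k x)\<^sup>2 - (f x)\<^sup>2) \<le> (f' k x - f x)\<^sup>2 + 2 * (\<bar>f' k x - f x\<bar> * \<bar>f x\<bar>)"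
   using abs_triangle_ineq[of "(f' k x - f x)\<^sup>2" "2 * ((f' k x - f x) * f x)"] by (simp add: abs_mult)
 qed
 have "integrable M (\<lambda>x. (f x)\<^sup>2)" using f by (intro integrableI_bounded) auto
 note L = L1_integral_limit[OF _ this lim]
 show "eventually (\<lambda>k. integrable M (\<lambda>x. (f' k x)\<^sup>2)) sequentially" by (rule L(1)) measurable
 show "(\<lambda>k. \<integral>x. (f' k x)\<^sup>2 \<partial>M) \<longlonglongrightarrow> (LINT x|M. (f x)\<^sup>2)" by (rule L(2)) measurable
qed

context noisy_space begin

lemma symbol_rate_eq: "symbol_rate u \<sigma> v f g = - of_real (u\<^sup>2 * \<sigma>\<^sup>2 / 2 * v\<^sup>2) + (LINT y|\<nu>. levy_term u (f y) (g y))"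
 by (simp add: symbol_rate_def levy_term_def)

definition rate_integral :: "real => real => real => real => (real => real) => (real => 'e => real) => (real => 'e => real) => complex" where
 "rate_integral u \<sigma> s t h f g = (LINT r:{s<..t}|lborel. symbol_rate u \<sigma> (h r) (f r) (g r))"

lemma rate_integral_split:
 assumes h: "integrable (interval_measure s t) (\<lambda>r. (h r)\<^sup>2)"
  and l: "integrable (interval_measure s t \<Otimes>\<^sub>M \<nu>) (\<lambda>p. levy_term u (f (fst p) (snd p)) (g (fst p) (snd p)))"
 shows "rate_integral u \<sigma> s t h f g = - of_real (u\<^sup>2 * \<sigma>\<^sup>2 / 2 * (LINT r|interval_measure s t. (h r)\<^sup>2))
  + (LINT p|(interval_measure s t \<Otimes>\<^sub>M \<nu>). levy_term u (f (fst p) (snd p)) (g (fst p) (snd p)))"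
proof -
 let ?a = "\<lambda>r. u\<^sup>2 * \<sigma>\<^sup>2 / 2 * (h r)\<^sup>2"
 let ?b = "\<integral>r. (LINT y|\<nu>. levy_term u (f r y) (g r y)) \<partial>interval_measure s t"
 interpret t: finite_measure "interval_measure s t" by (rule finite_interval_measure)
 interpret tm: pair_sigma_finite "interval_measure s t" \<nu> ..
 have fub: "?b
   = (LINT p|(interval_measure s t \<Otimes>\<^sub>M \<nu>). levy_term u (f (fst p) (snd p)) (g (fst p) (snd p)))"
  using tm.integral_fst'[OF l] by simp
 have int: "integrable (interval_measure s t) (\<lambda>r. \<integral>y. levy_term u (f r y) (g r y) \<partial>\<nu>)"
  using tm.integrable_fst'[OF l] by simp
 have hi: "integrable (interval_measure s t) (\<lambda>r. - complex_of_real (?a r))"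
  using h by (intro Bochner_Integration.integrable_minus integrable_of_real integrable_mult_right)
 have "rate_integral u \<sigma> s t h f g = (LINT r|interval_measure s t. symbol_rate u \<sigma> (h r) (f r) (g r))"
  unfolding rate_integral_def set_lebesgue_integral_def by (subst integral_restrict_space) auto
 also have "\<dots> = (LINT r|interval_measure s t. - of_real (?a r) + (LINT y|\<nu>. levy_term u (f r y) (g r y)))" by (simp add: symbol_rate_eq)
 also have "\<dots> = (LINT r|interval_measure s t. - of_real (?a r)) + ?b" by (intro Bochner_Integration.integral_add hi int)
 also have "(LINT r|interval_measure s t. - complex_of_real (?a r)) = - of_real (u\<^sup>2 * \<sigma>\<^sup>2 / 2 * (LINT r|interval_measure s t. (h r)\<^sup>2))"
  by (simp add: integral_complex_of_real flip: of_real_power)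
 finally show ?thesis unfolding fub .
qed

lemma rate_integral_limit:
 fixes h :: "real => real" and f g :: "real => 'e => real"
 assumes s: "0 \<le> s" "s \<le> t"
  and hm [measurable]: "h \<in> borel_measurable (interval_measure s t)" "\<And>k. h' k \<in> borel_measurable (interval_measure s t)"
  and fm [measurable]: "(\<lambda>p. f (fst p) (snd p)) \<in> borel_measurable (interval_measure s t \<Otimes>\<^sub>M \<nu>)"
   "\<And>k. (\<lambda>p. f' k (fst p) (snd p)) \<in> borel_measurable (interval_measure s t \<Otimes>\<^sub>M \<nu>)"
  and gm [measurable]: "\<And>k. (\<lambda>p. g' k (fst p) (snd p)) \<in> borel_measurable (interval_measure s t \<Otimes>\<^sub>M \<nu>)"
  and S: "S \<in> sets \<nu>" "emeasure \<nu> S < \<infinity>"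
  and g0: "\<And>r y k. s < r ==> r \<le> t ==> y \<in> space \<nu> ==> y \<notin> S ==> g' k r y = 0"
  and glim: "\<And>r y. s < r ==> r \<le> t ==> y \<in> space \<nu> ==> (\<lambda>k. g' k r y) \<longlonglongrightarrow> g r y"
  and h2: "(\<integral>\<^sup>+r. ennreal ((h r)\<^sup>2) \<partial>interval_measure s t) < \<infinity>"
  and hlim: "(\<lambda>k. \<integral>\<^sup>+r\<in>{0<..t}. ennreal ((h r - h' k r)\<^sup>2) \<partial>lborel) \<longlonglongrightarrow> 0"
  and f2: "(\<integral>\<^sup>+p. ennreal ((f (fst p) (snd p))\<^sup>2) \<partial>(interval_measure s t \<Otimes>\<^sub>M \<nu>)) < \<infinity>"
  and flim: "(\<lambda>k. \<integral>\<^sup>+r\<in>{0<..t}. (\<integral>\<^sup>+y. ennreal ((f r y - f' k r y)\<^sup>2) \<partial>\<nu>) \<partial>lborel) \<longlonglongrightarrow> 0"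
 shows "(\<lambda>k. rate_integral u \<sigma> s t (h' k) (f' k) (g' k)) \<longlonglongrightarrow> rate_integral u \<sigma> s t h f g"
proof -
 let ?a = "interval_measure s t \<Otimes>\<^sub>M \<nu>"
 let ?b = "\<lambda>k. \<integral>\<^sup>+p. ennreal ((f' k (fst p) (snd p) - f (fst p) (snd p))\<^sup>2) \<partial>?a"
 let ?c = "\<lambda>r k. \<integral>\<^sup>+y. ennreal ((f r y - f' k r y)\<^sup>2) \<partial>\<nu>"
 let ?d = "\<lambda>k. of_real (u\<^sup>2 * \<sigma>\<^sup>2 / 2 * (LINT r|interval_measure s t. (h' k r)\<^sup>2))"
 let ?e = "\<lambda>k. \<integral>p. levy_term u (f' k (fst p) (snd p)) (g' k (fst p) (snd p)) \<partial>?a"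
 interpret t: finite_measure "interval_measure s t" by (rule finite_interval_measure)
 have sp: "space (interval_measure s t) = {s<..t}" by (simp add: space_restrict_space)
 have le: "(\<integral>\<^sup>+r. w r \<partial>interval_measure s t) \<le> (\<integral>\<^sup>+r\<in>{0<..t}. w r \<partial>lborel)" for w
 proof -
  have "(\<integral>\<^sup>+r. w r \<partial>interval_measure s t) = (\<integral>\<^sup>+r. w r * indicator {s<..t} r \<partial>lborel)"
   by (subst nn_integral_restrict_space) auto
  also have "\<dots> \<le> (\<integral>\<^sup>+r\<in>{0<..t}. w r \<partial>lborel)" using s by (intro nn_integral_mono) (auto simp: indicator_def)
  finally show ?thesis .
 qed
 have hh: "(\<lambda>k. \<integral>\<^sup>+r. ennreal ((h' k r - h r)\<^sup>2) \<partial>interval_measure s t) \<longlonglongrightarrow> 0"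
 proof (rule tendsto_sandwich[OF _ _ tendsto_const hlim])
  show "\<forall>\<^sub>F k in sequentially. (\<integral>\<^sup>+r. ennreal ((h' k r - h r)\<^sup>2) \<partial>interval_measure s t) \<le> (\<integral>\<^sup>+r\<in>{0<..t}. ennreal ((h r - h' k r)\<^sup>2) \<partial>lborel)"
   using le[of "\<lambda>r. ennreal ((h r - h' k r)\<^sup>2)" for k] by (simp add: power2_commute)
 qed simp
 have ff: "(\<lambda>k. \<integral>\<^sup>+p. ennreal ((f' k (fst p) (snd p) - f (fst p) (snd p))\<^sup>2) \<partial>?a) \<longlonglongrightarrow> 0"
 proof (rule tendsto_sandwich[OF _ _ tendsto_const flim])
  show "\<forall>\<^sub>F k in sequentially. (?b k)
   \<le> (\<integral>\<^sup>+r\<in>{0<..t}. (?c r k) \<partial>lborel)"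
  proof (intro always_eventually allI)
   fix k
   have "(?b k)
    = (\<integral>\<^sup>+r. (?c r k) \<partial>interval_measure s t)" by (subst mark.nn_integral_fst[symmetric]) (auto simp: power2_commute)
   thus "(?b k)
    \<le> (\<integral>\<^sup>+r\<in>{0<..t}. (?c r k) \<partial>lborel)"
    using le[of "\<lambda>r. \<integral>\<^sup>+y. ennreal ((f r y - f' k r y)\<^sup>2) \<partial>\<nu>"] by simp
  qed
 qed simp
 have gm' [measurable]: "(\<lambda>p. g (fst p) (snd p)) \<in> borel_measurable ?a"
 proof (rule borel_measurable_LIMSEQ_metric[OF gm])
  fix p assume "p \<in> space ?a"
  thus "(\<lambda>k. g' k (fst p) (snd p)) \<longlonglongrightarrow> g (fst p) (snd p)" using sp by (auto simp: space_pair_measure intro!: glim)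
 qed
 let ?S = "{s<..t} \<times> S"
 have "{s<..t} \<in> sets (interval_measure s t)" by (simp add: sets_restrict_space_iff)
 hence SS: "?S \<in> sets ?a" "emeasure ?a ?S < \<infinity>"
  using S by (auto simp: mark.emeasure_pair_measure_Times t.emeasure_eq_measure ennreal_mult_less_top)
 have g00: "g r y = 0" if "s < r" "r \<le> t" "y \<in> space \<nu>" "y \<notin> S" for r y
  using glim[OF that(1,2,3)] g0[OF that] by (simp add: LIMSEQ_const_iff)
 note L = levy_term_integral_limit[where M="interval_measure s t \<Otimes>\<^sub>M \<nu>" and f="\<lambda>p. f (fst p) (snd p)" and g="\<lambda>p. g (fst p) (snd p)"
   and f'="\<lambda>k p. f' k (fst p) (snd p)" and g'="\<lambda>k p. g' k (fst p) (snd p)" and u=u, OF fm(1) gm' fm(2) gm SS _ _ f2 ff]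
 have L1: "eventually (\<lambda>k. integrable ?a (\<lambda>p. levy_term u (f' k (fst p) (snd p)) (g' k (fst p) (snd p)))) sequentially"
  and L2: "(\<lambda>k. \<integral>p. levy_term u (f' k (fst p) (snd p)) (g' k (fst p) (snd p)) \<partial>?a)
    \<longlonglongrightarrow> (LINT p|?a. levy_term u (f (fst p) (snd p)) (g (fst p) (snd p)))"
  using sp by (auto simp: space_pair_measure intro!: L g0 g00 glim)
 have L3: "integrable ?a (\<lambda>p. levy_term u (f (fst p) (snd p)) (g (fst p) (snd p)))"
 proof (rule levy_term_integrable(1)[OF fm(1) gm' SS _ f2])
  fix p assume "p \<in> space ?a" "p \<notin> ?S"
  thus "g (fst p) (snd p) = 0" using sp g00[of "fst p" "snd p"] by (cases p) (auto simp: space_pair_measure)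
 qed
 note Q = L2_square_integral_limit[OF hm h2 hh]
 have hi: "integrable (interval_measure s t) (\<lambda>r. (h r)\<^sup>2)" using h2 by (intro integrableI_bounded) auto
 have "eventually (\<lambda>k. rate_integral u \<sigma> s t (h' k) (f' k) (g' k) = - ?d k
  + (?e k)) sequentially" using L1 Q(1) by eventually_elim (rule rate_integral_split)
 hence ev: "eventually (\<lambda>k. - ?d k
  + (?e k) = rate_integral u \<sigma> s t (h' k) (f' k) (g' k)) sequentially" by eventually_elim simp
 show ?thesis unfolding rate_integral_split[OF hi L3] by (rule Lim_transform_eventually[OF _ ev]) (intro tendsto_intros Q L2)
qed

lemma norm_rate_integral_le:
 assumes s: "s \<le> t" and S: "S \<in> sets \<nu>" "emeasure \<nu> S < \<infinity>"
  and fm: "\<And>r. s < r ==> r \<le> t ==> f r \<in> borel_measurable \<nu>" "\<And>r. s < r ==> r \<le> t ==> g r \<in> borel_measurable \<nu>"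
  and g0: "\<And>r y. s < r ==> r \<le> t ==> y \<in> space \<nu> ==> y \<notin> S ==> g r y = 0"
  and h: "\<And>r. s < r ==> r \<le> t ==> (h r)\<^sup>2 \<le> K0"
  and f: "\<And>r. s < r ==> r \<le> t ==> (\<integral>\<^sup>+y. ennreal ((f r y)\<^sup>2) \<partial>\<nu>) \<le> ennreal K1" and K: "0 \<le> K0" "0 \<le> K1"
 shows "norm (rate_integral u \<sigma> s t h f g) \<le> (u\<^sup>2 * \<sigma>\<^sup>2 / 2 * K0 + u\<^sup>2 * K1 + 2 * measure \<nu> S) * (t - s)"
proof -
 let ?a = "\<lambda>r. \<integral>\<^sup>+y. ennreal ((f r y)\<^sup>2) \<partial>\<nu>"
 let ?K = "u\<^sup>2 * \<sigma>\<^sup>2 / 2 * K0 + u\<^sup>2 * K1 + 2 * measure \<nu> S"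
 have bd: "norm (symbol_rate u \<sigma> (h r) (f r) (g r)) \<le> ?K" if r: "s < r" "r \<le> t" for r
 proof -
  have fin: "(?a r) < \<infinity>" using f[OF r] by (rule le_less_trans) simp
  have "enn2real (?a r) \<le> K1" using f[OF r] K by (intro enn2real_leI)
  hence "u\<^sup>2 * enn2real (?a r) \<le> u\<^sup>2 * K1" by (intro mult_left_mono) auto
  hence n1: "norm (LINT y|\<nu>. levy_term u (f r y) (g r y)) \<le> u\<^sup>2 * K1 + 2 * measure \<nu> S"
   using levy_term_integrable(2)[OF fm(1)[OF r] fm(2)[OF r] S g0[OF r] fin, of u] by linarith
  have "norm (- complex_of_real (u\<^sup>2 * \<sigma>\<^sup>2 / 2 * (h r)\<^sup>2)) = u\<^sup>2 * \<sigma>\<^sup>2 / 2 * (h r)\<^sup>2" unfolding norm_minus_cancel norm_of_real by simp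
  also have "\<dots> \<le> u\<^sup>2 * \<sigma>\<^sup>2 / 2 * K0" using h[OF r] by (intro mult_left_mono) auto
  finally show ?thesis
   unfolding symbol_rate_eq using n1 norm_triangle_ineq[of "- complex_of_real (u\<^sup>2 * \<sigma>\<^sup>2 / 2 * (h r)\<^sup>2)" "\<integral>y. levy_term u (f r y) (g r y) \<partial>\<nu>"] by linarith
 qed
 have K0: "0 \<le> ?K" using K by auto
 show ?thesis
 proof (cases "set_integrable lborel {s<..t} (\<lambda>r. symbol_rate u \<sigma> (h r) (f r) (g r))")
  case True
  have "norm (rate_integral u \<sigma> s t h f g) \<le> (LINT r|lborel. norm (indicator {s<..t} r *\<^sub>R symbol_rate u \<sigma> (h r) (f r) (g r)))"
   unfolding rate_integral_def set_lebesgue_integral_def by (rule integral_norm_bound)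
  also have "\<dots> \<le> (LINT r|lborel. ?K * indicator {s<..t} r)" using True bd s unfolding set_integrable_def
   by (intro integral_mono integrable_norm integrable_mult_right integrable_real_indicator) (auto simp: indicator_def)
  also have "\<dots> = ?K * (t - s)" using s by simp
  finally show ?thesis .
 next
  \<comment> \<open>An integral that does not exist has the value 0, so the bound needs no joint
    measurability of the integrand.\<close>
  case False
  hence "rate_integral u \<sigma> s t h f g = 0"
   unfolding rate_integral_def set_integrable_def set_lebesgue_integral_def by (rule not_integrable_integral_eq)
  thus ?thesis using K0 s by simp
 qed
qed

text \<open>The truncation in \<open>simple_exp_martingale\<close> is used at level
  \<open>C + 1\<close>, strictly above the bound of the limit \<open>I\<close>. It is therefore
  eventually inactive on almost every path, and the error term, a probability, tends to 0.\<close>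

lemma exp_martingale_limit:
 fixes Z :: "'a => complex"
 assumes D: "\<And>k. simple_integrand P F (count_space UNIV) (D1 k)" "\<And>k. simple_integrand P F \<nu> (D2 k)" "\<And>k. simple_integrand P F \<nu> (D3 k)"
  and st: "0 \<le> s" "s \<le> t"
  and Z: "Z \<in> borel_measurable (F s)" and Zb: "\<And>y. y \<in> space P ==> norm (Z y) \<le> 1"
  and lim1: "AE y in P. (\<lambda>k. exponent \<sigma> (D1 k) (D2 k) (D3 k) s t y) \<longlonglongrightarrow> \<Theta> y"
  and lim2: "AE y in P. (\<lambda>k. LINT r:{s<..t}|lborel. simple_rate u \<sigma> (D1 k) (D2 k) (D3 k) r y) \<longlonglongrightarrow> I y"
  and bound: "AE y in P. - Re (I y) \<le> C" and C: "0 \<le> C"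
 shows "(LINT y|P. Z y * exp (\<i> * of_real (u * \<Theta> y) - I y)) = (LINT y|P. Z y)"
proof -
 let ?a = "\<lambda>y. exp (\<i> * of_real (u * \<Theta> y) - I y)"
 let ?b = "\<integral>y. Z y \<partial>P"
 have sn: "simple_noise P F W \<nu> N (D1 k) (D2 k) (D3 k)" for k by (intro simple_noise.intro noisy_space_axioms simple_noise_axioms.intro D)
 define Ik where "Ik k y = (LINT r:{s<..t}|lborel. simple_rate u \<sigma> (D1 k) (D2 k) (D3 k) r y)" for k y
 define Tk where "Tk k y = exponent \<sigma> (D1 k) (D2 k) (D3 k) s t y" for k y
 have [measurable]: "Ik k \<in> borel_measurable P" for k using measurable_F[OF simple_noise.rate_int_adapted[OF sn st]] st unfolding Ik_def by simp
 have Tm [measurable]: "Tk k \<in> borel_measurable P" for k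
  using measurable_F[OF simple_noise.exponent_measurable[OF sn st]] st unfolding Tk_def by simp
 have Zm [measurable]: "Z \<in> borel_measurable P" by (rule measurable_F[OF Z st(1)])
 have Im [measurable]: "I \<in> borel_measurable P" using measurable_P_AE_LIMSEQ[of Ik I] lim2 unfolding Ik_def[symmetric] by simp
 have \<Theta>m [measurable]: "\<Theta> \<in> borel_measurable P" using measurable_P_AE_LIMSEQ[OF Tm] lim1 unfolding Tk_def[symmetric] by simp
 define R where "R k y = (if - Re (Ik k y) \<le> C + 1 then exp (\<i> * of_real (u * Tk k y) - Ik k y) else 0)" for k y
 have Rm [measurable]: "R k \<in> borel_measurable P" for k unfolding R_def by measurable
 have Rb: "norm (R k y) \<le> exp (C + 1)" for k y by (simp add: R_def)
 have near: "norm ((LINT y|P. Z y * R k y) - ?b) \<le> exp (C + 1) * prob {y\<in>space P. C + 1 < - Re (Ik k y)}" for k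
  using simple_noise.simple_exp_martingale[OF sn st _ Z Zb, of "C + 1" u \<sigma> k] C unfolding R_def Ik_def[symmetric] Tk_def[symmetric] by simp
 have ev: "AE y in P. eventually (\<lambda>k. - Re (Ik k y) < C + 1) sequentially" using lim2 bound
 proof eventually_elim
  case (elim y)
  have "(\<lambda>k. - Re (Ik k y)) \<longlonglongrightarrow> - Re (I y)" using elim(1) unfolding Ik_def[symmetric] by (intro tendsto_intros)
  thus ?case by (rule order_tendstoD) (use elim(2) in simp)
 qed
 have p0: "(\<lambda>k. prob {y\<in>space P. C + 1 < - Re (Ik k y)}) \<longlonglongrightarrow> 0"
 proof -
  have "(\<lambda>k. \<integral>y. (indicator {y\<in>space P. C + 1 < - Re (Ik k y)} y :: real) \<partial>P) \<longlonglongrightarrow> (LINT y|P. 0)"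
  proof (rule integral_dominated_convergence[where w="\<lambda>_. 1"])
   show "AE y in P. (\<lambda>k. indicator {y\<in>space P. C + 1 < - Re (Ik k y)} y :: real) \<longlonglongrightarrow> 0" using ev
   proof eventually_elim
    case (elim y)
    hence "eventually (\<lambda>k. 0 = (indicator {y\<in>space P. C + 1 < - Re (Ik k y)} y :: real)) sequentially"
     by eventually_elim (auto simp: indicator_def)
    thus ?case by (rule Lim_transform_eventually[OF tendsto_const])
   qed
  qed (auto simp: indicator_def)
  thus ?thesis by simp
 qed
 have "(\<lambda>k. \<integral>y. Z y * R k y \<partial>P) \<longlonglongrightarrow> (LINT y|P. Z y * ?a y)"
 proof (rule integral_dominated_convergence[where w="\<lambda>_. exp (C + 1)"])
  show "AE y in P. (\<lambda>k. Z y * R k y) \<longlonglongrightarrow> Z y * ?a y" using ev lim1 lim2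
  proof eventually_elim
   case (elim y)
   have e: "eventually (\<lambda>k. Z y * exp (\<i> * of_real (u * Tk k y) - Ik k y) = Z y * R k y) sequentially"
    using elim(1) by eventually_elim (simp add: R_def)
   have "(\<lambda>k. Z y * exp (\<i> * of_real (u * Tk k y) - Ik k y)) \<longlonglongrightarrow> Z y * ?a y"
    using elim(2,3) unfolding Tk_def Ik_def by (intro tendsto_intros)
   thus ?case by (rule Lim_transform_eventually[OF _ e])
  qed
  show "AE y in P. norm (Z y * R k y) \<le> exp (C + 1)" for k
   using Zb Rb mult_mono[of "norm (Z y)" 1 "norm (R k y)" "exp (C + 1)" for y] by (auto intro!: AE_I2 simp: norm_mult)
 qed auto
 moreover have "(\<lambda>k. \<integral>y. Z y * R k y \<partial>P) \<longlonglongrightarrow> ?b"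
 proof (rule LIM_zero_cancel, rule Lim_null_comparison)
  show "\<forall>\<^sub>F k in sequentially. norm ((LINT y|P. Z y * R k y) - ?b) \<le> exp (C + 1) * prob {y\<in>space P. C + 1 < - Re (Ik k y)}"
   using near by (auto intro: always_eventually)
  show "(\<lambda>k. exp (C + 1) * prob {y\<in>space P. C + 1 < - Re (Ik k y)}) \<longlonglongrightarrow> 0" using tendsto_mult_right_zero[OF p0] .
 qed
 ultimately show ?thesis by (rule LIMSEQ_unique)
qed

end

section \<open>Exponential martingale of the stopped solution\<close>

lemma ennreal_abs_diff_tendsto:
 fixes a :: "nat => real"
 assumes "(\<lambda>k. ennreal \<bar>l - a k\<bar>) \<longlonglongrightarrow> 0" shows "a \<longlonglongrightarrow> l"
proof -
 have "(\<lambda>k. \<bar>l - a k\<bar>) \<longlonglongrightarrow> 0" using assms by (simp add: ennreal_tendsto_0_iff)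
 hence "(\<lambda>k. l - a k) \<longlonglongrightarrow> 0" by (rule tendsto_rabs_zero_cancel)
 from tendsto_diff[OF tendsto_const this, of l] show ?thesis by simp
qed

context noisy_space begin

lemma L2_error_measurable:
 assumes H: "(\<lambda>(w, s, y). H s y w) \<in> borel_measurable (P \<Otimes>\<^sub>M time_mark \<mu>)"
  and D: "simple_integrand P F \<mu> D" and sf: "sigma_finite_measure \<mu>"
 shows "(\<lambda>w. \<integral>\<^sup>+ s\<in>{0<..t}. (\<integral>\<^sup>+ y. ennreal ((H s y w - simple_value D s y w)\<^sup>2) \<partial>\<mu>) \<partial>lborel) \<in> borel_measurable P"
proof -
 let ?a = "(P \<Otimes>\<^sub>M interval_measure 0 t) \<Otimes>\<^sub>M \<mu>"
 interpret \<mu>: sigma_finite_measure \<mu> by (rule sf)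
 interpret t: finite_measure "interval_measure 0 t" by (rule finite_interval_measure)
 have id: "(\<lambda>s. s) \<in> measurable (interval_measure 0 t) borel" by (rule measurable_restrict_space1) simp
 have id0: "(\<lambda>s. s) \<in> measurable (interval_measure 0 t) (restrict_space lborel {0<..})"
  by (rule measurable_restrict_space2) (use id in \<open>auto simp: space_restrict_space\<close>)
 have "(\<lambda>p. (fst (fst p), snd (fst p), snd p)) \<in> measurable ?a (P \<Otimes>\<^sub>M time_mark \<mu>)"
  unfolding time_mark_def by (intro measurable_Pair measurable_compose[OF _ id0]) simp_all
 from measurable_compose[OF this H] have [measurable]: "(\<lambda>p. H (snd (fst p)) (snd p) (fst (fst p))) \<in> borel_measurable ?a" by simp
 have "(\<lambda>p. (fst (fst p), snd (fst p), snd p)) \<in> measurable ?a (P \<Otimes>\<^sub>M (borel \<Otimes>\<^sub>M \<mu>))"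
  by (intro measurable_Pair measurable_compose[OF _ id]) simp_all
 from measurable_compose[OF this simple_value_joint[OF D]]
 have [measurable]: "(\<lambda>p. simple_value D (snd (fst p)) (snd p) (fst (fst p))) \<in> borel_measurable ?a" by simp
 have "(\<lambda>p. \<integral>\<^sup>+ y. ennreal ((H (snd p) y (fst p) - simple_value D (snd p) y (fst p))\<^sup>2) \<partial>\<mu>) \<in> borel_measurable (P \<Otimes>\<^sub>M interval_measure 0 t)"
  by (rule \<mu>.borel_measurable_nn_integral) (simp add: case_prod_unfold)
 hence "(\<lambda>w. \<integral>\<^sup>+ s. (\<integral>\<^sup>+ y. ennreal ((H s y w - simple_value D s y w)\<^sup>2) \<partial>\<mu>) \<partial>interval_measure 0 t) \<in> borel_measurable P"
  by (intro t.borel_measurable_nn_integral) (simp add: case_prod_unfold)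
 thus ?thesis by (subst (asm) nn_integral_restrict_space) auto
qed

text \<open>All approximation errors are packed into one nonnegative sequence \<open>Y\<close> that
  tends to 0 in probability. The sequences of two different integrals can then be added, and a
  single almost surely convergent subsequence serves both.\<close>

lemma stochastic_integral_approx:
 assumes si: "stochastic_integral P F \<mu> L H J" and sf: "sigma_finite_measure \<mu>"
  and L: "\<And>A r. A \<in> sets \<mu> ==> emeasure \<mu> A < \<infinity> ==> 0 \<le> r ==> L A r \<in> borel_measurable (F r)"
  and st: "0 \<le> s" "s \<le> t"
 obtains D and Y :: "nat => 'a => ennreal" where "\<And>k. simple_integrand P F \<mu> (D k)" "\<And>k. Y k \<in> borel_measurable P" "tendsto_0_in_prob P Y"
  "\<And>r w. (\<lambda>k. Y (r k) w) \<longlonglongrightarrow> 0 ==>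
   (\<lambda>k. \<integral>\<^sup>+ s\<in>{0<..t}. (\<integral>\<^sup>+ y. ennreal ((H s y w - simple_value (D (r k)) s y w)\<^sup>2) \<partial>\<mu>) \<partial>lborel) \<longlonglongrightarrow> 0
   \<and> (\<forall>q\<in>{s, t}. (\<lambda>k. simple_integral L (D (r k)) q w) \<longlonglongrightarrow> J q w)"
proof -
 obtain D where D: "\<And>k. simple_integrand P F \<mu> (D k)"
  and l1: "\<And>t. 0 \<le> t ==> tendsto_0_in_prob P (\<lambda>k w. \<integral>\<^sup>+ s\<in>{0<..t}. (\<integral>\<^sup>+ y. ennreal ((H s y w - simple_value (D k) s y w)\<^sup>2) \<partial>\<mu>) \<partial>lborel)"
  and l2: "\<And>t. 0 \<le> t ==> tendsto_0_in_prob P (\<lambda>k w. ennreal \<bar>J t w - simple_integral L (D k) t w\<bar>)"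
  and Hm: "(\<lambda>(w, s, y). H s y w) \<in> borel_measurable (P \<Otimes>\<^sub>M time_mark \<mu>)" and ad: "adapted F J"
  using si unfolding stochastic_integral_def by blast
 define E where "E k w = (\<integral>\<^sup>+ s\<in>{0<..t}. (\<integral>\<^sup>+ y. ennreal ((H s y w - simple_value (D k) s y w)\<^sup>2) \<partial>\<mu>) \<partial>lborel)" for k w
 define e where "e q k w = ennreal \<bar>J q w - simple_integral L (D k) q w\<bar>" for q k w
 have E: "E k \<in> borel_measurable P" "tendsto_0_in_prob P E" for k
  using L2_error_measurable[OF Hm D sf] l1[of t] st unfolding E_def[abs_def] by auto
 have e: "e q k \<in> borel_measurable P" "tendsto_0_in_prob P (e q)" if "0 \<le> q" for k q
 proof -
  have [measurable]: "J q \<in> borel_measurable P" using ad that by (auto simp: adapted_def intro: measurable_F)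
  have [measurable]: "simple_integral L (D k) q \<in> borel_measurable P" for k
   by (rule measurable_F[OF measurable_simple_integral[where L=L, OF D L that] that])
  show "e q k \<in> borel_measurable P" "tendsto_0_in_prob P (e q)" using l2[OF that] unfolding e_def[abs_def] by auto
 qed
 show ?thesis
 proof (rule that[OF D])
  show "(\<lambda>w. E k w + (e s k w + e t k w)) \<in> borel_measurable P" for k using st by (intro borel_measurable_add E e) auto
  show "tendsto_0_in_prob P (\<lambda>k w. E k w + (e s k w + e t k w))" using st by (intro tendsto_0_in_prob_add borel_measurable_add E e) auto
  fix r w assume l: "(\<lambda>k. E (r k) w + (e s (r k) w + e t (r k) w)) \<longlonglongrightarrow> 0"
  have sw: "f \<longlonglongrightarrow> 0" if "\<And>k. f k \<le> E (r k) w + (e s (r k) w + e t (r k) w)" for f :: "nat => ennreal"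
   by (rule tendsto_sandwich[OF _ _ tendsto_const l]) (use that in auto)
  have "(\<lambda>k. E (r k) w) \<longlonglongrightarrow> 0" by (rule sw) simp
  moreover have "(\<lambda>k. e q (r k) w) \<longlonglongrightarrow> 0" if "q \<in> {s, t}" for q
   by (rule sw, rule add_increasing[OF zero_le]) (use that in \<open>auto simp: add_increasing add_increasing2\<close>)
  ultimately show "(\<lambda>k. \<integral>\<^sup>+ s\<in>{0<..t}. (\<integral>\<^sup>+ y. ennreal ((H s y w - simple_value (D (r k)) s y w)\<^sup>2) \<partial>\<mu>) \<partial>lborel) \<longlonglongrightarrow> 0
   \<and> (\<forall>q\<in>{s, t}. (\<lambda>k. simple_integral L (D (r k)) q w) \<longlonglongrightarrow> J q w)"
   unfolding E_def e_def by (blast intro: ennreal_abs_diff_tendsto)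
 qed
qed

lemma simple_value_section:
 assumes D: "simple_integrand P F \<mu> D" and w: "y \<in> space P" and id: "f \<in> measurable K borel"
 shows "(\<lambda>p. simple_value D (f (fst p)) (snd p) y) \<in> borel_measurable (K \<Otimes>\<^sub>M \<mu>)"
proof -
 have "(\<lambda>p. (y, f (fst p), snd p)) \<in> measurable (K \<Otimes>\<^sub>M \<mu>) (P \<Otimes>\<^sub>M (borel \<Otimes>\<^sub>M \<mu>))"
  using w by (intro measurable_Pair measurable_compose[OF measurable_fst id]) simp_all
 from measurable_compose[OF this simple_value_joint[OF D]] show ?thesis by simp
qed

lemma time_coordinate: "(\<lambda>s. s) \<in> measurable (restrict_space lborel {0<..}) borel" by (rule measurable_restrict_space1) simp

end

context branching_sde begin

lemma space_mark: "space (mark_measure \<pi>) = {0<..} \<times> {0<..}"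
 by (simp add: mark_measure_def space_pair_measure space_\<pi> space_restrict_space)

lemma space_N: "w \<in> space P ==> space (N w) = {0<..} \<times> ({0<..} \<times> {0<..})"
 using sets_eq_imp_space_eq[OF sets_N] space_time_mark space_mark by simp

lemma simple_value_N_measurable:
 assumes D: "simple_integrand P F (mark_measure \<pi>) D" and w: "y \<in> space P"
 shows "(\<lambda>p. if fst p \<le> t then simple_value D (fst p) (snd p) y else 0) \<in> borel_measurable (N y)"
proof -
 let ?a = "borel_measurable (time_mark (mark_measure \<pi>))"
 have [measurable]: "(\<lambda>p. simple_value D (fst p) (snd p) y) \<in> ?a"
  unfolding time_mark_def by (rule simple_value_section[OF D w time_coordinate])
 have [measurable]: "(\<lambda>p. fst p) \<in> ?a" unfolding time_mark_def by (rule measurable_compose[OF measurable_fst time_coordinate])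
 have "(\<lambda>p. if fst p \<le> t then simple_value D (fst p) (snd p) y else 0) \<in> ?a" by measurable
 thus ?thesis unfolding measurable_cong_sets[OF sets_N[OF w] refl] .
qed

abbreviation "big_jump_upto n e t w p \<equiv> if fst p \<le> t then big_jump n e (fst p) (snd p) w else 0"

definition jumps_upto :: "nat => real => real => 'a => real" where
 "jumps_upto n e t w = (LINT p|N w. big_jump_upto n e t w p)"

text \<open>Dominated convergence along a fixed path, with the bound from
  \<open>big_jump_integrable\<close>. Measurability of the limit with respect to \<open>N w\<close>
  is a by-product, recorded for the limit in the width of the cut.\<close>

lemma jump_approx_integral_limit:
 assumes n: "1 \<le> n" and e: "0 < e" "real n powr \<theta> + e \<le> real h"
 shows "AE w in P. \<forall>t\<in>{0..real T}. (\<lambda>m. simple_integral raw_noise (jump_approx n e T h m) t w) \<longlonglongrightarrow> jumps_upto n e t w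
  \<and> big_jump_upto n e t w \<in> borel_measurable (N w)"
proof -
 have "AE w in P. \<forall>m. \<forall>t\<in>{0..real T}. simple_integral raw_noise (jump_approx n e T h m) t w =
   (\<integral>(s, y). (if s \<le> t then simple_value (jump_approx n e T h m) s y w else 0) \<partial>N w)"
  unfolding AE_all_countable using simple_integral_raw[OF jump_approx_simple[OF n]] by blast
 thus ?thesis using big_jump_integrable[of "real T" h] AE_space
 proof eventually_elim
  case (elim w)
  show ?case
  proof
   fix t assume t: "t \<in> {0..real T}"
   let ?f = "\<lambda>m p. if fst p \<le> t then simple_value (jump_approx n e T h m) (fst p) (snd p) w else 0"
   have m: "?f m \<in> borel_measurable (N w)" for m by (rule simple_value_N_measurable[OF jump_approx_simple[OF n] elim(3)])
   have lim: "(\<lambda>m. ?f m p) \<longlonglongrightarrow> big_jump_upto n e t w p" if "p \<in> space (N w)" for p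
    using that jump_approx_limit[OF n elim(3) e, of "fst p" T "snd (snd p)" "fst (snd p)"] t by (auto simp: space_N[OF elim(3)])
   have gm: "big_jump_upto n e t w \<in> borel_measurable (N w)" by (rule borel_measurable_LIMSEQ_metric[OF m lim])
   have "(\<lambda>m. \<integral>p. ?f m p \<partial>N w) \<longlonglongrightarrow> jumps_upto n e t w" unfolding jumps_upto_def
   proof (rule integral_dominated_convergence[OF gm m elim(2)])
    show "AE p in N w. (\<lambda>m. ?f m p) \<longlonglongrightarrow> big_jump_upto n e t w p" by (rule AE_I2[OF lim])
    show "AE p in N w. norm (?f m p) \<le> (case p of (s, z, u) => z * indicator ({0<..real T} \<times> big_marks h) (s, z, u))" for m
    proof (rule AE_I2)
     fix p assume p: "p \<in> space (N w)"
     obtain s z u where pz: "p = (s, z, u)" by (cases p)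
     hence "0 < z" using p by (auto simp: space_N[OF elim(3)])
     thus "norm (?f m p) \<le> (case p of (s, z, u) => z * indicator ({0<..real T} \<times> big_marks h) (s, z, u))"
      using jump_approx_bounds[of n e T h m s z u w] by (auto simp: pz)
    qed
   qed
   moreover have "simple_integral raw_noise (jump_approx n e T h m) t w = (LINT p|N w. ?f m p)" for m using elim(1) t by (auto simp: case_prod_unfold)
   ultimately show "(\<lambda>m. simple_integral raw_noise (jump_approx n e T h m) t w) \<longlonglongrightarrow> jumps_upto n e t w
    \<and> big_jump_upto n e t w \<in> borel_measurable (N w)" using gm by simp
  qed
 qed
qed

definition jumps_of :: "nat => real => 'a => real" where
 "jumps_of n t w = (\<integral>(s, z, u). (if s \<le> t \<and> ereal s \<le> \<zeta> n w \<and> 1 < z \<and> u \<le> 1 / enn2real (left_limit X s w) powr (- \<theta>) then z else 0) \<partial>N w)"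

lemma jumps_upto_limit:
 assumes n: "1 \<le> n"
 shows "AE w in P. \<forall>t\<in>{0..real T}. (\<lambda>k. jumps_upto n (1 / real (Suc k)) t w) \<longlonglongrightarrow> jumps_of n t w"
proof -
 obtain h :: nat where h: "real n powr \<theta> + 1 \<le> real h" using real_arch_simple by blast
 have e: "0 < 1 / real (Suc k)" "real n powr \<theta> + 1 / real (Suc k) \<le> real h" for k
 proof -
  have "1 / real (Suc k) \<le> 1" by simp
  thus "real n powr \<theta> + 1 / real (Suc k) \<le> real h" using h by linarith
 qed simp
 have "AE w in P. \<forall>k. \<forall>t\<in>{0..real T}. big_jump_upto n (1 / real (Suc k)) t w \<in> borel_measurable (N w)"
  unfolding AE_all_countable
 proof
  fix k
  show "AE w in P. \<forall>t\<in>{0..real T}. big_jump_upto n (1 / real (Suc k)) t w \<in> borel_measurable (N w)"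
   using jump_approx_integral_limit[OF n e] by eventually_elim blast
 qed
 thus ?thesis using big_jump_integrable[of "real T" h] AE_space
 proof eventually_elim
  case (elim w)
  show ?case
  proof
   fix t assume t: "t \<in> {0..real T}"
   let ?f = "\<lambda>k p. big_jump_upto n (1 / real (Suc k)) t w p"
   let ?g = "\<lambda>p. if fst p \<le> t \<and> ereal (fst p) \<le> \<zeta> n w \<and> 1 < fst (snd p) \<and> snd (snd p) \<le> 1 / enn2real (left_limit X (fst p) w) powr (- \<theta>) then fst (snd p) else 0"
   have m: "?f k \<in> borel_measurable (N w)" for k using elim(1) t by blast
   have lim: "(\<lambda>k. ?f k p) \<longlonglongrightarrow> ?g p" if p: "p \<in> space (N w)" for p
   proof -
    obtain s z u where pz: "p = (s, z, u)" by (cases p)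
    hence z: "0 < z" using p by (auto simp: space_N[OF elim(3)])
    have "?g p = (if s \<le> t then (if ereal s \<le> \<zeta> n w \<and> 1 < z \<and> u \<le> rate_left n s w then z else 0) else 0)"
     by (auto simp: pz rate_left_def powr_minus_divide)
    thus ?thesis using big_jump_limit_e[OF elim(3) z, of n s u] by (auto simp: pz)
   qed
   have gm: "?g \<in> borel_measurable (N w)" by (rule borel_measurable_LIMSEQ_metric[OF m lim])
   have "(\<lambda>k. \<integral>p. ?f k p \<partial>N w) \<longlonglongrightarrow> (LINT p|N w. ?g p)"
   proof (rule integral_dominated_convergence[OF gm m elim(2) AE_I2[OF lim]])
    show "AE p in N w. norm (?f k p) \<le> (case p of (s, z, u) => z * indicator ({0<..real T} \<times> big_marks h) (s, z, u))" for k
    proof (rule AE_I2)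
     fix p assume p: "p \<in> space (N w)"
     obtain s z u where pz: "p = (s, z, u)" by (cases p)
     hence pos: "0 < z" "0 < u" "0 < s" using p by (auto simp: space_N[OF elim(3)])
     show "norm (?f k p) \<le> (case p of (s, z, u) => z * indicator ({0<..real T} \<times> big_marks h) (s, z, u))"
      using big_jump_bounds[OF elim(3) e[of k] pos(3) _ pos(2) pos(1), of "real T"] t pos by (auto simp: pz simp del: of_nat_Suc)
    qed
   qed
   thus "(\<lambda>k. jumps_upto n (1 / real (Suc k)) t w) \<longlonglongrightarrow> jumps_of n t w"
    by (simp add: jumps_upto_def jumps_of_def case_prod_unfold del: of_nat_Suc)
  qed
 qed
qed

definition small_jump :: "nat => real => real \<times> real => 'a => real" where
 "small_jump n r = (\<lambda>(z, u) w. if ereal r \<le> \<zeta> n w \<and> z \<le> 1 \<and> u \<le> rate_left n r w then z else 0)"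

definition large_jump :: "nat => real => real \<times> real => 'a => real" where
 "large_jump n r = (\<lambda>(z, u) w. if ereal r \<le> \<zeta> n w \<and> 1 < z \<and> u \<le> rate_left n r w then z else 0)"

text \<open>With \<open>char_exponent\<close>, the Levy-Khintchine formula at a complex frequency
  \<open>w\<close>. For \<open>Im w \<ge> 0\<close> and positive jumps the exponential is bounded;
  at \<open>\<i> * l\<close> the exponent is \<open>psi l\<close>.\<close>

definition levy_kernel :: "complex => real => complex" where
 "levy_kernel w z = exp (\<i> * w * of_real z) - 1 - \<i> * w * of_real (z * indicator {0<..1} z)"

definition char_exponent :: "complex => complex" where
 "char_exponent w = - \<i> * w * of_real b - of_real c * w\<^sup>2 + (LINT z|\<pi>. levy_kernel w z)"

abbreviation "half_line \<equiv> restrict_space lborel {0::real<..}"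

lemma half_line_sigma_finite: "sigma_finite_measure half_line"
 by (rule sigma_finite_measure_restrict_space) (auto intro: lborel.sigma_finite_measure_axioms)

lemma mark_coordinates [measurable]:
 "fst \<in> borel_measurable (mark_measure \<pi>)" "snd \<in> borel_measurable (mark_measure \<pi>)" unfolding mark_measure_def
 by (rule measurable_compose[OF measurable_fst measurable_\<pi>], simp)
   (rule measurable_compose[OF measurable_snd measurable_restrict_space1], simp)

lemma small_jump_measurable: "(\<lambda>y. small_jump n r y w) \<in> borel_measurable (mark_measure \<pi>)"
 unfolding small_jump_def case_prod_unfold by measurable

lemma big_jump_measurable: "(\<lambda>y. big_jump n e r y w) \<in> borel_measurable (mark_measure \<pi>)"
proof -
 have [measurable]: "cut e \<in> borel_measurable borel" unfolding cut_def by measurable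
 show ?thesis unfolding big_jump_def case_prod_unfold by measurable
qed

lemma large_jump_measurable: "(\<lambda>y. large_jump n r y w) \<in> borel_measurable (mark_measure \<pi>)"
 unfolding large_jump_def case_prod_unfold by measurable

lemma half_line_below: "0 \<le> v ==> {u\<in>space half_line. u \<le> v} \<in> sets half_line \<and> emeasure half_line {u\<in>space half_line. u \<le> v} = ennreal v"
proof -
 assume v: "0 \<le> v"
 have "{u\<in>space half_line. u \<le> v} = {0<..v}" by (auto simp: space_restrict_space)
 moreover have "emeasure half_line {0<..v} = ennreal v" using v by (subst emeasure_restrict_space) auto
 moreover have "{0<..v} \<in> sets half_line" by (auto simp: sets_restrict_space_iff)
 ultimately show ?thesis by simp
qed

definition "small_moment = (\<integral>\<^sup>+z. ennreal (if z \<le> 1 then z\<^sup>2 else 0) \<partial>\<pi>)"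

lemma small_moment_finite: "small_moment < \<infinity>"
proof -
 have "small_moment \<le> (\<integral>\<^sup>+z. ennreal (min 1 (z\<^sup>2)) \<partial>\<pi>)" unfolding small_moment_def
  by (intro nn_integral_mono ennreal_leI) (auto simp: space_\<pi> power_le_one)
 also have "\<dots> < \<infinity>" using levy by (simp add: levy_measure_def)
 finally show ?thesis .
qed

lemma small_jump_L2:
 assumes w: "k \<in> space P" and r: "0 < r"
 shows "(\<integral>\<^sup>+y. ennreal ((small_jump n r y k)\<^sup>2) \<partial>mark_measure \<pi>) \<le> ennreal (real n powr \<theta> * enn2real small_moment)"
proof -
 interpret l: sigma_finite_measure half_line by (rule half_line_sigma_finite)
 have v: "0 \<le> rate_left n r k" "rate_left n r k \<le> real n powr \<theta>" using rate_left_bounds[OF w r] by auto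
 have [measurable]: "(\<lambda>z. z) \<in> borel_measurable \<pi>" by (rule measurable_\<pi>) simp
 have [measurable]: "(\<lambda>z. z) \<in> borel_measurable half_line" by (rule time_coordinate)
 have "(\<integral>\<^sup>+y. ennreal ((small_jump n r y k)\<^sup>2) \<partial>mark_measure \<pi>)
  \<le> (\<integral>\<^sup>+y. ennreal (if fst y \<le> 1 then (fst y)\<^sup>2 else 0) * indicator {u\<in>space half_line. u \<le> rate_left n r k} (snd y) \<partial>mark_measure \<pi>)"
  by (intro nn_integral_mono) (auto simp: small_jump_def case_prod_unfold indicator_def space_mark space_restrict_space)
 also have "\<dots> = (\<integral>\<^sup>+z. (\<integral>\<^sup>+u. ennreal (if z \<le> 1 then z\<^sup>2 else 0) * indicator {u\<in>space half_line. u \<le> rate_left n r k} u \<partial>half_line) \<partial>\<pi>)"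
  unfolding mark_measure_def by (subst l.nn_integral_fst[symmetric]) (use half_line_below[OF v(1)] in \<open>auto cong: if_cong\<close>)
 also have "\<dots> = small_moment * ennreal (rate_left n r k)"
  using half_line_below[OF v(1)] by (simp add: nn_integral_cmult_indicator nn_integral_multc small_moment_def)
 also have "\<dots> \<le> ennreal (enn2real small_moment) * ennreal (real n powr \<theta>)"
  using small_moment_finite v by (intro mult_mono) (auto intro!: ennreal_leI simp: less_top)
 finally show ?thesis by (simp add: ennreal_mult mult.commute)
qed

lemma levy_kernel_measurable [measurable]: "levy_kernel w \<in> borel_measurable \<pi>"
 by (rule measurable_\<pi>) (unfold levy_kernel_def, measurable)

text \<open>Integrating out the level \<open>u\<close> up to \<open>rate_left\<close> multiplies the
  jump exponent by the rate. This thinning is where the factor \<open>1 / f(X)\<close> in front of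
  the Levy exponent comes from.\<close>

lemma levy_symbol:
 assumes w: "k \<in> space P" and r: "0 < r" and h: "real n powr \<theta> \<le> real h"
 shows "(LINT y|mark_measure \<pi>. levy_term u (small_jump n r y k) (large_jump n r y k))
  = of_real (rate_left n r k) * (LINT z|\<pi>. levy_kernel (of_real u) z)"
proof -
 interpret l: sigma_finite_measure half_line by (rule half_line_sigma_finite)
 interpret pr: pair_sigma_finite \<pi> half_line ..
 have v: "0 \<le> rate_left n r k" "rate_left n r k \<le> real n powr \<theta>" using rate_left_bounds[OF w r] by auto
 define B where "B = {u\<in>space half_line. u \<le> rate_left n r k}"
 have B: "B \<in> sets half_line" "measure half_line (B \<inter> space half_line) = rate_left n r k" "emeasure half_line B < \<infinity>"
  using half_line_below[OF v(1)] v(1) unfolding B_def[symmetric] by (auto simp: B_def Int_def measure_def conj_commute)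
 have eq: "levy_term u (small_jump n r y k) (large_jump n r y k) = indicator B (snd y) *\<^sub>R levy_kernel (of_real u) (fst y)"
  if "y \<in> space (mark_measure \<pi>)" for y
  using that by (auto simp: levy_term_def small_jump_def large_jump_def levy_kernel_def case_prod_unfold indicator_def
    space_mark space_restrict_space rate_left_def mult_ac B_def)
 have "integrable (mark_measure \<pi>) (\<lambda>y. levy_term u (small_jump n r y k) (large_jump n r y k))"
 proof (rule levy_term_integrable(1)[OF small_jump_measurable large_jump_measurable big_marks[of h]])
  show "large_jump n r y k = 0" if "y \<in> space (mark_measure \<pi>)" "y \<notin> big_marks h" for y
   using that v h by (auto simp: large_jump_def case_prod_unfold big_marks_def space_mark)
  show "(\<integral>\<^sup>+y. ennreal ((small_jump n r y k)\<^sup>2) \<partial>mark_measure \<pi>) < \<infinity>"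
   using small_jump_L2[OF w r, of n] by (rule le_less_trans) simp
 qed
 hence int: "integrable (\<pi> \<Otimes>\<^sub>M half_line) (\<lambda>y. indicator B (snd y) *\<^sub>R levy_kernel (of_real u) (fst y))"
  using eq unfolding mark_measure_def by (subst (asm) Bochner_Integration.integrable_cong[OF refl]) (auto simp: mark_measure_def)
 have "(LINT y|mark_measure \<pi>. levy_term u (small_jump n r y k) (large_jump n r y k))
  = (LINT y|mark_measure \<pi>. indicator B (snd y) *\<^sub>R levy_kernel (of_real u) (fst y))" by (intro lebesgue_integral_cong refl eq)
 also have "\<dots> = (LINT z|\<pi>. (LINT u'|half_line. indicator B u' *\<^sub>R levy_kernel (of_real u) z))"
  unfolding mark_measure_def using pr.integral_fst'[OF int] by simp
 also have "\<dots> = (LINT z|\<pi>. of_real (rate_left n r k) * levy_kernel (of_real u) z)" using B by (simp add: scaleR_conv_of_real)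
 finally show ?thesis by simp
qed

lemma rate_measurable_path:
 assumes "1 \<le> n" "0 \<le> T" "w \<in> space P" shows "(\<lambda>r. rate n (min (max r 0) T) w) \<in> borel_measurable borel"
 using measurable_compose[OF measurable_Pair2'[of w "F T" borel] rate_progressive[OF assms(1,2)]] assms by simp

definition cum_rate :: "nat => real => real => 'a => real" where
 "cum_rate n s t w = (LINT r:{s<..t}|lborel. rate n r w)"

lemma cum_rate_path:
 assumes "0 \<le> s" "t \<le> T" shows "cum_rate n s t w = (LINT r:{s<..t}|lborel. rate n (min (max r 0) T) w)"
 unfolding cum_rate_def by (rule set_lebesgue_integral_cong) (use assms in auto)

lemma rate_integrable:
 assumes n: "1 \<le> n" and s: "0 \<le> s" "s \<le> t" and w: "y \<in> space P"
 shows "set_integrable lborel {s<..t} (\<lambda>r. rate n r y)" "\<bar>cum_rate n s t y\<bar> \<le> real n powr \<theta> * (t - s)"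
proof -
 have "0 \<le> t" using s by simp
 from interval_integral_bound[OF rate_measurable_path[OF n this w] s(2), of "real n powr \<theta>"]
 have i: "set_integrable lborel {s<..t} (\<lambda>r. rate n (min (max r 0) t) y)" and b: "\<bar>cum_rate n s t y\<bar> \<le> real n powr \<theta> * (t - s)"
  using rate_bounds[of _ n y] s by (auto simp: cum_rate_path[OF s(1) order_refl])
 show "set_integrable lborel {s<..t} (\<lambda>r. rate n r y)" by (rule set_integrable_cong[THEN iffD1, OF refl refl _ i]) (use s in auto)
 show "\<bar>cum_rate n s t y\<bar> \<le> real n powr \<theta> * (t - s)" by (rule b)
qed

lemma cum_rate_add:
 assumes "1 \<le> n" "0 \<le> q" "q \<le> s" "s \<le> t" "w \<in> space P" shows "cum_rate n q t w = cum_rate n q s w + cum_rate n s t w"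
 unfolding cum_rate_def using assms by (intro interval_integral_add rate_integrable) auto

text \<open>The Gaussian and drift parts contain \<open>rate\<close>, the jump parts
  \<open>rate_left\<close>; this identification lets both be expressed by one clock
  \<open>cum_rate\<close>.\<close>

lemma cum_rate_left:
 assumes n: "1 \<le> n" and s: "0 \<le> s" "s \<le> t" and w: "y \<in> space P"
 shows "set_integrable lborel {s<..t} (\<lambda>r. rate_left n r y)" "(LINT r:{s<..t}|lborel. rate_left n r y) = cum_rate n s t y"
proof -
 have t: "0 \<le> t" using s by simp
 define f where "f r = rate n (min (max r 0) t) y" for r
 \<comment> \<open>Beyond \<open>t\<close> the clamped path is constant, so its left limit there is
   the value at \<open>t\<close>.\<close>
 define g where "g r = (if r \<le> t then rate_left n r y else rate n t y)" for r
 have fm: "f \<in> borel_measurable borel" unfolding f_def by (rule rate_measurable_path[OF n t w])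
 have fb: "\<bar>f r\<bar> \<le> real n powr \<theta>" for r using rate_bounds[of "min (max r 0) t" n y] t by (simp add: f_def)
 have lim: "(f \<longlongrightarrow> g r) (at_left r)" if "s < r" for r
 proof (cases "r \<le> t")
  case True
  have r: "0 < r" using that s by simp
  hence "eventually (\<lambda>q. q \<in> {0<..<r}) (at_left r)" by (intro eventually_at_left_real)
  hence "eventually (\<lambda>q. rate n q y = f q) (at_left r)" by eventually_elim (use True in \<open>auto simp: f_def\<close>)
  thus ?thesis using Lim_transform_eventually[OF rate_left_limit[OF w r n]] True by (simp add: g_def)
 next
  case False
  hence "eventually (\<lambda>q. q \<in> {t<..<r}) (at_left r)" by (intro eventually_at_left_real) simp
  thus ?thesis by (rule tendsto_eventually[OF eventually_mono]) (use False t in \<open>auto simp: f_def g_def\<close>)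
 qed
 note L = integral_left_limits[OF fm fb lim s(2)]
 show "set_integrable lborel {s<..t} (\<lambda>r. rate_left n r y)" by (rule set_integrable_cong[THEN iffD1, OF refl refl _ L(1)]) (auto simp: g_def)
 have "(LINT r:{s<..t}|lborel. rate_left n r y) = (LINT r:{s<..t}|lborel. g r)" by (rule set_lebesgue_integral_cong) (auto simp: g_def)
 thus "(LINT r:{s<..t}|lborel. rate_left n r y) = cum_rate n s t y" using L(2) unfolding f_def cum_rate_path[OF s(1) order_refl] by simp
qed

text \<open>\<open>char_exponent\<close> contains the drift term \<open>- \<i> * u * b\<close>,
  which is added back here because the drift of the equation is not part of the noise.\<close>

abbreviation "path_exponent n u s t w \<equiv> (char_exponent (of_real u) + \<i> * of_real (u * b)) * of_real (cum_rate n s t w)"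

lemma rate_integral_value:
 assumes n: "1 \<le> n" and s: "0 \<le> s" "s \<le> t" and w: "v \<in> space P"
 shows "rate_integral u (sqrt (2 * c)) s t (\<lambda>r. sqrt (rate n r v)) (\<lambda>r y. small_jump n r y v) (\<lambda>r y. large_jump n r y v)
  = path_exponent n u s t v"
proof -
 let ?a = "- of_real (u\<^sup>2 * c)"
 obtain h :: nat where h: "real n powr \<theta> \<le> real h" using real_arch_simple by blast
 let ?k = "\<integral>z. levy_kernel (of_real u) z \<partial>\<pi>"
 have "rate_integral u (sqrt (2 * c)) s t (\<lambda>r. sqrt (rate n r v)) (\<lambda>r y. small_jump n r y v) (\<lambda>r y. large_jump n r y v)
  = (LINT r:{s<..t}|lborel. of_real (rate n r v) * ?a + of_real (rate_left n r v) * ?k)" unfolding rate_integral_def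
 proof (rule set_lebesgue_integral_cong)
  show "\<forall>r. r \<in> {s<..t} \<longrightarrow> symbol_rate u (sqrt (2 * c)) (sqrt (rate n r v)) (\<lambda>y. small_jump n r y v) (\<lambda>y. large_jump n r y v)
   = of_real (rate n r v) * ?a + of_real (rate_left n r v) * ?k"
  proof (intro allI impI)
   fix r assume r: "r \<in> {s<..t}"
   hence "(sqrt (rate n r v))\<^sup>2 = rate n r v" using rate_bounds[of r n v] s by simp
   thus "symbol_rate u (sqrt (2 * c)) (sqrt (rate n r v)) (\<lambda>y. small_jump n r y v) (\<lambda>y. large_jump n r y v)
    = of_real (rate n r v) * ?a + of_real (rate_left n r v) * ?k" unfolding symbol_rate_eq using levy_symbol[OF w _ h, of r u] r s c by simp
  qed
 qed simp
 also have "\<dots> = of_real (cum_rate n s t v) * ?a + of_real (cum_rate n s t v) * ?k"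
 proof -
  have mc: "set_integrable lborel A (\<lambda>r. complex_of_real (f r) * k)" "(LINT r:A|lborel. complex_of_real (f r) * k) = of_real (LINT r:A|lborel. f r) * k"
   if f: "set_integrable lborel A f" for A k and f :: "real => real"
  proof -
   have eq: "indicator A r *\<^sub>R (complex_of_real (f r) * k) = complex_of_real (indicator A r *\<^sub>R f r) * k" for r
    by (simp add: scaleR_conv_of_real)
   show "set_integrable lborel A (\<lambda>r. complex_of_real (f r) * k)"
    using f unfolding set_integrable_def eq by (intro integrable_mult_left integrable_of_real)
   show "(LINT r:A|lborel. complex_of_real (f r) * k) = of_real (LINT r:A|lborel. f r) * k"
    unfolding set_lebesgue_integral_def eq integral_mult_left_zero by (simp only: integral_complex_of_real)
  qed
  note m1 = mc[OF rate_integrable(1)[OF n s w]] and m2 = mc[OF cum_rate_left(1)[OF n s w]]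
  show ?thesis unfolding set_integral_add(2)[OF m1(1) m2(1)] m1(2) m2(2) cum_rate_left(2)[OF n s w] cum_rate_def[symmetric] ..
 qed
 finally show ?thesis by (simp add: char_exponent_def algebra_simps)
qed

definition stopped :: "nat => real => 'a => ennreal" where
 "stopped n t w = X (real_of_ereal (min (ereal t) (\<zeta> n w))) w"

definition stopped_real :: "nat => real => 'a => real" where
 "stopped_real n t w = enn2real (stopped n t w)"

text \<open>The two domains of integration differ at most at the times 0 and
  \<open>\<zeta> n\<close>. For infinite \<open>\<zeta> n\<close> the value
  \<open>real_of_ereal \<infinity> = 0\<close> merely repeats the first of them.\<close>

lemma drift_integral:
 assumes n: "1 \<le> n" and t: "0 \<le> t" and w: "y \<in> space P"
 shows "(LINT s:{s. 0 \<le> s \<and> s \<le> t \<and> ereal s \<le> \<zeta> n y}|lborel. 1 / enn2real (X s y) powr (- \<theta>)) = cum_rate n 0 t y"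
 unfolding cum_rate_def set_lebesgue_integral_def
proof (rule integral_discrete_difference[where X="{0, real_of_ereal (\<zeta> n y)}"])
 fix s assume s: "s \<in> space lborel" "s \<notin> {0, real_of_ereal (\<zeta> n y)}"
 hence "ereal s \<le> \<zeta> n y \<longleftrightarrow> ereal s < \<zeta> n y" by (cases "\<zeta> n y") auto
 thus "indicator {s. 0 \<le> s \<and> s \<le> t \<and> ereal s \<le> \<zeta> n y} s *\<^sub>R (1 / enn2real (X s y) powr (- \<theta>)) = indicator {0<..t} s *\<^sub>R rate n s y"
  using s by (auto simp: indicator_def rate_def powr_minus_divide)
qed auto

lemma ito_sqrt_rate:
 assumes w: "y \<in> space P" shows "(\<integral>\<^sup>+r\<in>{0<..t}. ennreal ((sqrt (rate n r y) - g r)\<^sup>2) \<partial>lborel) =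
  (\<integral>\<^sup>+r\<in>{0<..t}. ennreal (((if ereal r \<le> \<zeta> n y then sqrt (1 / enn2real (X r y) powr (- \<theta>)) else 0) - g r)\<^sup>2) \<partial>lborel)"
proof (rule nn_integral_cong_AE)
 have "AE r in lborel. r \<noteq> real_of_ereal (\<zeta> n y)" by (rule AE_lborel_singleton)
 thus "AE r in lborel. ennreal ((sqrt (rate n r y) - g r)\<^sup>2) * indicator {0<..t} r =
  ennreal (((if ereal r \<le> \<zeta> n y then sqrt (1 / enn2real (X r y) powr (- \<theta>)) else 0) - g r)\<^sup>2) * indicator {0<..t} r"
 proof eventually_elim
  case (elim r)
  hence "ereal r \<le> \<zeta> n y \<longleftrightarrow> ereal r < \<zeta> n y" by (cases "\<zeta> n y") auto
  thus ?case by (simp add: rate_def powr_minus_divide)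
 qed
qed

lemma sqrt_rate_measurable:
 assumes n: "1 \<le> n" and s: "0 \<le> s" "s \<le> t" and w: "y \<in> space P"
 shows "(\<lambda>r. sqrt (rate n r y)) \<in> borel_measurable (interval_measure s t)"
proof -
 have [measurable]: "(\<lambda>r. rate n (min (max r 0) t) y) \<in> borel_measurable borel" using s by (intro rate_measurable_path n w) auto
 have "(\<lambda>r. sqrt (rate n (min (max r 0) t) y)) \<in> borel_measurable (interval_measure s t)" by (rule measurable_restrict_space1) simp
 thus ?thesis by (rule measurable_cong[THEN iffD1, rotated]) (use s in \<open>auto simp: space_restrict_space\<close>)
qed

lemma sqrt_rate_L2:
 assumes n: "1 \<le> n" and s: "0 \<le> s" "s \<le> t"
 shows "(\<integral>\<^sup>+r. ennreal ((sqrt (rate n r w))\<^sup>2) \<partial>interval_measure s t) < \<infinity>"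
proof -
 interpret t: finite_measure "interval_measure s t" by (rule finite_interval_measure)
 have "(\<integral>\<^sup>+r. ennreal ((sqrt (rate n r w))\<^sup>2) \<partial>interval_measure s t) \<le> (\<integral>\<^sup>+r. ennreal (real n powr \<theta>) \<partial>interval_measure s t)"
 proof (intro nn_integral_mono ennreal_leI)
  fix r assume "r \<in> space (interval_measure s t)"
  hence "0 \<le> r" using s by (simp add: space_restrict_space)
  thus "(sqrt (rate n r w))\<^sup>2 \<le> real n powr \<theta>" using rate_bounds[of r n w] by simp
 qed
 also have "\<dots> < \<infinity>" by (simp add: t.emeasure_eq_measure ennreal_mult_less_top)
 finally show ?thesis .
qed

lemma small_jump_product_L2:
 assumes n: "1 \<le> n" and s: "0 \<le> s" "s \<le> t" and w: "v \<in> space P"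
  and m: "(\<lambda>p. small_jump n (fst p) (snd p) v) \<in> borel_measurable (interval_measure s t \<Otimes>\<^sub>M mark_measure \<pi>)"
 shows "(\<integral>\<^sup>+p. ennreal ((small_jump n (fst p) (snd p) v)\<^sup>2) \<partial>(interval_measure s t \<Otimes>\<^sub>M mark_measure \<pi>)) < \<infinity>"
proof -
 interpret t: finite_measure "interval_measure s t" by (rule finite_interval_measure)
 have "(\<integral>\<^sup>+p. ennreal ((small_jump n (fst p) (snd p) v)\<^sup>2) \<partial>(interval_measure s t \<Otimes>\<^sub>M mark_measure \<pi>))
  = (\<integral>\<^sup>+r. (\<integral>\<^sup>+y. ennreal ((small_jump n r y v)\<^sup>2) \<partial>mark_measure \<pi>) \<partial>interval_measure s t)"
  using m by (subst mark.nn_integral_fst[symmetric]) auto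
 also have "\<dots> \<le> (\<integral>\<^sup>+r. ennreal (real n powr \<theta> * enn2real small_moment) \<partial>interval_measure s t)"
  by (intro nn_integral_mono small_jump_L2 w) (use s in \<open>auto simp: space_restrict_space\<close>)
 also have "\<dots> < \<infinity>" by (simp add: t.emeasure_eq_measure ennreal_mult_less_top)
 finally show ?thesis .
qed

lemma rate_bound_const:
 assumes n: "1 \<le> n" and s: "0 \<le> s" "s \<le> t" and w: "v \<in> space P" and e: "0 < e" "real n powr \<theta> + e \<le> real h"
 shows "norm (rate_integral u \<sigma> s t (\<lambda>r. sqrt (rate n r v)) (\<lambda>r y. small_jump n r y v) (\<lambda>r y. big_jump n e r y v))
  \<le> (u\<^sup>2 * \<sigma>\<^sup>2 / 2 * real n powr \<theta> + u\<^sup>2 * (real n powr \<theta> * enn2real small_moment) + 2 * measure (mark_measure \<pi>) (big_marks h)) * (t - s)"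
proof (rule norm_rate_integral_le[OF s(2) big_marks small_jump_measurable big_jump_measurable])
 fix r assume r: "s < r" "r \<le> t"
 hence "0 < r" using s by simp
 show "(sqrt (rate n r v))\<^sup>2 \<le> real n powr \<theta>" using rate_bounds[of r n v] \<open>0 < r\<close> by simp
 show "(\<integral>\<^sup>+y. ennreal ((small_jump n r y v)\<^sup>2) \<partial>mark_measure \<pi>) \<le> ennreal (real n powr \<theta> * enn2real small_moment)"
  by (rule small_jump_L2[OF w \<open>0 < r\<close>])
 fix y assume y: "y \<in> space (mark_measure \<pi>)" "y \<notin> big_marks h"
 thus "big_jump n e r y v = 0" using big_jump_bounds[OF w e \<open>0 < r\<close> order_refl, of "snd y" "fst y"] by (cases y) (auto simp: space_mark)
qed (auto simp: enn2real_nonneg)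

text \<open>Two limits in succession: for a fixed width of the cut the simple integrands converge,
  and afterwards the width tends to 0. The bound \<open>C\<close> on the exponents is the same for
  all widths, which allows dominated convergence in the second limit.\<close>

lemma exp_martingale_noise:
 fixes Z :: "'a => complex"
 assumes n: "1 \<le> n" and st: "0 \<le> s" "s \<le> t"
  and ito: "ito_integral P F W (\<lambda>s v. if ereal s \<le> \<zeta> n v then sqrt (1 / enn2real (X s v) powr (- \<theta>)) else 0) I"
  and comp: "compensated_integral P F (mark_measure \<pi>) N (small_jump n) J"
  and Z: "Z \<in> borel_measurable (F s)" and Zb: "\<And>v. v \<in> space P ==> norm (Z v) \<le> 1"
 defines "\<Theta> \<equiv> \<lambda>v. sqrt (2 * c) * (I t v - I s v) + (J t v - J s v) + (jumps_of n t v - jumps_of n s v)"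
 shows "(LINT v|P. Z v * exp (\<i> * of_real (u * \<Theta> v) - path_exponent n u s t v)) = (LINT v|P. Z v)"
proof -
 let ?a = "\<lambda>s. interval_measure s t \<Otimes>\<^sub>M mark_measure \<pi>"
 let ?b = "\<lambda>k. 1 / real (Suc k)"
 let ?c = "\<lambda>v D2 r. \<lambda>k. \<integral>\<^sup>+p\<in>{0<..t}. (\<integral>\<^sup>+y. ennreal ((small_jump n p y v - simple_value (D2 (r k)) p y v)\<^sup>2) \<partial>mark_measure \<pi>) \<partial>lborel"
 let ?d = "mark_measure \<pi>"
 let ?e = "\<lambda>v D1 r. \<lambda>k. \<integral>\<^sup>+p\<in>{0<..t}. ennreal ((sqrt (rate n p v) - simple_value (D1 (r k)) p () v)\<^sup>2) \<partial>lborel"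
 let ?f = "\<lambda>v Io. exp (\<i> * of_real (u * \<Theta> v) - Io v)"
 let ?g = "\<lambda>Te k v. of_real (u * Te (?b k) v)"
 let ?h = "\<lambda>s. borel_measurable (?a s)"
 let ?\<sigma> = "sqrt (2 * c)"
 obtain T :: nat where T: "t \<le> real T" using real_arch_simple by blast
 \<comment> \<open>The widths \<open>1 / Suc k\<close> are at most 1, so one \<open>h\<close> serves
   all of them.\<close>
 obtain h :: nat where h: "real n powr \<theta> + 1 \<le> real h" using real_arch_simple by blast
 have e: "0 < 1 / real (Suc k)" "real n powr \<theta> + 1 / real (Suc k) \<le> real h" for k
 proof -
  have "1 / real (Suc k) \<le> 1" by simp
  thus "real n powr \<theta> + 1 / real (Suc k) \<le> real h" using h by linarith
 qed simp
 obtain D1 and Y1 :: "nat => 'a => ennreal" where D1: "\<And>k. simple_integrand P F (count_space (UNIV :: unit set)) (D1 k)"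
  "\<And>k. Y1 k \<in> borel_measurable P" "tendsto_0_in_prob P Y1"
  "\<And>r v. (\<lambda>k. Y1 (r k) v) \<longlonglongrightarrow> 0 ==>
   (\<lambda>k. \<integral>\<^sup>+ s\<in>{0<..t}. (\<integral>\<^sup>+ y. ennreal (((if ereal s \<le> \<zeta> n v then sqrt (1 / enn2real (X s v) powr (- \<theta>)) else 0) - simple_value (D1 (r k)) s y v)\<^sup>2) \<partial>count_space (UNIV :: unit set)) \<partial>lborel) \<longlonglongrightarrow> 0
   \<and> (\<forall>q\<in>{s, t}. (\<lambda>k. simple_integral bm_noise (D1 (r k)) q v) \<longlonglongrightarrow> I q v)"
  by (rule stochastic_integral_approx[OF ito[unfolded ito_integral_def] _ _ st])
    (auto intro: measurable_noises sigma_finite_measure_count_space)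
 obtain D2 and Y2 :: "nat => 'a => ennreal" where D2: "\<And>k. simple_integrand P F ?d (D2 k)"
  "\<And>k. Y2 k \<in> borel_measurable P" "tendsto_0_in_prob P Y2"
  "\<And>r v. (\<lambda>k. Y2 (r k) v) \<longlonglongrightarrow> 0 ==>
   (\<lambda>k. \<integral>\<^sup>+ s\<in>{0<..t}. (\<integral>\<^sup>+ y. ennreal ((small_jump n s y v - simple_value (D2 (r k)) s y v)\<^sup>2) \<partial>mark_measure \<pi>) \<partial>lborel) \<longlonglongrightarrow> 0
   \<and> (\<forall>q\<in>{s, t}. (\<lambda>k. simple_integral comp_noise (D2 (r k)) q v) \<longlonglongrightarrow> J q v)"
  by (rule stochastic_integral_approx[OF comp[unfolded compensated_integral_def] sf _ st])
    (auto intro: measurable_noises)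
 \<comment> \<open>Adding the error sequences of both integrals yields one subsequence along which
   both converge.\<close>
 have "tendsto_0_in_prob P (\<lambda>k v. Y1 k v + Y2 k v)" by (rule tendsto_0_in_prob_add[OF D1(2) D2(2) D1(3) D2(3)])
 then obtain r where r: "AE v in P. (\<lambda>k. Y1 (r k) v + Y2 (r k) v) \<longlonglongrightarrow> 0"
  using tendsto_0_in_prob_AE_subseq[of "\<lambda>k v. Y1 k v + Y2 k v"] D1(2) D2(2) by auto
 have hm: "(\<lambda>(v, s, y). small_jump n s y v) \<in> borel_measurable (P \<Otimes>\<^sub>M time_mark ?d)"
  using comp unfolding compensated_integral_def stochastic_integral_def by blast
 have id: "(\<lambda>s. s) \<in> measurable (interval_measure s t) borel" by (rule measurable_restrict_space1) simp
 have id0: "(\<lambda>s. s) \<in> measurable (interval_measure s t) (restrict_space lborel {0<..})"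
  by (rule measurable_restrict_space2) (use id st in \<open>auto simp: space_restrict_space\<close>)
 have sm: "(\<lambda>p. small_jump n (fst p) (snd p) v) \<in> ?h s" if w: "v \<in> space P" for v
 proof -
  have "(\<lambda>p. (v, fst p, snd p)) \<in> measurable (?a s) (P \<Otimes>\<^sub>M time_mark ?d)"
   unfolding time_mark_def using w by (intro measurable_Pair measurable_compose[OF measurable_fst id0]) simp_all
  from measurable_compose[OF this hm] show ?thesis by simp
 qed
 have lims: "(?e v D1 r) \<longlonglongrightarrow> 0"
    "(?c v D2 r) \<longlonglongrightarrow> 0"
    "\<forall>q\<in>{s, t}. (\<lambda>k. simple_integral bm_noise (D1 (r k)) q v) \<longlonglongrightarrow> I q v"
    "\<forall>q\<in>{s, t}. (\<lambda>k. simple_integral comp_noise (D2 (r k)) q v) \<longlonglongrightarrow> J q v"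
  if l: "(\<lambda>k. Y1 (r k) v + Y2 (r k) v) \<longlonglongrightarrow> 0" and w: "v \<in> space P" for v
 proof -
  have "(\<lambda>k. Y1 (r k) v) \<longlonglongrightarrow> 0" "(\<lambda>k. Y2 (r k) v) \<longlonglongrightarrow> 0"
   by (rule tendsto_sandwich[OF _ _ tendsto_const l]; simp)+
  note L = D1(4)[OF this(1)] D2(4)[OF this(2)]
  show "(?e v D1 r) \<longlonglongrightarrow> 0" using L(1) by (simp add: ito_sqrt_rate[OF w] nn_integral_count_space_finite UNIV_unit)
  show "(?c v D2 r) \<longlonglongrightarrow> 0"
    "\<forall>q\<in>{s, t}. (\<lambda>k. simple_integral bm_noise (D1 (r k)) q v) \<longlonglongrightarrow> I q v"
    "\<forall>q\<in>{s, t}. (\<lambda>k. simple_integral comp_noise (D2 (r k)) q v) \<longlonglongrightarrow> J q v" using L by blast+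
 qed
 define Ie where "Ie e v = rate_integral u ?\<sigma> s t (\<lambda>r. sqrt (rate n r v)) (\<lambda>r y. small_jump n r y v) (\<lambda>r y. big_jump n e r y v)" for e v
 define Te where "Te e v = ?\<sigma> * (I t v - I s v) + (J t v - J s v) + (jumps_upto n e t v - jumps_upto n e s v)" for e v
 define C where "C = (u\<^sup>2 * ?\<sigma>\<^sup>2 / 2 * real n powr \<theta> + u\<^sup>2 * (real n powr \<theta> * enn2real small_moment) + 2 * measure ?d (big_marks h)) * (t - s)"
 have C0: "0 \<le> C" using st by (simp add: C_def enn2real_nonneg)
 have bdI: "- Re (Ie (?b k) v) \<le> C" if "v \<in> space P" for k v
  using rate_bound_const[OF n st that e, of u ?\<sigma> k] abs_Re_le_cmod[of "Ie (?b k) v"] unfolding Ie_def[symmetric] C_def by linarith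
 have limD: "AE v in P. (\<lambda>k. exponent ?\<sigma> (D1 (r k)) (D2 (r k)) (jump_approx n e' T h k) s t v) \<longlonglongrightarrow> Te e' v"
  and limI: "AE v in P. (\<lambda>k. LINT p:{s<..t}|lborel. simple_rate u ?\<sigma> (D1 (r k)) (D2 (r k)) (jump_approx n e' T h k) p v) \<longlonglongrightarrow> Ie e' v"
  if e': "0 < e'" "real n powr \<theta> + e' \<le> real h" for e'
 proof -
  show "AE v in P. (\<lambda>k. exponent ?\<sigma> (D1 (r k)) (D2 (r k)) (jump_approx n e' T h k) s t v) \<longlonglongrightarrow> Te e' v"
   using r jump_approx_integral_limit[OF n e', of T] AE_space
  proof eventually_elim
   case (elim v)
   have "s \<in> {0..real T}" "t \<in> {0..real T}" using st T by auto
   thus ?case unfolding exponent_def Te_def using lims[OF elim(1,3)] elim(2) by (intro tendsto_intros) auto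
  qed
  show "AE v in P. (\<lambda>k. LINT p:{s<..t}|lborel. simple_rate u ?\<sigma> (D1 (r k)) (D2 (r k)) (jump_approx n e' T h k) p v) \<longlonglongrightarrow> Ie e' v"
   using r AE_space
  proof eventually_elim
   case (elim v)
   have "(\<lambda>k. rate_integral u ?\<sigma> s t (\<lambda>p. simple_value (D1 (r k)) p () v) (\<lambda>p y. simple_value (D2 (r k)) p y v) (\<lambda>p y. simple_value (jump_approx n e' T h k) p y v))
    \<longlonglongrightarrow> Ie e' v" unfolding Ie_def
   proof (rule rate_integral_limit[where S="big_marks h", OF st sqrt_rate_measurable[OF n st elim(2)] _ sm[OF elim(2)] _ _ big_marks _ _
      sqrt_rate_L2[OF n st] lims(1)[OF elim] small_jump_product_L2[OF n st elim(2) sm[OF elim(2)]] lims(2)[OF elim]])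
    have "(\<lambda>p. (p, ())) \<in> measurable (interval_measure s t) (interval_measure s t \<Otimes>\<^sub>M count_space UNIV)" by simp
    from measurable_compose[OF this simple_value_section[OF D1(1) elim(2) id]]
    show "(\<lambda>p. simple_value (D1 (r k)) p () v) \<in> borel_measurable (interval_measure s t)" for k by simp
    show "(\<lambda>p. simple_value (D2 (r k)) (fst p) (snd p) v) \<in> ?h s" for k by (rule simple_value_section[OF D2(1) elim(2) id])
    show "(\<lambda>p. simple_value (jump_approx n e' T h k) (fst p) (snd p) v) \<in> ?h s" for k
     by (rule simple_value_section[OF jump_approx_simple[OF n] elim(2) id])
    fix p y assume p: "s < p" "p \<le> t" and y: "y \<in> space ?d"
    show "simple_value (jump_approx n e' T h k) p y v = 0" if "y \<notin> big_marks h" for k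
     using jump_approx_bounds[of n e' T h k p "fst y" "snd y" v] that by (auto simp: indicator_def)
    show "(\<lambda>k. simple_value (jump_approx n e' T h k) p y v) \<longlonglongrightarrow> big_jump n e' p y v"
     using jump_approx_limit[OF n elim(2) e', of p T "snd y" "fst y"] y p st T by (auto simp: space_mark)
   qed
   thus ?case by (simp add: rate_integral_def simple_rate_def)
  qed
 qed
 \<comment> \<open>The martingale identity for a fixed width of the cut; the second limit starts
   from here.\<close>
 have stage: "(LINT v|P. Z v * exp (\<i> * ?g Te k v - Ie (?b k) v)) = (LINT v|P. Z v)" for k
  by (rule exp_martingale_limit[OF D1(1) D2(1) jump_approx_simple[OF n] st Z Zb limD[OF e] limI[OF e] AE_I2[OF bdI] C0])
 define Io where "Io v = path_exponent n u s t v" for v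
 have meas: "(\<lambda>v. Z v * exp (\<i> * ?g Te k v - Ie (?b k) v)) \<in> borel_measurable P" for k
 proof -
  have sn: "simple_noise P F W ?d N (D1 (r j)) (D2 (r j)) (jump_approx n (?b k) T h j)" for j
   by (intro simple_noise.intro noisy_space_axioms simple_noise_axioms.intro D1 D2 jump_approx_simple[OF n])
  have [measurable]: "Ie (?b k) \<in> borel_measurable P"
   by (rule measurable_P_AE_LIMSEQ[OF _ limI[OF e]]) (rule measurable_F[OF simple_noise.rate_int_adapted[OF sn st]], use st in simp)
  have [measurable]: "Te (?b k) \<in> borel_measurable P"
   by (rule measurable_P_AE_LIMSEQ[OF _ limD[OF e]]) (rule measurable_F[OF simple_noise.exponent_measurable[OF sn st]], use st in simp)
  have [measurable]: "Z \<in> borel_measurable P" by (rule measurable_F[OF Z st(1)])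
  show ?thesis by measurable
 qed
 have AElim: "AE v in P. (\<lambda>k. Z v * exp (\<i> * ?g Te k v - Ie (?b k) v)) \<longlonglongrightarrow> Z v * ?f v Io"
  using jumps_upto_limit[OF n, of T] AE_space
 proof eventually_elim
  case (elim v)
  have "s \<in> {0..real T}" "t \<in> {0..real T}" using st T by auto
  hence T: "(\<lambda>k. Te (?b k) v) \<longlonglongrightarrow> \<Theta> v" unfolding Te_def \<Theta>_def using elim(1) by (intro tendsto_intros) auto
  have I: "(\<lambda>k. Ie (?b k) v) \<longlonglongrightarrow> Io v" unfolding Ie_def Io_def rate_integral_value[OF n st elim(2), symmetric]
  proof (rule rate_integral_limit[where S="big_marks h", OF st sqrt_rate_measurable[OF n st elim(2)] sqrt_rate_measurable[OF n st elim(2)]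
     sm[OF elim(2)] sm[OF elim(2)] _ big_marks _ _ sqrt_rate_L2[OF n st] _ small_jump_product_L2[OF n st elim(2) sm[OF elim(2)]]])
   show "(\<lambda>p. big_jump n (?b k) (fst p) (snd p) v) \<in> ?h s" for k
   proof (rule borel_measurable_LIMSEQ_metric)
    show "(\<lambda>p. simple_value (jump_approx n (?b k) T h j) (fst p) (snd p) v) \<in> ?h s" for j
     by (rule simple_value_section[OF jump_approx_simple[OF n] elim(2) id])
    fix p assume "p \<in> space (?a s)"
    hence "s < fst p" "fst p \<le> t" "0 < fst (snd p)" "0 < snd (snd p)" by (auto simp: space_pair_measure space_mark space_restrict_space)
    thus "(\<lambda>j. simple_value (jump_approx n (?b k) T h j) (fst p) (snd p) v) \<longlonglongrightarrow> big_jump n (?b k) (fst p) (snd p) v"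
     using jump_approx_limit[OF n elim(2) e, of "fst p" T "snd (snd p)" "fst (snd p)" k] st \<open>t \<in> {0..real T}\<close> by (auto simp del: of_nat_Suc)
   qed
   fix p y assume p: "s < p" "p \<le> t" and y: "y \<in> space ?d"
   have p0: "0 < p" using p st by simp
   show "big_jump n (?b k) p y v = 0" if "y \<notin> big_marks h" for k
    using big_jump_bounds[OF elim(2) e[of k] p0 order_refl, of "snd y" "fst y"] that y by (cases y) (auto simp: space_mark simp del: of_nat_Suc)
   show "(\<lambda>k. big_jump n (?b k) p y v) \<longlonglongrightarrow> large_jump n p y v"
    using big_jump_limit_e[OF elim(2), of "fst y" n p "snd y"] y by (cases y) (auto simp: space_mark large_jump_def simp del: of_nat_Suc)
  qed auto
  show ?case using T I by (intro tendsto_intros)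
 qed
 have mlim: "(\<lambda>v. Z v * ?f v Io) \<in> borel_measurable P" by (rule measurable_P_AE_LIMSEQ[OF meas AElim])
 have "(\<lambda>k. \<integral>v. Z v * exp (\<i> * ?g Te k v - Ie (?b k) v) \<partial>P) \<longlonglongrightarrow> (LINT v|P. Z v * ?f v Io)"
 proof (rule integral_dominated_convergence[where w="\<lambda>_. exp C", OF mlim meas _ AElim])
  show "AE v in P. norm (Z v * exp (\<i> * ?g Te k v - Ie (?b k) v)) \<le> exp C" for k
  proof (rule AE_I2)
   fix v assume w: "v \<in> space P"
   have "norm (exp (\<i> * ?g Te k v - Ie (?b k) v)) \<le> exp C" using bdI[OF w, of k] by simp
   thus "norm (Z v * exp (\<i> * ?g Te k v - Ie (?b k) v)) \<le> exp C" using Zb[OF w] mult_mono[of "norm (Z v)" 1 _ "exp C"] by (simp add: norm_mult)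
  qed
 qed simp
 hence "(LINT v|P. Z v * ?f v Io) = (LINT v|P. Z v)" unfolding stage by (simp add: LIMSEQ_const_iff)
 thus ?thesis by (simp only: Io_def)
qed

end

context noisy_space begin

lemma stochastic_integral_0:
 assumes si: "stochastic_integral P F \<mu> L H J" and sf: "sigma_finite_measure \<mu>"
  and L: "\<And>A r. A \<in> sets \<mu> ==> emeasure \<mu> A < \<infinity> ==> 0 \<le> r ==> L A r \<in> borel_measurable (F r)"
 shows "AE w in P. J 0 w = 0"
proof -
 obtain D and Y :: "nat => 'a => ennreal" where D: "\<And>k. simple_integrand P F \<mu> (D k)"
  and m: "\<And>k. Y k \<in> borel_measurable P" and l: "tendsto_0_in_prob P Y"
  and J: "\<And>r w. (\<lambda>k. Y (r k) w) \<longlonglongrightarrow> 0 ==> (\<lambda>k. simple_integral L (D (r k)) 0 w) \<longlonglongrightarrow> J 0 w"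
  by (rule stochastic_integral_approx[OF si sf L order_refl order_refl]) auto
 have z: "simple_integral L (D k) 0 w = 0" for k w
 proof -
  have "simple_integral L (D k) 0 w = (\<Sum>x\<leftarrow>D k. 0)" unfolding simple_integral_def
  proof (intro sum_list_cong refl)
   fix x assume mem: "x \<in> set (D k)"
   obtain a b A \<xi> where x: "x = (a, b, A, \<xi>)" by (cases x)
   show "(case x of (a, b, A, \<xi>) => \<xi> w * (L A (min 0 b) w - L A (min 0 a) w)) = 0"
    using simple_integrandD(1,2)[OF D mem[unfolded x]] by (simp add: x)
  qed
  thus ?thesis by simp
 qed
 obtain r where "AE w in P. (\<lambda>k. Y (r k) w) \<longlonglongrightarrow> 0" using tendsto_0_in_prob_AE_subseq[OF m l] by blast
 thus ?thesis using J by (auto simp: z LIMSEQ_const_iff elim!: eventually_mono)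
qed

end

context branching_sde begin

text \<open>The equation equates the stopped state with a real number in \<open>ereal\<close>; so
  the stopped state is finite and may be replaced by \<open>stopped_real\<close>, with the
  right-hand side automatically nonnegative.\<close>

lemma stopped_equation:
 assumes n: "1 \<le> n"
 obtains I J where
  "ito_integral P F W (\<lambda>s w. if ereal s \<le> \<zeta> n w then sqrt (1 / enn2real (X s w) powr (- \<theta>)) else 0) I"
  "compensated_integral P F (mark_measure \<pi>) N (small_jump n) J"
  "AE w in P. \<forall>t\<ge>0. stopped n t w = ennreal (stopped_real n t w) \<and>
    stopped_real n t w = x + sqrt (2 * c) * I t w + J t w - b * cum_rate n 0 t w + jumps_of n t w"
proof -
 let ?a = "\<lambda>z u w. \<lambda>s (z, u) w. if ereal s \<le> \<zeta> n w \<and> z \<le> 1 \<and> u \<le> 1 / enn2real (left_limit X s w) powr (- \<theta>) then z else 0"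
 obtain I J where I: "ito_integral P F W (\<lambda>s w. if ereal s \<le> \<zeta> n w then sqrt (1 / enn2real (X s w) powr (- \<theta>)) else 0) I"
  and J: "compensated_integral P F (mark_measure \<pi>) N
     (?a z u w) J"
  and eq: "AE w in P. \<forall>t\<ge>0.
     enn2ereal (X (real_of_ereal (min (ereal t) (\<zeta> n w))) w) =
     ereal (x + sqrt (2 * c) * I t w + J t w
      - b * (LINT s:{s. 0 \<le> s \<and> s \<le> t \<and> ereal s \<le> \<zeta> n w}|lborel. 1 / enn2real (X s w) powr (- \<theta>))
      + (\<integral>(s, z, u). (if s \<le> t \<and> ereal s \<le> \<zeta> n w \<and> 1 < z \<and>
          u \<le> 1 / enn2real (left_limit X s w) powr (- \<theta>) then z else 0) \<partial>N w))"
  using sol n unfolding sde_solution_def solves_up_to_zeta_def by blast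
 have "(?a z u w) = small_jump n" by (auto simp: fun_eq_iff small_jump_def rate_left_def powr_minus_divide)
 with J have J': "compensated_integral P F (mark_measure \<pi>) N (small_jump n) J" by simp
 have "AE w in P. \<forall>t\<ge>0. stopped n t w = ennreal (stopped_real n t w) \<and>
    stopped_real n t w = x + sqrt (2 * c) * I t w + J t w - b * cum_rate n 0 t w + jumps_of n t w" using eq AE_space
 proof eventually_elim
  case (elim w)
  show ?case
  proof (intro allI impI)
   fix t :: real assume t: "0 \<le> t"
   let ?v = "x + sqrt (2 * c) * I t w + J t w - b * cum_rate n 0 t w + jumps_of n t w"
   have e: "enn2ereal (stopped n t w) = ereal ?v" using elim(1)[rule_format, OF t] unfolding drift_integral[OF n t elim(2)] stopped_def jumps_of_def .
   have nn: "0 \<le> ?v" using enn2ereal_nonneg[of "stopped n t w"] unfolding e by simp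
   have s: "stopped n t w = ennreal ?v" using e by (metis e2ennreal_enn2ereal e2ennreal_ereal)
   hence "stopped_real n t w = ?v" using nn by (simp add: stopped_real_def)
   thus "stopped n t w = ennreal (stopped_real n t w) \<and> stopped_real n t w = ?v" using s by simp
  qed
 qed
 thus ?thesis using that[OF I J'] by blast
qed

lemma jumps_of_0: "y \<in> space P ==> jumps_of n 0 y = 0"
proof -
 assume w: "y \<in> space P"
 have "jumps_of n 0 y = (LINT p|N y. 0)" unfolding jumps_of_def by (intro lebesgue_integral_cong refl) (auto simp: space_N[OF w])
 thus ?thesis by simp
qed

lemma X_0: "AE w in P. X 0 w = ennreal x"
proof -
 obtain I J where I: "ito_integral P F W (\<lambda>s w. if ereal s \<le> \<zeta> 1 w then sqrt (1 / enn2real (X s w) powr (- \<theta>)) else 0) I"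
  and J: "compensated_integral P F (mark_measure \<pi>) N (small_jump 1) J"
  and eq: "AE w in P. \<forall>t\<ge>0. stopped 1 t w = ennreal (stopped_real 1 t w) \<and>
    stopped_real 1 t w = x + sqrt (2 * c) * I t w + J t w - b * cum_rate 1 0 t w + jumps_of 1 t w" by (rule stopped_equation[of 1]) auto
 have "AE w in P. I 0 w = 0"
  by (rule stochastic_integral_0[OF I[unfolded ito_integral_def]]) (auto intro: measurable_noises sigma_finite_measure_count_space)
 moreover have "AE w in P. J 0 w = 0" by (rule stochastic_integral_0[OF J[unfolded compensated_integral_def] sf]) (auto intro: measurable_noises)
 ultimately show ?thesis using eq AE_space
 proof eventually_elim
  case (elim w)
  have "min (ereal 0) (\<zeta> 1 w) = ereal 0" using \<zeta>_nonneg[of 1 w] by (intro min_absorb1) (simp add: zero_ereal_def)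
  hence "stopped 1 0 w = X 0 w" by (simp add: stopped_def)
  moreover have "stopped_real 1 0 w = x" using elim jumps_of_0[OF elim(4)] by (simp add: cum_rate_def set_lebesgue_integral_def)
  ultimately show ?case using elim(3) by (metis order_refl)
 qed
qed

lemma stopped_finite: "1 \<le> n ==> AE w in P. \<forall>t\<ge>0. stopped n t w = ennreal (stopped_real n t w)"
 by (erule stopped_equation) (auto elim: eventually_mono)

text \<open>Over \<open>[s, t]\<close> the noise and the increment of the stopped solution differ by
  \<open>b * cum_rate n s t\<close>. Accounting for this drift completes
  \<open>path_exponent\<close> to \<open>char_exponent\<close>.\<close>

lemma exp_martingale_stopped:
 fixes Z :: "'a => complex"
 assumes n: "1 \<le> n" and st: "0 \<le> s" "s \<le> t"
  and Z: "Z \<in> borel_measurable (F s)" and Zb: "\<And>w. w \<in> space P ==> norm (Z w) \<le> 1"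
  and m: "stopped_real n s \<in> borel_measurable P" "stopped_real n t \<in> borel_measurable P" "cum_rate n s t \<in> borel_measurable P"
 shows "(LINT w|P. Z w * exp (\<i> * of_real (u * (stopped_real n t w - stopped_real n s w)) - char_exponent (of_real u) * of_real (cum_rate n s t w))) = (LINT w|P. Z w)"
proof -
 let ?a = "\<lambda>t w s. exp (\<i> * of_real (u * (stopped_real n t w - stopped_real n s w)) - char_exponent (of_real u) * of_real (cum_rate n s t w))"
 obtain I J where I: "ito_integral P F W (\<lambda>s w. if ereal s \<le> \<zeta> n w then sqrt (1 / enn2real (X s w) powr (- \<theta>)) else 0) I"
  and J: "compensated_integral P F (mark_measure \<pi>) N (small_jump n) J"
  and eq: "AE w in P. \<forall>t\<ge>0. stopped n t w = ennreal (stopped_real n t w) \<and>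
    stopped_real n t w = x + sqrt (2 * c) * I t w + J t w - b * cum_rate n 0 t w + jumps_of n t w" by (rule stopped_equation[OF n])
 let ?T = "\<lambda>w. sqrt (2 * c) * (I t w - I s w) + (J t w - J s w) + (jumps_of n t w - jumps_of n s w)"
 have T: "AE w in P. ?T w = stopped_real n t w - stopped_real n s w + b * cum_rate n s t w" using eq AE_space
 proof eventually_elim
  case (elim w)
  have "cum_rate n 0 t w = cum_rate n 0 s w + cum_rate n s t w" using st by (intro cum_rate_add[OF n _ _ _ elim(2)]) auto
  moreover have "stopped_real n t w = x + sqrt (2 * c) * I t w + J t w - b * cum_rate n 0 t w + jumps_of n t w"
   "stopped_real n s w = x + sqrt (2 * c) * I s w + J s w - b * cum_rate n 0 s w + jumps_of n s w" using elim(1) st by auto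
  ultimately show ?case by (simp add: algebra_simps)
 qed
 note [measurable] = m measurable_F[OF Z st(1)]
 have Tm [measurable]: "?T \<in> borel_measurable P"
  by (rule measurable_P_AE_LIMSEQ[of "\<lambda>_ w. stopped_real n t w - stopped_real n s w + b * cum_rate n s t w"])
    (measurable, use T in \<open>eventually_elim, simp\<close>)
 have "(LINT w|P. Z w * ?a t w s)
  = (LINT w|P. Z w * exp (\<i> * of_real (u * ?T w) - path_exponent n u s t w))"
 proof (rule integral_cong_AE)
  show "AE w in P. Z w * ?a t w s
   = Z w * exp (\<i> * of_real (u * ?T w) - path_exponent n u s t w)" using T
  proof eventually_elim
   case (elim w)
   show ?case unfolding elim by (simp add: algebra_simps)
  qed
 qed measurable
 also have "\<dots> = (LINT w|P. Z w)" by (rule exp_martingale_noise[OF n st I J Z Zb])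
 finally show ?thesis .
qed

lemma X_progressive:
 assumes "0 \<le> T" shows "(\<lambda>(r, w). X (min (max r 0) T) w) \<in> borel_measurable (borel \<Otimes>\<^sub>M F T)"
 by (rule borel_measurable_progressive[OF _ assms])
   (use measurable_F_mono[OF X_adapted] X_right assms in auto)

text \<open>The progressively measurable path is evaluated at the exit time capped at
  \<open>t\<close>, so it is read only up to time \<open>t\<close>.\<close>

lemma stopped_adapted:
 assumes n: "1 \<le> n" and t: "0 \<le> t" shows "stopped n t \<in> borel_measurable (F t)"
proof -
 define \<tau> where "\<tau> w = real_of_ereal (min (ereal t) (\<zeta> n w))" for w
 have \<tau>: "ereal (\<tau> w) = min (ereal t) (\<zeta> n w)" for w
  using \<zeta>_nonneg[of n w] t unfolding \<tau>_def by (cases "\<zeta> n w") (auto simp: min_def)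
 have \<tau>0: "0 \<le> \<tau> w" for w unfolding ereal_less_eq(3)[symmetric] \<tau> using \<zeta>_nonneg[of n w] t by (simp add: zero_ereal_def)
 have [measurable]: "\<tau> \<in> borel_measurable (F t)"
 proof (rule borel_measurableI_greater)
  fix r
  consider "r < 0" | "0 \<le> r" "r < t" | "t \<le> r" by linarith
  thus "{w \<in> space (F t). r < \<tau> w} \<in> sets (F t)"
  proof cases
   case 1
   hence "{w \<in> space (F t). r < \<tau> w} = space (F t)" using \<tau>0 by (auto intro: less_le_trans)
   thus ?thesis by simp
  next
   case 2
   hence "{w \<in> space (F t). r < \<tau> w} = {w \<in> space P. ereal r < \<zeta> n w}"
    using t by (auto simp: \<tau> simp flip: less_ereal.simps(1))
   thus ?thesis using \<zeta>_stopping_less[OF n 2(1)] F_mono[OF 2(1), of t] 2 by auto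
  next
   case 3
   hence "{w \<in> space (F t). r < \<tau> w} = {}" by (auto simp: \<tau> simp flip: less_ereal.simps(1), simp)
   thus ?thesis by (simp only: sets.empty_sets)
  qed
 qed
 have "(\<lambda>w. (\<tau> w, w)) \<in> measurable (F t) (borel \<Otimes>\<^sub>M F t)" by measurable
 from measurable_compose[OF this X_progressive[OF t]]
 have "(\<lambda>w. X (min (max (\<tau> w) 0) t) w) \<in> borel_measurable (F t)" by simp
 moreover have "min (max (\<tau> w) 0) t = \<tau> w" for w
 proof -
  have "ereal 0 \<le> ereal (\<tau> w)" "ereal (\<tau> w) \<le> ereal t" unfolding \<tau> using \<zeta>_nonneg[of n w] t by (auto simp flip: zero_ereal_def)
  thus ?thesis by simp
 qed
 ultimately show ?thesis by (simp add: stopped_def[abs_def] \<tau>_def)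
qed

lemma stopped_real_adapted: "1 \<le> n ==> 0 \<le> t ==> stopped_real n t \<in> borel_measurable (F t)"
 unfolding stopped_real_def using borel_measurable_enn2real[OF stopped_adapted] by simp

lemma cum_rate_adapted:
 assumes n: "1 \<le> n" and st: "0 \<le> s" "s \<le> t" shows "cum_rate n s t \<in> borel_measurable (F t)"
proof -
 have t: "0 \<le> t" using st by simp
 have "(\<lambda>p. (snd p, fst p)) \<in> measurable (F t \<Otimes>\<^sub>M lborel) (borel \<Otimes>\<^sub>M F t)" by measurable
 from measurable_compose[OF this rate_progressive[OF n t]]
 have [measurable]: "(\<lambda>p. rate n (min (max (snd p) 0) t) (fst p)) \<in> borel_measurable (F t \<Otimes>\<^sub>M lborel)" by simp
 show ?thesis unfolding cum_rate_path[OF st(1) order_refl, abs_def] set_lebesgue_integral_def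
  by (intro lborel.borel_measurable_lebesgue_integral) (simp add: case_prod_unfold)
qed

lemma cum_rate_bounds:
 assumes n: "1 \<le> n" and st: "0 \<le> s" "s \<le> t" and w: "y \<in> space P"
 shows "0 \<le> cum_rate n s t y" "cum_rate n s t y \<le> real n powr \<theta> * (t - s)"
proof -
 show "0 \<le> cum_rate n s t y" unfolding cum_rate_def set_lebesgue_integral_def
  by (intro integral_nonneg_AE AE_I2) (use st rate_bounds in \<open>auto simp: indicator_def\<close>)
 show "cum_rate n s t y \<le> real n powr \<theta> * (t - s)" using rate_integrable(2)[OF n st w] by simp
qed

end

section \<open>Continuation from characteristic functions to Laplace transforms\<close>

text \<open>A local integrable bound on \<open>h\<close> also bounds its difference quotients,
  through Cauchy's estimate for the derivative; dominated convergence then produces the complex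
  derivative of the integral.\<close>

lemma holomorphic_on_integral:
 fixes h :: "complex => 'a => complex"
 assumes S: "open S"
  and meas: "\<And>w. w \<in> S ==> h w \<in> borel_measurable M"
  and hol: "\<And>p. p \<in> space M ==> (\<lambda>w. h w p) holomorphic_on S"
  and dom: "\<And>w. w \<in> S ==> \<exists>r>0. \<exists>g. integrable M g \<and> cball w r \<subseteq> S \<and> (\<forall>v\<in>cball w r. \<forall>p\<in>space M. norm (h v p) \<le> g p)"
 shows "(\<lambda>w. \<integral>p. h w p \<partial>M) holomorphic_on S" unfolding holomorphic_on_open[OF S]
proof
 let ?a = "\<lambda>p. \<lambda>w. h w p"
 let ?b = "\<lambda>w. \<integral>p. h w p \<partial>M"
 let ?c = "\<lambda>D. \<integral>p. D p \<partial>M"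
 fix w assume w: "w \<in> S"
 obtain r g where r: "0 < r" and g: "integrable M g" and sub: "cball w r \<subseteq> S"
  and bd: "\<And>v p. v \<in> cball w r ==> p \<in> space M ==> norm (h v p) \<le> g p" using dom[OF w] by blast
 have int: "integrable M (h v)" if "v \<in> cball w r" for v
  by (rule Bochner_Integration.integrable_bound[OF g]) (use meas that sub in \<open>auto intro!: AE_I2 intro: order_trans[OF bd abs_ge_self]\<close>)
 \<comment> \<open>Staying in the ball of radius \<open>r / 2\<close> leaves room for Cauchy circles
   of radius \<open>r / 2\<close> inside the disc where \<open>g\<close> dominates.\<close>
 have lip: "norm (h v p - h w p) \<le> 2 * g p / r * norm (v - w)" if v: "v \<in> ball w (r / 2)" and p: "p \<in> space M" for v p
 proof (rule field_differentiable_bound[where S="ball w (r / 2)" and f'="deriv (?a p)"])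
  fix z assume z: "z \<in> ball w (r / 2)"
  have zr: "cball z (r / 2) \<subseteq> cball w r"
  proof
   fix y assume "y \<in> cball z (r / 2)"
   thus "y \<in> cball w r" using z dist_triangle[of w y z] by (simp add: dist_commute)
  qed
  have hz: "(?a p) holomorphic_on cball z (r / 2)" using hol[OF p] zr sub by (meson holomorphic_on_subset order_trans)
  show "((?a p) has_field_derivative deriv (?a p) z) (at z within ball w (r / 2))"
   by (rule has_field_derivative_at_within, rule holomorphic_derivI[OF hol[OF p] S subsetD[OF sub]]) (use z r in auto)
  have "norm ((deriv ^^ 1) (?a p) z) \<le> fact 1 * g p / (r / 2) ^ 1"
  proof (rule Cauchy_inequality)
   show "(?a p) holomorphic_on ball z (r / 2)" using hz by (rule holomorphic_on_subset) auto
   show "continuous_on (cball z (r / 2)) (?a p)" using hz by (rule holomorphic_on_imp_continuous_on)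
   show "0 < r / 2" using r by simp
   fix y assume "norm (z - y) = r / 2"
   hence "y \<in> cball z (r / 2)" by (simp add: dist_norm)
   thus "norm (h y p) \<le> g p" using zr bd[OF _ p] by blast
  qed
  thus "norm (deriv (?a p) z) \<le> 2 * g p / r" by (simp add: field_simps)
 qed (use v r in auto)
 define D where "D p = deriv (?a p) w" for p
 have quot: "(\<lambda>k. (h (v k) p - h w p) / (v k - w)) \<longlonglongrightarrow> D p"
  if "p \<in> space M" "\<And>k. v k \<noteq> w" "v \<longlonglongrightarrow> w" for p v
 proof -
  have "((\<lambda>v. (h v p - h w p) / (v - w)) \<longlongrightarrow> D p) (at w)"
   using holomorphic_derivI[OF hol[OF that(1)] S w] unfolding D_def has_field_derivative_iff .
  moreover have "filterlim v (at w) sequentially" using that by (simp add: filterlim_at)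
  ultimately show ?thesis by (rule filterlim_compose)
 qed
 have "((\<lambda>v. ((LINT p|M. h v p) - (?b w)) / (v - w)) \<longlongrightarrow> (?c D)) (at w)" unfolding tendsto_at_iff_sequentially comp_def
 proof (intro allI impI)
  fix v :: "nat => complex" assume v: "\<forall>k. v k \<in> UNIV - {w}" "v \<longlonglongrightarrow> w"
  have "eventually (\<lambda>k. v k \<in> ball w (r / 2)) sequentially" using v(2) r by (intro topological_tendstoD[OF v(2)]) auto
  then obtain k0 where k0: "\<And>k. k \<ge> k0 ==> v k \<in> ball w (r / 2)" by (auto simp: eventually_sequentially)
  define v' where "v' k = v (k + k0)" for k
  have v': "v' k \<in> ball w (r / 2)" "v' k \<noteq> w" for k using k0[of "k + k0"] v(1) by (auto simp: v'_def)
  have v'c: "v' k \<in> cball w r" for k using v'(1)[of k] r by auto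
  have v'l: "v' \<longlonglongrightarrow> w" unfolding v'_def using v(2) by (rule LIMSEQ_ignore_initial_segment)
  have qm: "(\<lambda>p. (h (v' k) p - h w p) / (v' k - w)) \<in> borel_measurable M" for k
   using meas[of "v' k"] meas[OF w] v'c[of k] sub by (intro borel_measurable_divide borel_measurable_diff) auto
  have ql: "(\<lambda>k. (h (v' k) p - h w p) / (v' k - w)) \<longlonglongrightarrow> D p" if "p \<in> space M" for p
   by (rule quot[OF that v'(2) v'l])
  have Dm: "D \<in> borel_measurable M" by (rule borel_measurable_LIMSEQ_metric[OF qm ql])
  have "(\<lambda>k. \<integral>p. (h (v' k) p - h w p) / (v' k - w) \<partial>M) \<longlonglongrightarrow> (?c D)"
  proof (rule integral_dominated_convergence[OF Dm qm])
   show "integrable M (\<lambda>p. 2 * g p / r)" using g by auto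
   show "AE p in M. (\<lambda>k. (h (v' k) p - h w p) / (v' k - w)) \<longlonglongrightarrow> D p" using ql by (rule AE_I2)
   show "AE p in M. norm ((h (v' k) p - h w p) / (v' k - w)) \<le> 2 * g p / r" for k
   proof (rule AE_I2)
    fix p assume "p \<in> space M"
    thus "norm ((h (v' k) p - h w p) / (v' k - w)) \<le> 2 * g p / r"
     using lip[OF v'(1)[of k]] v'(2)[of k] by (simp add: norm_divide pos_divide_le_eq)
   qed
  qed
  moreover have "(LINT p|M. (h (v' k) p - h w p) / (v' k - w)) = ((LINT p|M. h (v' k) p) - (?b w)) / (v' k - w)" for k
   using int[OF v'c[of k]] int[of w] r by simp
  ultimately have "(\<lambda>k. ((LINT p|M. h (v (k + k0)) p) - (?b w)) / (v (k + k0) - w)) \<longlonglongrightarrow> (?c D)" by (simp only: v'_def)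
  thus "(\<lambda>k. ((LINT p|M. h (v k) p) - (?b w)) / (v k - w)) \<longlonglongrightarrow> (?c D)" by (rule LIMSEQ_offset)
 qed
 thus "\<exists>f'. ((\<lambda>w. \<integral>p. h w p \<partial>M) has_field_derivative f') (at w)" by (auto simp: has_field_derivative_iff)
qed

lemma continuous_on_integral_dominated:
 fixes h :: "'b::metric_space => 'a => complex"
 assumes meas: "\<And>w. w \<in> T ==> h w \<in> borel_measurable M"
  and cont: "\<And>y. y \<in> space M ==> continuous_on T (\<lambda>w. h w y)"
  and dom: "\<And>w. w \<in> T ==> \<exists>r>0. \<exists>g. integrable M g \<and> (\<forall>v\<in>T \<inter> cball w r. \<forall>y\<in>space M. norm (h v y) \<le> g y)"
 shows "continuous_on T (\<lambda>w. \<integral>y. h w y \<partial>M)" unfolding continuous_on_sequentially comp_def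
proof (intro allI ballI impI)
 fix v w assume w: "w \<in> T" and "(\<forall>n. v n \<in> T) \<and> v \<longlonglongrightarrow> w"
 hence v: "w \<in> T \<and> (\<forall>n. v n \<in> T) \<and> v \<longlonglongrightarrow> w" by blast
 obtain r g where r: "0 < r" and g: "integrable M g"
  and bd: "\<And>v y. v \<in> T ==> v \<in> cball w r ==> y \<in> space M ==> norm (h v y) \<le> g y" using dom[of w] v by blast
 have "eventually (\<lambda>k. v k \<in> ball w r) sequentially" using v r by (intro topological_tendstoD[of v w]) auto
 then obtain k0 where k0: "\<And>k. k \<ge> k0 ==> v k \<in> ball w r" by (auto simp: eventually_sequentially)
 have "(\<lambda>k. \<integral>y. h (v (k + k0)) y \<partial>M) \<longlonglongrightarrow> (LINT y|M. h w y)"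
 proof (rule integral_dominated_convergence[OF _ _ g])
  show "AE y in M. (\<lambda>k. h (v (k + k0)) y) \<longlonglongrightarrow> h w y"
  proof (rule AE_I2)
   fix y assume "y \<in> space M"
   hence "(\<lambda>k. h (v k) y) \<longlonglongrightarrow> h w y" using cont[of y] v unfolding continuous_on_sequentially comp_def by blast
   thus "(\<lambda>k. h (v (k + k0)) y) \<longlonglongrightarrow> h w y" by (rule LIMSEQ_ignore_initial_segment)
  qed
  show "AE y in M. norm (h (v (k + k0)) y) \<le> g y" for k using bd v k0[of "k + k0"] by (intro AE_I2) auto
 qed (use meas v in auto)
 thus "(\<lambda>n. \<integral>y. h (v n) y \<partial>M) \<longlonglongrightarrow> (LINT y|M. h w y)" by (rule LIMSEQ_offset)
qed

text \<open>Extended by 0 to the lower half-plane, the function is continuous across the real line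
  and hence entire. It vanishes on an open half-plane, so it vanishes identically.\<close>

lemma zero_on_upper_half_plane:
 assumes hol: "f holomorphic_on {w. 0 < Im w}" and cont: "continuous_on {w. 0 \<le> Im w} f"
  and zero: "\<And>u. f (of_real u) = 0" and w: "0 \<le> Im w" shows "f w = 0"
proof -
 define g where "g w = (if 0 \<le> Im w then f w else 0)" for w
 have r: "f v = 0" if "Im v = 0" for v
 proof -
  have "v = of_real (Re v)" using that by (simp add: complex_eq_iff)
  thus ?thesis using zero by metis
 qed
 have "g holomorphic_on UNIV"
 proof (rule holomorphic_on_paste_across_line[where d="\<i>" and k=0])
  have "g holomorphic_on {w. Im w < 0}" by (rule holomorphic_transform[of "\<lambda>_. 0"]) (auto simp: g_def)
  thus "g holomorphic_on UNIV \<inter> {z. \<i> \<bullet> z < 0}" by (simp add: inner_complex_def)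
  have "g holomorphic_on {w. 0 < Im w}" by (rule holomorphic_transform[OF hol]) (auto simp: g_def)
  thus "g holomorphic_on UNIV \<inter> {z. 0 < \<i> \<bullet> z}" by (simp add: inner_complex_def)
  have "continuous_on ({w. 0 \<le> Im w} \<union> {w. Im w \<le> 0}) (\<lambda>w. if 0 \<le> Im w then f w else 0)"
   by (rule continuous_on_cases) (use cont r in \<open>auto intro: closed_halfspace_Im_ge closed_halfspace_Im_le\<close>)
  moreover have "{w. 0 \<le> Im w} \<union> {w. Im w \<le> 0} = UNIV" by auto
  ultimately show "continuous_on UNIV g" by (simp add: g_def[abs_def])
 qed auto
 hence "g w = 0"
 proof (rule analytic_continuation[where U="{z. Im z < 0}" and \<xi>="- \<i>"])
  have "- \<i> \<in> interior {z. Im z < 0}" by (subst interior_open) (auto intro: open_halfspace_Im_lt)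
  thus "- \<i> islimpt {z. Im z < 0}" by (rule interior_limit_point)
 qed (auto simp: g_def)
 thus ?thesis using w by (simp add: g_def)
qed

lemma norm_exp_le_linear:
 assumes "Re z \<le> 0" shows "norm (exp z - 1) \<le> norm z"
proof -
 have "norm (exp z - exp 0) \<le> 1 * norm (z - 0)"
 proof (rule field_differentiable_bound[where S="{v. Re v \<le> 0}" and f'=exp])
  show "convex {v. Re v \<le> 0}" by (rule convex_halfspace_Re_le)
  fix v assume "v \<in> {v. Re v \<le> 0}"
  thus "norm (exp v) \<le> 1" by simp
  show "(exp has_field_derivative exp v) (at v within {v. Re v \<le> 0})" by (rule has_field_derivative_at_within) (rule DERIV_exp)
 qed (use assms in auto)
 thus ?thesis by simp
qed

lemma norm_exp_le_quadratic:
 assumes "Re z \<le> 0" shows "norm (exp z - 1 - z) \<le> (norm z)\<^sup>2"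
proof -
 have "norm ((exp z - 1 - z) - (exp 0 - 1 - 0)) \<le> norm z * norm (z - 0)"
 proof (rule field_differentiable_bound[where S="{v. Re v \<le> 0} \<inter> cball 0 (norm z)" and f'="\<lambda>v. exp v - 1"])
  show "convex ({v. Re v \<le> 0} \<inter> cball 0 (norm z))" by (intro convex_Int convex_halfspace_Re_le convex_cball)
  fix v assume v: "v \<in> {v. Re v \<le> 0} \<inter> cball 0 (norm z)"
  hence "norm (exp v - 1) \<le> norm v" by (intro norm_exp_le_linear) simp
  thus "norm (exp v - 1) \<le> norm z" using v by simp
  show "((\<lambda>v. exp v - 1 - v) has_field_derivative exp v - 1) (at v within {v. Re v \<le> 0} \<inter> cball 0 (norm z))"
   by (auto intro!: derivative_eq_intros)
 qed (use assms in auto)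
 thus ?thesis by (simp add: power2_eq_square)
qed

text \<open>On \<open>Im w \<ge> 0\<close> the factor with \<open>Y \<ge> 0\<close> has norm at most
  1, and \<open>A \<le> C\<close> controls the other one on compact sets of frequencies. Both sides
  of the martingale identity have this shape.\<close>

lemma (in prob_space) half_plane_integral:
 fixes Z :: "'a => complex" and Y A :: "'a => real"
 assumes hol: "\<eta> holomorphic_on {w. 0 < Im w}" and cont: "continuous_on {w. 0 \<le> Im w} \<eta>"
  and m [measurable]: "Z \<in> borel_measurable M" "Y \<in> borel_measurable M" "A \<in> borel_measurable M"
  and b: "\<And>y. y \<in> space M ==> norm (Z y) \<le> 1 \<and> 0 \<le> Y y \<and> 0 \<le> A y \<and> A y \<le> C"
 shows "(\<lambda>w. \<integral>y. Z y * exp (\<i> * w * of_real (Y y) - \<eta> w * of_real (A y)) \<partial>M) holomorphic_on {w. 0 < Im w}"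
  and "continuous_on {w. 0 \<le> Im w} (\<lambda>w. \<integral>y. Z y * exp (\<i> * w * of_real (Y y) - \<eta> w * of_real (A y)) \<partial>M)"
proof -
 let ?h = "\<lambda>w y. Z y * exp (\<i> * w * of_real (Y y) - \<eta> w * of_real (A y))"
 have hm: "?h w \<in> borel_measurable M" for w by measurable
 have dom: "\<exists>g. integrable M g \<and> (\<forall>v\<in>V. \<forall>y\<in>space M. norm (?h v y) \<le> g y)"
  if "compact V" "V \<subseteq> {w. 0 \<le> Im w}" for V
 proof -
  have "bounded (\<eta> ` V)" using continuous_on_subset[OF cont that(2)] that(1) by (intro compact_imp_bounded compact_continuous_image)
  then obtain B where B: "\<And>v. v \<in> V ==> norm (\<eta> v) \<le> B" by (auto simp: bounded_iff)
  have "norm (?h v y) \<le> 1 * exp (B * C)" if v: "v \<in> V" and y: "y \<in> space M" for v y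
  proof -
   have "- Re (\<eta> v) * A y \<le> B * C" using B[OF v] b[OF y] abs_Re_le_cmod[of "\<eta> v"] by (intro mult_mono) auto
   moreover have "0 \<le> Im v * Y y" using v \<open>V \<subseteq> _\<close> b[OF y] by auto
   ultimately show ?thesis unfolding norm_mult using b[OF y] by (intro mult_mono) auto
  qed
  thus ?thesis by (intro exI[of _ "\<lambda>_. 1 * exp (B * C)"]) auto
 qed
 show "(\<lambda>w. \<integral>y. ?h w y \<partial>M) holomorphic_on {w. 0 < Im w}"
 proof (rule holomorphic_on_integral)
  show "open {w. 0 < Im w}" by (rule open_halfspace_Im_gt)
  show "(\<lambda>w. ?h w y) holomorphic_on {w. 0 < Im w}" for y using hol by (intro holomorphic_intros)
  fix w assume "w \<in> {w. 0 < Im w}"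
  then obtain r where r: "0 < r" "cball w r \<subseteq> {w. 0 < Im w}" using open_contains_cball[THEN iffD1, OF open_halfspace_Im_gt] by blast
  hence "cball w r \<subseteq> {w. 0 \<le> Im w}" by (auto dest!: subsetD)
  from dom[OF compact_cball this] r
  show "\<exists>r>0. \<exists>g. integrable M g \<and> cball w r \<subseteq> {w. 0 < Im w} \<and> (\<forall>v\<in>cball w r. \<forall>y\<in>space M. norm (?h v y) \<le> g y)"
   by (intro exI[of _ r]) blast
 qed (rule hm)
 show "continuous_on {w. 0 \<le> Im w} (\<lambda>w. \<integral>y. ?h w y \<partial>M)"
 proof (rule continuous_on_integral_dominated)
  show "continuous_on {w. 0 \<le> Im w} (\<lambda>w. ?h w y)" for y using cont by (intro continuous_intros)
  fix w assume "w \<in> {w. 0 \<le> Im w}"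
  have "compact ({w. 0 \<le> Im w} \<inter> cball w 1)" by (intro closed_Int_compact closed_halfspace_Im_ge compact_cball)
  from dom[OF this] show "\<exists>r>0. \<exists>g. integrable M g \<and> (\<forall>v\<in>{w. 0 \<le> Im w} \<inter> cball w r. \<forall>y\<in>space M. norm (?h v y) \<le> g y)"
   by (intro exI[of _ 1] conjI zero_less_one) auto
 qed (rule hm)
qed

context branching_sde begin

lemma integrable_min_square: "integrable \<pi> (\<lambda>z. min 1 (z\<^sup>2))"
proof (intro integrableI_nonneg AE_I2)
 show "(\<lambda>z. min 1 (z\<^sup>2)) \<in> borel_measurable \<pi>" by (rule measurable_\<pi>) measurable
qed (use levy in \<open>auto simp: levy_measure_def\<close>)

lemma levy_kernel_bound:
 assumes w: "0 \<le> Im w" and z: "z \<in> space \<pi>" shows "norm (levy_kernel w z) \<le> ((norm w)\<^sup>2 + 2) * min 1 (z\<^sup>2)"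
proof -
 have z0: "0 < z" using z by (simp add: space_\<pi>)
 have re: "Re (\<i> * w * of_real z) \<le> 0" using w z0 by simp
 show ?thesis
 proof (cases "z \<le> 1")
  case True
  hence "norm (levy_kernel w z) \<le> (norm w)\<^sup>2 * z\<^sup>2"
   using norm_exp_le_quadratic[OF re] z0 by (simp add: levy_kernel_def norm_mult power_mult_distrib)
  moreover have "z\<^sup>2 \<le> 1" using True z0 by (simp add: power_le_one)
  moreover have "0 \<le> z\<^sup>2" by simp
  ultimately show ?thesis by (simp add: min_absorb2 distrib_right add_increasing2)
 next
  case False
  have "norm (exp (\<i> * w * of_real z) - 1) \<le> 1 + 1" using re by (intro norm_triangle_le_diff add_mono) auto
  moreover have "1 \<le> z\<^sup>2" using False by (simp add: one_le_power)
  ultimately show ?thesis using False by (simp add: levy_kernel_def add_increasing)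
 qed
qed

lemma levy_kernel_dominated:
 assumes V: "V \<subseteq> cball w r" "V \<subseteq> {w. 0 \<le> Im w}"
 shows "\<exists>g. integrable \<pi> g \<and> (\<forall>v\<in>V. \<forall>z\<in>space \<pi>. norm (levy_kernel v z) \<le> g z)"
proof (intro exI[of _ "\<lambda>z. ((norm w + r)\<^sup>2 + 2) * min 1 (z\<^sup>2)"] conjI ballI)
 fix v z assume v: "v \<in> V" and z: "z \<in> space \<pi>"
 have "norm v \<le> norm w + r" using V(1) v norm_triangle_ineq3[of v w] by (auto simp: dist_norm norm_minus_commute dest!: subsetD)
 hence "((norm v)\<^sup>2 + 2) * min 1 (z\<^sup>2) \<le> ((norm w + r)\<^sup>2 + 2) * min 1 (z\<^sup>2)"
  by (intro mult_right_mono add_right_mono power_mono) auto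
 thus "norm (levy_kernel v z) \<le> ((norm w + r)\<^sup>2 + 2) * min 1 (z\<^sup>2)" using levy_kernel_bound[OF _ z, of v] v V(2) by auto
qed (intro integrable_mult_right integrable_min_square)

lemma char_exponent_holomorphic: "char_exponent holomorphic_on {w. 0 < Im w}"
proof -
 have "(\<lambda>w. \<integral>z. levy_kernel w z \<partial>\<pi>) holomorphic_on {w. 0 < Im w}"
 proof (rule holomorphic_on_integral)
  show "open {w. 0 < Im w}" by (rule open_halfspace_Im_gt)
  show "(\<lambda>w. levy_kernel w z) holomorphic_on {w. 0 < Im w}" for z unfolding levy_kernel_def by (intro holomorphic_intros)
  fix w assume "w \<in> {w. 0 < Im w}"
  then obtain r where r: "0 < r" "cball w r \<subseteq> {w. 0 < Im w}" using open_contains_cball[THEN iffD1, OF open_halfspace_Im_gt] by blast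
  hence "cball w r \<subseteq> {w. 0 \<le> Im w}" by (auto dest!: subsetD)
  from levy_kernel_dominated[OF order_refl this] r
  show "\<exists>r>0. \<exists>g. integrable \<pi> g \<and> cball w r \<subseteq> {w. 0 < Im w} \<and> (\<forall>v\<in>cball w r. \<forall>z\<in>space \<pi>. norm (levy_kernel v z) \<le> g z)"
   by (intro exI[of _ r]) blast
 qed (rule levy_kernel_measurable)
 thus ?thesis unfolding char_exponent_def[abs_def] by (intro holomorphic_intros)
qed

lemma char_exponent_continuous: "continuous_on {w. 0 \<le> Im w} char_exponent"
proof -
 have "continuous_on {w. 0 \<le> Im w} (\<lambda>w. \<integral>z. levy_kernel w z \<partial>\<pi>)"
 proof (rule continuous_on_integral_dominated)
  show "continuous_on {w. 0 \<le> Im w} (\<lambda>w. levy_kernel w z)" for z unfolding levy_kernel_def by (intro continuous_intros)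
  show "\<exists>r>0. \<exists>g. integrable \<pi> g \<and> (\<forall>v\<in>{w. 0 \<le> Im w} \<inter> cball w r. \<forall>z\<in>space \<pi>. norm (levy_kernel v z) \<le> g z)" for w
   by (intro exI[of _ "1::real"] conjI zero_less_one) (rule levy_kernel_dominated[OF Int_lower2 Int_lower1])
 qed (rule levy_kernel_measurable)
 thus ?thesis unfolding char_exponent_def[abs_def] by (intro continuous_intros)
qed

lemma levy_kernel_imaginary:
 "levy_kernel (\<i> * of_real l) z = of_real (exp (- l * z) - 1 + l * z * indicator {0<..1} z)"
proof -
 have e: "\<i> * (\<i> * complex_of_real l) * of_real z = of_real (- l * z)" for z by (simp add: mult.assoc[symmetric])
 show ?thesis by (simp only: levy_kernel_def e exp_of_real) simp
qed

lemma char_exponent_imaginary: "char_exponent (\<i> * of_real l) = of_real (psi b c \<pi> l)"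
proof -
 have "- \<i> * (\<i> * complex_of_real l) * of_real b = of_real (b * l)" "of_real c * (\<i> * complex_of_real l)\<^sup>2 = of_real (- (c * l\<^sup>2))"
  by (auto simp: power_mult_distrib mult.assoc[symmetric] mult.commute)
 thus ?thesis unfolding char_exponent_def levy_kernel_imaginary integral_complex_of_real psi_def by (simp only:) simp
qed

lemma stopped_real_nonneg: "0 \<le> stopped_real n t w" by (simp add: stopped_real_def)

text \<open>At a real frequency \<open>u\<close> the identity is
  \<open>exp_martingale_stopped\<close> with \<open>exp (\<i> * u * stopped_real n s)\<close>
  included in the weight. Both sides are holomorphic above the real line and continuous up to it, so
  equality extends to the frequency \<open>\<i> * l\<close>.\<close>

lemma laplace_stopped:
 fixes Z :: "'a => real"
 assumes n: "1 \<le> n" and st: "0 \<le> s" "s \<le> t" and l: "0 \<le> l"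
  and Z: "Z \<in> borel_measurable (F s)" and Zb: "\<And>y. y \<in> space P ==> \<bar>Z y\<bar> \<le> 1"
 shows "(LINT y|P. Z y * exp (- l * stopped_real n t y - psi b c \<pi> l * cum_rate n s t y)) = (LINT y|P. Z y * exp (- l * stopped_real n s y))"
proof -
 let ?a = "\<lambda>y. complex_of_real (Z y)"
 have t: "0 \<le> t" using st by simp
 note [measurable] = measurable_F[OF stopped_real_adapted[OF n t] t] measurable_F[OF stopped_real_adapted[OF n st(1)] st(1)]
  measurable_F[OF cum_rate_adapted[OF n st] t] measurable_F[OF Z st(1)]
 define G where "G Y A w = (LINT y|P. ?a y * exp (\<i> * w * of_real (Y y) - char_exponent w * of_real (A y)))" for Y A w
 let ?Y = "stopped_real n s" and ?Y' = "stopped_real n t" and ?A = "cum_rate n s t"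
 have G: "G Y A holomorphic_on {w. 0 < Im w}" "continuous_on {w. 0 \<le> Im w} (G Y A)"
  if "(Y, A) \<in> {(?Y, \<lambda>_. 0), (?Y', ?A)}" for Y A unfolding G_def[abs_def] using that Zb cum_rate_bounds[OF n st] st stopped_real_nonneg
  by (auto intro!: half_plane_integral[where C="real n powr \<theta> * (t - s)"] char_exponent_holomorphic char_exponent_continuous)
 have "G ?Y' ?A (\<i> * of_real l) - G ?Y (\<lambda>_. 0) (\<i> * of_real l) = 0"
 proof (rule zero_on_upper_half_plane[where f="\<lambda>w. G ?Y' ?A w - G ?Y (\<lambda>_. 0) w"])
  fix u
  have "(LINT y|P. ?a y * exp (\<i> * of_real u * of_real (?Y y)) * exp (\<i> * of_real (u * (?Y' y - ?Y y)) - char_exponent (of_real u) * of_real (?A y)))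
   = (LINT y|P. ?a y * exp (\<i> * of_real u * of_real (?Y y)))"
  proof (rule exp_martingale_stopped[OF n st])
   note [measurable] = stopped_real_adapted[OF n st(1)] Z
   show "(\<lambda>y. ?a y * exp (\<i> * of_real u * of_real (?Y y))) \<in> borel_measurable (F s)" by measurable
  qed (use Zb in \<open>auto simp: norm_mult\<close>)
  moreover have "?a y * exp (\<i> * of_real u * of_real (?Y y)) * exp (\<i> * of_real (u * (?Y' y - ?Y y)) - char_exponent (of_real u) * of_real (?A y))
   = ?a y * exp (\<i> * of_real u * of_real (?Y' y) - char_exponent (of_real u) * of_real (?A y))" for y
   by (simp add: mult.assoc exp_add[symmetric] algebra_simps)
  ultimately show "G ?Y' ?A (of_real u) - G ?Y (\<lambda>_. 0) (of_real u) = 0" by (simp only: G_def of_real_0 mult_zero_right diff_zero diff_self)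
 qed (use G l in \<open>auto intro: holomorphic_on_diff continuous_on_diff\<close>)
 moreover have e: "\<i> * (\<i> * complex_of_real l) * of_real z = of_real (- l * z)" for z by (simp add: mult.assoc[symmetric])
 have "G Y A (\<i> * of_real l) = of_real (LINT y|P. Z y * exp (- l * Y y - psi b c \<pi> l * A y))" for Y A
  by (simp only: G_def e char_exponent_imaginary exp_of_real flip: of_real_mult of_real_diff integral_complex_of_real)
 ultimately show ?thesis by simp
qed

end

section \<open>The integral equation for the Laplace transform\<close>

lemma exp_bound_linear: "\<bar>exp y - 1\<bar> \<le> \<bar>y\<bar> * exp \<bar>y\<bar>" for y :: real
proof -
 have "norm (exp y - exp 0) \<le> exp \<bar>y\<bar> * norm (y - 0)"
  by (rule field_differentiable_bound[where S="cball 0 \<bar>y\<bar>" and f'=exp]) (auto intro!: derivative_eq_intros)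
 thus ?thesis by (simp add: mult.commute)
qed

lemma exp_bound_quadratic: "\<bar>exp y - 1 - y\<bar> \<le> y\<^sup>2 * exp \<bar>y\<bar>" for y :: real
proof -
 have "norm ((exp y - 1 - y) - (exp 0 - 1 - 0)) \<le> (\<bar>y\<bar> * exp \<bar>y\<bar>) * norm (y - 0)"
 proof (rule field_differentiable_bound[where S="cball 0 \<bar>y\<bar>" and f'="\<lambda>z. exp z - 1"])
  fix z :: real assume z: "z \<in> cball 0 \<bar>y\<bar>"
  have "\<bar>exp z - 1\<bar> \<le> \<bar>z\<bar> * exp \<bar>z\<bar>" by (rule exp_bound_linear)
  also have "\<dots> \<le> \<bar>y\<bar> * exp \<bar>y\<bar>" using z by (intro mult_mono) auto
  finally show "norm (exp z - 1) \<le> \<bar>y\<bar> * exp \<bar>y\<bar>" by simp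
 qed (auto intro!: derivative_eq_intros)
 thus ?thesis by (simp add: power2_eq_square mult_ac)
qed

lemma quadratic_increments_constant:
 fixes g :: "real => real"
 assumes st: "s \<le> t" and g: "\<And>q r. s \<le> q ==> q \<le> r ==> r \<le> t ==> \<bar>g r - g q\<bar> \<le> C * (r - q)\<^sup>2"
 shows "g t = g s"
proof -
 have "\<exists>k. \<forall>r\<in>{s..t}. g r = k"
 proof (rule has_field_derivative_zero_constant)
  fix q assume q: "q \<in> {s..t}"
  have "((\<lambda>r. (g r - g q) / (r - q)) \<longlongrightarrow> 0) (at q within {s..t})"
  proof (rule Lim_null_comparison)
   show "eventually (\<lambda>r. norm ((g r - g q) / (r - q)) \<le> C * \<bar>r - q\<bar>) (at q within {s..t})" unfolding eventually_at_filter
   proof (intro always_eventually allI impI)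
    fix r assume r: "r \<noteq> q" "r \<in> {s..t}"
    have "\<bar>g r - g q\<bar> \<le> C * (r - q)\<^sup>2"
     using g[of q r] g[of r q] q r by (cases "q \<le> r") (auto simp: abs_minus_commute power2_commute)
    hence "\<bar>g r - g q\<bar> \<le> C * \<bar>r - q\<bar> * \<bar>r - q\<bar>" by (simp add: power2_eq_square mult.assoc)
    thus "norm ((g r - g q) / (r - q)) \<le> C * \<bar>r - q\<bar>" using r by (simp add: pos_divide_le_eq)
   qed
   have "((\<lambda>r. C * \<bar>r - q\<bar>) \<longlongrightarrow> C * \<bar>q - q\<bar>) (at q within {s..t})" by (intro tendsto_intros)
   thus "((\<lambda>r. C * \<bar>r - q\<bar>) \<longlongrightarrow> 0) (at q within {s..t})" by simp
  qed
  thus "(g has_field_derivative 0) (at q within {s..t})" by (simp add: has_field_derivative_iff)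
 qed simp
 thus ?thesis using st by auto
qed

text \<open>Formally the fundamental theorem of calculus for an exponential of an integral. As
  \<open>f\<close> is merely bounded and measurable, that integral need not be differentiable
  everywhere; instead the defect of the identity is shown to have increments of second order, hence
  derivative 0.\<close>

lemma exp_integral_identity:
 fixes f :: "real => real"
 assumes [measurable]: "f \<in> borel_measurable borel" and f: "\<And>r. \<bar>f r\<bar> \<le> K" and st: "s \<le> t"
 shows "1 - exp (- p * (LINT u:{s<..t}|lborel. f u)) = p * (LINT u:{s<..t}|lborel. f u * exp (- p * (LINT v:{u<..t}|lborel. f v)))"
proof -
 define A where "A q r = (LINT u:{q<..r}|lborel. f u)" for q r
 define E where "E q = exp (- p * A q t)" for q
 define C where "C = exp (\<bar>p\<bar> * K * (t - s))"
 have K: "0 \<le> K" using f[of 0] by linarith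
 have "A q t = (LINT u|lborel. (if q < u \<and> u \<le> t then f u else 0))" for q
  unfolding A_def set_lebesgue_integral_def by (intro lebesgue_integral_cong) (auto simp: indicator_def)
 hence [measurable]: "E \<in> borel_measurable borel" unfolding E_def[abs_def] by (simp only:) measurable
 have A: "set_integrable lborel {q<..r} f" "\<bar>A q r\<bar> \<le> K * (r - q)" if "q \<le> r" for q r
  using interval_integral_bound[of f q r K] f that unfolding A_def by auto
 have y: "\<bar>p * A q r\<bar> \<le> \<bar>p\<bar> * K * (r - q)" "\<bar>p\<bar> * K * (r - q) \<le> \<bar>p\<bar> * K * (t - s)" "exp \<bar>p * A q r\<bar> \<le> C"
  if "s \<le> q" "q \<le> r" "r \<le> t" for q r
 proof -
  show 1: "\<bar>p * A q r\<bar> \<le> \<bar>p\<bar> * K * (r - q)" using A(2)[OF that(2)] by (simp add: abs_mult mult.assoc mult_left_mono)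
  show 2: "\<bar>p\<bar> * K * (r - q) \<le> \<bar>p\<bar> * K * (t - s)" using that K by (intro mult_left_mono) auto
  show "exp \<bar>p * A q r\<bar> \<le> C" unfolding C_def using 1 2 by simp
 qed
 have E: "E q = E r * exp (- p * A q r)" if "q \<le> r" "r \<le> t" for q r
  using interval_integral_add[OF that A(1) A(1)] that by (simp add: E_def A_def algebra_simps flip: exp_add)
 have Eb: "0 \<le> E q" "E q \<le> C" if "s \<le> q" "q \<le> t" for q
  using y(3)[OF that order_refl] by (auto simp: E_def intro: order_trans[rotated])
 have fE: "set_integrable lborel {q<..r} (\<lambda>u. f u * E u)" if "s \<le> q" "q \<le> r" "r \<le> t" for q r
  using that Eb f K by (intro interval_integral_bound(1)[where B="K * C"]) (auto simp: abs_mult intro!: mult_mono)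
 \<comment> \<open>The claim says that \<open>g\<close> has the same value at \<open>s\<close> as at
   \<open>t\<close>, where it is 1.\<close>
 define g where "g q = E q + p * (LINT u:{q<..t}|lborel. f u * E u)" for q
 have "g t = g s"
 proof (rule quadratic_increments_constant[OF st])
  fix q r assume qr: "s \<le> q" "q \<le> r" "r \<le> t"
  let ?y = "- p * A q r" and ?d = "\<bar>p\<bar> * K * (r - q)"
  have d: "0 \<le> ?d" using K qr by simp
  have E_diff: "\<bar>f u * (E r - E u)\<bar> \<le> K * (C * (?d * C))" if u: "q < u" "u \<le> r" for u
  proof -
   have "\<bar>exp (- p * A u r) - 1\<bar> \<le> \<bar>p * A u r\<bar> * exp \<bar>p * A u r\<bar>" using exp_bound_linear[of "- p * A u r"] by simp
   also have "\<dots> \<le> (\<bar>p\<bar> * K * (r - u)) * C" using y[of u r] u qr K by (intro mult_mono) auto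
   also have "\<dots> \<le> ?d * C" using u K by (intro mult_right_mono mult_left_mono) (auto simp: C_def)
   finally have "\<bar>E r * (1 - exp (- p * A u r))\<bar> \<le> C * (?d * C)" unfolding abs_mult using Eb[of r] qr by (intro mult_mono) auto
   moreover have "E r - E u = E r * (1 - exp (- p * A u r))" using E[OF u(2) qr(3)] by (simp add: right_diff_distrib)
   ultimately have "\<bar>E r - E u\<bar> \<le> C * (?d * C)" by simp
   thus ?thesis unfolding abs_mult using f[of u] K by (intro mult_mono) auto
  qed
  have i: "set_integrable lborel {q<..r} (\<lambda>u. f u * E r)" using A(1)[OF qr(2)] by (rule set_integrable_mult_left)
  have G: "g q = E q + p * ((LINT u:{q<..r}|lborel. f u * E u) + (LINT u:{r<..t}|lborel. f u * E u))"
   unfolding g_def using interval_integral_add[OF qr(2,3) fE fE] qr by simp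
  have X: "(LINT u:{q<..r}|lborel. f u * E u) = A q r * E r - (LINT u:{q<..r}|lborel. f u * (E r - E u))"
   using set_integral_diff(2)[OF i fE[OF qr]] by (simp add: right_diff_distrib A_def)
  have "g r - g q = p * (LINT u:{q<..r}|lborel. f u * (E r - E u)) - E r * (exp ?y - 1 - ?y)"
   unfolding G X unfolding g_def E[OF qr(2,3)] by (simp add: algebra_simps)
  moreover have "\<bar>LINT u:{q<..r}|lborel. f u * (E r - E u)\<bar> \<le> K * (C * (?d * C)) * (r - q)"
   by (rule interval_integral_bound(2)[OF _ qr(2) E_diff]) measurable
  moreover have "\<bar>E r * (exp ?y - 1 - ?y)\<bar> \<le> C * (?d\<^sup>2 * C)"
  proof -
   have "\<bar>exp ?y - 1 - ?y\<bar> \<le> \<bar>p * A q r\<bar>\<^sup>2 * exp \<bar>p * A q r\<bar>" using exp_bound_quadratic[of ?y] by simp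
   also have "\<dots> \<le> ?d\<^sup>2 * C" using y[OF qr] by (intro mult_mono power_mono) auto
   finally show ?thesis unfolding abs_mult using Eb[of r] qr by (intro mult_mono) auto
  qed
  ultimately have "\<bar>g r - g q\<bar> \<le> \<bar>p\<bar> * (K * (C * (?d * C)) * (r - q)) + C * (?d\<^sup>2 * C)"
   by (auto simp: abs_mult intro!: order_trans[OF abs_triangle_ineq4] add_mono mult_left_mono)
  also have "\<dots> = (2 * (\<bar>p\<bar> * K * C)\<^sup>2) * (r - q)\<^sup>2" by algebra
  finally show "\<bar>g r - g q\<bar> \<le> (2 * (\<bar>p\<bar> * K * C)\<^sup>2) * (r - q)\<^sup>2" .
 qed
 moreover have "A t t = 0" by (simp add: A_def set_lebesgue_integral_def)
 ultimately have "1 - E s = p * (LINT u:{s<..t}|lborel. f u * E u)" by (simp add: g_def E_def set_lebesgue_integral_def)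
 thus ?thesis unfolding E_def A_def .
qed

lemma (in prob_space) bounded_integrable:
 "V \<in> borel_measurable M ==> (\<And>w. w \<in> space M ==> \<bar>V w\<bar> \<le> B) ==> integrable M V" for V :: "'a => real"
 by (rule integrable_const_bound[where B=B]) (auto intro!: AE_I2)

lemma (in prob_space) bounded_integral:
 fixes V :: "'a => real"
 assumes V: "V \<in> borel_measurable M" "\<And>w. w \<in> space M ==> \<bar>V w\<bar> \<le> B" shows "\<bar>\<integral>w. V w \<partial>M\<bar> \<le> B"
proof -
 have "\<bar>\<integral>w. V w \<partial>M\<bar> \<le> (LINT w|M. \<bar>V w\<bar>)" by (rule integral_abs_bound)
 also have "\<dots> \<le> (LINT w|M. B)" using bounded_integrable[OF V] V(2) by (intro integral_mono) auto
 finally show ?thesis by (simp add: prob_space)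
qed

context branching_sde begin

text \<open>The value at \<open>\<infinity>\<close> is the limit for \<open>l > 0\<close>; it has to
  be set separately because \<open>enn2real \<infinity> = 0\<close> would give 1. In
  \<open>laplace_rate\<close> that default gives the right value 0.\<close>

definition laplace :: "real => ennreal => real" where
 "laplace l y = (if y = \<infinity> then 0 else exp (- l * enn2real y))"

definition laplace_rate :: "real => ennreal => real" where
 "laplace_rate l y = enn2real y powr \<theta> * exp (- l * enn2real y)"

lemma laplace_measurable [measurable]: "laplace l \<in> borel_measurable borel" "laplace_rate l \<in> borel_measurable borel"
 unfolding laplace_def laplace_rate_def by measurable

lemma X_joint: "0 \<le> T ==> (\<lambda>p. X (min (max (snd p) 0) T) (fst p)) \<in> borel_measurable (P \<Otimes>\<^sub>M lborel)"
proof -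
 assume T: "0 \<le> T"
 have "(\<lambda>p. (snd p, fst p)) \<in> measurable (P \<Otimes>\<^sub>M lborel) (borel \<Otimes>\<^sub>M F T)"
  using measurable_compose[OF measurable_fst measurable_F[OF measurable_ident T]] by (intro measurable_Pair) auto
 from measurable_compose[OF this X_progressive[OF T]] show ?thesis by simp
qed

lemma rate_joint: "1 \<le> n ==> 0 \<le> T ==> (\<lambda>p. rate n (min (max (snd p) 0) T) (fst p)) \<in> borel_measurable (P \<Otimes>\<^sub>M lborel)"
proof -
 assume n: "1 \<le> n" and T: "0 \<le> T"
 have "(\<lambda>p. (snd p, fst p)) \<in> measurable (P \<Otimes>\<^sub>M lborel) (borel \<Otimes>\<^sub>M F T)"
  using measurable_compose[OF measurable_fst measurable_F[OF measurable_ident T]] by (intro measurable_Pair) auto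
 from measurable_compose[OF this rate_progressive[OF n T]] show ?thesis by simp
qed

text \<open>\<open>laplace_stopped\<close> carries a random factor
  \<open>exp (- psi l * cum_rate)\<close> inside the mean. \<open>exp_integral_identity\<close>
  expands it in time, and the same martingale identity at each intermediate time \<open>u\<close>,
  now with weight \<open>Z * rate n u\<close>, replaces the factor and the terminal value by the
  value at \<open>u\<close>.\<close>

lemma laplace_equation_stopped:
 assumes n: "1 \<le> n" and l: "0 \<le> l" and s: "0 \<le> s" "s \<le> T"
  and Z: "Z \<in> borel_measurable (F s)" and Zb: "\<And>w. w \<in> space P ==> \<bar>Z w\<bar> \<le> 1"
 shows "(LINT w|P. Z w * exp (- l * stopped_real n T w)) - (LINT w|P. Z w * exp (- l * stopped_real n s w))
  = psi b c \<pi> l * (LINT u:{s<..T}|lborel. (LINT w|P. Z w * rate n u w * exp (- l * stopped_real n u w)))"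
proof -
 let ?a = "P \<Otimes>\<^sub>M lborel"
 let ?b = "\<lambda>h w. \<integral>u. h w u \<partial>lborel"
 interpret pl: pair_sigma_finite P lborel ..
 have T: "0 \<le> T" using s by simp
 let ?e = "\<lambda>r w. exp (- l * stopped_real n r w)"
 define p where "p = psi b c \<pi> l"
 define \<kappa> where "\<kappa> = real n powr \<theta>"
 define f where "f w u = rate n (min (max u 0) T) w" for w u
 define E where "E w u = exp (- p * (LINT v:{u<..T}|lborel. f w v))" for w u
 have \<kappa>: "0 < \<kappa>" using n by (simp add: \<kappa>_def)
 have fb: "0 \<le> f w u" "f w u \<le> \<kappa>" for w u using rate_bounds[of "min (max u 0) T" n w] T by (auto simp: f_def \<kappa>_def)
 have fm [measurable]: "(\<lambda>p. f (fst p) (snd p)) \<in> borel_measurable ?a" unfolding f_def by (rule rate_joint[OF n T])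
 have fw: "f w \<in> borel_measurable borel" if "w \<in> space P" for w unfolding f_def by (rule rate_measurable_path[OF n T that])
 have cum: "cum_rate n q T w = (LINT v:{q<..T}|lborel. f w v)" if "0 \<le> q" for q w unfolding f_def by (rule cum_rate_path[OF that order_refl])
 note [measurable] = measurable_F[OF Z s(1)] measurable_F[OF stopped_real_adapted[OF n T] T]
 have [measurable]: "(\<lambda>p. E (fst p) (snd p)) \<in> borel_measurable ?a"
 proof -
  have eq: "(LINT v:{u<..T}|lborel. f w v) = (LINT v|lborel. (if u < v \<and> v \<le> T then f w v else 0))" for u w
   unfolding set_lebesgue_integral_def by (intro lebesgue_integral_cong) (auto simp: indicator_def)
  have "(\<lambda>q. (fst (fst q), snd q)) \<in> measurable (?a \<Otimes>\<^sub>M lborel) ?a" by measurable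
  from measurable_compose[OF this fm] have [measurable]: "(\<lambda>q. f (fst (fst q)) (snd q)) \<in> borel_measurable (?a \<Otimes>\<^sub>M lborel)" by simp
  have "(\<lambda>p. \<integral>v. (if snd p < v \<and> v \<le> T then f (fst p) v else 0) \<partial>lborel) \<in> borel_measurable ?a"
   by (rule lborel.borel_measurable_lebesgue_integral) (simp add: case_prod_unfold)
  thus ?thesis unfolding E_def eq by measurable
 qed
 have stop: "(LINT w|P. V w * (?e T w * E w u)) = (LINT w|P. V w * ?e u w)"
  if u: "0 \<le> u" "u \<le> T" and V: "V \<in> borel_measurable (F u)" "\<And>w. w \<in> space P ==> \<bar>V w\<bar> \<le> B" "0 < B" for u V B
 proof -
  have "(LINT w|P. V w / B * exp (- l * stopped_real n T w - p * cum_rate n u T w)) = (LINT w|P. V w / B * ?e u w)"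
   using V l unfolding p_def by (intro laplace_stopped n u) auto
  moreover have "exp (- l * stopped_real n T w - p * cum_rate n u T w) = ?e T w * E w u" for w by (simp add: E_def cum[OF u(1)] flip: exp_add)
  ultimately show ?thesis using V(3) by (simp add: mult.assoc)
 qed
 define h where "h w u = indicator {s<..T} u * (Z w * f w u * (?e T w * E w u))" for w u
 have Eb: "E w u \<le> exp (\<bar>p\<bar> * \<kappa> * T)" if "0 \<le> u" "u \<le> T" "w \<in> space P" for w u
 proof -
  have "\<bar>LINT v:{u<..T}|lborel. f w v\<bar> \<le> \<kappa> * (T - u)" using fb by (intro interval_integral_bound fw that) auto
  also have "\<dots> \<le> \<kappa> * T" using \<kappa> that by (intro mult_left_mono) auto
  finally have "\<bar>p\<bar> * \<bar>LINT v:{u<..T}|lborel. f w v\<bar> \<le> \<bar>p\<bar> * (\<kappa> * T)" by (intro mult_left_mono) auto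
  thus ?thesis unfolding E_def abs_mult[symmetric] by (simp add: mult.assoc)
 qed
 have hi: "integrable ?a (\<lambda>(w, u). h w u)"
 proof (rule Bochner_Integration.integrable_bound)
  show "integrable ?a (\<lambda>z. (\<kappa> * exp (\<bar>p\<bar> * \<kappa> * T)) * indicator (space P \<times> {s<..T}) z)"
   using s by (intro integrable_mult_right integrable_real_indicator) (auto simp: lborel.emeasure_pair_measure_Times emeasure_space_1)
  show "(\<lambda>(w, u). h w u) \<in> borel_measurable ?a" unfolding h_def case_prod_unfold by measurable
  have "\<bar>Z w * f w u * (?e T w * E w u)\<bar> \<le> (1 * \<kappa>) * (1 * exp (\<bar>p\<bar> * \<kappa> * T))" if "0 \<le> u" "u \<le> T" "w \<in> space P" for w u
   unfolding abs_mult using Eb[OF that] Zb[OF that(3)] fb[of w u] \<kappa> l stopped_real_nonneg[of n T w] by (intro mult_mono) (auto simp: E_def)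
  thus "AE z in P \<Otimes>\<^sub>M lborel. norm (case z of (w, u) => h w u) \<le> norm (\<kappa> * exp (\<bar>p\<bar> * \<kappa> * T) * indicator (space P \<times> {s<..T}) z)"
   using s \<kappa> by (intro AE_I2) (auto simp: h_def indicator_def space_pair_measure)
 qed
 have path: "Z w * ?e T w - Z w * (?e T w * E w s) = p * (?b h w)" if "w \<in> space P" for w
 proof -
  have "1 - E w s = p * (LINT u:{s<..T}|lborel. f w u * E w u)" unfolding E_def using fb[of w] by (intro exp_integral_identity fw that s) auto
  moreover have "(?b h w) = Z w * ?e T w * (LINT u:{s<..T}|lborel. f w u * E w u)"
   unfolding h_def set_lebesgue_integral_def by (subst integral_mult_right_zero[symmetric]) (simp add: mult_ac)
  moreover have "Z w * ?e T w - Z w * (?e T w * E w s) = Z w * ?e T w * (1 - E w s)" by (simp add: algebra_simps)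
  ultimately show ?thesis by simp
 qed
 have e1: "\<bar>Z w * ?e r w\<bar> \<le> 1 * 1" if "w \<in> space P" for w r
  unfolding abs_mult using Zb[OF that] l stopped_real_nonneg[of n r w] by (intro mult_mono) auto
 have i: "integrable P (\<lambda>w. Z w * ?e T w)" by (rule bounded_integrable[OF _ e1]) measurable
 have ip: "integrable P (\<lambda>w. p * (?b h w))" using pl.integrable_fst[OF hi] by simp
 have i': "integrable P (\<lambda>w. Z w * (?e T w * E w s))"
 proof -
  have "integrable P (\<lambda>w. Z w * ?e T w - p * (?b h w))" using i ip by (rule Bochner_Integration.integrable_diff)
  thus ?thesis by (rule Bochner_Integration.integrable_cong[THEN iffD1, OF refl, rotated]) (simp flip: path)
 qed
 have "(LINT w|P. Z w * ?e T w) - (LINT w|P. Z w * ?e s w) = (LINT w|P. Z w * ?e T w - Z w * (?e T w * E w s))"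
  using i i' stop[OF s Z Zb zero_less_one] by simp
 also have "\<dots> = p * (LINT w|P. (?b h w))" by (subst lebesgue_integral_cong[OF refl path]) simp_all
 also have "(LINT w|P. (?b h w)) = (LINT u|lborel. (LINT w|P. h w u))" by (rule pl.Fubini_integral[OF hi, symmetric])
 also have "\<dots> = (LINT u:{s<..T}|lborel. (LINT w|P. Z w * rate n u w * ?e u w))" unfolding set_lebesgue_integral_def
 proof (intro lebesgue_integral_cong refl)
  fix u
  show "(LINT w|P. h w u) = indicator {s<..T} u *\<^sub>R (LINT w|P. Z w * rate n u w * ?e u w)"
  proof (cases "u \<in> {s<..T}")
   case True
   hence u: "0 \<le> u" "u \<le> T" "s \<le> u" "f w u = rate n u w" for w using s by (auto simp: f_def)
   have "(\<lambda>w. Z w * rate n u w) \<in> borel_measurable (F u)" using measurable_F_mono[OF Z s(1) u(3)] rate_adapted[OF n u(1)] by measurable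
   moreover have "\<bar>Z w * rate n u w\<bar> \<le> 1 * \<kappa>" if "w \<in> space P" for w
    unfolding abs_mult using Zb[OF that] fb[of w u] unfolding u(4) by (intro mult_mono) auto
   ultimately show ?thesis using stop[OF u(1,2), of "\<lambda>w. Z w * rate n u w" \<kappa>] \<kappa> True by (simp add: h_def u(4))
  qed (simp add: h_def)
 qed
 finally show ?thesis by (simp add: p_def)
qed

end

lemma powr_exp_bound:
 fixes y l a :: real
 assumes "0 \<le> y" "0 < l" "0 < a" shows "y powr a * exp (- l * y) \<le> (a / l) powr a"
proof -
 have "l * y / a \<le> exp (l * y / a)" using exp_ge_add_one_self[of "l * y / a"] by linarith
 hence "y \<le> a / l * exp (l * y / a)" using assms by (simp add: field_simps)
 hence "y powr a \<le> (a / l * exp (l * y / a)) powr a" using assms by (intro powr_mono2) auto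
 also have "\<dots> = (a / l) powr a * exp (l * y)" using assms by (subst powr_mult) (auto simp: exp_powr_real)
 finally have "y powr a * exp (- l * y) \<le> (a / l) powr a * exp (l * y) * exp (- l * y)" by (rule mult_right_mono) simp
 thus ?thesis by (simp add: mult.assoc flip: exp_add)
qed

context branching_sde begin

text \<open>If no \<open>\<zeta> n\<close> exceeds \<open>t\<close>, the states at these times leave
  every compact part of \<open>(0, \<infinity>)\<close>, while left or right limits of the path
  exist; so the states tend to 0 or \<open>\<infinity>\<close>, and absorption holds the process
  there until \<open>t\<close>.\<close>

lemma stopped_limit:
 "AE w in P. \<forall>t\<ge>0. (\<lambda>k. stopped (Suc k) t w) \<longlonglongrightarrow> X t w \<and> ((\<forall>n\<ge>1. \<zeta> n w \<le> ereal t) \<longrightarrow> X t w = 0 \<or> X t w = \<infinity>)"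
proof -
 have "AE w in P. \<forall>t\<ge>0. X t w = a \<or> (0 < t \<and> left_limit X t w = a) \<longrightarrow> (\<forall>s\<ge>t. X s w = a)" if "a = 0 \<or> a = \<infinity>" for a
  using sol that unfolding sde_solution_def absorbing_def by blast
 from this[OF disjI1[OF refl]] this[OF disjI2[OF refl]] show ?thesis using AE_space
 proof (eventually_elim)
  case (elim w)
  have absorb: "X r w = a" if "a = 0 \<or> a = \<infinity>" "0 \<le> q" "q \<le> r" "X q w = a \<or> (0 < q \<and> left_limit X q w = a)" for a q r
   using elim that by blast
  show ?case
  proof (intro allI impI)
   fix t :: real assume t: "0 \<le> t"
   show "(\<lambda>k. stopped (Suc k) t w) \<longlonglongrightarrow> X t w \<and> ((\<forall>n\<ge>1. \<zeta> n w \<le> ereal t) \<longrightarrow> X t w = 0 \<or> X t w = \<infinity>)"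
   proof (cases "\<forall>n\<ge>1. \<zeta> n w \<le> ereal t")
    case False
    then obtain n where n: "1 \<le> n" "ereal t < \<zeta> n w" by (auto simp: not_le)
    have "stopped (Suc k) t w = X t w" if "n \<le> k" for k
    proof -
     have "ereal t < \<zeta> (Suc k) w" using n \<zeta>_mono[OF n(1), of "Suc k" w] that by (intro less_le_trans[OF n(2)]) auto
     thus ?thesis by (simp add: stopped_def min_absorb1)
    qed
    hence "(\<lambda>k. stopped (Suc k) t w) \<longlonglongrightarrow> X t w" by (intro tendsto_eventually eventually_sequentiallyI)
    thus ?thesis using False by blast
   next
    case True
    define \<tau> where "\<tau> k = real_of_ereal (\<zeta> (Suc k) w)" for k
    have \<tau>: "ereal (\<tau> k) = \<zeta> (Suc k) w" for k
     using True[rule_format, of "Suc k"] \<zeta>_nonneg[of "Suc k" w] unfolding \<tau>_def by (cases "\<zeta> (Suc k) w") auto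
    have st: "stopped (Suc k) t w = X (\<tau> k) w" for k using True[rule_format, of "Suc k"] by (simp add: stopped_def min_absorb2 \<tau>_def)
    have inc: "incseq \<tau>" using \<zeta>_mono by (intro monoI) (simp add: \<tau> flip: ereal_less_eq(3))
    have \<tau>b: "0 \<le> \<tau> k" "\<tau> k \<le> t" for k
     using True[rule_format, of "Suc k"] \<zeta>_nonneg[of "Suc k" w] unfolding \<tau>[symmetric] by simp_all
    obtain \<sigma> where \<sigma>: "\<tau> \<longlonglongrightarrow> \<sigma>" "\<And>k. \<tau> k \<le> \<sigma>" using incseq_convergent[OF inc, of t] \<tau>b(2) by blast
    have \<sigma>b: "0 \<le> \<sigma>" "\<sigma> \<le> t" using \<tau>b(1)[of 0] \<sigma>(2)[of 0] LIMSEQ_le_const2[OF \<sigma>(1)] \<tau>b(2) by auto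
    have lim: "a = 0 \<or> a = \<infinity>" if a: "(\<lambda>k. X (\<tau> k) w) \<longlonglongrightarrow> a" for a
    proof (rule ccontr)
     assume "\<not> ?thesis"
     then obtain r where r: "a = ennreal r" "0 < r" by (cases a) auto
     obtain m :: nat where m: "max r (1 / r) < real m" using reals_Archimedean2 by blast
     have m0: "0 < real m" using m r by linarith
     have "1 / real m < r" using m r m0 by (simp add: field_simps)
     hence "a \<in> {ennreal (1 / real m)<..<ennreal (real m)}" using m r by (auto simp: ennreal_less_iff)
     from topological_tendstoD[OF a _ this]
     obtain k0 where k0: "\<And>k. k0 \<le> k ==> X (\<tau> k) w \<in> {ennreal (1 / real m)<..<ennreal (real m)}"
      by (auto simp: eventually_sequentially)
     define k where "k = max k0 m"
     have "ennreal (real m) \<le> ennreal (real (Suc k))" "ennreal (1 / real (Suc k)) \<le> ennreal (1 / real m)"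
      using m0 by (auto simp: k_def simp del: of_nat_Suc intro!: ennreal_leI divide_left_mono)
     moreover have "X (\<tau> k) w \<in> {ennreal (1 / real m)<..<ennreal (real m)}" by (rule k0) (simp add: k_def)
     ultimately show False using at_\<zeta>[OF elim(3) \<tau>[symmetric, of k]] by (metis greaterThanLessThan_iff leD order_trans)
    qed
    \<comment> \<open>Either the exit times become constant and the limit is attained, or they stay
      strictly below their limit and converge to a left limit. The latter is why
      \<open>absorbing\<close> speaks of left limits as well.\<close>
    show ?thesis
    proof (cases "\<exists>k0. \<tau> k0 = \<sigma>")
     case True
     then obtain k0 where "\<tau> k0 = \<sigma>" ..
     hence "\<tau> k = \<sigma>" if "k0 \<le> k" for k using \<sigma>(2)[of k] incseqD[OF inc that] by simp
     hence L: "(\<lambda>k. X (\<tau> k) w) \<longlonglongrightarrow> X \<sigma> w" by (intro tendsto_eventually eventually_sequentiallyI[of k0]) simp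
     from absorb[OF lim[OF L] \<sigma>b] have "X t w = X \<sigma> w" by simp
     thus ?thesis using L lim[OF L] by (simp add: st)
    next
     case False
     hence lt: "\<tau> k < \<sigma>" for k using \<sigma>(2)[of k] by (metis order_le_less)
     hence \<sigma>0: "0 < \<sigma>" using \<tau>b(1)[of 0] by (metis le_less_trans)
     have "filterlim \<tau> (at_left \<sigma>) sequentially" using \<sigma>(1) lt by (auto simp: filterlim_at intro!: always_eventually)
     from filterlim_compose[OF X_left[OF elim(3) \<sigma>0] this]
     have L: "(\<lambda>k. X (\<tau> k) w) \<longlonglongrightarrow> left_limit X \<sigma> w" .
     from absorb[OF lim[OF L] \<sigma>b] \<sigma>0 have "X t w = left_limit X \<sigma> w" by simp
     thus ?thesis using L lim[OF L] by (simp add: st)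
    qed
   qed
  qed
 qed
qed

lemma laplace_tendsto:
 assumes l: "0 < l" and f: "(\<lambda>k. ennreal (g k)) \<longlonglongrightarrow> y" and g: "\<And>k. 0 \<le> g k"
 shows "(\<lambda>k. exp (- l * g k)) \<longlonglongrightarrow> laplace l y"
proof (cases "y = \<infinity>")
 case True
 have "filterlim g at_top sequentially" unfolding filterlim_at_top
 proof
  fix K :: real
  have "eventually (\<lambda>k. ennreal K < ennreal (g k)) sequentially" using True by (intro order_tendstoD[OF f]) auto
  thus "eventually (\<lambda>k. K \<le> g k) sequentially" by eventually_elim (meson leD linear ennreal_leI)
 qed
 hence "filterlim (\<lambda>k. - l * g k) at_bot sequentially" using l by (intro filterlim_tendsto_neg_mult_at_bot[OF tendsto_const]) auto
 hence "(\<lambda>k. exp (- l * g k)) \<longlonglongrightarrow> 0" by (rule filterlim_compose[OF exp_at_bot])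
 thus ?thesis using True by (simp add: laplace_def)
next
 case False
 hence "(\<lambda>k. enn2real (ennreal (g k))) \<longlonglongrightarrow> enn2real y" using f by (intro tendsto_enn2real) (auto simp: top.not_eq_extremum)
 hence "g \<longlonglongrightarrow> enn2real y" using g by simp
 thus ?thesis using False by (auto simp: laplace_def intro!: tendsto_intros)
qed

lemma laplace_bounds: "0 \<le> l ==> 0 \<le> laplace l y \<and> laplace l y \<le> 1" by (auto simp: laplace_def)

lemma laplace_rate_bounds: "0 < l ==> 0 \<le> laplace_rate l y \<and> laplace_rate l y \<le> (\<theta> / l) powr \<theta>"
 using powr_exp_bound[of "enn2real y" l \<theta>] \<theta> by (auto simp: laplace_rate_def)

lemma laplace_rate_absorbed: "y = 0 \<or> y = \<infinity> ==> laplace_rate l y = 0" by (auto simp: laplace_rate_def)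

lemma X_measurable [measurable]: "0 \<le> t ==> X t \<in> borel_measurable P" by (rule measurable_F[OF X_adapted])

lemma expectation_path_measurable:
 fixes g :: "'a => real => real"
 assumes "(\<lambda>p. g (fst p) (snd p)) \<in> borel_measurable (P \<Otimes>\<^sub>M lborel)"
 shows "(\<lambda>u. \<integral>w. g w u \<partial>P) \<in> borel_measurable borel"
 using borel_measurable_lebesgue_integral[of "\<lambda>u w. g w u" lborel] measurable_compose[OF measurable_pair_swap' assms]
 by (simp add: case_prod_unfold)

text \<open>The limit of \<open>laplace_equation_stopped\<close> in \<open>n\<close>. For
  \<open>l > 0\<close> the exponential bounds the rate uniformly in \<open>n\<close>, and once all
  exit times are passed the rate of the absorbed state is 0, so no mass is lost at the
  boundaries.\<close>

lemma laplace_equation: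
 assumes l: "0 < l" and st: "0 \<le> s" "s \<le> t" and U: "U \<in> sets (F s)"
 shows "(LINT y|P. indicator U y * laplace l (X t y)) - (LINT y|P. indicator U y * laplace l (X s y))
  = psi b c \<pi> l * (LINT u:{s<..t}|lborel. (LINT y|P. indicator U y * laplace_rate l (X u y)))"
proof -
 let ?a = "\<lambda>k u y. exp (- l * stopped_real (Suc k) u y)"
 let ?b = "\<lambda>u. \<integral>y. indicator U y * laplace_rate l (X u y) \<partial>P"
 define C where "C = (\<theta> / l) powr \<theta>"
 have t: "0 \<le> t" using st by simp
 have UP [measurable]: "U \<in> sets P" using U sets_F[OF st(1)] by auto
 define a where "a k u = (LINT y|P. indicator U y * rate (Suc k) u y * ?a k u y)" for k u
 have r: "rate (Suc k) u y * ?a k u y = (if ereal u < \<zeta> (Suc k) y then laplace_rate l (X u y) else 0)" if "0 \<le> u" for k u y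
  using that by (auto simp: rate_def stopped_real_def stopped_def min_absorb1 laplace_rate_def)
 have rm: "(\<lambda>y. indicator U y * rate (Suc k) u y * ?a k u y) \<in> borel_measurable P" if "0 \<le> u" for k u
  using measurable_F[OF rate_adapted[of "Suc k"] that] measurable_F[OF stopped_real_adapted[of "Suc k"] that] that by measurable
 have lim1: "(\<lambda>k. \<integral>y. indicator U y * ?a k u y \<partial>P) \<longlonglongrightarrow> (LINT y|P. indicator U y * laplace l (X u y))" if u: "0 \<le> u" for u
 proof (rule integral_dominated_convergence[where w="\<lambda>_. 1"])
  have "AE y in P. \<forall>k. \<forall>t\<ge>0. stopped (Suc k) t y = ennreal (stopped_real (Suc k) t y)"
   unfolding AE_all_countable by (intro allI stopped_finite) simp
  with stopped_limit show "AE y in P. (\<lambda>k. indicator U y * ?a k u y) \<longlonglongrightarrow> indicator U y * laplace l (X u y)"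
  proof eventually_elim
   case (elim y)
   have "(\<lambda>k. stopped (Suc k) u y) \<longlonglongrightarrow> X u y" using elim(1) u by blast
   moreover have "(\<lambda>k. stopped (Suc k) u y) = (\<lambda>k. ennreal (stopped_real (Suc k) u y))" using elim(2) u by blast
   ultimately show ?case using stopped_real_nonneg by (intro tendsto_mult_left laplace_tendsto l) auto
  qed
  show "(\<lambda>y. indicator U y * ?a k u y) \<in> borel_measurable P" for k
   using measurable_F[OF stopped_real_adapted[of "Suc k"] u] u by measurable
  show "AE y in P. norm (indicator U y * ?a k u y) \<le> 1" for k using l stopped_real_nonneg by (auto simp: indicator_def)
 qed (use u in auto)
 have rb: "norm (indicator U y * rate (Suc k) u y * ?a k u y) \<le> C" if "0 \<le> u" for k u y
  using laplace_rate_bounds[OF l, of "X u y"] by (simp add: mult.assoc r[OF that, simplified] C_def indicator_def)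
 have lim2: "(\<lambda>k. a k u) \<longlonglongrightarrow> (?b u)" if u: "0 \<le> u" for u unfolding a_def
 proof (rule integral_dominated_convergence[where w="\<lambda>_. C"])
  show "AE y in P. (\<lambda>k. indicator U y * rate (Suc k) u y * ?a k u y) \<longlonglongrightarrow> indicator U y * laplace_rate l (X u y)"
   using stopped_limit
  proof eventually_elim
   case (elim y)
   have "(\<lambda>k. if ereal u < \<zeta> (Suc k) y then laplace_rate l (X u y) else 0) \<longlonglongrightarrow> laplace_rate l (X u y)"
   proof (cases "\<forall>n\<ge>1. \<zeta> n y \<le> ereal u")
    case True
    hence "laplace_rate l (X u y) = 0" using elim u by (intro laplace_rate_absorbed) blast
    thus ?thesis by (simp cong: if_cong)
   next
    case False
    then obtain n where n: "1 \<le> n" "ereal u < \<zeta> n y" by (auto simp: not_le)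
    have "ereal u < \<zeta> (Suc k) y" if "n \<le> k" for k using n \<zeta>_mono[OF n(1), of "Suc k" y] that by (intro less_le_trans[OF n(2)]) auto
    thus ?thesis by (intro tendsto_eventually eventually_sequentiallyI[of n]) simp
   qed
   thus ?case unfolding mult.assoc r[OF u] by (rule tendsto_mult_left)
  qed
 qed (use u rm rb in auto)
 have am: "(\<lambda>u. indicator {s<..t} u *\<^sub>R a k u) \<in> borel_measurable lborel" for k
 proof -
  have [measurable]: "(\<lambda>p. X (min (max (snd p) 0) t) (fst p)) \<in> borel_measurable (P \<Otimes>\<^sub>M lborel)"
   "(\<lambda>p. rate (Suc k) (min (max (snd p) 0) t) (fst p)) \<in> borel_measurable (P \<Otimes>\<^sub>M lborel)" by (intro X_joint rate_joint t; simp)+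
  let ?h = "\<lambda>y u. indicator U y * rate (Suc k) (min (max u 0) t) y * exp (- l * enn2real (X (min (max u 0) t) y))"
  have m [measurable]: "(\<lambda>u. \<integral>y. ?h y u \<partial>P) \<in> borel_measurable borel" by (rule expectation_path_measurable) measurable
  have "a k u = (LINT y|P. ?h y u)" if "u \<in> {s<..t}" for u unfolding a_def using that st
   by (intro lebesgue_integral_cong refl) (auto simp: rate_def stopped_real_def stopped_def min_absorb1)
  hence "(\<lambda>u. indicator {s<..t} u *\<^sub>R a k u) = (\<lambda>u. indicator {s<..t} u *\<^sub>R (LINT y|P. ?h y u))"
   by (auto simp: fun_eq_iff indicator_def)
  thus ?thesis by (simp only:) measurable
 qed
 have lim3: "(\<lambda>k. LINT u:{s<..t}|lborel. a k u) \<longlonglongrightarrow> (LINT u:{s<..t}|lborel. (?b u))" unfolding set_lebesgue_integral_def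
 proof (rule integral_dominated_convergence[where w="\<lambda>u. C * indicator {s<..t} u"])
  show l3: "AE u in lborel. (\<lambda>k. indicator {s<..t} u *\<^sub>R a k u) \<longlonglongrightarrow> indicator {s<..t} u *\<^sub>R (?b u)"
   using lim2 st by (intro AE_I2) (auto simp: indicator_def)
  show "(\<lambda>u. indicator {s<..t} u *\<^sub>R (?b u)) \<in> borel_measurable lborel"
   by (rule borel_measurable_LIMSEQ_metric[where f="\<lambda>k u. indicator {s<..t} u *\<^sub>R a k u", OF am]) (use lim2 st in \<open>auto simp: indicator_def\<close>)
  show "AE u in lborel. norm (indicator {s<..t} u *\<^sub>R a k u) \<le> C * indicator {s<..t} u" for k
  proof (rule AE_I2)
   fix u
   have "\<bar>a k u\<bar> \<le> C" if "0 \<le> u" unfolding a_def using rb[OF that] by (intro bounded_integral rm that) auto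
   thus "norm (indicator {s<..t} u *\<^sub>R a k u) \<le> C * indicator {s<..t} u" using st by (auto simp: indicator_def)
  qed
  show "integrable lborel (\<lambda>u. C * indicator {s<..t} u)" using st by (intro integrable_mult_right integrable_real_indicator) auto
 qed (rule am)
 have eq: "(LINT y|P. indicator U y * exp (- l * stopped_real (Suc k) t y)) - (LINT y|P. indicator U y * exp (- l * stopped_real (Suc k) s y))
   = psi b c \<pi> l * (LINT u:{s<..t}|lborel. a k u)" for k
  unfolding a_def using U l by (intro laplace_equation_stopped t st) (auto simp: indicator_def)
 show ?thesis by (rule LIMSEQ_unique[OF tendsto_diff[OF lim1[OF t] lim1[OF st(1)]]]) (unfold eq, rule tendsto_mult_left[OF lim3])
qed

end

section \<open>Convexity and sign of the Laplace exponent\<close>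

lemma exp_gt_add_one: "z \<noteq> 0 ==> 1 + z < exp z" for z :: real
proof (cases "1 + z / 2 \<ge> 0")
 case True
 assume z: "z \<noteq> 0"
 have "1 + z < (1 + z / 2)\<^sup>2" using z by (simp add: power2_eq_square field_simps flip: zero_less_power2)
 also have "\<dots> \<le> (exp (z / 2))\<^sup>2" using True by (intro power_mono exp_ge_add_one_self) auto
 also have "\<dots> = exp z" by (simp add: power2_eq_square flip: exp_add)
 finally show ?thesis .
next
 case False
 hence "1 + z < 0" by simp
 thus ?thesis using exp_gt_zero[of z] by linarith
qed

lemma exp_strict_convex:
 fixes p y :: real
 assumes p: "0 < p" "p < 1" and y: "0 < y" shows "exp (- (p * y)) < p * exp (- y) + (1 - p)"
proof -
 let ?m = "- (p * y)"
 have "exp ?m * (1 + (- y - ?m)) < exp ?m * exp (- y - ?m)" using p y by (intro mult_strict_left_mono exp_gt_add_one) (auto simp: algebra_simps)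
 hence 1: "exp ?m * (1 + (- y - ?m)) < exp (- y)" by (simp flip: exp_add)
 have "exp ?m * (1 + (- ?m)) < exp ?m * exp (- ?m)" using p y by (intro mult_strict_left_mono exp_gt_add_one) auto
 hence 2: "exp ?m * (1 + (- ?m)) < 1" by (simp flip: exp_add)
 have "p * (exp ?m * (1 + (- y - ?m))) + (1 - p) * (exp ?m * (1 + (- ?m))) < p * exp (- y) + (1 - p) * 1"
  using p by (intro add_strict_mono mult_strict_left_mono 1 2) auto
 thus ?thesis by (simp add: algebra_simps)
qed

context branching_sde begin

abbreviation "\<psi> \<equiv> psi b c \<pi>"

definition real_kernel :: "real => real => real" where
 "real_kernel l u = exp (- l * u) - 1 + l * u * indicator {0<..1} u"

lemma psi_eq: "\<psi> l = b * l + c * l\<^sup>2 + (LINT u|\<pi>. real_kernel l u)" by (simp add: psi_def real_kernel_def)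

lemma real_kernel_integrable: "0 \<le> l ==> integrable \<pi> (real_kernel l)"
proof (rule Bochner_Integration.integrable_bound)
 let ?a = "(norm (\<i> * complex_of_real l))\<^sup>2 + 2"
 assume l: "0 \<le> l"
 show "integrable \<pi> (\<lambda>z. ?a * min 1 (z\<^sup>2))" by (intro integrable_mult_right integrable_min_square)
 show "AE z in \<pi>. norm (real_kernel l z) \<le> norm (?a * min 1 (z\<^sup>2))"
 proof (rule AE_I2)
  fix z assume "z \<in> space \<pi>"
  from levy_kernel_bound[OF _ this, of "\<i> * complex_of_real l"] l
  have "\<bar>real_kernel l z\<bar> \<le> ?a * min 1 (z\<^sup>2)" unfolding levy_kernel_imaginary norm_of_real real_kernel_def by simp
  thus "norm (real_kernel l z) \<le> norm (?a * min 1 (z\<^sup>2))" by simp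
 qed
 show "real_kernel l \<in> borel_measurable \<pi>" unfolding real_kernel_def[abs_def] by (rule measurable_\<pi>) measurable
qed

lemma psi_measurable [measurable]: "\<psi> \<in> borel_measurable borel"
proof -
 have s: "snd \<in> borel_measurable (borel \<Otimes>\<^sub>M \<pi>)" by (rule measurable_compose[OF measurable_snd measurable_\<pi>]) simp
 have "(\<lambda>(l, u). real_kernel l u) \<in> borel_measurable (borel \<Otimes>\<^sub>M \<pi>)"
  unfolding real_kernel_def case_prod_unfold using s by measurable
 hence [measurable]: "(\<lambda>l. \<integral>u. real_kernel l u \<partial>\<pi>) \<in> borel_measurable borel" by (rule jumps.borel_measurable_lebesgue_integral)
 show ?thesis unfolding psi_eq[abs_def] by measurable
qed

lemma kernel_gap:
 assumes p: "0 < p" "p < 1" and l: "0 < l" and u: "u \<in> space \<pi>" shows "0 < p * real_kernel l u - real_kernel (p * l) u"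
 using exp_strict_convex[OF p, of "l * u"] l u by (simp add: real_kernel_def space_\<pi> algebra_simps)

text \<open>Convexity of \<open>psi\<close> on \<open>[0, l]\<close> with \<open>psi 0 = 0\<close>,
  in a quantitative form: the linear terms cancel and the gap splits into a Gaussian and a jump
  part, each nonnegative for \<open>0 < p < 1\<close>.\<close>

lemma psi_gap:
 assumes "0 \<le> p" "0 \<le> l"
 shows "p * \<psi> l - \<psi> (p * l) = c * l\<^sup>2 * (p * (1 - p)) + (LINT u|\<pi>. p * real_kernel l u - real_kernel (p * l) u)"
 using real_kernel_integrable assms by (simp add: psi_eq algebra_simps power2_eq_square)

lemma psi_scale:
 assumes p: "0 < p" "p \<le> 1" and l: "0 < l" shows "\<psi> (p * l) \<le> p * \<psi> l"
proof (cases "p = 1")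
 case False
 hence "0 \<le> (LINT u|\<pi>. p * real_kernel l u - real_kernel (p * l) u)" using p l by (intro integral_nonneg_AE AE_I2 less_imp_le kernel_gap) auto
 thus ?thesis using psi_gap[of p l] p l c by (smt (verit) mult_nonneg_nonneg zero_le_power2)
qed simp

text \<open>By \<open>psi_scale\<close> the quotient \<open>psi l / l\<close> does not decrease, so
  positivity at some \<open>r < l\<close> is inherited by \<open>l\<close>.\<close>

lemma psi_positive_above:
 assumes l: "Phi0 b c \<pi> < ereal l" shows "0 < l" "0 < \<psi> l"
proof -
 obtain r where r: "0 < r" "0 < \<psi> r" "r < l" using l unfolding Phi0_def Inf_less_iff by auto
 have "\<psi> (r / l * l) \<le> r / l * \<psi> l" using r by (intro psi_scale) auto
 hence "0 < r / l * \<psi> l" using r by simp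
 moreover have "0 < r / l" using r by simp
 ultimately show "0 < l" "0 < \<psi> l" using r by (auto simp only: zero_less_mult_pos)
qed

text \<open>A zero below the infimum would force equality in the convexity inequality, hence no
  Gaussian part and no jumps. Then \<open>psi\<close> is linear with a positive zero, thus
  identically 0, although it is positive somewhere.\<close>

lemma psi_negative_below:
 assumes fin: "Phi0 b c \<pi> < \<infinity>" and l: "0 < l" "ereal l < Phi0 b c \<pi>" shows "\<psi> l < 0"
proof (rule ccontr)
 assume "\<not> ?thesis"
 obtain r where r: "0 < r" "0 < \<psi> r" using fin unfolding Phi0_def Inf_less_iff by auto
 have np: "\<psi> q \<le> 0" if "0 < q" "ereal q < Phi0 b c \<pi>" for q
 proof (rule ccontr)
  assume "\<not> \<psi> q \<le> 0"
  hence "Phi0 b c \<pi> \<le> ereal q" unfolding Phi0_def using that by (intro Inf_lower) auto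
  thus False using that by simp
 qed
 obtain q where q: "l < q" "ereal q < Phi0 b c \<pi>" using ereal_dense2[OF l(2)] by auto
 define p where "p = l / q"
 have p: "0 < p" "p < 1" "p * q = l" "0 < q" using l q by (auto simp: p_def)
 have "\<psi> l = 0" using \<open>\<not> \<psi> l < 0\<close> np[OF l] by simp
 moreover have "\<psi> q \<le> 0" using np q p by auto
 ultimately have "p * \<psi> q - \<psi> (p * q) \<le> 0" using p by (simp add: mult_nonneg_nonpos)
 moreover have k: "0 \<le> (LINT u|\<pi>. p * real_kernel q u - real_kernel (p * q) u)"
  using p by (intro integral_nonneg_AE AE_I2 less_imp_le kernel_gap) auto
 moreover have "0 \<le> c * q\<^sup>2 * (p * (1 - p))" using c p by simp
 ultimately have z: "c * q\<^sup>2 * (p * (1 - p)) = 0" "(LINT u|\<pi>. p * real_kernel q u - real_kernel (p * q) u) = 0"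
  using psi_gap[OF less_imp_le[OF p(1)] less_imp_le[OF p(4)]] by linarith+
 have c0: "c = 0" using z(1) p by simp
 have "AE u in \<pi>. p * real_kernel q u - real_kernel (p * q) u = 0"
 proof (rule integral_nonneg_eq_0_iff_AE[THEN iffD1, OF _ _ z(2)])
  show "AE u in \<pi>. 0 \<le> p * real_kernel q u - real_kernel (p * q) u" using p by (intro AE_I2 less_imp_le kernel_gap) auto
 qed (use p real_kernel_integrable in auto)
 hence "AE u in \<pi>. False" using AE_space by eventually_elim (use kernel_gap[OF p(1,2,4)] in force)
 hence I0: "(LINT u|\<pi>. real_kernel r' u) = 0" for r' by (intro integral_eq_zero_AE) auto
 have "b * l = 0" using \<open>\<psi> l = 0\<close> unfolding psi_eq I0 by (simp add: c0)
 thus False using r l unfolding psi_eq I0 by (simp add: c0)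
qed

end

section \<open>Mixing the equation over the Laplace parameter\<close>

lemma (in sigma_finite_measure) nn_integral_swap_lborel:
 assumes "case_prod f \<in> borel_measurable (lborel \<Otimes>\<^sub>M M)"
 shows "(\<integral>\<^sup>+l. (\<integral>\<^sup>+w. f l w \<partial>M) \<partial>(lborel :: real measure)) = (\<integral>\<^sup>+w. (\<integral>\<^sup>+l. f l w \<partial>lborel) \<partial>M)"
proof -
 interpret pair_sigma_finite lborel M ..
 show ?thesis using Fubini'[OF assms] by simp
qed

context branching_sde begin

text \<open>A part of the Euler integral; for \<open>A = {0<..}\<close> it is
  \<open>Gamma \<theta>\<close>.\<close>

definition gamma_part :: "real set => ennreal" where
 "gamma_part A = (\<integral>\<^sup>+m\<in>A. ennreal (m powr (\<theta> - 1) * exp (- m)) \<partial>lborel)"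

text \<open>The absolute value lets one argument serve both boundaries, since \<open>psi\<close> is
  positive above \<open>Phi0\<close> and negative below it.\<close>

definition weight :: "real => real" where "weight l = l powr (\<theta> - 1) / \<bar>\<psi> l\<bar>"

definition mixed_rate :: "real set => ennreal => ennreal" where
 "mixed_rate S y = (\<integral>\<^sup>+l\<in>S. ennreal (l powr (\<theta> - 1) * laplace_rate l y) \<partial>lborel)"

definition mixture :: "real set => (real => ennreal => real) => ennreal => ennreal" where
 "mixture S f y = (\<integral>\<^sup>+l\<in>S. ennreal (weight l * f l y) \<partial>lborel)"

abbreviation "weight_integral S \<equiv> \<integral>\<^sup>+l\<in>S. ennreal (weight l) \<partial>lborel"
abbreviation "mixed_occupation S t \<equiv> \<integral>\<^sup>+u\<in>{0<..t}. (\<integral>\<^sup>+w. mixed_rate S (X u w) \<partial>P) \<partial>lborel"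
abbreviation "laplace_occupation l t \<equiv> \<integral>\<^sup>+u\<in>{0<..t}. (\<integral>\<^sup>+w. ennreal (laplace_rate l (X u w)) \<partial>P) \<partial>lborel"
abbreviation "vanishes w \<equiv> ((\<lambda>t. X t w) \<longlongrightarrow> 0) at_top"
abbreviation "mean_laplace_rate l t \<equiv> LINT u:{0<..t}|lborel. (LINT w|P. laplace_rate l (X u w))"

lemma weight_measurable [measurable]: "weight \<in> borel_measurable borel" unfolding weight_def[abs_def] by measurable

lemma gamma_part_bounded: "A \<subseteq> {0<..} ==> gamma_part A \<le> ennreal (Gamma \<theta>)"
 unfolding Gamma_conv_nn_integral_real[OF \<theta>] gamma_part_def by (intro nn_integral_mono) (auto simp: indicator_def exp_minus divide_inverse)

lemma gamma_part_mono: "A \<subseteq> B ==> gamma_part A \<le> gamma_part B"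
 unfolding gamma_part_def by (intro nn_integral_mono) (auto simp: indicator_def)

lemma gamma_part_positive:
 assumes "0 \<le> p" "p < q" shows "0 < gamma_part {p<..<q}"
proof -
 have "\<not> (AE m in lborel. ennreal (m powr (\<theta> - 1) * exp (- m)) * indicator {p<..<q} m = 0)"
 proof
  assume "AE m in lborel. ennreal (m powr (\<theta> - 1) * exp (- m)) * indicator {p<..<q} m = 0"
  hence "AE m in lborel. m \<notin> {p<..<q}" by eventually_elim (use assms in \<open>auto simp: indicator_def split: if_splits\<close>)
  hence "emeasure lborel {p<..<q} = 0" by (subst (asm) AE_iff_measurable[of "{p<..<q}"]) auto
  thus False using assms by simp
 qed
 thus ?thesis unfolding gamma_part_def zero_less_iff_neq_zero by (subst nn_integral_0_iff_AE) auto
qed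

text \<open>The substitution \<open>m = r * l\<close> absorbs the factor
  \<open>r powr \<theta>\<close> of the rate, so that only the rescaled domain depends on
  \<open>r\<close>. This scaling dictates the exponent \<open>\<theta> - 1\<close> of the
  weight.\<close>

lemma mixed_rate_eq:
 assumes S: "S \<in> sets borel" "S \<subseteq> {0<..}" and r: "0 < r" shows "mixed_rate S (ennreal r) = gamma_part {m. m / r \<in> S}"
proof -
 let ?a = "\<lambda>l. ennreal ((0 + r * l) powr (\<theta> - 1) * exp (- (0 + r * l)))"
 have [measurable]: "Measurable.pred borel (\<lambda>m. m / r \<in> S)" using S(1) by measurable
 have "gamma_part {m. m / r \<in> S} = \<bar>r\<bar> * (\<integral>\<^sup>+l. ?a l * indicator {m. m / r \<in> S} (0 + r * l) \<partial>lborel)"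
  unfolding gamma_part_def using r by (intro nn_integral_real_affine) auto
 also have "\<dots> = (\<integral>\<^sup>+l. ennreal \<bar>r\<bar> * (?a l * indicator {m. m / r \<in> S} (0 + r * l)) \<partial>lborel)"
  by (intro nn_integral_cmult[symmetric]) measurable
 also have "\<dots> = mixed_rate S (ennreal r)" unfolding mixed_rate_def
 proof (intro nn_integral_cong)
  fix l
  have "r * ((r * l) powr (\<theta> - 1) * exp (- (r * l))) = l powr (\<theta> - 1) * (r powr \<theta> * exp (- (r * l)))" if "l \<in> S"
   using r S(2) that by (auto simp: powr_mult powr_diff)
  thus "ennreal \<bar>r\<bar> * (?a l * indicator {m. m / r \<in> S} (0 + r * l)) = ennreal (l powr (\<theta> - 1) * laplace_rate l (ennreal r)) * indicator S l"
   using r by (auto simp: indicator_def laplace_rate_def mult.commute[of l r] ennreal_mult''[symmetric] simp flip: ennreal_mult'')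
 qed
 finally show ?thesis by simp
qed

lemma mixed_rate_absorbed: "y = 0 \<or> y = \<infinity> ==> mixed_rate S y = 0" by (simp add: mixed_rate_def laplace_rate_absorbed)

lemma mixed_rate_bounded:
 assumes S: "S \<in> sets borel" "S \<subseteq> {0<..}" shows "mixed_rate S y \<le> ennreal (Gamma \<theta>)"
proof (cases "y = 0 \<or> y = \<infinity>")
 case False
 then obtain r where r: "y = ennreal r" "0 < r" by (cases y) auto
 have "{m. m / r \<in> S} \<subseteq> {0<..}" using S(2) r by (auto simp: zero_less_divide_iff)
 thus ?thesis unfolding r(1) mixed_rate_eq[OF S r(2)] by (rule gamma_part_bounded)
qed (simp add: mixed_rate_absorbed)

lemma mixed_rate_measurable [measurable]:
 assumes [measurable]: "S \<in> sets borel" shows "mixed_rate S \<in> borel_measurable borel"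
 unfolding mixed_rate_def[abs_def] laplace_rate_def by measurable

lemma laplace_integrable: "0 \<le> l ==> 0 \<le> t ==> integrable P (\<lambda>w. laplace l (X t w))"
 using laplace_bounds by (intro bounded_integrable[where B=1]) (auto intro: measurable_compose[OF X_measurable])

lemma laplace_rate_integrable: "0 < l ==> 0 \<le> t ==> integrable P (\<lambda>w. laplace_rate l (X t w))"
 using laplace_rate_bounds by (intro bounded_integrable[where B="(\<theta> / l) powr \<theta>"]) (auto intro: measurable_compose[OF X_measurable])

lemma laplace_rate_integral:
 assumes l: "0 < l" and t: "0 \<le> t" shows "laplace_occupation l t = ennreal (mean_laplace_rate l t)"
  "0 \<le> mean_laplace_rate l t"
  "set_integrable lborel {0<..t} (\<lambda>u. \<integral>w. laplace_rate l (X u w) \<partial>P)"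
proof -
 let ?a = "\<lambda>u. \<integral>w. laplace_rate l (X u w) \<partial>P"
 have b: "0 \<le> laplace_rate l y" "\<bar>laplace_rate l y\<bar> \<le> (\<theta> / l) powr \<theta>" for y using laplace_rate_bounds[OF l, of y] by auto
 have [measurable]: "(\<lambda>p. X (min (max (snd p) 0) t) (fst p)) \<in> borel_measurable (P \<Otimes>\<^sub>M lborel)" by (rule X_joint[OF t])
 have "(\<lambda>u. ?a (min (max u 0) t)) \<in> borel_measurable borel" by (rule expectation_path_measurable) measurable
 moreover have "\<bar>?a (min (max u 0) t)\<bar> \<le> (\<theta> / l) powr \<theta>" for u
  using t b by (intro bounded_integral) (auto intro: measurable_compose[OF X_measurable])
 ultimately have "set_integrable lborel {0<..t} (\<lambda>u. ?a (min (max u 0) t))" by (intro interval_integral_bound(1) t)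
 thus i: "set_integrable lborel {0<..t} ?a" by (rule set_integrable_cong[THEN iffD1, OF refl refl, rotated]) auto
 have a: "0 \<le> indicator {0<..t} u *\<^sub>R ?a u" for u using b by (auto simp: indicator_def)
 thus "0 \<le> (LINT u:{0<..t}|lborel. ?a u)" unfolding set_lebesgue_integral_def by (intro integral_nonneg_AE AE_I2)
 have "(\<integral>\<^sup>+w. ennreal (laplace_rate l (X u w)) \<partial>P) = ennreal (?a u)" if "0 \<le> u" for u
  using b that l by (intro nn_integral_eq_integral laplace_rate_integrable) auto
 hence "laplace_occupation l t = (\<integral>\<^sup>+u. ennreal (indicator {0<..t} u *\<^sub>R ?a u) \<partial>lborel)"
  by (intro nn_integral_cong) (auto simp: indicator_def)
 also have "\<dots> = ennreal (LINT u:{0<..t}|lborel. ?a u)"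
  unfolding set_lebesgue_integral_def using i a by (intro nn_integral_eq_integral) (auto simp: set_integrable_def)
 finally show "laplace_occupation l t = ennreal (LINT u:{0<..t}|lborel. ?a u)" .
qed

lemma laplace_equation_0:
 assumes l: "0 < l" and t: "0 \<le> t" shows "(LINT w|P. laplace l (X t w)) = laplace l (ennreal x) + \<psi> l * mean_laplace_rate l t"
proof -
 have "(LINT w|P. laplace l (X 0 w)) = (LINT w|P. laplace l (ennreal x))"
  by (rule integral_cong_AE) (use X_0 in \<open>auto intro: measurable_compose[OF X_measurable]\<close>)
 also have "\<dots> = laplace l (ennreal x)" by (simp add: prob_space)
 moreover have i: "(LINT w|P. indicator (space P) w * f w) = (LINT w|P. f w)" for f :: "'a => real" by (intro lebesgue_integral_cong) auto
 have "space P \<in> sets (F 0)" by (metis order_refl sets.top space_F)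
 from laplace_equation[OF l order_refl t this, unfolded i] calculation show ?thesis by (simp add: prob_space)
qed

text \<open>The weight cancels \<open>\<bar>psi l\<bar>\<close> and leaves
  \<open>l powr (\<theta> - 1)\<close>. All terms are nonnegative, so the order of integration can
  be changed even where integrals are infinite.\<close>

lemma mixed_equation:
 assumes S: "S \<in> sets borel" "S \<subseteq> {0<..}" and t: "0 \<le> t"
  and f: "(\<lambda>(l, y). f l y) \<in> borel_measurable (borel \<Otimes>\<^sub>M borel)" "\<And>l y. 0 \<le> f l y"
  and eq: "\<And>l. l \<in> S ==> \<psi> l \<noteq> 0 \<and> (\<integral>\<^sup>+w. ennreal (f l (X t w)) \<partial>P) = ennreal (f l (ennreal x)) + ennreal \<bar>\<psi> l\<bar> * laplace_occupation l t"
 shows "(\<integral>\<^sup>+w. mixture S f (X t w) \<partial>P) = mixture S f (ennreal x) + mixed_occupation S t"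
proof -
 let ?a = "P \<Otimes>\<^sub>M lborel"
 let ?b = "\<lambda>l. ennreal (l powr (\<theta> - 1))"
 let ?c = "\<lambda>l. \<integral>\<^sup>+w. ennreal (weight l * f l (X t w)) * indicator S l \<partial>P"
 let ?d = "borel_measurable (lborel \<Otimes>\<^sub>M P)"
 let ?e = "\<lambda>l. ennreal (weight l * f l (ennreal x))"
 interpret pl: pair_sigma_finite P lborel ..
 note [measurable] = S(1) f(1)
 let ?X = "\<lambda>u. X (min (max u 0) t)"
 let ?r = "\<lambda>l p. ennreal (laplace_rate l (?X (snd p) (fst p))) * indicator {0<..t} (snd p)"
 have [measurable]: "(\<lambda>p. ?X (snd p) (fst p)) \<in> borel_measurable ?a" by (rule X_joint[OF t])
 have fm: "(\<lambda>p. f (g p) (h p)) \<in> borel_measurable M" if [measurable]: "g \<in> borel_measurable M" "h \<in> borel_measurable M" for g h and M :: "'z measure"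
  using measurable_compose[OF measurable_Pair[OF that] f(1)] by simp
 have w0: "0 \<le> weight l" for l by (simp add: weight_def)
 let ?R = "\<lambda>l. \<integral>\<^sup>+u\<in>{0<..t}. (\<integral>\<^sup>+w. ennreal (laplace_rate l (X u w)) \<partial>P) \<partial>lborel"
 have clip: "ennreal (laplace_rate l (X u w)) * indicator {0<..t} u = ennreal (laplace_rate l (?X u w)) * indicator {0<..t} u" for l u w
  by (auto simp: indicator_def)
 have lr [measurable]: "(\<lambda>p. laplace_rate (g p) (h p)) \<in> borel_measurable M" if [measurable]: "g \<in> borel_measurable M" "h \<in> borel_measurable M" for g h and M :: "'z measure"
  unfolding laplace_rate_def by measurable
 have R: "?R l = (\<integral>\<^sup>+p. ?r l p \<partial>?a)" for l
 proof -
  have "?R l = (\<integral>\<^sup>+u. \<integral>\<^sup>+w. ennreal (laplace_rate l (?X u w)) * indicator {0<..t} u \<partial>P \<partial>lborel)"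
   by (intro nn_integral_cong) (auto simp: indicator_def)
  also have "\<dots> = (\<integral>\<^sup>+p. ?r l p \<partial>?a)" by (subst pl.nn_integral_snd[symmetric]) (simp_all add: case_prod_unfold)
  finally show ?thesis .
 qed
 have "(\<integral>\<^sup>+w. mixture S f (X t w) \<partial>P) = (\<integral>\<^sup>+l. (?c l) \<partial>lborel)" unfolding mixture_def
 proof (rule nn_integral_swap_lborel[symmetric])
  have "(\<lambda>p. X t (snd p)) \<in> ?d" using t by measurable
  from fm[OF _ this, of fst] have [measurable]: "(\<lambda>p. f (fst p) (X t (snd p))) \<in> ?d" by simp
  show "(\<lambda>(l, w). ennreal (weight l * f l (X t w)) * indicator S l) \<in> ?d" unfolding case_prod_unfold by measurable
 qed
 also have "\<dots> = (\<integral>\<^sup>+l. ?e l * indicator S l + ?b l * indicator S l * ?R l \<partial>lborel)"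
 proof (intro nn_integral_cong)
  fix l :: real
  show "(?c l) = ?e l * indicator S l + ?b l * indicator S l * ?R l"
  proof (cases "l \<in> S")
   case True
   have "(?c l) = (\<integral>\<^sup>+w. ennreal (weight l) * ennreal (f l (X t w)) \<partial>P)"
    using True w0 f(2) by (intro nn_integral_cong) (simp add: ennreal_mult)
   also have "\<dots> = ennreal (weight l) * (\<integral>\<^sup>+w. ennreal (f l (X t w)) \<partial>P)"
    by (intro nn_integral_cmult measurable_compose[OF fm measurable_ennreal]) (use t in measurable)
   also have "\<dots> = ?e l + ennreal (weight l * \<bar>\<psi> l\<bar>) * ?R l"
    using eq[OF True] w0 f(2) by (simp add: distrib_left ennreal_mult mult.assoc)
   also have "weight l * \<bar>\<psi> l\<bar> = l powr (\<theta> - 1)" using eq[OF True] by (simp add: weight_def)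
   finally show ?thesis using True by simp
  qed simp
 qed
 also have "\<dots> = mixture S f (ennreal x) + (\<integral>\<^sup>+l. ?b l * indicator S l * ?R l \<partial>lborel)" unfolding mixture_def R
 proof (rule nn_integral_add)
  show "(\<lambda>l. ?e l * indicator S l) \<in> borel_measurable lborel" using fm[of "\<lambda>l. l" lborel "\<lambda>_. ennreal x"] by measurable
  show "(\<lambda>l. ?b l * indicator S l * (\<integral>\<^sup>+p. ?r l p \<partial>?a)) \<in> borel_measurable lborel" by measurable
 qed
 also have "(\<integral>\<^sup>+l. ?b l * indicator S l * ?R l \<partial>lborel)
   = (\<integral>\<^sup>+l. (\<integral>\<^sup>+p. ?b l * indicator S l * ?r l p \<partial>?a) \<partial>lborel)"
  unfolding R by (intro nn_integral_cong nn_integral_cmult[symmetric]) measurable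
 also have "\<dots> = (\<integral>\<^sup>+p. (\<integral>\<^sup>+l. ?b l * indicator S l * ?r l p \<partial>lborel) \<partial>?a)"
  by (rule pl.nn_integral_swap_lborel) (unfold case_prod_unfold, measurable)
 also have "\<dots> = (\<integral>\<^sup>+p. mixed_rate S (?X (snd p) (fst p)) * indicator {0<..t} (snd p) \<partial>?a)" unfolding mixed_rate_def
  by (intro nn_integral_cong) (auto simp: indicator_def ennreal_mult' mult_ac intro!: nn_integral_cong)
 also have "\<dots> = (\<integral>\<^sup>+u. \<integral>\<^sup>+w. mixed_rate S (?X u w) * indicator {0<..t} u \<partial>P \<partial>lborel)"
  by (subst pl.nn_integral_snd[symmetric]) (simp_all add: case_prod_unfold)
 also have "\<dots> = mixed_occupation S t" by (intro nn_integral_cong) (auto simp: indicator_def)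
 finally show ?thesis .
qed

text \<open>A set outside the sigma-algebra has \<open>measure\<close> 0 by default, so
  measurability of the event need not be known.\<close>

lemma null_prob: "AE w in P. \<not> Q w ==> \<P>(w in P. Q w) = 0"
 by (cases "{w\<in>space P. Q w} \<in> sets P") (auto simp: prob_eq_0 measure_notin_sets)

lemmas AE_measurable = AE_sets[OF refl null_sets_P]

lemma absorbed: "a = 0 \<or> a = \<infinity> ==> AE w in P. \<forall>t\<ge>0. X t w = a \<longrightarrow> (\<forall>s\<ge>t. X s w = a)"
proof -
 assume "a = 0 \<or> a = \<infinity>"
 hence "AE w in P. \<forall>t\<ge>0. X t w = a \<or> (0 < t \<and> left_limit X t w = a) \<longrightarrow> (\<forall>s\<ge>t. X s w = a)"
  using sol unfolding sde_solution_def absorbing_def by blast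
 thus ?thesis by eventually_elim blast
qed

lemma hitting_finite: "hitting_time X {a} w < \<infinity> \<longleftrightarrow> (\<exists>t\<ge>0. X t w = a)"
 unfolding hitting_time_def Inf_less_iff by force

text \<open>Absorption keeps a path that has hit the boundary there, so testing integer times
  suffices. This also makes the hitting event measurable.\<close>

lemma hitting_nat:
 assumes a: "a = 0 \<or> a = \<infinity>" shows "AE w in P. hitting_time X {a} w < \<infinity> \<longleftrightarrow> (\<exists>n::nat. X (real n) w = a)"
 using absorbed[OF a]
proof eventually_elim
 case (elim w)
 have "\<exists>n::nat. X (real n) w = a" if "0 \<le> t" "X t w = a" for t using elim that real_arch_simple[of t] by blast
 thus ?case unfolding hitting_finite by (metis of_nat_0_le_iff)
qed

lemma hitting_positive:
 assumes a: "a = 0 \<or> a = \<infinity>"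
 shows "0 < \<P>(w in P. hitting_time X {a} w < \<infinity>) \<longleftrightarrow> \<not> (\<forall>t\<ge>0. AE w in P. X t w \<noteq> a)"
proof -
 have "{w\<in>space P. hitting_time X {a} w < \<infinity>} \<in> sets P"
 proof (rule AE_measurable)
  show "(\<Union>n::nat. {w\<in>space P. X (real n) w = a}) \<in> sets P" by measurable
  show "AE w in P. hitting_time X {a} w < \<infinity> \<longleftrightarrow> w \<in> (\<Union>n::nat. {w\<in>space P. X (real n) w = a})"
   using hitting_nat[OF a] AE_space by eventually_elim auto
 qed
 hence "\<P>(w in P. hitting_time X {a} w < \<infinity>) = 0 \<longleftrightarrow> (AE w in P. \<not> hitting_time X {a} w < \<infinity>)"
  by (auto simp: prob_eq_0 cong: AE_cong)
 also have "\<dots> \<longleftrightarrow> (\<forall>t\<ge>0. AE w in P. X t w \<noteq> a)"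
 proof
  assume "AE w in P. \<not> hitting_time X {a} w < \<infinity>"
  thus "\<forall>t\<ge>0. AE w in P. X t w \<noteq> a" unfolding hitting_finite by (auto elim: eventually_mono)
 next
  assume "\<forall>t\<ge>0. AE w in P. X t w \<noteq> a"
  hence "AE w in P. \<forall>n::nat. X (real n) w \<noteq> a" unfolding AE_all_countable by simp
  with hitting_nat[OF a] show "AE w in P. \<not> hitting_time X {a} w < \<infinity>" by eventually_elim auto
 qed
 finally show ?thesis by (simp only: zero_less_measure_iff)
qed

lemma mixture_measurable:
 assumes [measurable]: "S \<in> sets borel" and f: "(\<lambda>(l, y). f l y) \<in> borel_measurable (borel \<Otimes>\<^sub>M borel)"
 shows "mixture S f \<in> borel_measurable borel"
proof -
 note [measurable] = f
 have "(\<lambda>(y, l). f l y) \<in> borel_measurable (borel \<Otimes>\<^sub>M lborel)"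
  using measurable_compose[OF measurable_pair_swap' f] by (simp add: case_prod_unfold)
 hence [measurable]: "(\<lambda>p. f (snd p) (fst p)) \<in> borel_measurable (borel \<Otimes>\<^sub>M lborel)" by (simp add: case_prod_unfold)
 show ?thesis unfolding mixture_def[abs_def] by measurable
qed

text \<open>One argument for both boundaries: \<open>a = 0\<close> with \<open>f = laplace\<close>,
  and \<open>a = \<infinity>\<close> with \<open>f = 1 - laplace\<close>. If the weight integral is
  infinite, so is the mixture at \<open>a\<close>, but its mean is finite: \<open>start\<close>
  bounds the initial value and the mixed rate is bounded. If the integral is finite, the mean
  mixture never falls below its initial value, which exceeds the value at \<open>M\<close>. States
  other than \<open>a\<close> have either a mixture of at most the value at \<open>M\<close> or a
  mixed rate of at least \<open>h\<close>, so avoiding \<open>a\<close> keeps the mean mixed rate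
  away from 0, and the occupation outgrows its bound.\<close>

lemma boundary_dichotomy:
 assumes S: "S \<in> sets borel" "S \<subseteq> {0<..}" "emeasure lborel S \<noteq> 0"
  and f: "(\<lambda>(l, y). f l y) \<in> borel_measurable (borel \<Otimes>\<^sub>M borel)" "\<And>l y. l \<in> S ==> f l y \<le> 1" "\<And>l y. 0 \<le> f l y" "\<And>l. l \<in> S ==> f l a = 1"
  and eq: "\<And>l t. l \<in> S ==> 0 \<le> t ==> \<psi> l \<noteq> 0 \<and> (\<integral>\<^sup>+w. ennreal (f l (X t w)) \<partial>P) = ennreal (f l (ennreal x)) + ennreal \<bar>\<psi> l\<bar> * laplace_occupation l t"
  and start: "\<And>l. l \<in> S ==> weight l * f l (ennreal x) \<le> C * (l powr (\<theta> - 1) * laplace_rate l (ennreal x))"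
  and M: "\<And>l. l \<in> S ==> f l (ennreal M) < f l (ennreal x)"
  and h: "0 < h" "\<And>y. y \<noteq> a ==> (\<forall>l\<in>S. f l y \<le> f l (ennreal M)) \<or> h \<le> mixed_rate S y"
 shows "((\<forall>t\<ge>0. AE w in P. X t w \<noteq> a) \<longleftrightarrow> weight_integral S = \<infinity>) \<and>
  (\<forall>t\<ge>0. mixed_occupation S t \<le> weight_integral S)"
proof -
 let ?a = "\<lambda>l. ennreal (weight l * f l (ennreal x))"
 let ?b = "\<lambda>l. ennreal (weight l * f l (ennreal M))"
 let ?c = "\<lambda>l. l powr (\<theta> - 1) * laplace_rate l (ennreal x)"
 let ?d = "ennreal (Gamma \<theta>)"
 let ?I = "\<integral>\<^sup>+l\<in>S. ennreal (weight l) \<partial>lborel"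
 let ?F = "mixture S f"
 note [measurable] = S(1) mixture_measurable[OF S(1) f(1)]
 have w0: "0 \<le> weight l" for l by (simp add: weight_def)
 have wpos: "0 < weight l" if "l \<in> S" for l using S(2) eq[OF that order_refl] that by (auto simp: weight_def)
 have E: "(\<integral>\<^sup>+w. ?F (X t w) \<partial>P) = ?F (ennreal x) + mixed_occupation S t" if "0 \<le> t" for t
  by (rule mixed_equation[OF S(1,2) that f(1,3) eq[OF _ that]])
 have FI: "?F y \<le> ?I" for y
  unfolding mixture_def using f(2) w0 by (intro nn_integral_mono) (auto simp: indicator_def intro!: ennreal_leI mult_left_le)
 have EI: "(\<integral>\<^sup>+w. ?F (X t w) \<partial>P) \<le> ?I" for t
  using nn_integral_mono[of P "\<lambda>w. ?F (X t w)" "\<lambda>_. ?I"] FI by (simp add: emeasure_space_1)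
 have RI: "mixed_occupation S t \<le> ?I" if "0 \<le> t" for t
 proof -
  have "mixed_occupation S t \<le> (\<integral>\<^sup>+w. ?F (X t w) \<partial>P)" unfolding E[OF that] by simp
  also have "\<dots> \<le> ?I" by (rule EI)
  finally show ?thesis .
 qed
 have "(\<forall>t\<ge>0. AE w in P. X t w \<noteq> a) \<longleftrightarrow> ?I = \<infinity>"
 proof
  assume I: "?I = \<infinity>"
  show "\<forall>t\<ge>0. AE w in P. X t w \<noteq> a"
  proof (intro allI impI)
   fix t :: real assume t: "0 \<le> t"
   have "?F (ennreal x) \<le> (\<integral>\<^sup>+l. ennreal \<bar>C\<bar> * (ennreal (?c l) * indicator S l) \<partial>lborel)" unfolding mixture_def
   proof (intro nn_integral_mono)
    fix l
    have "weight l * f l (ennreal x) \<le> \<bar>C\<bar> * (?c l)" if "l \<in> S"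
     by (rule order_trans[OF start[OF that] mult_right_mono]) (auto simp: laplace_rate_def)
    thus "?a l * indicator S l \<le> ennreal \<bar>C\<bar> * (ennreal (?c l) * indicator S l)"
     by (auto simp: indicator_def laplace_rate_def simp flip: ennreal_mult' intro!: ennreal_leI)
   qed
   also have "\<dots> = ennreal \<bar>C\<bar> * mixed_rate S (ennreal x)"
    unfolding mixed_rate_def laplace_rate_def by (intro nn_integral_cmult) measurable
   also have "\<dots> \<le> ennreal \<bar>C\<bar> * ?d" by (intro mult_left_mono mixed_rate_bounded S) simp
   finally have Fx: "?F (ennreal x) < \<infinity>" by (auto simp: ennreal_mult_less_top intro: le_less_trans)
   have "mixed_occupation S t \<le> (\<integral>\<^sup>+u\<in>{0<..t}. ?d \<partial>lborel)"
   proof (intro nn_integral_mono mult_right_mono)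
    fix u show "(\<integral>\<^sup>+w. mixed_rate S (X u w) \<partial>P) \<le> ?d"
     using nn_integral_mono[of P "\<lambda>w. mixed_rate S (X u w)" "\<lambda>_. ?d"] mixed_rate_bounded[OF S(1,2)] by (simp add: emeasure_space_1)
   qed simp
   also have "\<dots> < \<infinity>" using t by (simp add: nn_integral_cmult_indicator ennreal_mult_less_top)
   finally have "(\<integral>\<^sup>+w. ?F (X t w) \<partial>P) \<noteq> \<infinity>" using E[OF t] Fx by auto
   hence "AE w in P. ?F (X t w) \<noteq> \<infinity>" using t by (intro nn_integral_PInf_AE) measurable
   moreover have "?F a = ?I" unfolding mixture_def using f(4) by (intro nn_integral_cong) (auto simp: indicator_def)
   ultimately show "AE w in P. X t w \<noteq> a" using I by (auto elim!: eventually_mono)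
  qed
 next
  assume na: "\<forall>t\<ge>0. AE w in P. X t w \<noteq> a"
  show "?I = \<infinity>"
  proof (rule ccontr)
   assume I: "?I \<noteq> \<infinity>"
   have fm: "(\<lambda>l. f l y) \<in> borel_measurable lborel" for y using measurable_compose[OF measurable_Pair2'[of y borel borel] f(1)] by simp
   have lt: "?F (ennreal M) < ?F (ennreal x)" unfolding mixture_def
   proof (rule nn_integral_less)
    show "(\<integral>\<^sup>+l\<in>S. ?b l \<partial>lborel) \<noteq> \<infinity>"
     using FI[of "ennreal M"] I unfolding mixture_def by (auto simp: top_unique)
    show "AE l in lborel. ?b l * indicator S l \<le> ?a l * indicator S l"
     using w0 by (intro AE_I2) (auto simp: indicator_def intro!: ennreal_leI mult_left_mono less_imp_le[OF M])
    show "\<not> (AE l in lborel. ?a l * indicator S l \<le> ?b l * indicator S l)"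
    proof
     assume "AE l in lborel. ?a l * indicator S l \<le> ?b l * indicator S l"
     hence "AE l in lborel. l \<notin> S"
     proof eventually_elim
      case (elim l)
      show ?case
      proof
       assume l: "l \<in> S"
       have "weight l * f l (ennreal x) \<le> weight l * f l (ennreal M)" using elim l f(3) w0 by (simp add: ennreal_le_iff)
       thus False using wpos[OF l] M[OF l] by simp
      qed
     qed
     hence "emeasure lborel S = 0" by (subst (asm) AE_iff_measurable[of S]) auto
     thus False using S(3) by simp
    qed
   qed (use fm in measurable)
   define F' where "F' = enn2real (?F (ennreal M))" define Fx where "Fx = enn2real (?F (ennreal x))"
   have fin: "?F y \<noteq> \<infinity>" for y using FI[of y] I by (auto simp: top_unique)
   have F': "?F (ennreal M) = ennreal F'" "?F (ennreal x) = ennreal Fx" "0 \<le> F'" using fin by (auto simp: F'_def Fx_def less_top)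
   have "F' < Fx" using lt unfolding F' by (simp add: ennreal_less_iff F'(3))
   obtain i where i: "?I = ennreal i" "0 \<le> i" using I by (cases ?I) auto
   obtain k where k: "0 < k" "ennreal k \<le> h"
   proof (cases h)
    case (real r)
    thus ?thesis using h(1) by (intro that[of r]) auto
   qed (intro that[of 1], auto)
   \<comment> \<open>Where the mixed rate is at least \<open>k\<close>, this multiple of it exceeds
     \<open>i\<close>, the largest possible value of the mixture. The summand 1 keeps
     \<open>D\<close> positive.\<close>
   define D where "D = (i + 1) / k"
   have D: "0 < D" using i k by (simp add: D_def)
   have Fy: "?F y \<le> ennreal F' + ennreal D * mixed_rate S y" if y: "y \<noteq> a" for y using h(2)[OF y]
   proof
    assume "\<forall>l\<in>S. f l y \<le> f l (ennreal M)"
    hence "?F y \<le> ?F (ennreal M)"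
     unfolding mixture_def using w0 by (intro nn_integral_mono) (auto simp: indicator_def intro!: ennreal_leI mult_left_mono)
    thus ?thesis unfolding F' by (rule order_trans) simp
   next
    assume hy: "h \<le> mixed_rate S y"
    have "?F y \<le> ennreal i" using FI[of y] i by simp
    also have "\<dots> \<le> ennreal (D * k)" using k by (intro ennreal_leI) (simp add: D_def)
    also have "\<dots> \<le> ennreal D * mixed_rate S y" using D k order_trans[OF k(2) hy] by (simp add: ennreal_mult mult_left_mono)
    finally show ?thesis by (rule order_trans) simp
   qed
   \<comment> \<open>The lower bound on the mean mixed rate that results from comparing the initial
     mixture \<open>Fx\<close> with \<open>F'\<close> plus \<open>D\<close> times that mean.\<close>
   define \<kappa> where "\<kappa> = (Fx - F') / D"
   have \<kappa>: "0 < \<kappa>" using D \<open>F' < Fx\<close> by (simp add: \<kappa>_def)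
   have low: "ennreal \<kappa> \<le> (\<integral>\<^sup>+w. mixed_rate S (X u w) \<partial>P)" (is "_ \<le> ?r") if u: "0 \<le> u" for u
   proof (cases ?r)
    case (real r)
    have "ennreal Fx \<le> (\<integral>\<^sup>+w. ?F (X u w) \<partial>P)" using E[OF u] unfolding F' by simp
    also have "\<dots> \<le> (\<integral>\<^sup>+w. ennreal F' + ennreal D * mixed_rate S (X u w) \<partial>P)"
     using na u by (intro nn_integral_mono_AE) (auto elim!: eventually_mono intro: Fy)
    also have "\<dots> = ennreal F' + ennreal D * ?r"
     using u by (subst nn_integral_add) (simp_all add: nn_integral_cmult emeasure_space_1 measurable_compose[OF X_measurable mixed_rate_measurable])
    also have "\<dots> = ennreal (F' + D * r)" using D real F'(3) by (simp add: ennreal_mult)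
    finally have "Fx \<le> F' + D * r" using D real F'(3) by (subst (asm) ennreal_le_iff) auto
    thus ?thesis unfolding real(2) \<kappa>_def using D by (intro ennreal_leI) (simp add: field_simps)
   qed simp
   \<comment> \<open>By this time the occupation would have reached \<open>i + 1\<close>, beyond its
     bound \<open>i\<close>.\<close>
   define T where "T = (i + 1) / \<kappa>"
   have T: "0 \<le> T" "\<kappa> * T = i + 1" using \<kappa> i by (auto simp: T_def)
   have "ennreal (i + 1) = (\<integral>\<^sup>+u\<in>{0<..T}. ennreal \<kappa> \<partial>lborel)"
    using T \<kappa> by (simp add: nn_integral_cmult_indicator flip: ennreal_mult)
   also have "\<dots> \<le> mixed_occupation S T" using low by (intro nn_integral_mono) (auto simp: indicator_def)
   also have "\<dots> \<le> ennreal i" using RI[OF T(1)] i by simp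
   finally show False using i by (simp add: ennreal_le_iff)
  qed
 qed
 with RI show ?thesis by blast
qed

section \<open>Criteria for reaching the two boundaries\<close>

lemma laplace_0: "laplace l 0 = 1" and laplace_infinity: "laplace l \<infinity> = 0" and laplace_ennreal: "0 \<le> r ==> laplace l (ennreal r) = exp (- l * r)"
 by (simp_all add: laplace_def)

lemma laplace_joint: "(\<lambda>(l, y). laplace l y) \<in> borel_measurable (borel \<Otimes>\<^sub>M borel)"
 unfolding laplace_def case_prod_unfold by measurable

lemma extinction_dichotomy:
 assumes K: "Phi0 b c \<pi> < ereal K"
 shows "(\<forall>t\<ge>0. AE w in P. X t w \<noteq> 0) \<longleftrightarrow> weight_integral {K<..} = \<infinity>"
  "0 \<le> t ==> mixed_occupation {K<..} t \<le> weight_integral {K<..}"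
proof -
 note K0 = psi_positive_above[OF K]
 have pos: "0 < l \<and> \<psi> K \<le> \<psi> l" if "l \<in> {K<..}" for l
 proof -
  have l: "K < l" "0 < l" using that K0 by auto
  have "\<psi> (K / l * l) \<le> K / l * \<psi> l" using l K0 by (intro psi_scale) auto
  also have "\<dots> \<le> 1 * \<psi> l" using l K0 psi_positive_above(2)[OF less_trans[OF K]] by (intro mult_right_mono) (auto intro: less_imp_le)
  finally show ?thesis using l by simp
 qed
 have *: "((\<forall>t\<ge>0. AE w in P. X t w \<noteq> 0) \<longleftrightarrow> weight_integral {K<..} = \<infinity>) \<and>
  (\<forall>t\<ge>0. mixed_occupation {K<..} t \<le> weight_integral {K<..})"
 \<comment> \<open>The constant \<open>C\<close> comes from \<open>psi l \<ge> psi K\<close> for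
   \<open>l > K\<close>. States above \<open>M = x + 1\<close> have smaller Laplace values; a state
   \<open>r\<close> below it collects at least \<open>h\<close>, since
   \<open>m > K * (x + 1)\<close> implies \<open>m / r > K\<close>.\<close>
 proof (rule boundary_dichotomy[where f=laplace and a=0 and M="x + 1" and C="1 / (\<psi> K * x powr \<theta>)" and h="gamma_part {K * (x + 1)<..<K * (x + 1) + 1}"])
  have "emeasure lborel {K<..<K + 1} \<le> emeasure lborel {K<..}" by (intro emeasure_mono) auto
  thus "emeasure lborel {K<..} \<noteq> 0" by auto
  show "laplace l y \<le> 1" if "l \<in> {K<..}" for l y using laplace_bounds[of l y] pos[OF that] by simp
  show "0 \<le> laplace l y" for l y by (simp add: laplace_def)
  fix l assume l: "l \<in> {K<..}"
  note p = pos[OF l]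
  show "laplace l (ennreal (x + 1)) < laplace l (ennreal x)" using x p by (simp add: laplace_ennreal del: ennreal_plus)
  have "weight l * exp (- l * x) \<le> l powr (\<theta> - 1) / \<psi> K * exp (- l * x)"
   unfolding weight_def using p K0 by (intro mult_right_mono divide_left_mono) auto
  thus "weight l * laplace l (ennreal x) \<le> 1 / (\<psi> K * x powr \<theta>) * (l powr (\<theta> - 1) * laplace_rate l (ennreal x))"
   using x K0 by (simp add: laplace_ennreal laplace_rate_def)
  fix t :: real assume t: "0 \<le> t"
  have "(\<integral>\<^sup>+w. ennreal (laplace l (X t w)) \<partial>P) = ennreal (laplace l (ennreal x) + \<psi> l * mean_laplace_rate l t)"
   using p t by (subst laplace_equation_0[symmetric]) (auto intro!: nn_integral_eq_integral laplace_integrable AE_I2 simp: laplace_bounds)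
  thus "\<psi> l \<noteq> 0 \<and> (\<integral>\<^sup>+w. ennreal (laplace l (X t w)) \<partial>P) = ennreal (laplace l (ennreal x)) + ennreal \<bar>\<psi> l\<bar> * laplace_occupation l t"
   using p K0 laplace_rate_integral[of l t] t by (simp add: ennreal_mult laplace_def)
 next
  fix y :: ennreal assume "y \<noteq> 0"
  then consider "y = \<infinity>" | r where "y = ennreal r" "0 < r" "x + 1 \<le> r" | r where "y = ennreal r" "0 < r" "r < x + 1" by (cases y) (auto, meson not_le)
  thus "(\<forall>l\<in>{K<..}. laplace l y \<le> laplace l (ennreal (x + 1))) \<or> gamma_part {K * (x + 1)<..<K * (x + 1) + 1} \<le> mixed_rate {K<..} y"
  proof cases
   case 1
   thus ?thesis by (simp add: laplace_def)
  next
   case 2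
   thus ?thesis using x pos by (auto simp: laplace_ennreal simp del: ennreal_plus)
  next
   case 3
   have "K * r \<le> K * (x + 1)" using 3 K0 by (intro mult_left_mono) auto
   hence "gamma_part {K * (x + 1)<..<K * (x + 1) + 1} \<le> gamma_part {m. m / r \<in> {K<..}}"
    using 3 by (intro gamma_part_mono) (auto simp: pos_less_divide_eq)
   moreover have "mixed_rate {K<..} (ennreal r) = gamma_part {m. m / r \<in> {K<..}}" using 3 K0 by (intro mixed_rate_eq) auto
   ultimately show ?thesis using 3 by simp
  qed
 qed (use K0 x laplace_joint in \<open>auto simp: laplace_0 intro!: gamma_part_positive\<close>)
 thus "(\<forall>t\<ge>0. AE w in P. X t w \<noteq> 0) \<longleftrightarrow> weight_integral {K<..} = \<infinity>"
  "0 \<le> t ==> mixed_occupation {K<..} t \<le> weight_integral {K<..}" by blast+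
qed

lemma explosion_dichotomy:
 assumes fin: "Phi0 b c \<pi> < \<infinity>" and \<delta>: "0 < \<delta>" "ereal \<delta> < Phi0 b c \<pi>"
 shows "(\<forall>t\<ge>0. AE w in P. X t w \<noteq> \<infinity>) \<longleftrightarrow> weight_integral {0<..<\<delta>} = \<infinity>"
proof -
 let ?a = "\<lambda>l y. if 0 \<le> l then laplace l y else 0"
 let ?b = "\<lambda>l. if 0 \<le> l then laplace l (ennreal x) else 0"
 \<comment> \<open>By convexity \<open>psi\<close> lies below its chord on
   \<open>[0, \<delta>]\<close>, which has slope \<open>- k\<close>; hence
   \<open>\<bar>psi l\<bar>\<close> is at least \<open>k * l\<close> near 0.\<close>
 define k where "k = - \<psi> \<delta> / \<delta>"
 have k: "0 < k" using psi_negative_below[OF fin \<delta>] \<delta> by (simp add: k_def field_simps)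
 have neg: "k * l \<le> - \<psi> l \<and> 0 < l" if "l \<in> {0<..<\<delta>}" for l
 proof -
  have "\<psi> (l / \<delta> * \<delta>) \<le> l / \<delta> * \<psi> \<delta>" using that by (intro psi_scale) auto
  thus ?thesis using that by (simp add: k_def mult.commute)
 qed
 show ?thesis
 \<comment> \<open>The case distinction on \<open>l\<close> only keeps \<open>f\<close> nonnegative
   off the domain. States below \<open>M = x / 2\<close> have a smaller \<open>f\<close>, states
   above it collect the part of the Euler integral below \<open>\<delta> * (x / 2)\<close>. The
   constant \<open>C\<close> combines \<open>1 - exp (- l * x) \<le> l * x\<close>, the chord bound
   and \<open>exp (- l * x) \<ge> exp (- \<delta> * x)\<close>.\<close>
 proof (rule boundary_dichotomy[where f="\<lambda>l y. 1 - (?a l y)" and M="x / 2" and C="x / k * exp (\<delta> * x) / x powr \<theta>" and h="gamma_part {0<..<\<delta> * (x / 2)}", THEN conjunct1])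
  show "emeasure lborel {0<..<\<delta>} \<noteq> 0" using \<delta> by simp
  show "(\<lambda>(l, y). 1 - (?a l y)) \<in> borel_measurable (borel \<Otimes>\<^sub>M borel)"
   using laplace_joint unfolding case_prod_unfold by measurable
  show "1 - (?a l y) \<le> 1" "0 \<le> 1 - (?a l y)" for l y using laplace_bounds[of l y] by auto
  fix l assume l: "l \<in> {0<..<\<delta>}"
  note p = neg[OF l]
  have np: "\<psi> l < 0" using p k by (smt (verit) mult_pos_pos)
  show "1 - (if 0 \<le> l then laplace l \<infinity> else 0) = 1" by (simp add: laplace_def)
  show "1 - (if 0 \<le> l then laplace l (ennreal (x / 2)) else 0) < 1 - (?b l)" using x p by (simp add: laplace_ennreal)
  have "weight l * (1 - exp (- l * x)) \<le> l powr (\<theta> - 1) / (k * l) * (l * x)"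
   unfolding weight_def using p k x np mult_pos_pos[of "\<bar>\<psi> l\<bar>" "k * l"] exp_ge_add_one_self[of "- l * x"] by (intro mult_mono divide_left_mono) auto
  also have "\<dots> = l powr (\<theta> - 1) * (x / k) * 1" using p by simp
  also have "\<dots> \<le> l powr (\<theta> - 1) * (x / k) * (exp (\<delta> * x) * exp (- l * x))"
   using l x k by (intro mult_left_mono) (auto simp: mult_right_mono simp flip: exp_add)
  finally show "weight l * (1 - (?b l)) \<le> x / k * exp (\<delta> * x) / x powr \<theta> * (l powr (\<theta> - 1) * laplace_rate l (ennreal x))"
   using x p by (simp add: laplace_ennreal laplace_rate_def mult_ac)
  fix t :: real assume t: "0 \<le> t"
  let ?R = "LINT u:{0<..t}|lborel. (LINT w|P. laplace_rate l (X u w))"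
  have i: "integrable P (\<lambda>w. laplace l (X t w))" using p t by (intro laplace_integrable) auto
  have "(\<integral>\<^sup>+w. ennreal (1 - laplace l (X t w)) \<partial>P) = ennreal (LINT w|P. 1 - laplace l (X t w))"
   using i laplace_bounds[of l] p by (intro nn_integral_eq_integral) auto
  also have "(LINT w|P. 1 - laplace l (X t w)) = (1 - laplace l (ennreal x)) + - \<psi> l * ?R"
   using i p t by (simp add: laplace_equation_0 prob_space)
  also have "ennreal \<dots> = ennreal (1 - laplace l (ennreal x)) + ennreal (- \<psi> l) * ennreal ?R"
   using np p t laplace_bounds[of l "ennreal x"] laplace_rate_integral(2)[of l t] by (subst ennreal_plus) (auto simp: ennreal_mult mult_nonpos_nonneg simp flip: ennreal_mult)
  finally show "\<psi> l \<noteq> 0 \<and> (\<integral>\<^sup>+w. ennreal (1 - (if 0 \<le> l then laplace l (X t w) else 0)) \<partial>P) = ennreal (1 - (?b l)) + ennreal \<bar>\<psi> l\<bar> * laplace_occupation l t"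
   using p np t laplace_rate_integral(1)[of l t] by simp
 next
  fix y :: ennreal assume "y \<noteq> \<infinity>"
  then consider r where "y = ennreal r" "0 \<le> r" "r \<le> x / 2" | r where "y = ennreal r" "0 < r" "x / 2 < r"
   using x by (cases y) (auto simp: not_le, force)
  thus "(\<forall>l\<in>{0<..<\<delta>}. 1 - (?a l y) \<le> 1 - (if 0 \<le> l then laplace l (ennreal (x / 2)) else 0)) \<or> gamma_part {0<..<\<delta> * (x / 2)} \<le> mixed_rate {0<..<\<delta>} y"
  proof cases
   case 1
   thus ?thesis using x mult_left_mono[of r "x / 2"] by (auto simp: laplace_ennreal)
  next
   case 2
   have "\<delta> * (x / 2) \<le> \<delta> * r" using 2 \<delta> by (intro mult_left_mono) auto
   hence "gamma_part {0<..<\<delta> * (x / 2)} \<le> gamma_part {m. m / r \<in> {0<..<\<delta>}}"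
    using 2 by (intro gamma_part_mono) (auto simp: pos_divide_less_eq)
   moreover have "mixed_rate {0<..<\<delta>} (ennreal r) = gamma_part {m. m / r \<in> {0<..<\<delta>}}" using 2 by (intro mixed_rate_eq) auto
   ultimately show ?thesis using 2 by simp
  qed
 qed (use \<delta> x in \<open>auto intro!: gamma_part_positive\<close>)
qed

text \<open>Here \<open>psi\<close> is positive on all of \<open>(0, \<infinity>)\<close>, so the
  mean of \<open>exp (- l * X t)\<close> is at least its initial value for every
  \<open>l > 0\<close>. Letting \<open>l\<close> tend to 0 gives full probability to finite
  states.\<close>

lemma no_explosion:
 assumes Phi: "\<not> 0 < Phi0 b c \<pi>" and t: "0 \<le> t" shows "AE v in P. X t v \<noteq> \<infinity>"
proof -
 let ?a = "\<integral>v. (if X t v = \<infinity> then 0 else (1::real)) \<partial>P"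
 let ?b = "\<integral>v. (if X t v = \<infinity> then 0 else 1) \<partial>P"
 note [measurable] = X_measurable[OF t]
 define l where "l k = 1 / real (Suc k)" for k
 have l: "0 < l k" "l \<longlonglongrightarrow> 0" for k using LIMSEQ_inverse_real_of_nat by (auto simp: l_def[abs_def] inverse_eq_divide)
 have lim: "(\<lambda>k. laplace (l k) y) \<longlonglongrightarrow> (if y = \<infinity> then 0 else 1)" for y
 proof (cases "y = \<infinity>")
  case False
  have "(\<lambda>k. exp (- l k * enn2real y)) \<longlonglongrightarrow> exp (- 0 * enn2real y)" by (intro tendsto_intros l(2))
  thus ?thesis using False by (simp add: laplace_def)
 qed (simp add: laplace_def)
 have "(\<lambda>k. \<integral>v. laplace (l k) (X t v) \<partial>P) \<longlonglongrightarrow> ?b"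
 proof (rule integral_dominated_convergence[where w="\<lambda>_. 1"])
  show "AE v in P. norm (laplace (l k) (X t v)) \<le> 1" for k using laplace_bounds[of "l k"] l(1)[of k] by (intro AE_I2) (simp add: less_imp_le)
 qed (use lim in auto)
 moreover have "laplace (l k) (ennreal x) \<le> (LINT v|P. laplace (l k) (X t v))" for k
 proof -
  have "Phi0 b c \<pi> < ereal (l k)" using Phi l(1)[of k] by (auto simp: not_less intro: le_less_trans)
  hence "0 < \<psi> (l k)" by (rule psi_positive_above)
  thus ?thesis unfolding laplace_equation_0[OF l(1) t] using laplace_rate_integral(2)[OF l(1) t, of k] by simp
 qed
 moreover have "(\<lambda>k. laplace (l k) (ennreal x)) \<longlonglongrightarrow> 1" using lim[of "ennreal x"] by simp
 ultimately have "(1::real) \<le> ?b" by (meson LIMSEQ_le)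
 moreover have "?a = prob {v\<in>space P. X t v \<noteq> \<infinity>}"
 proof -
  have "?a = (LINT v|P. indicator {v\<in>space P. X t v \<noteq> \<infinity>} v)" by (intro lebesgue_integral_cong refl) (auto simp: indicator_def)
  thus ?thesis by simp
 qed
 ultimately have "prob {v\<in>space P. X t v \<noteq> \<infinity>} = 1" using prob_le_1 by (intro antisym) auto
 thus ?thesis by (subst (asm) prob_Collect_eq_1) auto
qed

text \<open>A path that tends to 0 without reaching it is eventually in \<open>(0, 1)\<close>, where
  the mixed rate is bounded below, so its total occupation is infinite. The mean total occupation is
  bounded by the finite weight integral.\<close>

lemma not_extinguishing:
 assumes K: "Phi0 b c \<pi> < ereal K" and I: "weight_integral {K<..} \<noteq> \<infinity>" (is "?I \<noteq> _")
 shows "AE w in P. \<not> ((\<forall>t\<ge>0. X t w \<noteq> 0) \<and> vanishes w)"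
proof -
 let ?H = "mixed_rate {K<..}"
 note K0 = psi_positive_above(1)[OF K]
 \<comment> \<open>The occupation of a single path up to time \<open>n\<close>. Clamping the time
   changes nothing on the domain and provides joint measurability.\<close>
 define Z where "Z n w = (\<integral>\<^sup>+u. ?H (X (min (max u 0) (real n)) w) * indicator {0<..real n} u \<partial>lborel)" for n w
 have Xm [measurable]: "(\<lambda>p. X (min (max (snd p) 0) (real n)) (fst p)) \<in> borel_measurable (P \<Otimes>\<^sub>M lborel)" for n by (rule X_joint) simp
 have Zm: "Z n \<in> borel_measurable P" for n
  unfolding Z_def[abs_def] by (rule lborel.borel_measurable_nn_integral) (unfold case_prod_unfold, measurable)
 have EZ: "(\<integral>\<^sup>+w. Z n w \<partial>P) \<le> ?I" for n
 proof -
  have "(\<integral>\<^sup>+w. Z n w \<partial>P) = (\<integral>\<^sup>+u. \<integral>\<^sup>+w. ?H (X (min (max u 0) (real n)) w) * indicator {0<..real n} u \<partial>P \<partial>lborel)"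
   unfolding Z_def
  proof (rule nn_integral_swap_lborel[symmetric])
   show "(\<lambda>(u, w). ?H (X (min (max u 0) (real n)) w) * indicator {0<..real n} u) \<in> borel_measurable (lborel \<Otimes>\<^sub>M P)"
   proof -
    have [measurable]: "(\<lambda>p. X (min (max (fst p) 0) (real n)) (snd p)) \<in> borel_measurable (lborel \<Otimes>\<^sub>M P)"
     using measurable_compose[OF measurable_pair_swap' Xm[of n]] by (simp add: case_prod_unfold)
    show ?thesis unfolding case_prod_unfold by measurable
   qed
  qed
  also have "\<dots> = (\<integral>\<^sup>+u\<in>{0<..real n}. (\<integral>\<^sup>+w. ?H (X u w) \<partial>P) \<partial>lborel)"
   by (intro nn_integral_cong) (auto simp: indicator_def)
  also have "\<dots> \<le> ?I" by (rule extinction_dichotomy(2)[OF K]) simp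
  finally show ?thesis .
 qed
 have inc: "incseq Z" unfolding incseq_def le_fun_def Z_def by (intro allI impI nn_integral_mono) (auto simp: indicator_def)
 have "(\<integral>\<^sup>+w. (SUP n. Z n w) \<partial>P) = (SUP n. \<integral>\<^sup>+w. Z n w \<partial>P)"
  by (rule nn_integral_monotone_convergence_SUP[OF inc Zm])
 also have "\<dots> \<le> ?I" using EZ by (rule SUP_least)
 finally have "(\<integral>\<^sup>+w. (SUP n. Z n w) \<partial>P) \<noteq> \<infinity>" using I by (auto simp: top_unique)
 hence "AE w in P. (SUP n. Z n w) \<noteq> \<infinity>" using Zm by (intro nn_integral_PInf_AE) measurable
 thus ?thesis
 proof eventually_elim
  case (elim w)
  show ?case
  proof
   assume B: "(\<forall>t\<ge>0. X t w \<noteq> 0) \<and> vanishes w"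
   hence "eventually (\<lambda>t. X t w < 1) at_top" by (intro order_tendstoD) auto
   then obtain t0 where t0: "\<And>t. t0 \<le> t ==> X t w < 1" by (auto simp: eventually_at_top_linorder)
   obtain N :: nat where N: "t0 \<le> real N" using real_arch_simple by blast
   define h where "h = gamma_part {K<..<K + 1}"
   have h: "0 < h" using K0 by (auto simp: h_def intro: gamma_part_positive)
   have low: "h \<le> ?H (X u w)" if u: "real N \<le> u" for u
   proof -
    have u0: "0 \<le> u" using u by (meson of_nat_0_le_iff order_trans)
    have "X u w < 1" "X u w \<noteq> 0" using t0[of u] N u B u0 by auto
    then obtain r where r: "X u w = ennreal r" "0 < r" "r < 1" by (cases "X u w") (auto simp: ennreal_less_one_iff)
    have "K * r \<le> K" using r K0 by simp
    hence "{K<..<K + 1} \<subseteq> {m. m / r \<in> {K<..}}" using r by (auto simp: pos_less_divide_eq)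
    thus ?thesis unfolding r(1) h_def using K0 r by (subst mixed_rate_eq) (auto intro!: gamma_part_mono)
   qed
   have "of_nat m * h \<le> (SUP n. Z n w)" for m :: nat
   proof -
    have "of_nat m * h = (\<integral>\<^sup>+u. h * indicator {real N<..real (N + m)} u \<partial>lborel)"
     by (simp add: nn_integral_cmult_indicator mult.commute ennreal_of_nat_eq_real_of_nat)
    also have "\<dots> \<le> Z (N + m) w" unfolding Z_def using low by (intro nn_integral_mono) (auto simp: indicator_def)
    also have "\<dots> \<le> (SUP n. Z n w)" by (rule SUP_upper) simp
    finally show ?thesis .
   qed
   hence "(SUP m. of_nat m * h) \<le> (SUP n. Z n w)" by (rule SUP_least)
   moreover have "(SUP m. of_nat m * h) = \<infinity>"
    using h by (simp add: SUP_mult_right_ennreal[symmetric] ennreal_SUP_of_nat_eq_top ennreal_top_mult)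
   ultimately show False using elim by (simp add: top_unique)
  qed
 qed
qed

section \<open>Convergence to 0 through a maximal inequality\<close>

lemma laplace_antimono: "0 \<le> l ==> ennreal k < y ==> 0 \<le> k ==> laplace l y \<le> exp (- l * k)"
proof (cases y)
 case (real r)
 assume "0 \<le> l" "ennreal k < y" "0 \<le> k"
 hence "l * k \<le> l * r" using real by (intro mult_left_mono) (auto simp: ennreal_less_iff)
 thus ?thesis using real by (simp add: laplace_ennreal)
qed (simp add: laplace_def)

text \<open>\<open>\<eta>\<close> is the value of the supermartingale \<open>1 - laplace K\<close>
  at the level \<open>k\<close>, and thus the threshold in the maximal inequality.\<close>

context
 fixes K k \<eta> :: real
 assumes K: "Phi0 b c \<pi> < ereal K" and k: "0 < k"
 defines "\<eta> \<equiv> 1 - exp (- K * k)"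
begin

abbreviation (input) "V r w \<equiv> 1 - laplace K (X r w)"

lemma V_bounds: "0 \<le> V r w" "V r w \<le> 1" using laplace_bounds[of K "X r w"] psi_positive_above(1)[OF K] by auto

lemma V_large: "ennreal k < X r w ==> \<eta> \<le> V r w"
 using laplace_antimono[of K k "X r w"] psi_positive_above(1)[OF K] k by (simp add: \<eta>_def)

lemma V_integrable: "0 \<le> r ==> U \<in> sets P ==> integrable P (\<lambda>w. indicator U w * V r w)"
 using V_bounds by (intro bounded_integrable[where B=1]) (auto simp: indicator_def intro!: borel_measurable_times borel_measurable_diff measurable_compose[OF X_measurable])

lemma V_supermartingale:
 assumes st: "0 \<le> s" "s \<le> t" and U: "U \<in> sets (F s)" shows "(LINT w|P. indicator U w * V t w) \<le> (LINT w|P. indicator U w * V s w)"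
proof -
 have UP: "U \<in> sets P" using U sets_F[OF st(1)] by auto
 have K0: "0 < K" "0 < \<psi> K" using psi_positive_above[OF K] by auto
 have i: "integrable P (\<lambda>w. indicator U w * laplace K (X r w))" if "0 \<le> r" for r
  using laplace_bounds[of K] K0 UP that by (intro bounded_integrable[where B=1]) (auto simp: indicator_def intro!: borel_measurable_times measurable_compose[OF X_measurable])
 have "0 \<le> (LINT u:{s<..t}|lborel. (LINT w|P. indicator U w * laplace_rate K (X u w)))"
  unfolding set_lebesgue_integral_def using laplace_rate_bounds[OF K0(1)] by (intro integral_nonneg_AE AE_I2) (auto intro!: integral_nonneg_AE)
 from mult_nonneg_nonneg[OF less_imp_le[OF K0(2)] this]
 have "(LINT w|P. indicator U w * laplace K (X s w)) \<le> (LINT w|P. indicator U w * laplace K (X t w))"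
  unfolding laplace_equation[OF K0(1) st U, symmetric] by simp
 thus ?thesis
 proof -
  have "integrable P (indicator U :: 'a => real)" using UP by (intro integrable_real_indicator) (auto simp: emeasure_eq_measure)
  hence "(LINT w|P. indicator U w * V r w) = (LINT w|P. indicator U w) - (LINT w|P. indicator U w * laplace K (X r w))" if "0 \<le> r" for r
   using i[OF that] by (simp add: right_diff_distrib)
  thus ?thesis using \<open>(LINT w|P. indicator U w * laplace K (X s w)) \<le> _\<close> st by simp
 qed
qed

lemma grid_event:
 assumes "0 \<le> s" "0 \<le> d" shows "{w\<in>space P. \<exists>j\<le>n. ennreal k < X (s + real j * d) w} \<in> sets P"
proof -
 let ?a = "\<Union>j\<in>{..n}. {w\<in>space P. ennreal k < X (s + real j * d) w}"
 have "{w\<in>space P. ennreal k < X r w} \<in> sets P" if "0 \<le> r" for r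
 proof -
  note [measurable] = X_measurable[OF that]
  show ?thesis by measurable
 qed
 hence "?a \<in> sets P" using assms by (intro sets.finite_UN) auto
 also have "?a = {w\<in>space P. \<exists>j\<le>n. ennreal k < X (s + real j * d) w}" by auto
 finally show ?thesis .
qed

text \<open>Induction on the number of grid points, with the starting time and the event
  \<open>U\<close> kept general: paths above the level at the first point are paid for by the
  supermartingale there, and the others form a smaller event that is passed on to the next
  point.\<close>

lemma maximal_grid:
 assumes d: "0 \<le> d" and "0 \<le> s" "U \<in> sets (F s)"
 shows "\<eta> * prob (U \<inter> {w\<in>space P. \<exists>j\<le>n. ennreal k < X (s + real j * d) w}) \<le> (LINT w|P. indicator U w * V s w)"
 using assms(2,3)
proof (induction n arbitrary: s U)
 case (0 s U)
 have UP [measurable]: "U \<in> sets P" using 0 sets_F[of s] by auto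
 note [measurable] = X_measurable[OF 0(1)]
 have "\<eta> * prob (U \<inter> {w\<in>space P. ennreal k < X s w}) = (LINT w|P. \<eta> * indicator (U \<inter> {w\<in>space P. ennreal k < X s w}) w)" by simp
 also have "\<dots> \<le> (LINT w|P. indicator U w * V s w)"
  using V_bounds(1) V_large by (intro integral_mono V_integrable 0 UP integrable_mult_right integrable_real_indicator) (auto simp: indicator_def emeasure_eq_measure)
 finally show ?case by simp
next
 case (Suc n s U)
 let ?A = "{w\<in>space P. ennreal k < X s w}"
 let ?E = "\<lambda>s n. {w\<in>space P. \<exists>j\<le>n. ennreal k < X (s + real j * d) w}"
 have sd: "0 \<le> s + d" "s \<le> s + d" using Suc.prems d by auto
 have UP: "U \<in> sets P" using Suc.prems sets_F[of s] by auto
 have "X s -` {ennreal k<..} \<inter> space (F s) \<in> sets (F s)" by (rule measurable_sets[OF X_adapted[OF Suc.prems(1)]]) simp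
 also have "X s -` {ennreal k<..} \<inter> space (F s) = ?A" using Suc.prems by auto
 finally have A: "?A \<in> sets (F s)" .
 hence AP: "?A \<in> sets P" using Suc.prems sets_F[of s] by auto
 have EP: "?E s n \<in> sets P" if "0 \<le> s" for s n using that d by (rule grid_event)
 have "?E s (Suc n) \<subseteq> ?A \<union> ?E (s + d) n"
 proof
  fix w assume "w \<in> ?E s (Suc n)"
  then obtain j where j: "w \<in> space P" "j \<le> Suc n" "ennreal k < X (s + real j * d) w" by auto
  show "w \<in> ?A \<union> ?E (s + d) n" using j by (cases j) (auto simp: algebra_simps)
 qed
 hence sub: "U \<inter> ?E s (Suc n) \<subseteq> (U \<inter> ?A) \<union> ((U - ?A) \<inter> ?E (s + d) n)" by auto
 have \<eta>: "0 \<le> \<eta>" using k psi_positive_above(1)[OF K] by (simp add: \<eta>_def)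
 have "prob (U \<inter> ?E s (Suc n)) \<le> prob ((U \<inter> ?A) \<union> ((U - ?A) \<inter> ?E (s + d) n))"
  by (rule finite_measure_mono[OF sub]) (intro sets.Un sets.Int sets.Diff UP AP EP sd)
 also have "\<dots> \<le> prob (U \<inter> ?A) + prob ((U - ?A) \<inter> ?E (s + d) n)" by (intro measure_Un_le sets.Int sets.Diff UP AP EP sd)
 finally have "\<eta> * prob (U \<inter> ?E s (Suc n)) \<le> \<eta> * prob (U \<inter> ?A) + \<eta> * prob ((U - ?A) \<inter> ?E (s + d) n)"
  using \<eta> by (simp add: mult_left_mono flip: distrib_left)
 also have "\<eta> * prob (U \<inter> ?A) = (LINT w|P. \<eta> * indicator (U \<inter> ?A) w)" using UP AP by simp
 also have "\<dots> \<le> (LINT w|P. indicator (U \<inter> ?A) w * V s w)"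
  using V_bounds(1) V_large UP AP by (intro integral_mono V_integrable Suc integrable_mult_right integrable_real_indicator) (auto simp: indicator_def emeasure_eq_measure)
 also have "\<eta> * prob ((U - ?A) \<inter> ?E (s + d) n) \<le> (LINT w|P. indicator (U - ?A) w * V (s + d) w)"
  using Suc.prems A F_mono[OF Suc.prems(1) sd(2)] by (intro Suc.IH sd(1)) auto
 also have "\<dots> \<le> (LINT w|P. indicator (U - ?A) w * V s w)" using Suc.prems A by (intro V_supermartingale sd) auto
 also have "(LINT w|P. indicator (U \<inter> ?A) w * V s w) + (LINT w|P. indicator (U - ?A) w * V s w) = (LINT w|P. indicator U w * V s w)"
  by (subst Bochner_Integration.integral_add[symmetric], (intro V_integrable Suc.prems sets.Int sets.Diff UP AP)+)
    (auto intro!: lebesgue_integral_cong simp: indicator_def)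
 finally show ?case by simp
qed

text \<open>Right continuity turns an excess over \<open>k\<close> at any time into one at a dyadic
  time after \<open>s\<close>, so the event is an increasing union of grid events and hence
  measurable.\<close>

lemma maximal_inequality:
 assumes s: "0 \<le> s" and U: "U \<in> sets (F s)" shows "{w\<in>space P. \<exists>t\<ge>s. ennreal k < X t w} \<in> sets P"
  "\<eta> * prob (U \<inter> {w\<in>space P. \<exists>t\<ge>s. ennreal k < X t w}) \<le> (LINT w|P. indicator U w * V s w)"
proof -
 have UP: "U \<in> sets P" using U sets_F[OF s] by auto
 \<comment> \<open>Mesh \<open>1 / 2 ^ m\<close> up to the horizon \<open>s + 2 ^ m\<close>, hence
   \<open>4 ^ m\<close> steps: fineness and horizon grow together.\<close>
 define E where "E m = {w\<in>space P. \<exists>j\<le>4 ^ m. ennreal k < X (s + real j * (1 / 2 ^ m)) w}" for m :: nat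
 have Em [measurable]: "E m \<in> sets P" for m unfolding E_def using s by (rule grid_event) simp
 have inc: "incseq E"
 proof (intro incseq_SucI subsetI)
  fix m w assume "w \<in> E m"
  then obtain j where j: "w \<in> space P" "j \<le> 4 ^ m" "ennreal k < X (s + real j * (1 / 2 ^ m)) w" by (auto simp: E_def)
  have "real (2 * j) * (1 / 2 ^ Suc m) = real j * (1 / 2 ^ m)" by simp
  thus "w \<in> E (Suc m)" unfolding E_def using j by (intro CollectI conjI exI[of _ "2 * j"]) auto
 qed
 have un: "{w\<in>space P. \<exists>t\<ge>s. ennreal k < X t w} = (\<Union>m. E m)"
 proof (intro set_eqI iffI)
  fix w assume "w \<in> {w\<in>space P. \<exists>t\<ge>s. ennreal k < X t w}"
  then obtain t where t: "w \<in> space P" "s \<le> t" "ennreal k < X t w" by auto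
  have "eventually (\<lambda>r. ennreal k < X r w) (at_right t)" using t s by (intro order_tendstoD(1)[OF X_right]) auto
  then obtain q where q: "t < q" "\<And>r. t < r ==> r < q ==> ennreal k < X r w" by (auto simp: eventually_at_right_field)
  \<comment> \<open>Large enough for a grid point between \<open>t\<close> and \<open>q\<close>, and
    for that point to lie before the horizon.\<close>
  obtain m where m: "max (1 / (q - t)) (t - s + 1) < 2 ^ m" using real_arch_pow[of 2 "max (1 / (q - t)) (t - s + 1)"] by auto
  define D where "D = (2::real) ^ m"
  have D: "1 / D < q - t" "t - s + 1 < D" "0 < D" using m q by (auto simp: D_def field_simps)
  define j where "j = nat \<lfloor>(t - s) * D\<rfloor> + 1"
  have jr: "real j = real_of_int \<lfloor>(t - s) * D\<rfloor> + 1" using t D by (simp add: j_def)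
  have j: "(t - s) * D < real j" "real j \<le> (t - s) * D + 1" unfolding jr by linarith+
  have D1: "1 \<le> D" by (simp add: D_def)
  have "real j \<le> (t - s + 1) * D" using j(2) D1 by (simp add: distrib_right)
  also have "\<dots> \<le> D * D" using D by (intro mult_right_mono) auto
  also have "D * D = real (4 ^ m)" by (simp add: D_def flip: power_mult_distrib)
  finally have j4: "j \<le> 4 ^ m" by (simp only: of_nat_le_iff)
  have "t < s + real j * (1 / D)" using j(1) D by (simp add: field_simps)
  moreover have "s + real j * (1 / D) < q"
  proof -
   have "real j * (1 / D) \<le> t - s + 1 / D" using j(2) D by (simp add: field_simps)
   thus ?thesis using D by linarith
  qed
  ultimately have "ennreal k < X (s + real j * (1 / D)) w" by (rule q(2))
  thus "w \<in> (\<Union>m. E m)" using t(1) j4 by (auto simp: E_def D_def)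
 next
  fix w assume "w \<in> (\<Union>m. E m)"
  then obtain m j where "w \<in> space P" "ennreal k < X (s + real j * (1 / 2 ^ m)) w" by (auto simp: E_def)
  thus "w \<in> {w\<in>space P. \<exists>t\<ge>s. ennreal k < X t w}" by (auto intro!: exI[of _ "s + real j * (1 / 2 ^ m)"])
 qed
 show "{w\<in>space P. \<exists>t\<ge>s. ennreal k < X t w} \<in> sets P" unfolding un by measurable
 have "(\<lambda>m. prob (U \<inter> E m)) \<longlonglongrightarrow> prob (\<Union>m. U \<inter> E m)"
  using inc UP by (intro finite_Lim_measure_incseq) (auto simp: incseq_def)
 hence "(\<lambda>m. \<eta> * prob (U \<inter> E m)) \<longlonglongrightarrow> \<eta> * prob (U \<inter> (\<Union>m. E m))" by (intro tendsto_mult_left) simp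
 thus "\<eta> * prob (U \<inter> {w\<in>space P. \<exists>t\<ge>s. ennreal k < X t w}) \<le> (LINT w|P. indicator U w * V s w)"
  unfolding un E_def by (rule LIMSEQ_le_const2) (intro exI allI impI maximal_grid s U, simp)
qed

text \<open>The number \<open>p = exp (- K * x)\<close> bounds the mean of
  \<open>laplace K (X s)\<close> from below at all times, while the mean of its rate cannot stay
  away from 0. At a time when the latter is small, \<open>X\<close> lies below a tiny level
  \<open>k'\<close> with probability at least \<open>p / 2\<close>, and from there it exceeds
  \<open>k\<close> later with probability at most \<open>p / 4\<close>.\<close>

lemma eventually_small:
 "\<exists>s\<ge>0. exp (- K * x) / 4 \<le> prob {w\<in>space P. \<forall>t\<ge>s. X t w \<le> ennreal k}"
proof -
 let ?a = "\<lambda>s. \<integral>w. laplace_rate K (X s w) \<partial>P"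
 define p where "p = exp (- K * x)"
 have K0: "0 < K" "0 < \<psi> K" using psi_positive_above[OF K] by auto
 have p: "0 < p" "p \<le> 1" using K0 x by (auto simp: p_def)
 have \<eta>: "0 < \<eta>" "\<eta> < 1" using k K0 by (auto simp: \<eta>_def)
 have \<eta>p: "0 < \<eta> * p / 4" "\<eta> * p / 4 < 1" using \<eta> p mult_mono[of \<eta> 1 p 1] by auto
 \<comment> \<open>The level at which \<open>1 - laplace K\<close> equals
   \<open>\<eta> * p / 4\<close>, so that dividing by \<open>\<eta>\<close> in the maximal
   inequality leaves \<open>p / 4\<close>.\<close>
 define k' where "k' = - ln (1 - \<eta> * p / 4) / K"
 have k': "0 < k'" "1 - exp (- K * k') = \<eta> * p / 4" using \<eta>p K0 by (auto simp: k'_def field_simps ln_less_zero)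
 \<comment> \<open>A state above \<open>k'\<close> with Laplace value above \<open>p / 4\<close> has
   \<open>laplace_rate K\<close> at least \<open>k' powr \<theta> * p / 4\<close>, which is
   \<open>1 / C\<close>.\<close>
 define C where "C = 4 / (p * k' powr \<theta>)"
 have C: "0 < C" using p k' by (simp add: C_def)
 have pt: "laplace K y \<le> (if y \<le> ennreal k' then 1 else 0) + p / 4 + C * laplace_rate K y" for y
 proof (cases "y \<le> ennreal k' \<or> laplace K y \<le> p / 4")
  case True
  thus ?thesis using laplace_bounds[of K y] laplace_rate_bounds[OF K0(1), of y] K0 C p by (auto intro: add_increasing2 add_increasing)
 next
  case False
  then obtain r where r: "y = ennreal r" "k' < r" using p k' by (cases y) (auto simp: laplace_def not_le ennreal_less_iff)
  have e: "p / 4 < exp (- K * r)" using False r k' by (simp add: laplace_ennreal)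
  have "1 = C * (k' powr \<theta> * (p / 4))" using p k' by (simp add: C_def)
  also have "\<dots> \<le> C * laplace_rate K y"
   unfolding laplace_rate_def using r k' e C p \<theta> by (intro mult_left_mono mult_mono powr_mono2) auto
  finally show ?thesis using laplace_bounds[of K y] K0 p False by simp
 qed
 have "\<exists>s\<ge>0. (?a s) \<le> p / (4 * C)"
 proof (rule ccontr)
  assume "\<not> ?thesis"
  hence big: "p / (4 * C) < (?a s)" if "0 \<le> s" for s using that by (meson not_le)
  \<comment> \<open>Over \<open>[0, T]\<close> the integrated rate would be at least
    \<open>1 / psi K + 1\<close>, but by \<open>laplace_equation_0\<close> it cannot exceed
    \<open>1 / psi K\<close>.\<close>
  define T where "T = 4 * C * (1 / \<psi> K + 1) / p"
  have T: "0 \<le> T" "p / (4 * C) * T = 1 / \<psi> K + 1" using p C K0 by (auto simp: T_def)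
  have "1 / \<psi> K + 1 = (LINT u:{0<..T}|lborel. p / (4 * C))" using T by (simp add: set_lebesgue_integral_def mult.commute)
  also have "\<dots> \<le> mean_laplace_rate K T"
   using big T(1) by (intro set_integral_mono laplace_rate_integral(3) K0) (auto simp: set_integrable_def less_imp_le)
  finally have "\<psi> K * (1 / \<psi> K + 1) \<le> \<psi> K * mean_laplace_rate K T" using K0 by (intro mult_left_mono) auto
  also have "\<dots> \<le> (LINT w|P. laplace K (X T w))" unfolding laplace_equation_0[OF K0(1) T(1)] using K0 laplace_bounds[of K] by simp
  also have "\<dots> \<le> 1"
   using laplace_bounds[of K] K0 T(1) bounded_integral[of "\<lambda>w. laplace K (X T w)" 1] by (auto intro: measurable_compose[OF X_measurable])
  finally show False using K0 by (simp add: distrib_left)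
 qed
 then obtain s where s: "0 \<le> s" and rs: "(?a s) \<le> p / (4 * C)" by blast
 define U where "U = {w\<in>space P. X s w \<le> ennreal k'}"
 have "X s -` {..ennreal k'} \<inter> space (F s) \<in> sets (F s)" by (rule measurable_sets[OF X_adapted[OF s]]) simp
 also have "X s -` {..ennreal k'} \<inter> space (F s) = U" using s by (auto simp: U_def)
 finally have U: "U \<in> sets (F s)" .
 hence UP [measurable]: "U \<in> sets P" using sets_F[OF s] by auto
 have ri: "integrable P (\<lambda>w. laplace_rate K (X s w))" using K0(1) s by (rule laplace_rate_integrable)
 have "p \<le> (LINT w|P. laplace K (X s w))"
  unfolding laplace_equation_0[OF K0(1) s] using K0 x laplace_rate_integral(2)[OF K0(1) s] by (simp add: laplace_ennreal p_def)
 also have "\<dots> \<le> (LINT w|P. indicator U w + p / 4 + C * laplace_rate K (X s w))"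
 proof (rule integral_mono)
  show "laplace K (X s w) \<le> indicator U w + p / 4 + C * laplace_rate K (X s w)" if "w \<in> space P" for w
   using pt[of "X s w"] that by (auto simp: U_def indicator_def split: if_splits)
 qed (use K0 s ri in \<open>auto intro!: laplace_integrable integrable_real_indicator simp: emeasure_eq_measure\<close>)
 also have "\<dots> = prob U + p / 4 + C * (?a s)" using ri by (simp add: prob_space emeasure_eq_measure)
 also have "\<dots> \<le> prob U + p / 4 + C * (p / (4 * C))" using rs C by (intro add_left_mono mult_left_mono) auto
 finally have PU: "p / 2 \<le> prob U" using C by simp
 let ?E = "{w\<in>space P. \<exists>t\<ge>s. ennreal k < X t w}"
 note m = maximal_inequality[OF s U]
 have "\<eta> * prob (U \<inter> ?E) \<le> (LINT w|P. indicator U w * V s w)" by (rule m(2))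
 also have "\<dots> \<le> (LINT w|P. \<eta> * p / 4)"
 proof (rule integral_mono)
  fix w
  have "V s w \<le> \<eta> * p / 4" if mem: "w \<in> U"
  proof -
   obtain r where r: "X s w = ennreal r" "0 \<le> r" "r \<le> k'" using mem k' unfolding U_def by (cases "X s w") (auto simp: top_unique)
   have "exp (- K * k') \<le> exp (- K * r)" using r(3) K0 by simp
   moreover have "laplace K (X s w) = exp (- K * r)" using r by (simp add: laplace_ennreal)
   ultimately show ?thesis using k'(2) by linarith
  qed
  thus "indicator U w * V s w \<le> \<eta> * p / 4" using \<eta>p by (auto simp: indicator_def)
 qed (use s UP in \<open>auto intro!: V_integrable\<close>)
 also have "\<dots> = \<eta> * (p / 4)" by (simp add: prob_space)
 finally have PE: "prob (U \<inter> ?E) \<le> p / 4" using \<eta> by simp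
 have eq: "{w\<in>space P. \<forall>t\<ge>s. X t w \<le> ennreal k} = space P - ?E" by (auto simp: not_less)
 have "prob U \<le> prob ((U \<inter> ?E) \<union> (space P - ?E))" using m(1) UP by (intro finite_measure_mono) (auto simp: U_def)
 also have "\<dots> \<le> prob (U \<inter> ?E) + prob (space P - ?E)" using m(1) UP by (intro measure_Un_le) auto
 finally have "p / 4 \<le> prob (space P - ?E)" using PU PE by linarith
 thus ?thesis using s unfolding eq[symmetric] p_def by blast
qed

end

text \<open>Restricting to countably many levels and starting times makes convergence to 0 a
  measurable event.\<close>

lemma tendsto_0_iff_small:
 "vanishes w \<longleftrightarrow> (\<forall>m. \<exists>n::nat. \<forall>t\<ge>real n. X t w \<le> ennreal (1 / real (Suc m)))"
proof
 assume L: "vanishes w"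
 show "\<forall>m. \<exists>n::nat. \<forall>t\<ge>real n. X t w \<le> ennreal (1 / real (Suc m))"
 proof
  fix m
  have "eventually (\<lambda>t. X t w < ennreal (1 / real (Suc m))) at_top" by (intro order_tendstoD[OF L]) simp
  then obtain t0 where "\<And>t. t0 \<le> t ==> X t w < ennreal (1 / real (Suc m))" by (auto simp: eventually_at_top_linorder)
  moreover obtain n :: nat where "t0 \<le> real n" using real_arch_simple by blast
  ultimately show "\<exists>n::nat. \<forall>t\<ge>real n. X t w \<le> ennreal (1 / real (Suc m))" by (meson less_imp_le order_trans)
 qed
next
 assume S: "\<forall>m. \<exists>n::nat. \<forall>t\<ge>real n. X t w \<le> ennreal (1 / real (Suc m))"
 show "vanishes w"
 proof (rule order_tendstoI)
  fix a :: ennreal assume a: "0 < a"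
  have "(\<lambda>m. ennreal (1 / real (Suc m))) \<longlonglongrightarrow> ennreal 0"
   using LIMSEQ_inverse_real_of_nat by (intro tendsto_ennrealI) (simp add: inverse_eq_divide)
  from order_tendstoD(2)[OF this, of a] a obtain m where m: "ennreal (1 / real (Suc m)) < a" by (auto simp: eventually_sequentially)
  from S obtain n :: nat where "\<forall>t\<ge>real n. X t w \<le> ennreal (1 / real (Suc m))" by blast
  thus "eventually (\<lambda>t. X t w < a) at_top" unfolding eventually_at_top_linorder using m by (meson le_less_trans)
 qed simp
qed

text \<open>The bound from \<open>eventually_small\<close> does not depend on the level
  \<open>k\<close>, so it survives the decreasing intersection over the levels
  \<open>1 / Suc m\<close>.\<close>

lemma extinguishing_event:
 assumes K: "Phi0 b c \<pi> < ereal K" shows "{w\<in>space P. vanishes w} \<in> sets P"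
  "0 < \<P>(w in P. vanishes w)"
proof -
 let ?a = "\<lambda>m. ennreal (1 / real (Suc m))"
 define G where "G m = {w\<in>space P. \<exists>n::nat. \<forall>t\<ge>real n. X t w \<le> ?a m}" for m :: nat
 have U: "space P \<in> sets (F r)" if "0 \<le> r" for r using that by (metis sets.top space_F)
 have tail: "{w\<in>space P. \<forall>t\<ge>r. X t w \<le> ennreal k} \<in> sets P" if "0 < k" "0 \<le> r" for k r
 proof -
  have "{w\<in>space P. \<forall>t\<ge>r. X t w \<le> ennreal k} = space P - {w\<in>space P. \<exists>t\<ge>r. ennreal k < X t w}" by (auto simp: not_less)
  thus ?thesis using maximal_inequality(1)[OF K that U[OF that(2)]] by simp
 qed
 have Geq: "G m = (\<Union>n::nat. {w\<in>space P. \<forall>t\<ge>real n. X t w \<le> ?a m})" for m by (auto simp: G_def)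
 have Gm [measurable]: "G m \<in> sets P" for m unfolding Geq by (intro sets.countable_UN image_subsetI tail) auto
 have eq: "{w\<in>space P. vanishes w} = (\<Inter>m. G m)" unfolding tendsto_0_iff_small by (auto simp: G_def)
 show "{w\<in>space P. vanishes w} \<in> sets P" unfolding eq by measurable
 have dec: "decseq G"
 proof (intro decseq_SucI subsetI)
  fix m w assume "w \<in> G (Suc m)"
  moreover have "ennreal (1 / real (Suc (Suc m))) \<le> ?a m" by (intro ennreal_leI divide_left_mono) auto
  ultimately show "w \<in> G m" unfolding G_def by (blast intro: order_trans)
 qed
 have "(\<lambda>m. prob (G m)) \<longlonglongrightarrow> prob (\<Inter>m. G m)" using dec by (intro finite_Lim_measure_decseq) auto
 moreover have "exp (- K * x) / 4 \<le> prob (G m)" for m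
 proof -
  obtain s where s: "0 \<le> s" "exp (- K * x) / 4 \<le> prob {w\<in>space P. \<forall>t\<ge>s. X t w \<le> ?a m}"
   using eventually_small[OF K, of "1 / real (Suc m)"] by auto
  obtain n :: nat where "s \<le> real n" using real_arch_simple by blast
  hence "{w\<in>space P. \<forall>t\<ge>s. X t w \<le> ?a m} \<subseteq> G m" unfolding G_def by (blast intro: order_trans)
  from finite_measure_mono[OF this Gm] show ?thesis using s(2) by simp
 qed
 ultimately have "exp (- K * x) / 4 \<le> prob (\<Inter>m. G m)" by (intro LIMSEQ_le_const) auto
 thus "0 < \<P>(w in P. vanishes w)" unfolding eq using exp_gt_zero[of "- K * x"] by linarith
qed

section \<open>The criteria in terms of extended integrals\<close>

lemma ext_integral_above:
 assumes K: "Phi0 b c \<pi> < ereal K" shows "ext_integral {K<..} (\<lambda>s. s powr (\<theta> - 1) / \<psi> s) = enn2ereal (weight_integral {K<..})"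
proof -
 have pos: "0 < \<psi> s" if "K < s" for s using psi_positive_above(2)[of s] less_trans[OF K, of "ereal s"] that by simp
 have "(\<integral>\<^sup>+s\<in>{K<..}. ennreal (s powr (\<theta> - 1) / \<psi> s) \<partial>lborel) = weight_integral {K<..}"
  by (intro nn_integral_cong) (auto simp: indicator_def weight_def abs_of_pos[OF pos])
 moreover have "(\<integral>\<^sup>+s\<in>{K<..}. ennreal (- (s powr (\<theta> - 1) / \<psi> s)) \<partial>lborel) = (\<integral>\<^sup>+s. 0 \<partial>(lborel :: real measure))"
  using pos by (intro nn_integral_cong) (auto simp: indicator_def ennreal_eq_0_iff less_imp_le)
 ultimately show ?thesis by (simp add: ext_integral_def zero_ennreal.rep_eq)
qed

lemma ext_integral_below:
 assumes "Phi0 b c \<pi> < \<infinity>" "ereal \<delta> < Phi0 b c \<pi>"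
 shows "ext_integral {0<..<\<delta>} (\<lambda>s. s powr (\<theta> - 1) / \<psi> s) = - enn2ereal (weight_integral {0<..<\<delta>})"
proof -
 have neg: "\<psi> s < 0" if "s < \<delta>" "0 < s" for s
  using psi_negative_below[OF assms(1) that(2)] less_trans[of "ereal s" "ereal \<delta>"] that assms(2) by simp
 have "(\<integral>\<^sup>+s\<in>{0<..<\<delta>}. ennreal (- (s powr (\<theta> - 1) / \<psi> s)) \<partial>lborel) = weight_integral {0<..<\<delta>}"
  by (intro nn_integral_cong) (auto simp: indicator_def weight_def abs_of_neg[OF neg])
 moreover have "(\<integral>\<^sup>+s\<in>{0<..<\<delta>}. ennreal (s powr (\<theta> - 1) / \<psi> s) \<partial>lborel) = (\<integral>\<^sup>+s. 0 \<partial>(lborel :: real measure))"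
  using neg by (intro nn_integral_cong) (auto simp: indicator_def ennreal_eq_0_iff divide_nonneg_neg)
 ultimately show ?thesis by (simp add: ext_integral_def zero_ennreal.rep_eq)
qed

text \<open>With an infinite weight integral extinction has probability 0, so the event agrees
  almost surely with convergence to 0, which always has positive probability. With a finite one it
  is excluded by \<open>not_extinguishing\<close>.\<close>

lemma extinguishing_iff:
 assumes K: "Phi0 b c \<pi> < ereal K"
 shows "0 < \<P>(w in P. extinction_time X w = \<infinity> \<and> vanishes w) \<longleftrightarrow> weight_integral {K<..} = \<infinity>"
  (is "_ \<longleftrightarrow> ?I = _")
proof (cases "?I = \<infinity>")
 case True
 note ev = extinguishing_event[OF K]
 have "AE w in P. \<forall>n::nat. X (real n) w \<noteq> 0" using True extinction_dichotomy(1)[OF K] unfolding AE_all_countable by simp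
 with hitting_nat[OF disjI1[OF refl]]
 have eq: "AE w in P. (extinction_time X w = \<infinity> \<and> vanishes w) \<longleftrightarrow> vanishes w"
  by eventually_elim (auto simp: extinction_time_def)
 have "{w\<in>space P. extinction_time X w = \<infinity> \<and> vanishes w} \<in> sets P"
  by (rule AE_measurable[OF ev(1)]) (use eq AE_space in \<open>eventually_elim, auto\<close>)
 from prob_eq_AE[OF eq this ev(1)] show ?thesis using True ev(2) by simp
next
 case False
 have "AE w in P. \<not> (extinction_time X w = \<infinity> \<and> vanishes w)" using not_extinguishing[OF K False]
 proof eventually_elim
  case (elim w)
  thus ?case using hitting_finite[of 0 w] by (auto simp: extinction_time_def)
 qed
 from null_prob[OF this] False show ?thesis by simp
qed

lemma main:
 assumes fin: "Phi0 b c \<pi> < \<infinity>" and K: "Phi0 b c \<pi> < ereal K"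
  and \<delta>: "0 < \<delta>" "0 < Phi0 b c \<pi> ==> ereal \<delta> < Phi0 b c \<pi>"
 shows "(\<P>(w in P. extinction_time X w < \<infinity>) > 0 \<longleftrightarrow>
      ext_integral {K<..} (\<lambda>s. s powr (\<theta> - 1) / \<psi> s) < \<infinity>) \<and>
     (\<P>(w in P. extinction_time X w = \<infinity> \<and> ((\<lambda>t. X t w) \<longlongrightarrow> 0) at_top) > 0 \<longleftrightarrow>
      ext_integral {K<..} (\<lambda>s. s powr (\<theta> - 1) / \<psi> s) = \<infinity>) \<and>
     (\<P>(w in P. explosion_time X w < \<infinity>) > 0 \<longleftrightarrow>
      0 < Phi0 b c \<pi> \<and>
      ext_integral {0<..<\<delta>} (\<lambda>s. s powr (\<theta> - 1) / \<psi> s) > -\<infinity>)"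
proof (intro conjI)
 let ?a = "\<lambda>s. s powr (\<theta> - 1) / \<psi> s"
 have top: "enn2ereal y = \<infinity> \<longleftrightarrow> y = \<infinity>" for y by (cases y) (auto simp: infinity_ennreal_def enn2ereal_ennreal)
 have neg_top: "- \<infinity> < - enn2ereal y \<longleftrightarrow> y \<noteq> \<infinity>" for y using top[of y] by (cases "enn2ereal y") auto
 show "\<P>(w in P. extinction_time X w < \<infinity>) > 0 \<longleftrightarrow> ext_integral {K<..} ?a < \<infinity>"
  unfolding extinction_time_def hitting_positive[OF disjI1[OF refl]] extinction_dichotomy(1)[OF K] ext_integral_above[OF K] top[symmetric] by auto
 show "\<P>(w in P. extinction_time X w = \<infinity> \<and> ((\<lambda>t. X t w) \<longlongrightarrow> 0) at_top) > 0 \<longleftrightarrow>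
  ext_integral {K<..} ?a = \<infinity>" unfolding extinguishing_iff[OF K] ext_integral_above[OF K] top ..
 show "\<P>(w in P. explosion_time X w < \<infinity>) > 0 \<longleftrightarrow>
  0 < Phi0 b c \<pi> \<and> ext_integral {0<..<\<delta>} ?a > -\<infinity>"
 proof (cases "0 < Phi0 b c \<pi>")
  case True
  show ?thesis unfolding explosion_time_def hitting_positive[OF disjI2[OF refl]] explosion_dichotomy[OF fin \<delta>(1) \<delta>(2)[OF True]]
    ext_integral_below[OF fin \<delta>(2)[OF True]] neg_top using True by simp
 next
  \<comment> \<open>Both sides are false; the integral near 0 has no constraint on
    \<open>\<delta>\<close> here and is not evaluated.\<close>
  case False
  thus ?thesis unfolding explosion_time_def hitting_positive[OF disjI2[OF refl]] using no_explosion[OF False] by auto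
 qed
qed

end

theorem corollary2p6:
  fixes b c \<theta> x K \<delta> :: real and \<pi> :: "real measure"
    and P :: "'a measure" and F :: "real \<Rightarrow> 'a measure"
    and W :: "real \<Rightarrow> 'a \<Rightarrow> real" and N :: "'a \<Rightarrow> (real \<times> real \<times> real) measure"
    and X :: "real \<Rightarrow> 'a \<Rightarrow> ennreal"
  assumes "0 \<le> c" and "levy_measure \<pi>" and "Phi0 b c \<pi> < \<infinity>"
    and "usual_hypotheses P F"
    and "brownian_motion P F W"
    and "poisson_random_measure P F (mark_measure \<pi>) N"
    and "independent_noises P (mark_measure \<pi>) W N"
    and "0 < \<theta>" and "0 < x"
    and "sde_solution P F W N b c \<pi> (\<lambda>u. u powr (- \<theta>)) x X"
    and "Phi0 b c \<pi> < ereal K"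
    and "0 < \<delta>" and "0 < Phi0 b c \<pi> \<Longrightarrow> ereal \<delta> < Phi0 b c \<pi>"
  shows "(\<P>(\<omega> in P. extinction_time X \<omega> < \<infinity>) > 0 \<longleftrightarrow>
            ext_integral {K<..} (\<lambda>s. s powr (\<theta> - 1) / psi b c \<pi> s) < \<infinity>) \<and>
         (\<P>(\<omega> in P. extinction_time X \<omega> = \<infinity> \<and> ((\<lambda>t. X t \<omega>) \<longlongrightarrow> 0) at_top) > 0 \<longleftrightarrow>
            ext_integral {K<..} (\<lambda>s. s powr (\<theta> - 1) / psi b c \<pi> s) = \<infinity>) \<and>
         (\<P>(\<omega> in P. explosion_time X \<omega> < \<infinity>) > 0 \<longleftrightarrow>
            0 < Phi0 b c \<pi> \<and>
            ext_integral {0<..<\<delta>} (\<lambda>s. s powr (\<theta> - 1) / psi b c \<pi> s) > -\<infinity>)"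
proof -
  interpret prob_space P using assms(4) by (simp add: usual_hypotheses_def)
  interpret marks: pair_sigma_finite \<pi> "restrict_space lborel {0::real<..}"
    using assms(2) by (intro pair_sigma_finite.intro sigma_finite_measure_restrict_space) (auto simp: levy_measure_def lborel.sigma_finite_measure_axioms)
  have sf: "sigma_finite_measure (mark_measure \<pi>)"
    unfolding mark_measure_def by (rule marks.P.sigma_finite_measure_axioms)
  interpret branching_sde P F W \<pi> N b c \<theta> x X
    by (intro branching_sde.intro branching_sde_axioms.intro noisy_space.intro noisy_space_axioms.intro) (rule assms sf prob_space_axioms)+
  show ?thesis using assms(3,11-13) by (rule main)
qed

end
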